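(* Let $J$ be an almost complex structure on $A$ and suppose that the right bimodule covariant derivative $(\Omega^1A,\square,\sigma^{-1})$ satisfies: a) $\wedge:\Omega^{1,0}A\otimes_A\Omega^{0,1}A\to\Omega^{1,1}A$ is an isomorphism with inverse $\phi$; b) $(J\otimes\mathrm{id})\square=\square\,J:\Omega^1A\to\Omega^1A\otimes_A\Omega^1A$; c) $\pi^{1,1}\mathrm{Tor}_R:\Omega^1A\to\Omega^{1,1}A$ vanishes, where $\mathrm{Tor}_R=\mathrm d+\wedge\,\square$; d) $\pi^{1,1}\wedge\sigma^{-1}=-\pi^{0,1}\wedge\pi^{1,0}-\pi^{1,0}\wedge\pi^{0,1}$ on $\Omega^1A\otimes_A\Omega^1A$. If $\underline v\in\mathcal T\mathrm{Vec}^{*,0}A$ and $a\in A$ with $\bar\partial a=0$, then $\bar\partial(\underline v\triangleright a)=\bar\partial_{\mathcal{HD}}(\underline v)\triangleright a$, where $(\omega\otimes\underline w)\triangleright a=\omega.(\underline w\triangleright a)$.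
   Context: $A$ is a unital $*$-algebra over $\mathbb C$ with a differential graded algebra $(\Omega A=\oplus_n\Omega^nA,\mathrm d,\wedge)$, $\Omega^0A=A$, $\mathrm d^2=0$, graded Leibniz rule, generated over $A$ by $\Omega^1A$, with $\Omega^1A=A.\mathrm dA$, such that $a.\mathrm db\mapsto\mathrm db^*.a^*$ is a well defined star operation on $\Omega^1A$ extending to all $\Omega^nA$. $\Omega^1A$ is finitely generated projective as a right $A$-module. An almost complex structure is an $A$-bimodule map $J:\Omega^1A\to\Omega^1A$ with $J(\xi^* )=J(\xi)^*$, $J^2=-\mathrm{id}$, such that $J\otimes\mathrm{id}^{\otimes n-1}+\dots+\mathrm{id}^{\otimes n-1}\otimes J$ descends via $\wedge$ to a well defined map $J:\Omega^nA\to\Omega^nA$ for each $n$. $\Omega^{p,q}A$ ($p,q\ge0$) is the $\mathrm i(p-q)$-eigenspace of $J$ in $\Omega^{p+q}A$, $\pi^{p,q}:\Omega^{p+q}A\to\Omega^{p,q}A$ the projection, $\partial=\pi^{p+1,q}\mathrm d$ and $\bar\partial=\pi^{p,q+1}\mathrm d$ on $\Omega^{p,q}A$; $\pi^{0,1}\wedge\pi^{1,0}=\wedge\circ(\pi^{0,1}\otimes\pi^{1,0})$, etc. $\mathrm{Vec}A=\mathrm{Hom}_A(\Omega^1A,A)$ (right module maps), a bimodule by $(a.v)(\xi)=a\,v(\xi)$, $(v.a)(\xi)=v(a\xi)$; $J(v)=v\circ J$; $\mathrm{Vec}^{1,0}A$ is the $+\mathrm i$ eigenspace of $J$ on $\mathrm{Vec}A$.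 $\Omega^{\otimes n}A$, $\mathrm{Vec}^{\otimes n}A$ are $n$-fold tensor powers over $A$ ($A$ for $n=0$), $\mathrm{Vec}^{\otimes n,0}A=(\mathrm{Vec}^{1,0}A)^{\otimes_An}$, $\mathcal T\mathrm{Vec}^{*,0}A=\bigoplus_{n\ge0}\mathrm{Vec}^{\otimes n,0}A$. $\mathrm{ev}$ is evaluation, $\mathrm{ev}^{\langle1\rangle}=\mathrm{ev}$, $\mathrm{ev}^{\langle n+1\rangle}=\mathrm{ev}(\mathrm{id}\otimes\mathrm{ev}^{\langle n\rangle}\otimes\mathrm{id})$, and $\mathrm{coev}(1)=\sum_i\xi_i\otimes u_i\in\Omega^1A\otimes_A\mathrm{Vec}A$ is the dual basis. Right bimodule covariant derivative: $\square:\Omega^1A\to\Omega^1A\otimes_A\Omega^1A$, $\square(\xi a)=\square(\xi)a+\xi\otimes\mathrm da$, $\square(a\xi)=a\square(\xi)+\sigma^{-1}(\mathrm da\otimes\xi)$, $\sigma^{-1}$ a bimodule map on $\Omega^1A\otimes_A\Omega^1A$ (not assumed invertible). On forms: $\square^{\langle0\rangle}=\mathrm d$, $\square^{\langle1\rangle}=\square$, $\square^{\langle n+1\rangle}=\mathrm{id}^{\otimes n}\otimes\square+(\mathrm{id}^{\otimes n}\otimes\sigma^{-1})(\square^{\langle n\rangle}\otimes\mathrm{id}):\Omega^{\otimes n+1}A\to\Omega^{\otimes n+2}A$. The dual $\square:\mathrm{Vec}A\to\Omega^1A\otimes_A\mathrm{Vec}A$ is determined by $\mathrm d\circ\mathrm{ev}=(\mathrm{id}\otimes\mathrm{ev})(\square\otimes\mathrm{id})+(\mathrm{ev}\otimes\mathrm{id})(\mathrm{id}\otimes\square)$,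 with $\sigma=(\mathrm{ev}\otimes\mathrm{id}\otimes\mathrm{id})(\mathrm{id}\otimes\sigma^{-1}\otimes\mathrm{id})(\mathrm{id}\otimes\mathrm{id}\otimes\mathrm{coev}(1))$; it extends to $\square^{\langle n\rangle}:\mathrm{Vec}^{\otimes n}A\to\Omega^1A\otimes_A\mathrm{Vec}^{\otimes n}A$ by $\square^{\langle0\rangle}=\mathrm d$, $\square^{\langle n+1\rangle}=\square\otimes\mathrm{id}^{\otimes n}+(\sigma\otimes\mathrm{id}^{\otimes n})(\mathrm{id}\otimes\square^{\langle n\rangle})$. $\mathcal T\mathrm{Vec}A_\bullet=\bigoplus_{n\ge0}\mathrm{Vec}^{\otimes n}A$ with the associative unital product $\bullet$ determined by $a\bullet\underline w=a.\underline w$, $u\bullet\underline w=u\otimes\underline w+(\mathrm{ev}\otimes\mathrm{id}^{\otimes m})(u\otimes\square^{\langle m\rangle}\underline w)$ and $(u\otimes\underline v)\bullet\underline w=u\bullet(\underline v\bullet\underline w)-\big((\mathrm{ev}\otimes\mathrm{id}^{\otimes n})(u\otimes\square^{\langle n\rangle}\underline v)\big)\bullet\underline w$, for $a\in A$, $u\in\mathrm{Vec}A$, $\underline v\in\mathrm{Vec}^{\otimes n}A$, $\underline w\in\mathrm{Vec}^{\otimes m}A$. It acts on $A$ (with $\nabla_A=\mathrm d$) by $\underline v\triangleright a=\mathrm{ev}^{\langle n\rangle}(\underline v\otimes\nabla^{(n)}a)$ for $\underline v\in\mathrm{Vec}^{\otimes n}A$, where $\nabla^{(1)}=\mathrm d$,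 $\nabla^{(n+1)}=\square^{\langle n\rangle}\nabla^{(n)}$ (and $b\triangleright a=ba$ for $b\in A$). Under b), $\mathcal T\mathrm{Vec}^{*,0}A$ is a subalgebra. $\bar\partial_{\mathcal{HD}}:\mathcal T\mathrm{Vec}^{*,0}A\to\Omega^{0,1}A\otimes_A\mathcal T\mathrm{Vec}^{*,0}A$ is the (well defined under a)–d)) left $\bar\partial$ covariant derivative (i.e. $\bar\partial_{\mathcal{HD}}(a\underline v)=\bar\partial a\otimes\underline v+a\bar\partial_{\mathcal{HD}}(\underline v)$) given recursively by $\bar\partial_{\mathcal{HD}}=\bar\partial$ on $A$, $\bar\partial_{\mathcal{HD}}=(\pi^{0,1}\otimes\mathrm{id})\square$ on $\mathrm{Vec}^{1,0}A$, and, for $u\in\mathrm{Vec}^{1,0}A$, $\underline v\in\mathrm{Vec}^{\otimes n,0}A$ with $\xi\otimes\underline w=\bar\partial_{\mathcal{HD}}(\underline v)$ (summation implicit), $\bar\partial_{\mathcal{HD}}(u\bullet\underline v)=((\pi^{0,1}\otimes\mathrm{id})\square u)\bullet\underline v-(\mathrm{ev}\otimes\mathrm{id})(u\otimes\phi(\pi^{0,1}\wedge\pi^{1,0})\square(\xi))\otimes\underline w-\sum_i(\mathrm{ev}\otimes\mathrm{id})(u\otimes\phi(\xi\wedge\eta_i))\otimes\eta^i\bullet\underline w$, where $\sum_i\eta_i\otimes\eta^i\in\Omega^{1,0}A\otimes_A\mathrm{Vec}^{1,0}A$ is a dual basis and $(\omega\otimes\underline x)\bullet\underline v=\omega\otimes(\underline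 x\bullet\underline v)$. *)

theory Defs
  imports Complex_Main "HOL-Computational_Algebra.Group_Closure"
begin

section \<open>Star differential calculi\<close>

text \<open>
  The sort \<open>{ring, monoid_mult}\<close> is used for unital rings instead of \<open>ring_1\<close>, since the latter
  excludes the zero ring.
\<close>

class complex_algebra = ring + monoid_mult +
  fixes scaleC :: "complex \<Rightarrow> 'a \<Rightarrow> 'a"  (infixr "*\<^sub>C" 75)
  assumes scaleC_add_right: "c *\<^sub>C (x + y) = c *\<^sub>C x + c *\<^sub>C y"
    and scaleC_add_left: "(b + c) *\<^sub>C x = b *\<^sub>C x + c *\<^sub>C x"
    and scaleC_scaleC: "b *\<^sub>C c *\<^sub>C x = (b * c) *\<^sub>C x"
    and scaleC_one: "1 *\<^sub>C x = x"
    and mult_scaleC_left: "(c *\<^sub>C x) * y = c *\<^sub>C (x * y)"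
    and mult_scaleC_right: "x * (c *\<^sub>C y) = c *\<^sub>C (x * y)"

text \<open>
  The type is the whole algebra \<open>\<Omega>A\<close>, its multiplication is the wedge product, \<open>forms n\<close>
  is \<open>\<Omega>\<^sup>nA\<close>, and the algebra \<open>A\<close> itself is the subalgebra \<open>forms 0\<close>. Both \<open>A\<close>-actions on
  \<open>\<Omega>\<^sup>nA\<close> are therefore multiplication by elements of \<open>forms 0\<close>. The star operation is the
  graded-antimultiplicative one, \<open>(\<xi> \<and> \<eta>)* = (-1)\<^sup>m\<^sup>n \<eta>* \<and> \<xi>*\<close>.
\<close>

class star_dga = complex_algebra +
  fixes forms :: "nat \<Rightarrow> 'a set"
    and ext_deriv :: "'a \<Rightarrow> 'a"
    and star :: "'a \<Rightarrow> 'a"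
  assumes forms_zero: "0 \<in> forms n"
    and forms_add: "\<xi> \<in> forms n \<Longrightarrow> \<eta> \<in> forms n \<Longrightarrow> \<xi> + \<eta> \<in> forms n"
    and forms_scaleC: "\<xi> \<in> forms n \<Longrightarrow> c *\<^sub>C \<xi> \<in> forms n"
    and forms_direct_sum:
      "\<exists>!c. (\<forall>n. c n \<in> forms n) \<and> finite {n. c n \<noteq> 0} \<and> \<omega> = (\<Sum>n | c n \<noteq> 0. c n)"
    and forms_one: "1 \<in> forms 0"
    and forms_mult: "\<xi> \<in> forms m \<Longrightarrow> \<eta> \<in> forms n \<Longrightarrow> \<xi> * \<eta> \<in> forms (m + n)"
    and ext_deriv_add: "ext_deriv (\<xi> + \<eta>) = ext_deriv \<xi> + ext_deriv \<eta>"
    and ext_deriv_scaleC: "ext_deriv (c *\<^sub>C \<xi>) = c *\<^sub>C ext_deriv \<xi>"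
    and ext_deriv_forms: "\<xi> \<in> forms n \<Longrightarrow> ext_deriv \<xi> \<in> forms (Suc n)"
    and ext_deriv_ext_deriv: "ext_deriv (ext_deriv \<xi>) = 0"
    and ext_deriv_mult:
      "\<xi> \<in> forms n \<Longrightarrow> ext_deriv (\<xi> * \<eta>) = ext_deriv \<xi> * \<eta> + (- 1) ^ n * (\<xi> * ext_deriv \<eta>)"
    and forms_1_eq: "forms 1 = group_closure {a * ext_deriv b | a b. a \<in> forms 0 \<and> b \<in> forms 0}"
    and forms_Suc_eq:
      "forms (Suc n) = group_closure {\<xi> * \<eta> | \<xi> \<eta>. \<xi> \<in> forms 1 \<and> \<eta> \<in> forms n}"
    and star_add: "star (\<xi> + \<eta>) = star \<xi> + star \<eta>"
    and star_scaleC: "star (c *\<^sub>C \<xi>) = cnj c *\<^sub>C star \<xi>"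
    and star_star: "star (star \<xi>) = \<xi>"
    and star_forms: "\<xi> \<in> forms n \<Longrightarrow> star \<xi> \<in> forms n"
    and star_mult:
      "\<xi> \<in> forms m \<Longrightarrow> \<eta> \<in> forms n \<Longrightarrow> star (\<xi> * \<eta>) = (- 1) ^ (m * n) * (star \<eta> * star \<xi>)"
    and star_mult_ext_deriv:
      "a \<in> forms 0 \<Longrightarrow> b \<in> forms 0 \<Longrightarrow> star (a * ext_deriv b) = ext_deriv (star b) * star a"

text \<open>
  A right \<open>A\<close>-module \<open>M\<close> is finitely generated projective if it is a retract (direct summand)
  of some \<open>A\<^sup>n\<close>.
\<close>

definition free_module :: "nat \<Rightarrow> (nat \<Rightarrow> 'w::star_dga) set" where
  "free_module n = {x. (\<forall>k<n. x k \<in> forms 0) \<and> (\<forall>k\<ge>n. x k = 0)}"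

definition fg_projective :: "'w::star_dga set \<Rightarrow> bool" where
  "fg_projective M \<longleftrightarrow> (\<exists>n (i :: 'w \<Rightarrow> nat \<Rightarrow> 'w) (p :: (nat \<Rightarrow> 'w) \<Rightarrow> 'w).
     (\<forall>\<xi>\<in>M. i \<xi> \<in> free_module n) \<and>
     (\<forall>\<xi>\<in>M. \<forall>\<eta>\<in>M. i (\<xi> + \<eta>) = (\<lambda>k. i \<xi> k + i \<eta> k)) \<and>
     (\<forall>\<xi>\<in>M. \<forall>a\<in>forms 0. i (\<xi> * a) = (\<lambda>k. i \<xi> k * a)) \<and>
     (\<forall>x\<in>free_module n. p x \<in> M) \<and>
     (\<forall>x\<in>free_module n. \<forall>y\<in>free_module n. p (\<lambda>k. x k + y k) = p x + p y) \<and>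
     (\<forall>x\<in>free_module n. \<forall>a\<in>forms 0. p (\<lambda>k. x k * a) = p x * a) \<and>
     (\<forall>\<xi>\<in>M. p (i \<xi>) = \<xi>))"


section \<open>Vector fields\<close>

lemma (in star_dga) forms_0_mult: "a \<in> forms 0 \<Longrightarrow> \<xi> \<in> forms n \<Longrightarrow> a * \<xi> \<in> forms n"
  using forms_mult[of a 0 \<xi> n] by simp

lemma (in star_dga) forms_mult_0: "\<xi> \<in> forms n \<Longrightarrow> a \<in> forms 0 \<Longrightarrow> \<xi> * a \<in> forms n"
  using forms_mult[of \<xi> n a 0] by simp

lemma (in star_dga) forms_uminus: "\<xi> \<in> forms n \<Longrightarrow> - \<xi> \<in> forms n"
proof -
  assume *: "\<xi> \<in> forms n"
  have "scaleC 0 \<xi> = 0"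
    using scaleC_add_left[of 0 0 \<xi>] by simp
  then have "scaleC (- 1) \<xi> = - \<xi>"
    using scaleC_add_left[of "- 1" 1 \<xi>] by (simp add: scaleC_one eq_neg_iff_add_eq_0)
  with forms_scaleC[OF *, of "- 1"] show ?thesis by simp
qed

text \<open>
  Right module maps \<open>\<Omega>\<^sup>1A \<rightarrow> A\<close>, represented by functions on all of \<open>\<Omega>A\<close> that vanish outside
  \<open>\<Omega>\<^sup>1A\<close>.
\<close>

typedef (overloaded) 'w vec =
  "{v :: 'w::star_dga \<Rightarrow> 'w.
      (\<forall>\<xi>\<in>forms 1. v \<xi> \<in> forms 0) \<and>
      (\<forall>\<xi>\<in>forms 1. \<forall>\<eta>\<in>forms 1. v (\<xi> + \<eta>) = v \<xi> + v \<eta>) \<and>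
      (\<forall>\<xi>\<in>forms 1. \<forall>a\<in>forms 0. v (\<xi> * a) = v \<xi> * a) \<and>
      (\<forall>\<xi>. \<xi> \<notin> forms 1 \<longrightarrow> v \<xi> = 0)}"
  morphisms vec_apply Abs_vec
  by (rule exI[of _ "\<lambda>_. 0"]) (simp add: forms_zero)

setup_lifting type_definition_vec

instantiation vec :: (star_dga) ab_group_add
begin

lift_definition zero_vec :: "'a vec" is "\<lambda>_. 0"
  by (simp add: forms_zero)

lift_definition plus_vec :: "'a vec \<Rightarrow> 'a vec \<Rightarrow> 'a vec" is "\<lambda>u v \<xi>. u \<xi> + v \<xi>"
  by (simp add: forms_add algebra_simps)

lift_definition uminus_vec :: "'a vec \<Rightarrow> 'a vec" is "\<lambda>v \<xi>. - v \<xi>"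
  by (simp add: forms_uminus)

definition minus_vec :: "'a vec \<Rightarrow> 'a vec \<Rightarrow> 'a vec" where
  "minus_vec u v = u + - v"

instance
  by (standard; (unfold minus_vec_def)?; transfer) (simp_all add: algebra_simps)

end

text \<open>The bimodule structure; the value for \<open>a \<notin> A\<close> is irrelevant.\<close>

lift_definition vec_lmult :: "'w::star_dga \<Rightarrow> 'w vec \<Rightarrow> 'w vec"
  is "\<lambda>a v \<xi>. if a \<in> forms 0 then a * v \<xi> else 0"
  by (auto simp: forms_0_mult forms_zero distrib_left mult.assoc simp del: One_nat_def)

lift_definition vec_rmult :: "'w::star_dga vec \<Rightarrow> 'w \<Rightarrow> 'w vec"
  is "\<lambda>v a \<xi>. if a \<in> forms 0 \<and> \<xi> \<in> forms 1 then v (a * \<xi>) else 0"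
  by (auto simp: forms_0_mult forms_mult_0 forms_add forms_zero distrib_left mult.assoc[symmetric]
      simp del: One_nat_def)


section \<open>Tensor products over the algebra\<close>

text \<open>
  All tensor products over \<open>A\<close> of copies of \<open>\<Omega>\<^sup>1A\<close> and \<open>Vec A\<close> live in one ring, the tensor algebra
  over \<open>A\<close> of the bimodule \<open>M = (\<Oplus>n\<ge>1. \<Omega>\<^sup>nA) \<oplus> Vec A\<close>. It is presented here as the ring generated by
  the elements of \<open>A\<close> and of \<open>M\<close>, subject to: the generators are additive, and products of a generator
  from \<open>A\<close> with another generator are computed in \<open>A\<close> and \<open>M\<close>. The product of this ring is the
  tensor product over \<open>A\<close>. As \<open>\<Omega>\<^sup>1A\<close> and \<open>Vec A\<close> are direct summands of \<open>M\<close>, a tensor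
  product such as \<open>\<Omega>\<^sup>1A \<otimes>\<^sub>A \<Omega>\<^sup>1A \<otimes>\<^sub>A Vec A\<close> is a direct summand of the corresponding tensor
  power of \<open>M\<close>, namely the additive span of the products of its factors.
\<close>

datatype ('f, 'v) texp =
    TForm 'f
  | TField 'v
  | TPlus "('f, 'v) texp" "('f, 'v) texp"
  | TNeg "('f, 'v) texp"
  | TTimes "('f, 'v) texp" "('f, 'v) texp"

inductive tcong :: "('w::star_dga, 'w vec) texp \<Rightarrow> ('w, 'w vec) texp \<Rightarrow> bool" where
  refl: "tcong x x"
| sym: "tcong x y \<Longrightarrow> tcong y x"
| trans: "tcong x y \<Longrightarrow> tcong y z \<Longrightarrow> tcong x z"
| Plus_cong: "tcong x x' \<Longrightarrow> tcong y y' \<Longrightarrow> tcong (TPlus x y) (TPlus x' y')"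
| Neg_cong: "tcong x x' \<Longrightarrow> tcong (TNeg x) (TNeg x')"
| Times_cong: "tcong x x' \<Longrightarrow> tcong y y' \<Longrightarrow> tcong (TTimes x y) (TTimes x' y')"
| Plus_assoc: "tcong (TPlus (TPlus x y) z) (TPlus x (TPlus y z))"
| Plus_commute: "tcong (TPlus x y) (TPlus y x)"
| Plus_zero: "tcong (TPlus (TForm 0) x) x"
| Plus_Neg: "tcong (TPlus (TNeg x) x) (TForm 0)"
| Times_assoc: "tcong (TTimes (TTimes x y) z) (TTimes x (TTimes y z))"
| Times_Plus: "tcong (TTimes x (TPlus y z)) (TPlus (TTimes x y) (TTimes x z))"
| Plus_Times: "tcong (TTimes (TPlus x y) z) (TPlus (TTimes x z) (TTimes y z))"
| one_Times: "tcong (TTimes (TForm 1) x) x"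
| Times_one: "tcong (TTimes x (TForm 1)) x"
| Form_add: "tcong (TForm (\<xi> + \<eta>)) (TPlus (TForm \<xi>) (TForm \<eta>))"
| Field_add: "tcong (TField (u + v)) (TPlus (TField u) (TField v))"
| Form_lmult: "a \<in> forms 0 \<Longrightarrow> tcong (TTimes (TForm a) (TForm \<xi>)) (TForm (a * \<xi>))"
| Form_rmult: "a \<in> forms 0 \<Longrightarrow> tcong (TTimes (TForm \<xi>) (TForm a)) (TForm (\<xi> * a))"
| Field_lmult: "a \<in> forms 0 \<Longrightarrow> tcong (TTimes (TForm a) (TField v)) (TField (vec_lmult a v))"
| Field_rmult: "a \<in> forms 0 \<Longrightarrow> tcong (TTimes (TField v) (TForm a)) (TField (vec_rmult v a))"

quotient_type (overloaded) 'w tensor = "('w::star_dga, 'w vec) texp" / tcong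
  by (rule equivpI) (auto intro: reflpI sympI transpI tcong.refl tcong.sym tcong.trans)

instantiation tensor :: (star_dga) "{ring, monoid_mult}"
begin

lift_definition zero_tensor :: "'a tensor" is "TForm 0" .
lift_definition one_tensor :: "'a tensor" is "TForm 1" .
lift_definition plus_tensor :: "'a tensor \<Rightarrow> 'a tensor \<Rightarrow> 'a tensor" is TPlus
  by (rule tcong.Plus_cong)
lift_definition uminus_tensor :: "'a tensor \<Rightarrow> 'a tensor" is TNeg
  by (rule tcong.Neg_cong)
lift_definition times_tensor :: "'a tensor \<Rightarrow> 'a tensor \<Rightarrow> 'a tensor" is TTimes
  by (rule tcong.Times_cong)

definition minus_tensor :: "'a tensor \<Rightarrow> 'a tensor \<Rightarrow> 'a tensor" where
  "minus_tensor x y = x + - y"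

instance
proof
  fix x y z :: "'a tensor"
  show "x + y + z = x + (y + z)" by transfer (rule tcong.Plus_assoc)
  show "x + y = y + x" by transfer (rule tcong.Plus_commute)
  show "0 + x = x" by transfer (rule tcong.Plus_zero)
  show "- x + x = 0" by transfer (rule tcong.Plus_Neg)
  show "x - y = x + - y" by (rule minus_tensor_def)
  show "x * y * z = x * (y * z)" by transfer (rule tcong.Times_assoc)
  show "(x + y) * z = x * z + y * z" by transfer (rule tcong.Plus_Times)
  show "x * (y + z) = x * y + x * z" by transfer (rule tcong.Times_Plus)
  show "1 * x = x" by transfer (rule tcong.one_Times)
  show "x * 1 = x" by transfer (rule tcong.Times_one)
qed

end

lifting_forget vec.lifting

lift_definition form :: "'w::star_dga \<Rightarrow> 'w tensor" is TForm .
lifting_forget vec.lifting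

lift_definition vfield :: "'w::star_dga vec \<Rightarrow> 'w tensor" is TField .

text \<open>
  The ring homomorphism to \<open>\<Omega>A\<close> that multiplies forms out (and kills vector fields). On
  \<open>\<Omega>\<^sup>1A \<otimes>\<^sub>A \<Omega>\<^sup>1A\<close> it is the wedge product \<open>\<and>\<close>, and \<open>wedge (form \<xi>) = \<xi>\<close>, so that it also reads off
  an element of \<open>\<Omega>A\<close> from its copy in the tensor ring.
\<close>

primrec wedge_texp :: "('w::star_dga, 'w vec) texp \<Rightarrow> 'w" where
  "wedge_texp (TForm \<xi>) = \<xi>"
| "wedge_texp (TField v) = 0"
| "wedge_texp (TPlus x y) = wedge_texp x + wedge_texp y"
| "wedge_texp (TNeg x) = - wedge_texp x"
| "wedge_texp (TTimes x y) = wedge_texp x * wedge_texp y"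

lift_definition wedge :: "'w::star_dga tensor \<Rightarrow> 'w" is wedge_texp
proof -
  fix x y :: "('w, 'w vec) texp"
  assume "tcong x y"
  then show "wedge_texp x = wedge_texp y"
    by (induction rule: tcong.induct) (simp_all add: algebra_simps)
qed

definition tprod :: "'w::star_dga tensor set \<Rightarrow> 'w tensor set \<Rightarrow> 'w tensor set"
    (infixr "\<otimes>\<^sub>A" 70) where
  "M \<otimes>\<^sub>A N = group_closure {x * y | x y. x \<in> M \<and> y \<in> N}"

abbreviation Alg :: "'w::star_dga tensor set" where
  "Alg \<equiv> form ` forms 0"

abbreviation Forms1 :: "'w::star_dga tensor set" where
  "Forms1 \<equiv> form ` forms 1"

abbreviation Fields :: "'w::star_dga tensor set" where
  "Fields \<equiv> range vfield"

primrec tpower :: "'w::star_dga tensor set \<Rightarrow> nat \<Rightarrow> 'w tensor set" where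
  "tpower M 0 = Alg"
| "tpower M (Suc n) = M \<otimes>\<^sub>A tpower M n"

definition tensor_algebra :: "'w::star_dga tensor set \<Rightarrow> 'w tensor set" where
  "tensor_algebra M = group_closure (\<Union>n. tpower M n)"

definition additive_on :: "'w::star_dga tensor set \<Rightarrow> ('w tensor \<Rightarrow> 'b::ab_group_add) \<Rightarrow> bool" where
  "additive_on M f \<longleftrightarrow> (\<forall>x\<in>M. \<forall>y\<in>M. f (x + y) = f x + f y)"

text \<open>
  The additive map \<open>M \<otimes>\<^sub>A N \<rightarrow> B\<close> induced by a balanced biadditive map \<open>M \<times> N \<rightarrow> B\<close>; only its values on
  \<open>M \<otimes>\<^sub>A N\<close> are meaningful.
\<close>

definition tensor_lift ::
    "'w::star_dga tensor set \<Rightarrow> 'w tensor set \<Rightarrow> ('w tensor \<Rightarrow> 'w tensor \<Rightarrow> 'b::ab_group_add)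
      \<Rightarrow> 'w tensor \<Rightarrow> 'b" where
  "tensor_lift M N f =
     (SOME g. additive_on (M \<otimes>\<^sub>A N) g \<and> (\<forall>x\<in>M. \<forall>y\<in>N. g (x * y) = f x y))"

text \<open>The map \<open>f \<otimes> g\<close> on \<open>M \<otimes>\<^sub>A N\<close>.\<close>

definition tensor_map ::
    "'w::star_dga tensor set \<Rightarrow> ('w tensor \<Rightarrow> 'w tensor) \<Rightarrow> 'w tensor set \<Rightarrow> ('w tensor \<Rightarrow> 'w tensor)
      \<Rightarrow> 'w tensor \<Rightarrow> 'w tensor" where
  "tensor_map M f N g = tensor_lift M N (\<lambda>x y. f x * g y)"

definition on_forms :: "('w::star_dga \<Rightarrow> 'w) \<Rightarrow> 'w tensor \<Rightarrow> 'w tensor" where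
  "on_forms f x = form (f (wedge x))"

definition ev :: "'w::star_dga tensor \<Rightarrow> 'w tensor" where
  "ev = (SOME g. additive_on (Fields \<otimes>\<^sub>A Forms1) g \<and>
           (\<forall>v. \<forall>\<xi>\<in>forms 1. g (vfield v * form \<xi>) = form (vec_apply v \<xi>)))"

text \<open>Only the indices \<open>n \<ge> 1\<close> occur in \<open>ev\<^sup>\<langle>\<^sup>n\<^sup>\<rangle>\<close>; the value at \<open>0\<close> is a convention, see \<open>act\<close>.\<close>

fun ev_iter :: "nat \<Rightarrow> 'w::star_dga tensor \<Rightarrow> 'w tensor" where
  "ev_iter 0 x = x"
| "ev_iter (Suc 0) x = ev x"
| "ev_iter (Suc (Suc n)) x =
     ev (tensor_map Fields id ((tpower Fields (Suc n) \<otimes>\<^sub>A tpower Forms1 (Suc n)) \<otimes>\<^sub>A Forms1)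
       (tensor_map (tpower Fields (Suc n) \<otimes>\<^sub>A tpower Forms1 (Suc n)) (ev_iter (Suc n)) Forms1 id) x)"

text \<open>\<open>(ev \<otimes> id)(u \<otimes> x)\<close> for \<open>x \<in> \<Omega>\<^sup>1A \<otimes>\<^sub>A N\<close>\<close>

definition ev_left :: "'w::star_dga tensor set \<Rightarrow> 'w vec \<Rightarrow> 'w tensor \<Rightarrow> 'w tensor" where
  "ev_left N u x = tensor_map (Fields \<otimes>\<^sub>A Forms1) ev N id (vfield u * x)"

text \<open>\<open>coev(1)\<close>; it does not depend on the dual basis used to write it.\<close>

definition coev_one :: "'w::star_dga tensor" where
  "coev_one = (SOME K. \<exists>n (\<xi> :: nat \<Rightarrow> 'w) (u :: nat \<Rightarrow> 'w vec).
     (\<forall>i<n. \<xi> i \<in> forms 1) \<and>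
     (\<forall>\<eta>\<in>forms 1. \<eta> = (\<Sum>i<n. \<xi> i * vec_apply (u i) \<eta>)) \<and>
     K = (\<Sum>i<n. form (\<xi> i) * vfield (u i)))"


section \<open>Bimodule covariant derivatives\<close>

definition right_bimodule_connection ::
    "('w::star_dga \<Rightarrow> 'w tensor) \<Rightarrow> ('w tensor \<Rightarrow> 'w tensor) \<Rightarrow> bool" where
  "right_bimodule_connection sq si \<longleftrightarrow>
     (\<forall>\<xi>\<in>forms 1. sq \<xi> \<in> Forms1 \<otimes>\<^sub>A Forms1) \<and>
     (\<forall>\<xi>\<in>forms 1. \<forall>\<eta>\<in>forms 1. sq (\<xi> + \<eta>) = sq \<xi> + sq \<eta>) \<and>
     (\<forall>\<xi>\<in>forms 1. \<forall>a\<in>forms 0. sq (\<xi> * a) = sq \<xi> * form a + form \<xi> * form (ext_deriv a)) \<and>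
     (\<forall>\<xi>\<in>forms 1. \<forall>a\<in>forms 0.
        sq (a * \<xi>) = form a * sq \<xi> + si (form (ext_deriv a) * form \<xi>)) \<and>
     (\<forall>x\<in>Forms1 \<otimes>\<^sub>A Forms1. si x \<in> Forms1 \<otimes>\<^sub>A Forms1) \<and>
     additive_on (Forms1 \<otimes>\<^sub>A Forms1) si \<and>
     (\<forall>x\<in>Forms1 \<otimes>\<^sub>A Forms1. \<forall>a\<in>forms 0. si (form a * x) = form a * si x \<and>
        si (x * form a) = si x * form a)"

text \<open>
  In the following, \<open>sq\<close> is \<open>\<square>\<close> on \<open>\<Omega>\<^sup>1A\<close> and \<open>si\<close> is \<open>\<sigma>\<^sup>-\<^sup>1\<close> (a single map, not assumed to be
  invertible). First \<open>\<square>\<^sup>\<langle>\<^sup>n\<^sup>\<rangle> : \<Omega>\<^sup>\<otimes>\<^sup>nA \<rightarrow> \<Omega>\<^sup>\<otimes>\<^sup>n\<^sup>+\<^sup>1A\<close>. The two summands of the recursion are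
  separately not well defined on the tensor product over \<open>A\<close>, so it is stated on simple tensors.
\<close>

fun sq_forms :: "('w::star_dga \<Rightarrow> 'w tensor) \<Rightarrow> ('w tensor \<Rightarrow> 'w tensor) \<Rightarrow> nat
    \<Rightarrow> 'w tensor \<Rightarrow> 'w tensor" where
  "sq_forms sq si 0 = on_forms ext_deriv"
| "sq_forms sq si (Suc 0) = (\<lambda>x. sq (wedge x))"
| "sq_forms sq si (Suc (Suc n)) =
     tensor_lift (tpower Forms1 (Suc n)) Forms1 (\<lambda>x y.
       x * sq (wedge y) +
       tensor_map (tpower Forms1 (Suc n)) id (Forms1 \<otimes>\<^sub>A Forms1) si (sq_forms sq si (Suc n) x * y))"

text \<open>The dual derivative on \<open>Vec A\<close>, the map \<open>\<sigma>\<close>, and \<open>\<square>\<^sup>\<langle>\<^sup>n\<^sup>\<rangle>\<close> on \<open>Vec\<^sup>\<otimes>\<^sup>nA\<close>.\<close>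

definition sq_vec :: "('w::star_dga \<Rightarrow> 'w tensor) \<Rightarrow> 'w vec \<Rightarrow> 'w tensor" where
  "sq_vec sq v = (THE X. X \<in> Forms1 \<otimes>\<^sub>A Fields \<and>
     (\<forall>\<xi>\<in>forms 1. form (ext_deriv (vec_apply v \<xi>)) =
        tensor_map Forms1 id (Fields \<otimes>\<^sub>A Forms1) ev (X * form \<xi>) + ev_left Forms1 v (sq \<xi>)))"

definition sigma :: "('w::star_dga tensor \<Rightarrow> 'w tensor) \<Rightarrow> 'w tensor \<Rightarrow> 'w tensor" where
  "sigma si x =
     tensor_map (Fields \<otimes>\<^sub>A Forms1) ev (Forms1 \<otimes>\<^sub>A Fields) id
       (tensor_map Fields id ((Forms1 \<otimes>\<^sub>A Forms1) \<otimes>\<^sub>A Fields)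
          (tensor_map (Forms1 \<otimes>\<^sub>A Forms1) si Fields id) (x * coev_one))"

primrec sq_vecs :: "('w::star_dga \<Rightarrow> 'w tensor) \<Rightarrow> ('w tensor \<Rightarrow> 'w tensor) \<Rightarrow> nat
    \<Rightarrow> 'w tensor \<Rightarrow> 'w tensor" where
  "sq_vecs sq si 0 = on_forms ext_deriv"
| "sq_vecs sq si (Suc n) =
     (SOME g. additive_on (tpower Fields (Suc n)) g \<and>
        (\<forall>v. \<forall>y\<in>tpower Fields n. g (vfield v * y) =
           sq_vec sq v * y +
           tensor_map (Fields \<otimes>\<^sub>A Forms1) (sigma si) (tpower Fields n) id
             (vfield v * sq_vecs sq si n y)))"


section \<open>The algebra of differential operators and its action\<close>

definition is_bullet :: "('w::star_dga \<Rightarrow> 'w tensor) \<Rightarrow> ('w tensor \<Rightarrow> 'w tensor)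
    \<Rightarrow> ('w tensor \<Rightarrow> 'w tensor \<Rightarrow> 'w tensor) \<Rightarrow> bool" where
  "is_bullet sq si m \<longleftrightarrow>
     (\<forall>x\<in>tensor_algebra Fields. \<forall>y\<in>tensor_algebra Fields. m x y \<in> tensor_algebra Fields) \<and>
     (\<forall>y\<in>tensor_algebra Fields. additive_on (tensor_algebra Fields) (\<lambda>x. m x y)) \<and>
     (\<forall>x\<in>tensor_algebra Fields. additive_on (tensor_algebra Fields) (m x)) \<and>
     (\<forall>x\<in>tensor_algebra Fields. m 1 x = x \<and> m x 1 = x) \<and>
     (\<forall>x\<in>tensor_algebra Fields. \<forall>y\<in>tensor_algebra Fields. \<forall>z\<in>tensor_algebra Fields.
        m (m x y) z = m x (m y z)) \<and>
     (\<forall>a\<in>forms 0. \<forall>y\<in>tensor_algebra Fields. m (form a) y = form a * y) \<and>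
     (\<forall>u k. \<forall>y\<in>tpower Fields k.
        m (vfield u) y = vfield u * y + ev_left (tpower Fields k) u (sq_vecs sq si k y)) \<and>
     (\<forall>u n. \<forall>x\<in>tpower Fields n. \<forall>y\<in>tensor_algebra Fields.
        m (vfield u * x) y =
          m (vfield u) (m x y) - m (ev_left (tpower Fields n) u (sq_vecs sq si n x)) y)"

definition bullet :: "('w::star_dga \<Rightarrow> 'w tensor) \<Rightarrow> ('w tensor \<Rightarrow> 'w tensor)
    \<Rightarrow> 'w tensor \<Rightarrow> 'w tensor \<Rightarrow> 'w tensor" where
  "bullet sq si = (SOME m. is_bullet sq si m)"

text \<open>\<open>(\<omega> \<otimes> x) \<bullet> y = \<omega> \<otimes> (x \<bullet> y)\<close>\<close>

definition form_bullet :: "('w::star_dga \<Rightarrow> 'w tensor) \<Rightarrow> ('w tensor \<Rightarrow> 'w tensor)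
    \<Rightarrow> 'w tensor \<Rightarrow> 'w tensor \<Rightarrow> 'w tensor" where
  "form_bullet sq si X y =
     tensor_lift Forms1 (tensor_algebra Fields) (\<lambda>\<omega> x. \<omega> * bullet sq si x y) X"

text \<open>\<open>\<nabla>\<^sup>(\<^sup>n\<^sup>)\<close>, where \<open>\<nabla>\<^sup>(\<^sup>0\<^sup>)\<close> is the identity, so that \<open>\<nabla>\<^sup>(\<^sup>1\<^sup>) = \<square>\<^sup>\<langle>\<^sup>0\<^sup>\<rangle> = d\<close>\<close>

primrec nabla :: "('w::star_dga \<Rightarrow> 'w tensor) \<Rightarrow> ('w tensor \<Rightarrow> 'w tensor) \<Rightarrow> nat
    \<Rightarrow> 'w \<Rightarrow> 'w tensor" where
  "nabla sq si 0 a = form a"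
| "nabla sq si (Suc n) a = sq_forms sq si n (nabla sq si n a)"

text \<open>
  The action \<open>v \<triangleright> a\<close>. With the conventions for \<open>ev_iter 0\<close> and \<open>nabla 0\<close>, the case \<open>n = 0\<close> says
  \<open>b \<triangleright> a = b a\<close>.
\<close>

definition act :: "('w::star_dga \<Rightarrow> 'w tensor) \<Rightarrow> ('w tensor \<Rightarrow> 'w tensor)
    \<Rightarrow> 'w tensor \<Rightarrow> 'w \<Rightarrow> 'w" where
  "act sq si x a =
     (SOME g. additive_on (tensor_algebra Fields) g \<and>
        (\<forall>n. \<forall>y\<in>tpower Fields n. g y = wedge (ev_iter n (y * nabla sq si n a)))) x"

text \<open>\<open>(\<omega> \<otimes> x) \<triangleright> a = \<omega>.(x \<triangleright> a)\<close>\<close>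

definition form_act :: "('w::star_dga \<Rightarrow> 'w tensor) \<Rightarrow> ('w tensor \<Rightarrow> 'w tensor)
    \<Rightarrow> 'w tensor \<Rightarrow> 'w \<Rightarrow> 'w" where
  "form_act sq si X a =
     tensor_lift Forms1 (tensor_algebra Fields) (\<lambda>\<omega> x. wedge \<omega> * act sq si x a) X"


section \<open>Almost complex structures\<close>

text \<open>
  \<open>J\<close> denotes the map on \<open>\<Omega>\<^sup>1A\<close> together with the induced maps on all \<open>\<Omega>\<^sup>nA\<close>; the latter are
  determined by the former, and their existence is the requirement that
  \<open>J \<otimes> id\<^sup>\<otimes>\<^sup>n\<^sup>-\<^sup>1 + \<dots> + id\<^sup>\<otimes>\<^sup>n\<^sup>-\<^sup>1 \<otimes> J\<close> descends. For \<open>n = 0\<close> the sum is empty.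
\<close>

definition almost_complex :: "('w::star_dga \<Rightarrow> 'w) \<Rightarrow> bool" where
  "almost_complex J \<longleftrightarrow>
     (\<forall>\<xi> \<eta>. J (\<xi> + \<eta>) = J \<xi> + J \<eta>) \<and>
     (\<forall>n. \<forall>\<xi>\<in>forms n. J \<xi> \<in> forms n) \<and>
     (\<forall>\<xi>\<in>forms 1. \<forall>a\<in>forms 0. J (a * \<xi>) = a * J \<xi> \<and> J (\<xi> * a) = J \<xi> * a) \<and>
     (\<forall>\<xi>\<in>forms 1. J (star \<xi>) = star (J \<xi>)) \<and>
     (\<forall>\<xi>\<in>forms 1. J (J \<xi>) = - \<xi>) \<and>
     (\<forall>a\<in>forms 0. J a = 0) \<and>
     (\<forall>\<xi>s. \<xi>s \<noteq> [] \<and> set \<xi>s \<subseteq> forms 1 \<longrightarrow>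
        J (prod_list \<xi>s) = (\<Sum>i<length \<xi>s. prod_list (\<xi>s[i := J (\<xi>s ! i)])))"

definition pq_forms :: "('w::star_dga \<Rightarrow> 'w) \<Rightarrow> nat \<Rightarrow> nat \<Rightarrow> 'w set" where
  "pq_forms J p q = {\<omega> \<in> forms (p + q). J \<omega> = (\<i> * (of_nat p - of_nat q)) *\<^sub>C \<omega>}"

text \<open>
  The projection \<open>\<pi>\<^sup>p\<^sup>,\<^sup>q\<close> for the decomposition of \<open>\<Omega>\<^sup>p\<^sup>+\<^sup>qA\<close> as the direct sum of the eigenspaces
  \<open>\<Omega>\<^sup>k\<^sup>,\<^sup>p\<^sup>+\<^sup>q\<^sup>-\<^sup>kA\<close>
\<close>

definition proj :: "('w::star_dga \<Rightarrow> 'w) \<Rightarrow> nat \<Rightarrow> nat \<Rightarrow> 'w \<Rightarrow> 'w" where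
  "proj J p q \<omega> = (THE x. \<exists>c. (\<forall>k\<le>p + q. c k \<in> pq_forms J k (p + q - k)) \<and>
     \<omega> = (\<Sum>k\<le>p + q. c k) \<and> x = c p)"

definition dbar :: "('w::star_dga \<Rightarrow> 'w) \<Rightarrow> nat \<Rightarrow> nat \<Rightarrow> 'w \<Rightarrow> 'w" where
  "dbar J p q \<omega> = proj J p (Suc q) (ext_deriv \<omega>)"

abbreviation PQ_Forms :: "('w::star_dga \<Rightarrow> 'w) \<Rightarrow> nat \<Rightarrow> nat \<Rightarrow> 'w tensor set" where
  "PQ_Forms J p q \<equiv> form ` pq_forms J p q"

text \<open>\<open>\<pi>\<^sup>p\<^sup>,\<^sup>q \<and> \<pi>\<^sup>r\<^sup>,\<^sup>s\<close> on \<open>\<Omega>\<^sup>1A \<otimes>\<^sub>A \<Omega>\<^sup>1A\<close>, for \<open>p + q = r + s = 1\<close>\<close>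

definition proj_wedge_proj :: "('w::star_dga \<Rightarrow> 'w) \<Rightarrow> nat \<times> nat \<Rightarrow> nat \<times> nat
    \<Rightarrow> 'w tensor \<Rightarrow> 'w" where
  "proj_wedge_proj J = (\<lambda>(p, q) (r, s) x.
     wedge (tensor_map Forms1 (on_forms (proj J p q)) Forms1 (on_forms (proj J r s)) x))"

definition vec10 :: "('w::star_dga \<Rightarrow> 'w) \<Rightarrow> 'w vec set" where
  "vec10 J = {v. \<forall>\<xi>\<in>forms 1. vec_apply v (J \<xi>) = \<i> *\<^sub>C vec_apply v \<xi>}"

abbreviation Fields10 :: "('w::star_dga \<Rightarrow> 'w) \<Rightarrow> 'w tensor set" where
  "Fields10 J \<equiv> vfield ` vec10 J"

text \<open>The inverse of \<open>\<and> : \<Omega>\<^sup>1\<^sup>,\<^sup>0A \<otimes>\<^sub>A \<Omega>\<^sup>0\<^sup>,\<^sup>1A \<rightarrow> \<Omega>\<^sup>1\<^sup>,\<^sup>1A\<close>\<close>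

definition phi :: "('w::star_dga \<Rightarrow> 'w) \<Rightarrow> 'w \<Rightarrow> 'w tensor" where
  "phi J = the_inv_into (PQ_Forms J 1 0 \<otimes>\<^sub>A PQ_Forms J 0 1) wedge"

definition torsion :: "('w::star_dga \<Rightarrow> 'w tensor) \<Rightarrow> 'w \<Rightarrow> 'w" where
  "torsion sq \<xi> = ext_deriv \<xi> + wedge (sq \<xi>)"

definition dual_basis10 :: "('w::star_dga \<Rightarrow> 'w) \<Rightarrow> nat \<Rightarrow> (nat \<Rightarrow> 'w) \<Rightarrow> (nat \<Rightarrow> 'w vec) \<Rightarrow> bool" where
  "dual_basis10 J n \<eta> e \<longleftrightarrow> (\<forall>i<n. \<eta> i \<in> pq_forms J 1 0 \<and> e i \<in> vec10 J) \<and>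
     (\<forall>\<xi>\<in>pq_forms J 1 0. \<xi> = (\<Sum>i<n. \<eta> i * vec_apply (e i) \<xi>))"

definition pi01_id :: "('w::star_dga \<Rightarrow> 'w) \<Rightarrow> 'w tensor \<Rightarrow> 'w tensor" where
  "pi01_id J = tensor_map Forms1 (on_forms (proj J 0 1)) Fields id"


section \<open>The holomorphic structure on the differential operators\<close>

text \<open>
  The recursion for \<open>\<partial>\<close>-bar on \<open>T Vec\<^sup>*\<^sup>,\<^sup>0A\<close> refers to an arbitrary expression
  \<open>\<Sum>k. \<xi>\<^sub>k \<otimes> w\<^sub>k\<close> of the value at \<open>v\<close>, and its last two summands are separately not well defined on
  the tensor product. It is therefore given as the graph generated by the defining clauses: base
  cases, additivity, the left Leibniz rule and the recursion. Every element of \<open>T Vec\<^sup>*\<^sup>,\<^sup>0A\<close> has a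
  value; the graph is single valued, i.e. the operator is well defined, under the conditions (a) to
  (d) of the theorem.
\<close>

inductive dbar_HD_graph :: "('w::star_dga \<Rightarrow> 'w) \<Rightarrow> ('w \<Rightarrow> 'w tensor) \<Rightarrow> ('w tensor \<Rightarrow> 'w tensor)
    \<Rightarrow> 'w tensor \<Rightarrow> 'w tensor \<Rightarrow> bool"
  for J sq si where
  alg: "a \<in> forms 0 \<Longrightarrow> dbar_HD_graph J sq si (form a) (form (dbar J 0 0 a))"
| vfield: "u \<in> vec10 J \<Longrightarrow> dbar_HD_graph J sq si (vfield u) (pi01_id J (sq_vec sq u))"
| add: "dbar_HD_graph J sq si x X \<Longrightarrow> dbar_HD_graph J sq si y Y \<Longrightarrow>
    dbar_HD_graph J sq si (x + y) (X + Y)"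
| Leibniz: "a \<in> forms 0 \<Longrightarrow> dbar_HD_graph J sq si x X \<Longrightarrow>
    dbar_HD_graph J sq si (form a * x) (form (dbar J 0 0 a) * x + form a * X)"
| bullet: "dbar_HD_graph J sq si
      (bullet sq si (vfield u) v)
      (form_bullet sq si (pi01_id J (sq_vec sq u)) v
       - (\<Sum>k<n::nat. ev_left Forms1 u (phi J (proj_wedge_proj J (0, 1) (1, 0) (sq (\<xi> k)))) * w k)
       - (\<Sum>k<n::nat. \<Sum>i<r. ev_left Forms1 u (phi J (\<xi> k * \<eta> i)) * bullet sq si (vfield (e i)) (w k)))"
  if "u \<in> vec10 J" and "v \<in> tpower (Fields10 J) m"
    and "dbar_HD_graph J sq si v (\<Sum>k<n::nat. form (\<xi> k) * w k)"
    and "\<forall>k<n::nat. \<xi> k \<in> pq_forms J 0 1 \<and> w k \<in> tensor_algebra (Fields10 J)"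
    and "dual_basis10 J r \<eta> e"

definition dbar_HD :: "('w::star_dga \<Rightarrow> 'w) \<Rightarrow> ('w \<Rightarrow> 'w tensor) \<Rightarrow> ('w tensor \<Rightarrow> 'w tensor)
    \<Rightarrow> 'w tensor \<Rightarrow> 'w tensor" where
  "dbar_HD J sq si x = (SOME X. dbar_HD_graph J sq si x X)"

end

theory Submission
  imports Defs
begin

text \<open>
  Once it is known that \<open>u \<bullet> x\<close> acts on \<open>A\<close> as \<open>a \<mapsto> u(d(x \<triangleright> a))\<close>, everything reduces to
  computing \<open>\<partial>\<close>-bar of \<open>u(db)\<close> for \<open>u\<close> of type (1,0), where \<open>b = x \<triangleright> a\<close>. By duality
  \<open>d(u(db)) = (id \<otimes> ev)(\<square>u \<otimes> db) + (ev \<otimes> id)(u \<otimes> \<square>db)\<close>. The (0,1) part of the last term only involves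
  the component of \<open>\<square>db\<close> in \<open>\<Omega>\<^sup>1\<^sup>,\<^sup>0 \<otimes> \<Omega>\<^sup>0\<^sup>,\<^sup>1\<close>, and that component is \<open>\<phi>\<close> of its wedge product. As the (1,1)
  part of the torsion vanishes on \<open>db\<close>, this is minus \<open>\<phi>(\<pi>\<^sup>0\<^sup>,\<^sup>1 \<and> \<pi>\<^sup>1\<^sup>,\<^sup>0)\<square>db\<close>, which by (b) depends on
  \<open>db\<close> only through its (0,1) part; inserting the induction hypothesis for the latter gives the
  recursion of the operator. Since this works for any value that the defining clauses generate,
  induction over the clauses proves the identity; it remains to see that every element has a value.

  All maps on tensor products are obtained from one universal property: the tensor ring \<open>T\<close>
  satisfies \<open>T = A \<oplus> M \<otimes>\<^sub>A T\<close>, so a balanced map on \<open>M \<times> T\<close> extends additively to \<open>T\<close>.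
\<close>

text \<open>The action formula for \<open>u \<bullet> x\<close> results from contracting
  \<open>u\<close> with a duality formula for n factors (\<open>d_ev_iter\<close>): d of a nested
  evaluation is a term that differentiates the fields plus a term that differentiates the forms. It
  reduces to one factor because \<open>sigma si\<close> is the transpose of \<open>si\<close>. Two
  obstacles shape the development. Almost every operator is selected by a choice or description
  operator, so a map with the specified properties must be produced before its equations can be
  used. The summands of its recursion are typically not balanced by themselves, so the Leibniz rule
  of the previous stage is carried along to make the defects cancel. Moreover, the recursion of the
  holomorphic structure accepts only a value written with coefficients in (0,1)-forms and in
  operators built from (1,0)-fields. Existence of a value therefore rests on the dual derivative and
  \<open>sigma si\<close> preserving (1,0)-fields, which is deduced from the uniqueness of the dual
  derivative.\<close>

declare One_nat_def [simp del]

section \<open>Subgroups and tensor products\<close>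

definition subgrp :: "'a::ab_group_add set \<Rightarrow> bool" where
  "subgrp S \<longleftrightarrow> 0 \<in> S \<and> (\<forall>x\<in>S. \<forall>y\<in>S. x - y \<in> S)"

lemma subgrp_zero: "subgrp S \<Longrightarrow> 0 \<in> S"
  and subgrp_diff: "subgrp S \<Longrightarrow> x \<in> S \<Longrightarrow> y \<in> S \<Longrightarrow> x - y \<in> S"
  by (auto simp: subgrp_def)

lemma subgrp_uminus: "subgrp S \<Longrightarrow> x \<in> S \<Longrightarrow> - x \<in> S"
  using subgrp_diff[OF _ subgrp_zero, of S x] by simp

lemma subgrp_add: "subgrp S \<Longrightarrow> x \<in> S \<Longrightarrow> y \<in> S \<Longrightarrow> x + y \<in> S"
  using subgrp_diff[OF _ _ subgrp_uminus, of S x y] by simp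

lemma subgrp_sum: "subgrp S \<Longrightarrow> (\<And>i. i \<in> I \<Longrightarrow> f i \<in> S) \<Longrightarrow> sum f I \<in> S"
  by (induction I rule: infinite_finite_induct) (auto simp: subgrp_zero subgrp_add)

lemma subgrp_group_closure: "subgrp (group_closure S)"
  by (auto simp: subgrp_def group_closure.diff)

lemma group_closure_least: "S \<subseteq> T \<Longrightarrow> subgrp T \<Longrightarrow> group_closure S \<subseteq> T"
proof
  fix x assume *: "S \<subseteq> T" "subgrp T" and "x \<in> group_closure S"
  show "x \<in> T"
    using \<open>x \<in> group_closure S\<close> * by induction (auto simp: subgrp_zero subgrp_diff)
qed

lemma additive_on_add: "additive_on M f \<Longrightarrow> x \<in> M \<Longrightarrow> y \<in> M \<Longrightarrow> f (x + y) = f x + f y"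
  by (simp add: additive_on_def)

lemma additive_on_zero: "additive_on M f \<Longrightarrow> subgrp M \<Longrightarrow> f 0 = 0"
  using additive_on_add[of M f 0 0] by (simp add: subgrp_zero)

lemma additive_on_uminus: "additive_on M f \<Longrightarrow> subgrp M \<Longrightarrow> x \<in> M \<Longrightarrow> f (- x) = - f x"
  using additive_on_add[of M f x "- x"]
  by (simp add: additive_on_zero subgrp_uminus eq_neg_iff_add_eq_0 add.commute)

lemma additive_on_diff:
  "additive_on M f \<Longrightarrow> subgrp M \<Longrightarrow> x \<in> M \<Longrightarrow> y \<in> M \<Longrightarrow> f (x - y) = f x - f y"
  using additive_on_add[of M f x "- y"] by (simp add: additive_on_uminus subgrp_uminus)

lemma additive_on_sum:
  "additive_on M f \<Longrightarrow> subgrp M \<Longrightarrow> (\<And>i. i \<in> I \<Longrightarrow> h i \<in> M) \<Longrightarrow> f (sum h I) = (\<Sum>i\<in>I. f (h i))"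
  by (induction I rule: infinite_finite_induct)
    (auto simp: additive_on_zero additive_on_add subgrp_sum)

lemma additive_on_subset: "additive_on M f \<Longrightarrow> N \<subseteq> M \<Longrightarrow> additive_on N f"
  by (auto simp: additive_on_def)

lemma additive_on_cong: "additive_on M f \<Longrightarrow> subgrp M \<Longrightarrow> (\<And>x. x \<in> M \<Longrightarrow> f x = g x) \<Longrightarrow> additive_on M g"
  unfolding additive_on_def using subgrp_add by metis

lemma additive_on_compose:
  "additive_on M f \<Longrightarrow> additive_on N g \<Longrightarrow> (\<And>x. x \<in> M \<Longrightarrow> f x \<in> N) \<Longrightarrow> additive_on M (\<lambda>x. g (f x))"
  by (auto simp: additive_on_def)

lemma additive_on_plus: "additive_on M f \<Longrightarrow> additive_on M g \<Longrightarrow> additive_on M (\<lambda>x. f x + g x)"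
  and additive_on_minus: "additive_on M f \<Longrightarrow> additive_on M g \<Longrightarrow> additive_on M (\<lambda>x. f x - g x)"
  by (auto simp: additive_on_def)

lemma additive_on_id: "additive_on M (\<lambda>x. x)"
  and additive_on_mult_left: "additive_on M (\<lambda>x. c * x)"
  and additive_on_mult_right: "additive_on M (\<lambda>x. x * c)"
  and additive_on_mult_left': "additive_on M f \<Longrightarrow> additive_on M (\<lambda>x. c * f x)"
  and additive_on_mult_right': "additive_on M f \<Longrightarrow> additive_on M (\<lambda>x. f x * c)"
  by (auto simp: additive_on_def algebra_simps)

lemma additive_on_mult_left_ring:
  fixes h :: "'w::star_dga tensor \<Rightarrow> 'w"
  shows "additive_on M h \<Longrightarrow> additive_on M (\<lambda>x. c * h x)"
    and "additive_on M h \<Longrightarrow> additive_on M (\<lambda>x. h x * c)"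
  by (auto simp: additive_on_def algebra_simps)

lemma additive_on_closure_eqI:
  assumes "additive_on (group_closure S) f" "additive_on (group_closure S) g"
    and "\<And>x. x \<in> S \<Longrightarrow> f x = g x" and "x \<in> group_closure S"
  shows "f x = g x"
  using assms(4)
proof induction
  case (base s)
  then show ?case
    using additive_on_zero[OF assms(1) subgrp_group_closure]
      additive_on_zero[OF assms(2) subgrp_group_closure] assms(3) by auto
next
  case (diff s t)
  then show ?case
    using additive_on_diff[OF assms(1) subgrp_group_closure] additive_on_diff[OF assms(2) subgrp_group_closure]
    by simp
qed

lemma tprodI: "x \<in> M \<Longrightarrow> y \<in> N \<Longrightarrow> x * y \<in> M \<otimes>\<^sub>A N"
  unfolding tprod_def by (rule group_closure.base) auto

lemma subgrp_tprod: "subgrp (M \<otimes>\<^sub>A N)"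
  unfolding tprod_def by (rule subgrp_group_closure)

lemma tprod_least:
  "(\<And>x y. x \<in> M \<Longrightarrow> y \<in> N \<Longrightarrow> x * y \<in> S) \<Longrightarrow> subgrp S \<Longrightarrow> M \<otimes>\<^sub>A N \<subseteq> S"
  unfolding tprod_def by (rule group_closure_least) auto

lemma tprod_mono: "M \<subseteq> M' \<Longrightarrow> N \<subseteq> N' \<Longrightarrow> M \<otimes>\<^sub>A N \<subseteq> M' \<otimes>\<^sub>A N'"
  by (rule tprod_least) (auto intro: tprodI subgrp_tprod)

lemma tprod_induct [consumes 1, case_names zero mult diff]:
  assumes "z \<in> M \<otimes>\<^sub>A N" and "P 0" and "\<And>x y. x \<in> M \<Longrightarrow> y \<in> N \<Longrightarrow> P (x * y)"
    and "\<And>x y. x \<in> M \<otimes>\<^sub>A N \<Longrightarrow> y \<in> M \<otimes>\<^sub>A N \<Longrightarrow> P x \<Longrightarrow> P y \<Longrightarrow> P (x - y)"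
  shows "P z"
proof -
  have "M \<otimes>\<^sub>A N \<subseteq> {z \<in> M \<otimes>\<^sub>A N. P z}"
    by (rule tprod_least)
      (auto simp: assms subgrp_def intro: tprodI subgrp_zero subgrp_diff subgrp_tprod)
  then show ?thesis using assms(1) by auto
qed

lemma tprod_eqI:
  assumes "z \<in> M \<otimes>\<^sub>A N" and "additive_on (M \<otimes>\<^sub>A N) f" "additive_on (M \<otimes>\<^sub>A N) g"
    and "\<And>x y. x \<in> M \<Longrightarrow> y \<in> N \<Longrightarrow> f (x * y) = g (x * y)"
  shows "f z = g z"
  by (rule additive_on_closure_eqI[OF assms(2,3)[unfolded tprod_def] _ assms(1)[unfolded tprod_def]])
    (auto simp: assms(4))

lemma subgrp_vimage_right: "subgrp S \<Longrightarrow> subgrp {x :: 'a::ring. x * y \<in> S}"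
  and subgrp_vimage_left: "subgrp S \<Longrightarrow> subgrp {x :: 'a::ring. y * x \<in> S}"
  by (auto simp: subgrp_def algebra_simps)

text \<open>Since all tensor products sit in one ring, this is associativity of its multiplication
  and an equality of sets. Later steps rebracket by rewriting instead of transporting along
  isomorphisms.\<close>

lemma tprod_assoc: "(M \<otimes>\<^sub>A N) \<otimes>\<^sub>A P = M \<otimes>\<^sub>A (N \<otimes>\<^sub>A P)"
proof
  show "(M \<otimes>\<^sub>A N) \<otimes>\<^sub>A P \<subseteq> M \<otimes>\<^sub>A (N \<otimes>\<^sub>A P)"
  proof (rule tprod_least[OF _ subgrp_tprod])
    fix x y assume "x \<in> M \<otimes>\<^sub>A N" "y \<in> P"
    have "M \<otimes>\<^sub>A N \<subseteq> {x. x * y \<in> M \<otimes>\<^sub>A (N \<otimes>\<^sub>A P)}"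
      using \<open>y \<in> P\<close> by (intro tprod_least subgrp_vimage_right subgrp_tprod) (auto simp: mult.assoc intro!: tprodI)
    then show "x * y \<in> M \<otimes>\<^sub>A (N \<otimes>\<^sub>A P)" using \<open>x \<in> M \<otimes>\<^sub>A N\<close> by auto
  qed
  show "M \<otimes>\<^sub>A (N \<otimes>\<^sub>A P) \<subseteq> (M \<otimes>\<^sub>A N) \<otimes>\<^sub>A P"
  proof (rule tprod_least[OF _ subgrp_tprod])
    fix x y assume "x \<in> M" "y \<in> N \<otimes>\<^sub>A P"
    have "N \<otimes>\<^sub>A P \<subseteq> {y. x * y \<in> (M \<otimes>\<^sub>A N) \<otimes>\<^sub>A P}"
      using \<open>x \<in> M\<close> by (intro tprod_least subgrp_vimage_left subgrp_tprod) (auto simp: mult.assoc[symmetric] intro!: tprodI)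
    then show "x * y \<in> (M \<otimes>\<^sub>A N) \<otimes>\<^sub>A P" using \<open>y \<in> N \<otimes>\<^sub>A P\<close> by auto
  qed
qed

text \<open>The recursion of the holomorphic structure asks for an explicit finite sum of simple
  tensors, while the closure provides differences. A minus sign can be absorbed in the left factor
  because M is a subgroup.\<close>

lemma tprod_sumE:
  assumes "z \<in> M \<otimes>\<^sub>A N" and "subgrp M"
  obtains n :: nat and x y where "\<And>k. k < n \<Longrightarrow> x k \<in> M \<and> y k \<in> N" "z = (\<Sum>k<n. x k * y k)"
proof -
  let ?P = "\<lambda>z. \<exists>(n::nat) x y. (\<forall>k<n. x k \<in> M \<and> y k \<in> N) \<and> z = (\<Sum>k<n. x k * y k)"
  have "?P z" using assms(1)
  proof (induction rule: tprod_induct)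
    case zero
    show ?case by (rule exI[of _ 0]) simp
  next
    case (mult x y)
    show ?case by (rule exI[of _ 1], rule exI[of _ "\<lambda>_. x"], rule exI[of _ "\<lambda>_. y"]) (simp add: mult One_nat_def)
  next
    case (diff z1 z2)
    then obtain n1 x1 y1 n2 x2 y2 where *:
      "\<forall>k<n1::nat. x1 k \<in> M \<and> y1 k \<in> N" "z1 = (\<Sum>k<n1. x1 k * y1 k)"
      "\<forall>k<n2::nat. x2 k \<in> M \<and> y2 k \<in> N" "z2 = (\<Sum>k<n2. x2 k * y2 k)" by blast
    define x where "x = (\<lambda>k. if k < n1 then x1 k else - x2 (k - n1))"
    define y where "y = (\<lambda>k. if k < n1 then y1 k else y2 (k - n1))"
    have "(\<Sum>k<n1+n2. x k * y k) = (\<Sum>k<n1. x k * y k) + (\<Sum>k<n2. x (n1 + k) * y (n1 + k))"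
      by (induction n2) (simp_all add: add.assoc)
    also have "\<dots> = z1 - z2" by (simp add: x_def y_def * sum_negf)
    finally have "z1 - z2 = (\<Sum>k<n1+n2. x k * y k)" ..
    moreover have "\<forall>k<n1+n2. x k \<in> M \<and> y k \<in> N"
      using * subgrp_uminus[OF assms(2)] by (auto simp: x_def y_def)
    ultimately show ?case by blast
  qed
  then show thesis using that by blast
qed

section \<open>Homogeneous components of forms\<close>

definition deg :: "nat \<Rightarrow> 'w::star_dga \<Rightarrow> 'w" where
  "deg n \<omega> = (THE c. (\<forall>n. c n \<in> forms n) \<and> finite {n. c n \<noteq> 0} \<and> \<omega> = (\<Sum>n | c n \<noteq> 0. c n)) n"

lemma deg_props:
  fixes \<omega> :: "'w::star_dga"
  shows "deg n \<omega> \<in> forms n" "finite {n. deg n \<omega> \<noteq> 0}" "\<omega> = (\<Sum>n | deg n \<omega> \<noteq> 0. deg n \<omega>)"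
  using theI'[OF forms_direct_sum[of \<omega>]] by (auto simp: deg_def)

text \<open>The finite set F may be larger than the support, so that sums and multiples of families
  can be handled without determining where they vanish.\<close>

lemma deg_unique:
  fixes \<omega> :: "'w::star_dga"
  assumes "\<And>n. c n \<in> forms n" "finite F" "\<And>n. n \<notin> F \<Longrightarrow> c n = 0" "\<omega> = (\<Sum>n\<in>F. c n)"
  shows "deg n \<omega> = c n"
proof -
  have F: "{n. c n \<noteq> 0} \<subseteq> F" using assms(3) by auto
  have "\<omega> = (\<Sum>n | c n \<noteq> 0. c n)"
    unfolding assms(4) by (rule sum.mono_neutral_right) (use assms F in auto)
  then have "(THE c. (\<forall>n. c n \<in> forms n) \<and> finite {n. c n \<noteq> 0} \<and> \<omega> = (\<Sum>n | c n \<noteq> 0. c n)) = c"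
    using assms(1) finite_subset[OF F assms(2)] by (intro the1_equality[OF forms_direct_sum]) auto
  then show ?thesis by (simp add: deg_def)
qed

lemma deg_sum_superset:
  fixes \<omega> :: "'w::star_dga"
  assumes "finite F" "{n. deg n \<omega> \<noteq> 0} \<subseteq> F"
  shows "\<omega> = (\<Sum>n\<in>F. deg n \<omega>)"
  by (subst deg_props(3)) (rule sum.mono_neutral_left, use assms in auto)

lemma deg_of_forms:
  fixes \<omega> :: "'w::star_dga"
  shows "\<omega> \<in> forms m \<Longrightarrow> deg n \<omega> = (if n = m then \<omega> else 0)"
  by (rule deg_unique[where F = "{m}"]) (auto simp: forms_zero)

lemma deg_add: "deg n (x + y) = deg n x + deg n (y :: 'w::star_dga)"
proof (rule deg_unique[where F = "{n. deg n x \<noteq> 0} \<union> {n. deg n y \<noteq> 0}"])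
  let ?F = "{n. deg n x \<noteq> 0} \<union> {n. deg n y \<noteq> 0}"
  show "x + y = (\<Sum>n\<in>?F. deg n x + deg n y)"
    unfolding sum.distrib by (intro arg_cong2[where f = "(+)"] deg_sum_superset) (auto simp: deg_props)
qed (auto simp: deg_props forms_add)

lemma deg_lmult: "a \<in> forms 0 \<Longrightarrow> deg n (a * x) = a * deg n (x :: 'w::star_dga)"
  by (rule deg_unique[where F = "{n. deg n x \<noteq> 0}"])
    (auto simp: deg_props forms_0_mult sum_distrib_left[symmetric] deg_props(3)[symmetric])

lemma deg_rmult: "a \<in> forms 0 \<Longrightarrow> deg n (x * a) = deg n (x :: 'w::star_dga) * a"
  by (rule deg_unique[where F = "{n. deg n x \<noteq> 0}"])
    (auto simp: deg_props forms_mult_0 sum_distrib_right[symmetric] deg_props(3)[symmetric])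

section \<open>Additive maps out of the tensor ring\<close>

lemma subgrp_forms: "subgrp (forms n :: 'w::star_dga set)"
  using forms_add[OF _ forms_uminus, of _ n] by (auto simp: subgrp_def forms_zero)

lemma vec_apply_forms: "\<xi> \<in> forms 1 \<Longrightarrow> vec_apply v \<xi> \<in> forms 0"
  and vec_apply_add: "\<xi> \<in> forms 1 \<Longrightarrow> \<eta> \<in> forms 1 \<Longrightarrow> vec_apply v (\<xi> + \<eta>) = vec_apply v \<xi> + vec_apply v \<eta>"
  and vec_apply_mult: "\<xi> \<in> forms 1 \<Longrightarrow> a \<in> forms 0 \<Longrightarrow> vec_apply v (\<xi> * a) = vec_apply v \<xi> * a"
  using vec_apply[of v] by auto

lemma vec_eqI: "(\<And>\<xi>. \<xi> \<in> forms 1 \<Longrightarrow> vec_apply u \<xi> = vec_apply v \<xi>) \<Longrightarrow> u = v"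
proof -
  assume *: "\<And>\<xi>. \<xi> \<in> forms 1 \<Longrightarrow> vec_apply u \<xi> = vec_apply v \<xi>"
  have "vec_apply u \<xi> = vec_apply v \<xi>" for \<xi>
    using * vec_apply[of v] vec_apply[of u] by (cases "\<xi> \<in> forms 1") auto
  then show ?thesis by (simp add: vec_apply_inject[symmetric] fun_eq_iff)
qed

lemma vec_apply_plus: "vec_apply (u + v) \<xi> = vec_apply u \<xi> + vec_apply v \<xi>"
  by (simp add: plus_vec.rep_eq)

lemma vec_apply_lmult: "a \<in> forms 0 \<Longrightarrow> vec_apply (vec_lmult a v) \<xi> = a * vec_apply v \<xi>"
  by (simp add: vec_lmult.rep_eq)

lemma vec_apply_rmult:
  "a \<in> forms 0 \<Longrightarrow> \<xi> \<in> forms 1 \<Longrightarrow> vec_apply (vec_rmult v a) \<xi> = vec_apply v (a * \<xi>)"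
  by (simp add: vec_rmult.rep_eq)

lemma vec_lmult_add_left:
  "a \<in> forms 0 \<Longrightarrow> b \<in> forms 0 \<Longrightarrow> vec_lmult (a + b) v = vec_lmult a v + vec_lmult b v"
  by (rule vec_eqI) (simp add: vec_apply_lmult vec_apply_plus forms_add algebra_simps)

lemma vec_lmult_add_right:
  "a \<in> forms 0 \<Longrightarrow> vec_lmult a (u + v) = vec_lmult a u + vec_lmult a v"
  by (rule vec_eqI) (simp add: vec_apply_lmult vec_apply_plus algebra_simps)

lemma vec_lmult_mult:
  "a \<in> forms 0 \<Longrightarrow> b \<in> forms 0 \<Longrightarrow> vec_lmult (a * b) v = vec_lmult a (vec_lmult b v)"
  by (rule vec_eqI) (simp add: vec_apply_lmult forms_0_mult mult.assoc)

lemma vec_lmult_rmult: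
  "a \<in> forms 0 \<Longrightarrow> b \<in> forms 0 \<Longrightarrow> vec_lmult a (vec_rmult v b) = vec_rmult (vec_lmult a v) b"
  by (rule vec_eqI) (simp add: vec_apply_lmult vec_apply_rmult forms_0_mult)

lemma vec_lmult_one: "vec_lmult 1 v = v"
  by (rule vec_eqI) (simp add: vec_apply_lmult forms_one)

section \<open>Generators and relations of the tensor ring\<close>

lemma form_add: "form (\<xi> + \<eta>) = form \<xi> + form \<eta>"
  by transfer (rule tcong.Form_add)

lemma vfield_add: "vfield (u + v) = vfield u + vfield v"
  by transfer (rule tcong.Field_add)

lemma form_lmult: "a \<in> forms 0 \<Longrightarrow> form a * form \<xi> = form (a * \<xi>)"
  by transfer (rule tcong.Form_lmult)

lemma form_rmult: "a \<in> forms 0 \<Longrightarrow> form \<xi> * form a = form (\<xi> * a)"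
  by transfer (rule tcong.Form_rmult)

lemma vfield_lmult: "a \<in> forms 0 \<Longrightarrow> form a * vfield v = vfield (vec_lmult a v)"
  by transfer (rule tcong.Field_lmult)

lemma vfield_rmult: "a \<in> forms 0 \<Longrightarrow> vfield v * form a = vfield (vec_rmult v a)"
  by transfer (rule tcong.Field_rmult)

lemma form_zero: "form 0 = 0" by transfer (rule tcong.refl)
lemma form_one: "form 1 = 1" by transfer (rule tcong.refl)

lemma form_uminus: "form (- \<xi>) = - form \<xi>"
  using form_add[of \<xi> "- \<xi>"] by (simp add: form_zero eq_neg_iff_add_eq_0 add.commute)

lemma form_diff: "form (\<xi> - \<eta>) = form \<xi> - form \<eta>"
  using form_add[of \<xi> "- \<eta>"] by (simp add: form_uminus)

lemma form_sum: "form (sum f I) = (\<Sum>i\<in>I. form (f i))"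
  by (induction I rule: infinite_finite_induct) (simp_all add: form_zero form_add)

lemma vfield_zero: "vfield 0 = 0"
  using vfield_add[of 0 0] by simp

lemma vfield_uminus: "vfield (- u) = - vfield u"
  using vfield_add[of u "- u"] by (simp add: vfield_zero eq_neg_iff_add_eq_0 add.commute)

lemma vfield_diff: "vfield (u - v) = vfield u - vfield v"
  using vfield_add[of u "- v"] by (simp add: vfield_uminus)

lemma wedge_form [simp]: "wedge (form \<xi>) = \<xi>" by transfer simp
lemma wedge_add: "wedge (x + y) = wedge x + wedge y" by transfer simp
lemma wedge_mult: "wedge (x * y) = wedge x * wedge y" by transfer simp
lemma wedge_zero: "wedge 0 = 0" by transfer simp
lemma wedge_uminus: "wedge (- x) = - wedge x" by transfer simp

lemma wedge_sum: "wedge (sum f I) = (\<Sum>i\<in>I. wedge (f i))"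
  by (induction I rule: infinite_finite_induct) (simp_all add: wedge_zero wedge_add)

lemma wedge_diff: "wedge (x - y) = wedge x - wedge y"
  using wedge_add[of x "- y"] by (simp add: wedge_uminus)

lemma ex_abs_tensor: "\<exists>x'. x = abs_tensor x'"
  by (induction x rule: tensor.abs_induct) blast

text \<open>The augmentation of the tensor ring: the ring homomorphism onto A that kills vector
  fields and all forms of positive degree. The twisted Leibniz rule below applies it to the left
  factor of a product.\<close>

primrec deg0_texp :: "('w::star_dga, 'w vec) texp \<Rightarrow> 'w" where
  "deg0_texp (TForm \<xi>) = deg 0 \<xi>"
| "deg0_texp (TField v) = 0"
| "deg0_texp (TPlus x y) = deg0_texp x + deg0_texp y"
| "deg0_texp (TNeg x) = - deg0_texp x"
| "deg0_texp (TTimes x y) = deg0_texp x * deg0_texp y"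

lemma deg0_texp_forms: "deg0_texp x \<in> forms 0"
  by (induction x) (auto simp: deg_props forms_zero forms_add forms_uminus forms_0_mult)

lemma deg0_texp_cong: "tcong x y \<Longrightarrow> deg0_texp x = deg0_texp y"
  by (induction rule: tcong.induct)
    (simp_all add: algebra_simps deg_add deg_lmult deg_rmult deg_of_forms[OF forms_one]
      deg_of_forms[where m = 0] forms_zero)

text \<open>
  The maps \<open>M \<times> T \<rightarrow> B\<close> given by \<open>hF\<close> and \<open>hV\<close> extend over the tensor ring \<open>T = A \<oplus> M \<otimes>\<^sub>A T\<close>. As in
  Fox calculus, the extension is computed on expressions by a twisted Leibniz rule, where \<open>a\<close>
  collects the part of degree 0 that precedes and \<open>t\<close> the factors that follow.
\<close>

locale fox =
  fixes hF :: "'w::star_dga \<Rightarrow> 'w tensor \<Rightarrow> 'b::ab_group_add" and hV :: "'w vec \<Rightarrow> 'w tensor \<Rightarrow> 'b"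
  assumes hF_add_left: "hF (\<xi> + \<eta>) t = hF \<xi> t + hF \<eta> t"
    and hF_add_right: "hF \<xi> (s + t) = hF \<xi> s + hF \<xi> t"
    and hF_0: "a \<in> forms 0 \<Longrightarrow> hF a t = 0"
    and hF_balanced: "a \<in> forms 0 \<Longrightarrow> hF (\<xi> * a) t = hF \<xi> (form a * t)"
    and hV_add_left: "hV (u + v) t = hV u t + hV v t"
    and hV_add_right: "hV u (s + t) = hV u s + hV u t"
    and hV_balanced: "a \<in> forms 0 \<Longrightarrow> hV (vec_rmult v a) t = hV v (form a * t)"
begin

text \<open>With \<open>a\<close> and \<open>t\<close> equal to 1 this is a Fox derivation, D(x y) =
  eps(x) D(y) + D(x) y, where eps is the augmentation. The target is only an abelian group, on which
  neither eps(x) nor y can act, so both are passed down as parameters and absorbed where a generator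
  is reached.\<close>

primrec fox_texp :: "('w, 'w vec) texp \<Rightarrow> 'w \<Rightarrow> 'w tensor \<Rightarrow> 'b" where
  "fox_texp (TForm \<xi>) a t = hF (a * \<xi>) t"
| "fox_texp (TField v) a t = hV (vec_lmult a v) t"
| "fox_texp (TPlus x y) a t = fox_texp x a t + fox_texp y a t"
| "fox_texp (TNeg x) a t = - fox_texp x a t"
| "fox_texp (TTimes x y) a t = fox_texp y (a * deg0_texp x) t + fox_texp x a (abs_tensor y * t)"

lemma fox_texp_add_left: "a \<in> forms 0 \<Longrightarrow> b \<in> forms 0 \<Longrightarrow> fox_texp x (a + b) t = fox_texp x a t + fox_texp x b t"
  by (induction x arbitrary: a b t)
    (simp_all add: distrib_right hF_add_left hV_add_left vec_lmult_add_left forms_0_mult deg0_texp_forms)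

lemma fox_texp_add_right: "fox_texp x a (s + t) = fox_texp x a s + fox_texp x a t"
  by (induction x arbitrary: a s t) (simp_all add: hF_add_right hV_add_right distrib_left)

lemma fox_texp_uminus_left: "a \<in> forms 0 \<Longrightarrow> fox_texp x (- a) t = - fox_texp x a t"
proof -
  assume a: "a \<in> forms 0"
  have "fox_texp x 0 t = 0" using fox_texp_add_left[OF forms_zero forms_zero, of x t] by simp
  then show ?thesis using fox_texp_add_left[OF a forms_uminus[OF a], of x t]
    by (simp add: eq_neg_iff_add_eq_0 add.commute)
qed

lemma hF_zero: "hF 0 t = 0"
  using hF_add_left[of 0 0 t] by simp

lemma fox_texp_cong: "tcong x y \<Longrightarrow> a \<in> forms 0 \<Longrightarrow> fox_texp x a t = fox_texp y a t"
proof (induction arbitrary: a t rule: tcong.induct)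
  case (Times_cong x x' y y')
  have "abs_tensor y = abs_tensor y'" using Times_cong.hyps(2) by (simp add: tensor.abs_eq_iff)
  then show ?case
    using Times_cong.IH[of _ "abs_tensor y * t"] Times_cong.IH(2)[of "a * deg0_texp x"] Times_cong.prems
      deg0_texp_cong[OF Times_cong.hyps(1)]
    by (simp add: forms_0_mult deg0_texp_forms)
next
  case (Times_assoc x y z)
  then show ?case by (simp add: times_tensor.abs_eq[symmetric] mult.assoc)
next
  case (Times_Plus x y z)
  then show ?case by (simp add: plus_tensor.abs_eq[symmetric] distrib_right fox_texp_add_right)
next
  case (Plus_Times x y z)
  then show ?case by (simp add: distrib_left fox_texp_add_left forms_0_mult deg0_texp_forms)
next
  case (one_Times x)
  then show ?case by (simp add: deg_of_forms[OF forms_one] hF_0)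
next
  case (Times_one x)
  then show ?case
    by (simp add: hF_0 forms_0_mult deg0_texp_forms forms_mult_0 forms_one one_tensor.abs_eq[symmetric])
next
  case (Form_lmult b \<xi>)
  then show ?case
    by (simp add: deg_of_forms[where m = 0] mult.assoc hF_0 forms_0_mult)
next
  case (Form_rmult b \<xi>)
  then have "hF (a * deg 0 \<xi> * b) t = 0"
    by (intro hF_0) (simp add: forms_0_mult deg_props forms_mult_0)
  with Form_rmult show ?case
    by (simp add: mult.assoc[symmetric] hF_balanced form.abs_eq[symmetric])
next
  case (Field_lmult b v)
  then show ?case by (simp add: deg_of_forms[where m = 0] vec_lmult_mult hF_0 forms_0_mult)
next
  case (Field_rmult b v)
  then show ?case
    by (simp add: hF_zero vec_lmult_rmult hV_balanced form.abs_eq[symmetric])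
qed (simp_all add: hF_add_left hV_add_left hF_zero vec_lmult_add_right distrib_left add_ac)

definition lift :: "'w tensor \<Rightarrow> 'b" where
  "lift x = fox_texp (rep_tensor x) 1 1"

lemma lift_abs: "lift (abs_tensor x) = fox_texp x 1 1"
  unfolding lift_def
  by (intro fox_texp_cong forms_one) (simp add: tensor.abs_eq_iff[symmetric] Quotient3_abs_rep[OF Quotient3_tensor])

lemma lift_add: "lift (x + y) = lift x + lift y"
proof -
  obtain x' y' where "x = abs_tensor x'" "y = abs_tensor y'" using ex_abs_tensor by metis
  then show ?thesis by (simp add: plus_tensor.abs_eq lift_abs)
qed

lemma fox_texp_one: "deg 0 \<xi> = 0 \<Longrightarrow> fox_texp (TTimes (TForm \<xi>) y) 1 1 = hF \<xi> (abs_tensor y)"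
  using fox_texp_uminus_left[OF forms_zero, of y 1] fox_texp_add_left[OF forms_zero forms_zero, of y 1] by simp

lemma lift_form_mult:
  assumes "\<xi> \<in> forms 1" shows "lift (form \<xi> * y) = hF \<xi> y"
proof -
  obtain y' where "y = abs_tensor y'" using ex_abs_tensor by metis
  then show ?thesis using assms by (simp add: form.abs_eq times_tensor.abs_eq lift_abs fox_texp_one deg_of_forms del: fox_texp.simps)
qed

lemma lift_vfield_mult: "lift (vfield v * y) = hV v y"
proof -
  obtain y' where y: "y = abs_tensor y'" using ex_abs_tensor by metis
  have "fox_texp y' 0 1 = 0" using fox_texp_add_left[OF forms_zero forms_zero, of y' 1] by simp
  then show ?thesis using y by (simp add: vfield.abs_eq times_tensor.abs_eq lift_abs vec_lmult_one)
qed

lemma lift_form: "a \<in> forms 0 \<Longrightarrow> lift (form a) = 0"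
  by (simp add: form.abs_eq lift_abs hF_0)

lemma lift_in:
  assumes S: "subgrp S" "\<And>\<xi> t. hF \<xi> t \<in> S" "\<And>v t. hV v t \<in> S"
  shows "lift x \<in> S"
proof -
  have "fox_texp x a t \<in> S" for x a t
    by (induction x arbitrary: a t) (simp_all add: S subgrp_add subgrp_uminus)
  then show ?thesis by (simp add: lift_def)
qed

text \<open>A left factor from A only changes the coefficient with which the recursion starts, so
  linearity passes from the values on generators to the extension. With \<open>l\<close> a left
  multiplication this makes the projections constructed below left linear.\<close>

lemma lift_left_linear:
  assumes b: "b \<in> forms 0" and l: "\<And>x y. l (x + y) = l x + l y"
    and F: "\<And>\<xi> t. hF (b * \<xi>) t = l (hF \<xi> t)" and V: "\<And>v t. hV (vec_lmult b v) t = l (hV v t)"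
  shows "lift (form b * x) = l (lift x)"
proof -
  have l0: "l 0 = 0" using l[of 0 0] by simp
  have lm: "l (- x) = - l x" for x using l[of x "- x"] by (simp add: l0 eq_neg_iff_add_eq_0 add.commute)
  have *: "fox_texp x (b * a) t = l (fox_texp x a t)" if "a \<in> forms 0" for x a t
    using that
    by (induction x arbitrary: a t) (simp_all add: F V l lm mult.assoc vec_lmult_mult b forms_0_mult deg0_texp_forms)
  obtain x' where "x = abs_tensor x'" using ex_abs_tensor by metis
  then show ?thesis
    using *[OF forms_one, of x' 1] b
    by (simp add: form.abs_eq times_tensor.abs_eq lift_abs deg_of_forms hF_0)
qed

end

section \<open>Modules inside the tensor ring, direct summands and induced maps\<close>

definition lmod :: "'w::star_dga tensor set \<Rightarrow> bool" where
  "lmod N \<longleftrightarrow> subgrp N \<and> (\<forall>a\<in>forms 0. \<forall>x\<in>N. form a * x \<in> N)"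

definition bimod :: "'w::star_dga tensor set \<Rightarrow> bool" where
  "bimod N \<longleftrightarrow> lmod N \<and> (\<forall>a\<in>forms 0. \<forall>x\<in>N. x * form a \<in> N)"

lemma lmod_subgrp: "lmod N \<Longrightarrow> subgrp N"
  and lmod_mult: "lmod N \<Longrightarrow> a \<in> forms 0 \<Longrightarrow> x \<in> N \<Longrightarrow> form a * x \<in> N"
  and bimod_lmod: "bimod N \<Longrightarrow> lmod N"
  and bimod_rmult: "bimod N \<Longrightarrow> a \<in> forms 0 \<Longrightarrow> x \<in> N \<Longrightarrow> x * form a \<in> N"
  by (auto simp: lmod_def bimod_def)

lemma subgrp_form_image: "subgrp S \<Longrightarrow> subgrp (form ` S)"
  unfolding subgrp_def by (auto simp: form_zero[symmetric] form_diff[symmetric])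

lemma subgrp_vfield_image: "subgrp S \<Longrightarrow> subgrp (vfield ` S)"
  unfolding subgrp_def by (auto simp: vfield_zero[symmetric] vfield_diff[symmetric])

lemma lmod_tprod: "lmod M \<Longrightarrow> lmod (M \<otimes>\<^sub>A N)"
proof -
  assume M: "lmod M"
  have "M \<otimes>\<^sub>A N \<subseteq> {x. form a * x \<in> M \<otimes>\<^sub>A N}" if "a \<in> forms 0" for a
    by (intro tprod_least subgrp_vimage_left subgrp_tprod)
      (auto simp: mult.assoc[symmetric] intro!: tprodI lmod_mult M that)
  then show ?thesis by (auto simp: lmod_def subgrp_tprod)
qed

lemma bimod_tprod: "lmod M \<Longrightarrow> bimod N \<Longrightarrow> bimod (M \<otimes>\<^sub>A N)"
proof -
  assume M: "lmod M" and N: "bimod N"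
  have "M \<otimes>\<^sub>A N \<subseteq> {x. x * form a \<in> M \<otimes>\<^sub>A N}" if "a \<in> forms 0" for a
    by (intro tprod_least subgrp_vimage_right subgrp_tprod)
      (auto simp: mult.assoc intro!: tprodI bimod_rmult N that)
  then show ?thesis by (auto simp: bimod_def lmod_tprod M)
qed

text \<open>The modules that occur as left factors of tensor products. Recording how they are built
  lets the summand property and the existence of induced maps be proved by induction on the shape,
  one elementary factor at a time.\<close>

inductive tmod :: "'w::star_dga tensor set \<Rightarrow> bool" where
  tmod_Alg: "tmod Alg"
| tmod_Forms1: "tmod Forms1"
| tmod_Fields: "tmod Fields"
| tmod_tprod: "tmod M \<Longrightarrow> tmod N \<Longrightarrow> tmod (M \<otimes>\<^sub>A N)"

lemma tmod_tpower: "tmod M \<Longrightarrow> tmod (tpower M n)"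
  by (induction n) (auto intro: tmod.intros)

lemma bimod_forms: "bimod (form ` forms n)"
  by (auto simp: bimod_def lmod_def subgrp_form_image subgrp_forms form_lmult form_rmult forms_0_mult forms_mult_0)

lemma bimod_Fields: "bimod Fields"
  by (auto simp: bimod_def lmod_def vfield_lmult vfield_rmult intro!: subgrp_vfield_image) (simp add: subgrp_def)

lemma tmod_bimod: "tmod M \<Longrightarrow> bimod M"
  by (induction rule: tmod.induct) (auto simp: bimod_forms bimod_Fields bimod_tprod bimod_lmod)

lemma tmod_lmod: "tmod M \<Longrightarrow> lmod M"
  and tmod_subgrp: "tmod M \<Longrightarrow> subgrp M"
  by (auto dest!: tmod_bimod simp: bimod_def lmod_def)

lemma Alg_tprod: "lmod M \<Longrightarrow> Alg \<otimes>\<^sub>A M = M"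
proof
  assume M: "lmod M"
  show "Alg \<otimes>\<^sub>A M \<subseteq> M"
    by (rule tprod_least) (auto intro: lmod_mult lmod_subgrp M)
  show "M \<subseteq> Alg \<otimes>\<^sub>A M"
  proof
    fix x assume "x \<in> M"
    then show "x \<in> Alg \<otimes>\<^sub>A M"
      using tprodI[of "form 1" Alg x M] by (simp add: forms_one) (simp add: form_one)
  qed
qed

lemma tprod_Alg: "bimod M \<Longrightarrow> M \<otimes>\<^sub>A Alg = M"
proof
  assume M: "bimod M"
  show "M \<otimes>\<^sub>A Alg \<subseteq> M"
    by (rule tprod_least) (auto intro: bimod_rmult lmod_subgrp bimod_lmod M)
  show "M \<subseteq> M \<otimes>\<^sub>A Alg"
  proof
    fix x assume "x \<in> M"
    then show "x \<in> M \<otimes>\<^sub>A Alg"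
      using tprodI[of x M "form 1" Alg] by (simp add: forms_one) (simp add: form_one)
  qed
qed

lemma lmod_tpower: "lmod M \<Longrightarrow> lmod (tpower M n)"
  by (induction n) (auto intro: lmod_tprod bimod_lmod bimod_forms)

lemma tpower_1: "bimod M \<Longrightarrow> tpower M (Suc 0) = M"
  by (simp add: tprod_Alg)

lemma tpower_add: "lmod M \<Longrightarrow> tpower M m \<otimes>\<^sub>A tpower M n = tpower M (m + n)"
  by (induction m) (auto simp: Alg_tprod lmod_tpower tprod_assoc)

text \<open>Tensor powers are defined by splitting off the leftmost factor, which suits the fields;
  the derivative on forms and the nested evaluation split off the rightmost form.\<close>

lemma tpower_Suc_right: "bimod M \<Longrightarrow> tpower M (Suc n) = tpower M n \<otimes>\<^sub>A M"
  using tpower_add[of M n 1] by (simp add: bimod_lmod tprod_Alg One_nat_def)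

definition balanced ::
  "'w::star_dga tensor set \<Rightarrow> 'w tensor set \<Rightarrow> ('w tensor \<Rightarrow> 'w tensor \<Rightarrow> 'b::ab_group_add) \<Rightarrow> bool" where
  "balanced M N f \<longleftrightarrow> (\<forall>x\<in>M. additive_on N (f x)) \<and> (\<forall>y\<in>N. additive_on M (\<lambda>x. f x y)) \<and>
     (\<forall>x\<in>M. \<forall>a\<in>forms 0. \<forall>y\<in>N. f (x * form a) y = f x (form a * y))"

text \<open>
  A direct summand of the tensor ring as a left module: a balanced map on \<open>M \<times> N\<close> can then be
  extended to \<open>M \<times> T\<close>.
\<close>

definition lsummand :: "'w::star_dga tensor set \<Rightarrow> bool" where
  "lsummand N \<longleftrightarrow> (\<exists>P. additive_on UNIV P \<and> (\<forall>x. P x \<in> N) \<and> (\<forall>x\<in>N. P x = x) \<and>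
     (\<forall>a\<in>forms 0. \<forall>x. P (form a * x) = form a * P x))"

lemma lsummandE:
  assumes "lsummand N"
  obtains P where "\<And>x y. P (x + y) = P x + P y" "\<And>x. P x \<in> N" "\<And>x. x \<in> N \<Longrightarrow> P x = x"
    "\<And>a x. a \<in> forms 0 \<Longrightarrow> P (form a * x) = form a * P x"
  using assms by (force simp: lsummand_def additive_on_def)

lemma lsummand_lmod: "lsummand N \<Longrightarrow> lmod N"
proof (erule lsummandE)
  fix P assume *: "\<And>x y. P (x + y) = P x + P y" "\<And>x. P x \<in> N" "\<And>x. x \<in> N \<Longrightarrow> P x = x"
    "\<And>a x. a \<in> forms 0 \<Longrightarrow> P (form a * x) = form a * P x"
  have P: "additive_on UNIV P" using * by (simp add: additive_on_def)
  have s: "subgrp (UNIV :: 'a tensor set)" by (simp add: subgrp_def)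
  show "lmod N"
    unfolding lmod_def subgrp_def
    using additive_on_zero[OF P s] additive_on_diff[OF P s] * by (metis UNIV_I)
qed

lift_definition deg0 :: "'w::star_dga tensor \<Rightarrow> 'w" is deg0_texp
  by (rule deg0_texp_cong)

lemma deg0_forms: "deg0 x \<in> forms 0"
  by transfer (rule deg0_texp_forms)

lemma deg0_simps:
  "deg0 (x + y) = deg0 x + deg0 y" "deg0 (x * y) = deg0 x * deg0 y"
  "deg0 (form \<xi>) = deg 0 \<xi>" "deg0 (vfield v) = 0"
  by (transfer; simp)+

lemma lsummand_Alg: "lsummand Alg"
  unfolding lsummand_def
  by (rule exI[of _ "\<lambda>x. form (deg0 x)"])
    (auto simp: additive_on_def deg0_simps form_add deg0_forms deg_of_forms form_lmult)

text \<open>Let P be the projection onto N. The map that sends (\<xi>, t) to the degree 1 part of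
  \<xi> times P t is defined for all forms and all t, so its Fox extension exists; it has values in
  \<open>Forms1 \<otimes>\<^sub>A N\<close> and fixes that module. With f in place of the product,
  the same extension is the induced map.\<close>

lemma
  assumes N: "lsummand N"
  shows lsummand_Forms1_tprod: "lsummand (Forms1 \<otimes>\<^sub>A N)"
    and ex_lift_Forms1: "balanced Forms1 N f \<Longrightarrow>
      \<exists>g. additive_on (Forms1 \<otimes>\<^sub>A N) g \<and> (\<forall>x\<in>Forms1. \<forall>y\<in>N. g (x * y) = (f x y :: 'b::ab_group_add))"
proof -
  obtain P where P: "\<And>x y. P (x + y) = P x + P y" "\<And>x. P x \<in> N" "\<And>x. x \<in> N \<Longrightarrow> P x = x"
    "\<And>a x. a \<in> forms 0 \<Longrightarrow> P (form a * x) = form a * P x" using lsummandE[OF N] by blast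
  interpret fox "\<lambda>\<xi> t. form (deg 1 \<xi>) * P t" "\<lambda>_ _. 0"
    by unfold_locales
      (simp_all add: P deg_add form_add algebra_simps deg_of_forms form_zero deg_rmult form_rmult[symmetric])
  have in_prod: "lift x \<in> Forms1 \<otimes>\<^sub>A N" for x
    by (rule lift_in) (auto intro!: subgrp_tprod tprodI P subgrp_zero simp: deg_props)
  have id: "lift x = x" if "x \<in> Forms1 \<otimes>\<^sub>A N" for x
    by (rule tprod_eqI[OF that])
      (auto simp: additive_on_def lift_add lift_form_mult P deg_of_forms)
  have "lift (form a * x) = form a * lift x" if "a \<in> forms 0" for a x
    by (rule lift_left_linear)
      (use that in \<open>auto simp: algebra_simps deg_lmult form_lmult[symmetric]\<close>)
  with in_prod id show "lsummand (Forms1 \<otimes>\<^sub>A N)"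
    unfolding lsummand_def by (intro exI[of _ lift]) (auto simp: additive_on_def lift_add)
next
  obtain P where P: "\<And>x y. P (x + y) = P x + P y" "\<And>x. P x \<in> N" "\<And>x. x \<in> N \<Longrightarrow> P x = x"
    "\<And>a x. a \<in> forms 0 \<Longrightarrow> P (form a * x) = form a * P x" using lsummandE[OF N] by blast
  assume f: "balanced Forms1 N f"
  have f1: "f (form \<xi>) (x + y) = f (form \<xi>) x + f (form \<xi>) y" if "\<xi> \<in> forms 1" "x \<in> N" "y \<in> N" for \<xi> x y
    using f that by (auto simp: balanced_def additive_on_def)
  have f2: "f (form \<xi> + form \<eta>) y = f (form \<xi>) y + f (form \<eta>) y"
    if "\<xi> \<in> forms 1" "\<eta> \<in> forms 1" "y \<in> N" for \<xi> \<eta> y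
    using f that by (auto simp: balanced_def additive_on_def)
  have f0: "f 0 y = 0" if "y \<in> N" for y
    using f2[OF forms_zero forms_zero that] by (simp add: form_zero)
  have f3: "f (form \<xi> * form a) y = f (form \<xi>) (form a * y)"
    if "\<xi> \<in> forms 1" "a \<in> forms 0" "y \<in> N" for \<xi> a y
    using f that by (auto simp: balanced_def)
  interpret fox "\<lambda>\<xi> t. f (form (deg 1 \<xi>)) (P t)" "\<lambda>_ _. 0"
    by unfold_locales
      (simp_all add: P deg_add form_add f1 f2 f3 deg_props f0 deg_of_forms form_zero deg_rmult form_rmult[symmetric])
  show "\<exists>g. additive_on (Forms1 \<otimes>\<^sub>A N) g \<and> (\<forall>x\<in>Forms1. \<forall>y\<in>N. g (x * y) = f x y)"
    by (rule exI[of _ lift])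
      (auto simp: additive_on_def lift_add lift_form_mult P deg_of_forms)
qed

lemma
  assumes N: "lsummand N"
  shows lsummand_Fields_tprod: "lsummand (Fields \<otimes>\<^sub>A N)"
    and ex_lift_Fields: "balanced Fields N f \<Longrightarrow>
      \<exists>g. additive_on (Fields \<otimes>\<^sub>A N) g \<and> (\<forall>x\<in>Fields. \<forall>y\<in>N. g (x * y) = (f x y :: 'b::ab_group_add))"
proof -
  obtain P where P: "\<And>x y. P (x + y) = P x + P y" "\<And>x. P x \<in> N" "\<And>x. x \<in> N \<Longrightarrow> P x = x"
    "\<And>a x. a \<in> forms 0 \<Longrightarrow> P (form a * x) = form a * P x" using lsummandE[OF N] by blast
  interpret fox "\<lambda>_ _. 0" "\<lambda>v t. vfield v * P t"
    by unfold_locales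
      (simp_all add: P vfield_add algebra_simps vfield_rmult[symmetric])
  have in_prod: "lift x \<in> Fields \<otimes>\<^sub>A N" for x
    by (rule lift_in) (auto intro!: subgrp_tprod tprodI P subgrp_zero)
  have id: "lift x = x" if "x \<in> Fields \<otimes>\<^sub>A N" for x
    by (rule tprod_eqI[OF that]) (auto simp: additive_on_def lift_add lift_vfield_mult P)
  have "lift (form a * x) = form a * lift x" if "a \<in> forms 0" for a x
    by (rule lift_left_linear)
      (use that in \<open>auto simp: algebra_simps vfield_lmult[symmetric]\<close>)
  with in_prod id show "lsummand (Fields \<otimes>\<^sub>A N)"
    unfolding lsummand_def by (intro exI[of _ lift]) (auto simp: additive_on_def lift_add)
next
  obtain P where P: "\<And>x y. P (x + y) = P x + P y" "\<And>x. P x \<in> N" "\<And>x. x \<in> N \<Longrightarrow> P x = x"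
    "\<And>a x. a \<in> forms 0 \<Longrightarrow> P (form a * x) = form a * P x" using lsummandE[OF N] by blast
  assume f: "balanced Fields N f"
  interpret fox "\<lambda>_ _. 0" "\<lambda>v t. f (vfield v) (P t)"
    by unfold_locales
      (use f P in \<open>simp_all add: balanced_def additive_on_def vfield_add vfield_rmult[symmetric]\<close>)
  show "\<exists>g. additive_on (Fields \<otimes>\<^sub>A N) g \<and> (\<forall>x\<in>Fields. \<forall>y\<in>N. g (x * y) = f x y)"
    by (rule exI[of _ lift]) (auto simp: additive_on_def lift_add lift_vfield_mult P)
qed

lemma lsummand_tprod: "tmod M \<Longrightarrow> lsummand N \<Longrightarrow> lsummand (M \<otimes>\<^sub>A N)"
  by (induction arbitrary: N rule: tmod.induct)
    (auto simp: Alg_tprod lsummand_lmod lsummand_Forms1_tprod lsummand_Fields_tprod tprod_assoc)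

lemma tmod_lsummand: "tmod M \<Longrightarrow> lsummand M"
  using lsummand_tprod[OF _ lsummand_Alg, of M] by (simp add: tprod_Alg tmod_bimod)

text \<open>For a product of two modules the argument is currying: for fixed x in the first module,
  f induces a map on the second module tensored with N, and these maps, as a function of x, induce
  the map on the whole.\<close>

lemma ex_tensor_lift:
  fixes f :: "'w::star_dga tensor \<Rightarrow> 'w tensor \<Rightarrow> 'b::ab_group_add"
  assumes "tmod M" "lsummand N" "balanced M N f"
  shows "\<exists>g. additive_on (M \<otimes>\<^sub>A N) g \<and> (\<forall>x\<in>M. \<forall>y\<in>N. g (x * y) = f x y)"
  using assms
proof (induction arbitrary: N f rule: tmod.induct)
  case tmod_Alg
  have N: "lmod N" using tmod_Alg by (simp add: lsummand_lmod)
  show ?case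
  proof (intro exI conjI ballI)
    show "additive_on (Alg \<otimes>\<^sub>A N) (f (form 1))"
      using tmod_Alg by (auto simp: Alg_tprod N balanced_def forms_one)
    fix x y :: "'w tensor" assume "x \<in> Alg" "y \<in> N"
    then obtain a where a: "x = form a" "a \<in> forms 0" by auto
    have "f (form 1 * form a) y = f (form 1) (form a * y)"
      using tmod_Alg(2) a \<open>y \<in> N\<close> unfolding balanced_def by (blast intro: forms_one)
    then show "f (form 1) (x * y) = f x y" by (simp add: a form_one)
  qed
next
  case tmod_Forms1
  then show ?case by (rule ex_lift_Forms1)
next
  case tmod_Fields
  then show ?case by (rule ex_lift_Fields)
next
  case (tmod_tprod M1 M2)
  have M1: "bimod M1" and M2: "bimod M2" using tmod_tprod.hyps by (auto intro: tmod_bimod)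
  have s: "subgrp M1" "subgrp M2" using M1 M2 by (auto simp: bimod_def lmod_def)
  have N: "lmod N" using tmod_tprod.prems by (simp add: lsummand_lmod)
  note bal = tmod_tprod.prems(2)
  have ex: "\<exists>g. additive_on (M2 \<otimes>\<^sub>A N) g \<and> (\<forall>y\<in>M2. \<forall>z\<in>N. g (y * z) = f (x * y) z)" if x: "x \<in> M1" for x
  proof (rule tmod_tprod.IH(2)[OF tmod_tprod.prems(1)], unfold balanced_def, intro conjI ballI)
    fix y assume y: "y \<in> M2"
    then have xy: "x * y \<in> M1 \<otimes>\<^sub>A M2" by (intro tprodI x)
    show "additive_on N (f (x * y))" using bal xy by (simp add: balanced_def)
    show "f (x * (y * form a)) z = f (x * y) (form a * z)" if "a \<in> forms 0" "z \<in> N" for a z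
      using bal xy that by (simp add: balanced_def mult.assoc[symmetric])
  next
    fix z assume z: "z \<in> N"
    have "additive_on (M1 \<otimes>\<^sub>A M2) (\<lambda>y. f y z)" using bal z by (simp add: balanced_def)
    then show "additive_on M2 (\<lambda>y. f (x * y) z)"
      using x by (auto simp: additive_on_def distrib_left intro: tprodI)
  qed
  then obtain G where G: "\<And>x. x \<in> M1 \<Longrightarrow> additive_on (M2 \<otimes>\<^sub>A N) (G x)"
    "\<And>x y z. x \<in> M1 \<Longrightarrow> y \<in> M2 \<Longrightarrow> z \<in> N \<Longrightarrow> G x (y * z) = f (x * y) z" by metis
  \<comment> \<open>Each \<open>G x\<close> was chosen separately, but its values on simple tensors
    determine it, so additivity and balance in x are inherited from f.\<close>
  have "balanced M1 (M2 \<otimes>\<^sub>A N) G"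
    unfolding balanced_def
  proof (intro conjI ballI)
    show "additive_on (M2 \<otimes>\<^sub>A N) (G x)" if "x \<in> M1" for x by (rule G that)+
  next
    fix z assume z: "z \<in> M2 \<otimes>\<^sub>A N"
    show "additive_on M1 (\<lambda>x. G x z)"
      unfolding additive_on_def
    proof (intro ballI)
      fix x x' assume x: "x \<in> M1" "x' \<in> M1"
      show "G (x + x') z = G x z + G x' z"
      proof (rule tprod_eqI[OF z])
        show "additive_on (M2 \<otimes>\<^sub>A N) (G (x + x'))" using x s by (intro G subgrp_add)
        show "additive_on (M2 \<otimes>\<^sub>A N) (\<lambda>z. G x z + G x' z)" using x by (intro G additive_on_plus)
        fix y w assume yw: "y \<in> M2" "w \<in> N"
        then have "x * y \<in> M1 \<otimes>\<^sub>A M2" "x' * y \<in> M1 \<otimes>\<^sub>A M2" using x by (auto intro: tprodI)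
        then show "G (x + x') (y * w) = G x (y * w) + G x' (y * w)"
          using x yw s bal by (simp add: G subgrp_add distrib_right balanced_def additive_on_def)
      qed
    qed
  next
    fix x z :: "'w tensor" and a :: 'w
    assume x: "x \<in> M1" and a: "a \<in> forms 0" and z: "z \<in> M2 \<otimes>\<^sub>A N"
    have xa: "x * form a \<in> M1" using M1 x a by (simp add: bimod_rmult)
    show "G (x * form a) z = G x (form a * z)"
    proof (rule tprod_eqI[OF z])
      show "additive_on (M2 \<otimes>\<^sub>A N) (G (x * form a))" by (rule G xa)+
      have "lmod (M2 \<otimes>\<^sub>A N)" by (simp add: lmod_tprod bimod_lmod M2)
      then show "additive_on (M2 \<otimes>\<^sub>A N) (\<lambda>z. G x (form a * z))"
        by (intro additive_on_compose[OF additive_on_mult_left G(1)[OF x]]) (simp add: lmod_mult a)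
      show "G (x * form a) (y * w) = G x (form a * (y * w))" if "y \<in> M2" "w \<in> N" for y w
        using that x xa a M2 by (simp add: G bimod_lmod lmod_mult mult.assoc[symmetric])
    qed
  qed
  from tmod_tprod.IH(1)[OF lsummand_tprod[OF tmod_tprod.hyps(2) tmod_tprod.prems(1)] this]
  obtain H where H: "additive_on (M1 \<otimes>\<^sub>A (M2 \<otimes>\<^sub>A N)) H"
    "\<And>x y. x \<in> M1 \<Longrightarrow> y \<in> M2 \<otimes>\<^sub>A N \<Longrightarrow> H (x * y) = G x y" by metis
  have "H (x * z) = f x z" if x: "x \<in> M1 \<otimes>\<^sub>A M2" and z: "z \<in> N" for x z
  proof (rule tprod_eqI[OF x])
    show "additive_on (M1 \<otimes>\<^sub>A M2) (\<lambda>x. H (x * z))"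
      by (rule additive_on_compose[OF additive_on_mult_right H(1)]) (simp add: tprod_assoc[symmetric] tprodI z)
    show "additive_on (M1 \<otimes>\<^sub>A M2) (\<lambda>x. f x z)" using bal z by (simp add: balanced_def)
    show "H (x * y * z) = f (x * y) z" if "x \<in> M1" "y \<in> M2" for x y
      using that z by (simp add: mult.assoc H G tprodI)
  qed
  with H(1) show ?case by (auto simp: tprod_assoc)
qed

lemma tensor_lift:
  fixes f :: "'w::star_dga tensor \<Rightarrow> 'w tensor \<Rightarrow> 'b::ab_group_add"
  assumes "tmod M" "lsummand N" "balanced M N f"
  shows tensor_lift_additive: "additive_on (M \<otimes>\<^sub>A N) (tensor_lift M N f)"
    and tensor_lift_mult: "\<And>x y. x \<in> M \<Longrightarrow> y \<in> N \<Longrightarrow> tensor_lift M N f (x * y) = f x y"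
  using someI_ex[OF ex_tensor_lift[OF assms]] unfolding tensor_lift_def by auto

lemma tensor_map:
  assumes "tmod M" "lsummand N" "additive_on M f" "additive_on N g"
    and fa: "\<And>x a. x \<in> M \<Longrightarrow> a \<in> forms 0 \<Longrightarrow> f (x * form a) = f x * form a"
    and ga: "\<And>x a. x \<in> N \<Longrightarrow> a \<in> forms 0 \<Longrightarrow> g (form a * x) = form a * g x"
  shows tensor_map_additive: "additive_on (M \<otimes>\<^sub>A N) (tensor_map M f N g)"
    and tensor_map_mult: "\<And>x y. x \<in> M \<Longrightarrow> y \<in> N \<Longrightarrow> tensor_map M f N g (x * y) = f x * g y"
proof -
  have "balanced M N (\<lambda>x y. f x * g y)"
    unfolding balanced_def
    by (intro conjI ballI additive_on_mult_left' additive_on_mult_right' assms)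
      (simp add: fa ga mult.assoc)
  note * = tensor_lift[OF assms(1,2) this]
  show "additive_on (M \<otimes>\<^sub>A N) (tensor_map M f N g)"
    and "\<And>x y. x \<in> M \<Longrightarrow> y \<in> N \<Longrightarrow> tensor_map M f N g (x * y) = f x * g y"
    using * by (auto simp: tensor_map_def)
qed

lemma additive_image_in:
  assumes "z \<in> M \<otimes>\<^sub>A N" "additive_on (M \<otimes>\<^sub>A N) h" "subgrp S"
    and "\<And>x y. x \<in> M \<Longrightarrow> y \<in> N \<Longrightarrow> h (x * y) \<in> S"
  shows "h z \<in> S"
  using assms(1)
proof (induction rule: tprod_induct)
  case zero
  then show ?case using additive_on_zero[OF assms(2) subgrp_tprod] assms(3) by (simp add: subgrp_zero)
next
  case (diff x y)
  then show ?case using additive_on_diff[OF assms(2) subgrp_tprod] assms(3) by (simp add: subgrp_diff)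
qed (rule assms)

section \<open>The tensor algebra of the vector fields\<close>

lemma tpower_tensor_algebra: "tpower M n \<subseteq> tensor_algebra M"
  unfolding tensor_algebra_def by (auto intro: group_closure.base)

lemma subgrp_tensor_algebra: "subgrp (tensor_algebra M)"
  unfolding tensor_algebra_def by (rule subgrp_group_closure)

lemma tensor_algebra_induct [consumes 1, case_names zero tpower diff]:
  assumes "x \<in> tensor_algebra M" "P 0" "\<And>n x. x \<in> tpower M n \<Longrightarrow> P x"
    and "\<And>x y. x \<in> tensor_algebra M \<Longrightarrow> y \<in> tensor_algebra M \<Longrightarrow> P x \<Longrightarrow> P y \<Longrightarrow> P (x - y)"
  shows "P x"
  using assms(1)[unfolded tensor_algebra_def]
proof induction
  case (diff s t)
  then show ?case by (intro assms(4)) (simp_all add: tensor_algebra_def)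
qed (use assms(2,3) in auto)

lemma tensor_algebra_eqI:
  assumes "x \<in> tensor_algebra M" "additive_on (tensor_algebra M) f" "additive_on (tensor_algebra M) g"
    and "\<And>n x. x \<in> tpower M n \<Longrightarrow> f x = g x"
  shows "f x = g x"
  using additive_on_closure_eqI[OF assms(2,3)[unfolded tensor_algebra_def] _ assms(1)[unfolded tensor_algebra_def]]
    assms(4) by blast

lemma tensor_algebra_image_in:
  assumes "x \<in> tensor_algebra M" "additive_on (tensor_algebra M) f" "subgrp S"
    and "\<And>n x. x \<in> tpower M n \<Longrightarrow> f x \<in> S"
  shows "f x \<in> S"
  using assms(1)
proof (induction rule: tensor_algebra_induct)
  case zero
  then show ?case using additive_on_zero[OF assms(2) subgrp_tensor_algebra] assms(3) by (simp add: subgrp_zero)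
next
  case (diff x y)
  then show ?case using additive_on_diff[OF assms(2) subgrp_tensor_algebra] assms(3) by (simp add: subgrp_diff)
qed (rule assms)

lemma tensor_algebra_mult:
  assumes M: "lmod M" and x: "x \<in> tensor_algebra M" and y: "y \<in> tensor_algebra M"
  shows "x * y \<in> tensor_algebra M"
proof (rule tensor_algebra_image_in[OF x additive_on_mult_right subgrp_tensor_algebra])
  fix m x assume x: "x \<in> tpower M m"
  show "x * y \<in> tensor_algebra M"
  proof (rule tensor_algebra_image_in[OF y additive_on_mult_left subgrp_tensor_algebra])
    fix n y assume "y \<in> tpower M n"
    then have "x * y \<in> tpower M (m + n)" using tprodI[OF x] tpower_add[OF M] by blast
    then show "x * y \<in> tensor_algebra M" using tpower_tensor_algebra by blast
  qed
qed

lemma Alg_tensor_algebra: "a \<in> forms 0 \<Longrightarrow> form a \<in> tensor_algebra M"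
  using tpower_tensor_algebra[of M 0] by auto

lemma one_tensor_algebra: "1 \<in> tensor_algebra M"
  using Alg_tensor_algebra[OF forms_one, of M] by (simp add: form_one)

lemma generator_tensor_algebra: "x \<in> M \<Longrightarrow> x \<in> tensor_algebra M"
proof -
  assume "x \<in> M"
  then have "x * form 1 \<in> tpower M 1" by (simp add: One_nat_def tprodI forms_one)
  then show ?thesis using tpower_tensor_algebra[of M 1] by (simp add: form_one subset_iff)
qed

primrec proj_fields_texp :: "('w::star_dga, 'w vec) texp \<Rightarrow> 'w tensor" where
  "proj_fields_texp (TForm \<xi>) = form (deg 0 \<xi>)"
| "proj_fields_texp (TField v) = vfield v"
| "proj_fields_texp (TPlus x y) = proj_fields_texp x + proj_fields_texp y"
| "proj_fields_texp (TNeg x) = - proj_fields_texp x"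
| "proj_fields_texp (TTimes x y) = proj_fields_texp x * proj_fields_texp y"

lift_definition proj_fields :: "'w::star_dga tensor \<Rightarrow> 'w tensor" is proj_fields_texp
proof -
  fix x y :: "('w, 'w vec) texp"
  assume "tcong x y"
  then show "proj_fields_texp x = proj_fields_texp y"
    by (induction rule: tcong.induct)
      (simp_all add: algebra_simps deg_add deg_lmult deg_rmult deg_of_forms[OF forms_one] form_one form_zero form_add
        deg_of_forms[where m = 0] forms_zero form_lmult form_rmult vfield_lmult vfield_rmult vfield_add)
qed

lemma proj_fields_simps:
  "proj_fields (x + y) = proj_fields x + proj_fields y" "proj_fields (x * y) = proj_fields x * proj_fields y"
  "proj_fields (form \<xi>) = form (deg 0 \<xi>)" "proj_fields (vfield v) = vfield v"
  by (transfer; simp)+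

text \<open>The tensor algebra is an infinite direct sum and hence not one of the modules covered by
  \<open>tmod\<close>. Killing the forms of positive degree is, however, a ring endomorphism of the
  tensor ring with the tensor algebra as image, and it fixes this image pointwise.\<close>

lemma lsummand_tensor_algebra: "lsummand (tensor_algebra Fields :: 'w::star_dga tensor set)"
proof -
  have "proj_fields_texp x \<in> tensor_algebra Fields" for x :: "('w::star_dga, 'w vec) texp"
    by (induction x)
      (simp_all add: deg_props bimod_lmod bimod_Fields Alg_tensor_algebra generator_tensor_algebra
        tensor_algebra_mult subgrp_add subgrp_uminus subgrp_tensor_algebra)
  then have 1: "proj_fields x \<in> tensor_algebra Fields" for x :: "'w tensor"
    using ex_abs_tensor[of x] by (auto simp: proj_fields.abs_eq)
  have 2: "proj_fields x = x" if "x \<in> tensor_algebra Fields" for x :: "'w tensor"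
  proof (rule tensor_algebra_eqI[OF that])
    fix n and x :: "'w tensor"
    show "x \<in> tpower Fields n \<Longrightarrow> proj_fields x = x"
    proof (induction n arbitrary: x)
      case 0
      then show ?case by (auto simp: proj_fields_simps deg_of_forms)
    next
      case (Suc n)
      show ?case
        by (rule tprod_eqI[OF Suc.prems[unfolded tpower.simps]])
          (auto simp: additive_on_def proj_fields_simps Suc.IH)
    qed
  qed (auto simp: additive_on_def proj_fields_simps)
  show ?thesis
    unfolding lsummand_def
    by (rule exI[of _ proj_fields]) (use 1 2 in \<open>auto simp: additive_on_def proj_fields_simps deg_of_forms\<close>)
qed

section \<open>The grading of the tensor algebra of vector fields\<close>

primrec tproj :: "nat \<Rightarrow> 'w::star_dga tensor \<Rightarrow> 'w tensor" where
  "tproj 0 = (\<lambda>x. form (deg0 x))"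
| "tproj (Suc n) = fox.lift (\<lambda>_ _. 0) (\<lambda>v t. vfield v * tproj n t)"

text \<open>One induction proves all four facts, because the Fox extension that defines the next
  projection is available only once the previous one is known to be additive and left
  linear.\<close>

lemma tproj_props:
  fixes a :: "'w::star_dga" and x y :: "'w tensor"
  shows "tproj n (x + y) = tproj n x + tproj n y \<and> (a \<in> forms 0 \<longrightarrow> tproj n (form a * x) = form a * tproj n x)
    \<and> tproj n x \<in> tpower Fields n \<and> (x \<in> tpower Fields m \<longrightarrow> tproj n x = (if m = n then x else 0))"
proof (induction n arbitrary: x y a m)
  case 0
  have "deg0 x = 0" if m0: "m \<noteq> 0" "x \<in> tpower Fields m"
  proof -
    obtain k where k: "m = Suc k" using m0 by (cases m) auto
    have "form (deg0 x) = 0"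
      by (rule tprod_eqI[OF that(2)[unfolded k tpower.simps]])
        (auto simp: additive_on_def deg0_simps form_add form_zero)
    then show ?thesis by (metis wedge_form wedge_zero)
  qed
  then show ?case
    by (auto simp: deg0_simps form_add deg0_forms deg_of_forms form_lmult form_zero)
next
  case (Suc n)
  have IH: "tproj n (x + y) = tproj n x + tproj n y" "tproj n x \<in> tpower Fields n"
    "a \<in> forms 0 \<Longrightarrow> tproj n (form a * x) = form a * tproj n x"
    "x \<in> tpower Fields m \<Longrightarrow> tproj n x = (if m = n then x else 0)" for x y m and a :: 'w
    using Suc.IH by blast+
  interpret fox "\<lambda>_ _. 0" "\<lambda>(v :: 'w vec) t. vfield v * tproj n t"
    by unfold_locales
      (simp_all add: IH(1,3) vfield_add algebra_simps vfield_rmult[symmetric])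
  have 1: "lift x \<in> Fields \<otimes>\<^sub>A tpower Fields n"
    by (rule lift_in) (auto intro!: subgrp_tprod tprodI subgrp_zero simp: IH)
  have 2: "lift x = (if m = Suc n then x else 0)" if xm: "x \<in> tpower Fields m"
  proof (cases m)
    case 0
    have "x \<in> Alg" using xm 0 by simp
    then obtain b where b: "b \<in> forms 0" "x = form b" by auto
    then show ?thesis using 0 by (simp add: lift_form del: tpower.simps)
  next
    case (Suc k)
    show ?thesis
      by (rule tprod_eqI[OF xm[unfolded Suc tpower.simps]])
        (auto simp: additive_on_def lift_add lift_vfield_mult IH Suc)
  qed
  have "lift (form a * x) = form a * lift x" if "a \<in> forms 0"
    by (rule lift_left_linear)
      (use that in \<open>auto simp: algebra_simps vfield_lmult[symmetric]\<close>)
  with 1 2 show ?case by (simp add: lift_add)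
qed

lemma tproj_add: "tproj n (x + y) = tproj n x + tproj n y"
  and tproj_in: "tproj n x \<in> tpower Fields n"
  and tproj_tpower: "x \<in> tpower Fields m \<Longrightarrow> tproj n x = (if m = n then x else 0)"
  using tproj_props[of n x y 0 m] by simp_all

lemma additive_tproj: "additive_on S (tproj n)"
  by (simp add: additive_on_def tproj_add)

lemma finite_tproj: "(x :: 'w::star_dga tensor) \<in> tensor_algebra Fields \<Longrightarrow> finite {n. tproj n x \<noteq> 0}"
proof (induction rule: tensor_algebra_induct)
  case zero
  have "tproj n (0 :: 'w tensor) = 0" for n using tproj_add[of n 0 "0 :: 'w tensor"] by simp
  then show ?case by simp
next
  case (tpower n x)
  show ?case by (rule finite_subset[of _ "{n}"]) (auto simp: tproj_tpower[OF tpower])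
next
  case (diff x y)
  have "tproj n (x - y) = tproj n x - tproj n y" for n
    by (rule additive_on_diff[OF additive_tproj[of UNIV]]) (auto simp: subgrp_def)
  then have "{n. tproj n (x - y) \<noteq> 0} \<subseteq> {n. tproj n x \<noteq> 0} \<union> {n. tproj n y \<noteq> 0}" by auto
  then show ?case using diff by (auto dest: finite_subset)
qed

text \<open>The projections show that the tensor powers are independent in the tensor ring, so
  additive maps given degree by degree combine. This provides the total derivative, the product and
  the action, all of which are specified one degree at a time.\<close>

lemma ex_glue:
  fixes g :: "nat \<Rightarrow> 'w::star_dga tensor \<Rightarrow> 'b::ab_group_add"
  assumes g: "\<And>n. additive_on (tpower Fields n) (g n)"
  shows "\<exists>h. additive_on (tensor_algebra Fields) h \<and> (\<forall>n. \<forall>x\<in>tpower Fields n. h x = g n x)"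
proof (intro exI conjI allI ballI)
  let ?h = "\<lambda>x. \<Sum>n | tproj n x \<noteq> 0. g n (tproj n x)"
  have g0: "g n 0 = 0" for n
    by (rule additive_on_zero[OF g]) (intro tmod_subgrp tmod_tpower tmod.intros)
  have *: "?h x = (\<Sum>n\<in>F. g n (tproj n x))" if "finite F" "{n. tproj n x \<noteq> 0} \<subseteq> F" for x F
    using that by (intro sum.mono_neutral_left) (auto simp: g0)
  show "additive_on (tensor_algebra Fields) ?h"
    unfolding additive_on_def
  proof (intro ballI)
    fix x y :: "'w tensor" assume xy: "x \<in> tensor_algebra Fields" "y \<in> tensor_algebra Fields"
    define F where "F = {n. tproj n x \<noteq> 0} \<union> {n. tproj n y \<noteq> 0}"
    have F: "finite F" unfolding F_def using xy by (simp add: finite_tproj)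
    have "?h (x + y) = (\<Sum>n\<in>F. g n (tproj n (x + y)))" by (rule *[OF F]) (auto simp: F_def tproj_add)
    also have "\<dots> = (\<Sum>n\<in>F. g n (tproj n x)) + (\<Sum>n\<in>F. g n (tproj n y))"
      by (simp add: tproj_add additive_on_add[OF g] tproj_in sum.distrib)
    also have "\<dots> = ?h x + ?h y"
      by (intro arg_cong2[where f = "(+)"] *[symmetric] F) (auto simp: F_def)
    finally show "?h (x + y) = ?h x + ?h y" .
  qed
  fix n and x :: "'w tensor" assume x: "x \<in> tpower Fields n"
  have "?h x = (\<Sum>n\<in>{n}. g n (tproj n x))"
    by (rule *) (auto simp: tproj_tpower[OF x])
  then show "?h x = g n x" by (simp add: tproj_tpower[OF x])
qed

lemma lsummand_UNIV: "lsummand UNIV"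
  unfolding lsummand_def by (intro exI[of _ "\<lambda>x. x"]) (auto simp: additive_on_def)

abbreviation Fields_Forms1 :: "'w::star_dga tensor set" where
  "Fields_Forms1 \<equiv> Fields \<otimes>\<^sub>A Forms1"

lemma additive_id: "additive_on M id"
  by (simp add: additive_on_def)

definition rlin :: "'w::star_dga tensor set \<Rightarrow> ('w tensor \<Rightarrow> 'w tensor) \<Rightarrow> bool" where
  "rlin M f \<longleftrightarrow> tmod M \<and> additive_on M f \<and> (\<forall>x\<in>M. \<forall>a\<in>forms 0. f (x * form a) = f x * form a)"

definition llin :: "'w::star_dga tensor set \<Rightarrow> ('w tensor \<Rightarrow> 'w tensor) \<Rightarrow> bool" where
  "llin N g \<longleftrightarrow> lsummand N \<and> additive_on N g \<and> (\<forall>x\<in>N. \<forall>a\<in>forms 0. g (form a * x) = form a * g x)"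

lemma llin_id: "lsummand N \<Longrightarrow> llin N id"
  by (simp add: llin_def additive_id)

lemma rlin_id: "tmod M \<Longrightarrow> rlin M id"
  by (simp add: rlin_def additive_id)

lemma tmap_add: "rlin M f \<Longrightarrow> llin N g \<Longrightarrow> additive_on (M \<otimes>\<^sub>A N) (tensor_map M f N g)"
  and tmap_mult: "rlin M f \<Longrightarrow> llin N g \<Longrightarrow> x \<in> M \<Longrightarrow> y \<in> N \<Longrightarrow> tensor_map M f N g (x * y) = f x * g y"
  using tensor_map[of M N f g] unfolding rlin_def llin_def by auto

text \<open>
  The map \<open>f \<otimes> id\<close> on \<open>M \<otimes>\<^sub>A T\<close> for the whole tensor ring \<open>T\<close>; on each \<open>M \<otimes>\<^sub>A N\<close> it restricts to
  \<open>tensor_map M f N id\<close>, so that the factors in \<open>N\<close> need not be tracked.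
\<close>

definition ext_id :: "'w::star_dga tensor set \<Rightarrow> ('w tensor \<Rightarrow> 'w tensor) \<Rightarrow> 'w tensor \<Rightarrow> 'w tensor" where
  "ext_id M f = tensor_map M f UNIV id"

lemma ext_id_add: "rlin M f \<Longrightarrow> additive_on (M \<otimes>\<^sub>A UNIV) (ext_id M f)"
  unfolding ext_id_def by (intro tmap_add llin_id lsummand_UNIV)

lemma ext_id_mult: "rlin M f \<Longrightarrow> x \<in> M \<Longrightarrow> ext_id M f (x * y) = f x * y"
  unfolding ext_id_def by (simp add: tmap_mult llin_id lsummand_UNIV)

lemma ext_id_mult_right:
  assumes f: "rlin M f" and z: "z \<in> M \<otimes>\<^sub>A UNIV"
  shows "ext_id M f (z * y) = ext_id M f z * y"
proof (rule tprod_eqI[OF z])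
  have "M \<otimes>\<^sub>A UNIV \<subseteq> {x. x * y \<in> M \<otimes>\<^sub>A UNIV}"
    by (intro tprod_least subgrp_vimage_right subgrp_tprod) (auto simp: mult.assoc intro: tprodI)
  then show "additive_on (M \<otimes>\<^sub>A UNIV) (\<lambda>z. ext_id M f (z * y))"
    by (intro additive_on_compose[OF additive_on_mult_right ext_id_add[OF f]]) auto
qed (simp_all add: ext_id_mult f mult.assoc additive_on_mult_right' ext_id_add)

lemma tmap_id_eq_ext_id:
  assumes f: "rlin M f" and N: "lsummand N" and z: "z \<in> M \<otimes>\<^sub>A N"
  shows "tensor_map M f N id z = ext_id M f z"
proof (rule tprod_eqI[OF z])
  show "additive_on (M \<otimes>\<^sub>A N) (ext_id M f)"
    by (rule additive_on_subset[OF ext_id_add[OF f] tprod_mono]) auto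
  show "additive_on (M \<otimes>\<^sub>A N) (tensor_map M f N id)" by (rule tmap_add[OF f llin_id[OF N]])
  show "tensor_map M f N id (x * y) = ext_id M f (x * y)" if "x \<in> M" "y \<in> N" for x y
    using tmap_mult[OF f llin_id[OF N] that] ext_id_mult[OF f that(1)] by simp
qed

lemma ext_id_in:
  assumes f: "rlin M f" and z: "z \<in> M \<otimes>\<^sub>A N" and S: "\<And>x. x \<in> M \<Longrightarrow> f x \<in> S"
  shows "ext_id M f z \<in> S \<otimes>\<^sub>A N"
proof (rule additive_image_in[OF z _ subgrp_tprod])
  show "additive_on (M \<otimes>\<^sub>A N) (ext_id M f)"
    by (rule additive_on_subset[OF ext_id_add[OF f] tprod_mono]) auto
qed (simp add: ext_id_mult f S tprodI)

subsection \<open>Evaluation\<close>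

lemma ex_eval: "\<exists>g :: 'w::star_dga tensor \<Rightarrow> 'w.
  (\<forall>x y. g (x + y) = g x + g y) \<and> (\<forall>v. \<forall>\<xi>\<in>forms 1. g (vfield v * form \<xi>) = vec_apply v \<xi>)"
proof -
  obtain P :: "'w tensor \<Rightarrow> 'w tensor" where P: "\<And>x y. P (x + y) = P x + P y" "\<And>x. P x \<in> Forms1" "\<And>x. x \<in> Forms1 \<Longrightarrow> P x = x"
    "\<And>a x. a \<in> forms 0 \<Longrightarrow> P (form a * x) = form a * P x"
    by (rule lsummandE[OF tmod_lsummand[OF tmod_Forms1]]) (rule that)
  have W: "wedge (P x) \<in> forms 1" for x using P(2)[of x] by auto
  interpret fox "\<lambda>_ _. 0" "\<lambda>v t. vec_apply v (wedge (P t))"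
    by unfold_locales
      (simp_all add: P vec_apply_plus wedge_add vec_apply_add W vec_apply_rmult wedge_mult)
  show ?thesis
    by (rule exI[of _ lift]) (simp add: lift_add lift_vfield_mult P)
qed

lemma ev:
  fixes \<xi> :: "'a::star_dga"
  shows ev_add: "additive_on Fields_Forms1 (ev :: 'a tensor \<Rightarrow> 'a tensor)"
    and ev_mult: "\<xi> \<in> forms 1 \<Longrightarrow> ev (vfield v * form \<xi>) = form (vec_apply v \<xi>)"
proof -
  obtain g :: "'a tensor \<Rightarrow> 'a" where g: "\<forall>x y. g (x + y) = g x + g y"
    "\<forall>v. \<forall>\<xi>\<in>forms 1. g (vfield v * form \<xi>) = vec_apply v \<xi>" using ex_eval by blast
  have "\<exists>g :: 'a tensor \<Rightarrow> 'a tensor. additive_on Fields_Forms1 g \<and>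
           (\<forall>v. \<forall>\<xi>\<in>forms 1. g (vfield v * form \<xi>) = form (vec_apply v \<xi>))"
    by (rule exI[of _ "\<lambda>x. form (g x)"]) (simp add: g additive_on_def form_add)
  note * = someI_ex[OF this]
  show "additive_on Fields_Forms1 (ev :: 'a tensor \<Rightarrow> 'a tensor)"
    and "\<xi> \<in> forms 1 \<Longrightarrow> ev (vfield v * form \<xi>) = form (vec_apply v \<xi>)"
    using * unfolding ev_def by blast+
qed

text \<open>The relations of the tensor ring do not identify distinct fields: evaluation is defined
  on the ring and recovers every value of the field. Hence \<open>the_field\<close> below can undo
  \<open>vfield\<close>.\<close>

lemma vfield_inject: "vfield u = vfield v \<longleftrightarrow> u = v"
proof
  assume *: "vfield u = vfield v"
  show "u = v"
  proof (rule vec_eqI)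
    fix \<xi> :: 'a assume "\<xi> \<in> forms 1"
    then have "form (vec_apply u \<xi>) = form (vec_apply v \<xi>)" using * by (metis ev_mult)
    then show "vec_apply u \<xi> = vec_apply v \<xi>" by (metis wedge_form)
  qed
qed simp

lemma tmod_FF: "tmod (Forms1 \<otimes>\<^sub>A Forms1)" and tmod_VF: "tmod Fields_Forms1" and tmod_FV: "tmod (Forms1 \<otimes>\<^sub>A Fields)"
  by (intro tmod.intros)+

lemma ev_rlin: "rlin Fields_Forms1 ev"
  unfolding rlin_def
proof (intro conjI ballI ev_add tmod_VF)
  fix x :: "'a tensor" and a :: 'a assume x: "x \<in> Fields_Forms1" and a: "a \<in> forms 0"
  show "ev (x * form a) = ev x * form a"
  proof (rule tprod_eqI[OF x])
    show "additive_on Fields_Forms1 (\<lambda>x. ev (x * form a))"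
      by (intro additive_on_compose[OF additive_on_mult_right ev_add] bimod_rmult tmod_bimod tmod_VF a)
  qed (auto simp: ev_add additive_on_mult_right' mult.assoc form_rmult a ev_mult forms_mult_0 vec_apply_mult)
qed

lemma ev_llin: "llin Fields_Forms1 ev"
  unfolding llin_def
proof (intro conjI ballI ev_add tmod_VF tmod_lsummand)
  fix x :: "'a tensor" and a :: 'a assume x: "x \<in> Fields_Forms1" and a: "a \<in> forms 0"
  show "ev (form a * x) = form a * ev x"
  proof (rule tprod_eqI[OF x])
    show "additive_on Fields_Forms1 (\<lambda>x. ev (form a * x))"
      by (intro additive_on_compose[OF additive_on_mult_left ev_add] lmod_mult tmod_lmod tmod_VF a)
  qed (auto simp: ev_add additive_on_mult_left' mult.assoc[symmetric] vfield_lmult a ev_mult vec_apply_lmult form_lmult)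
qed

lemma ev_Alg: "x \<in> Fields_Forms1 \<Longrightarrow> ev x \<in> Alg"
  by (rule additive_image_in[OF _ ev_add tmod_subgrp[OF tmod_Alg]]) (auto simp: ev_mult vec_apply_forms)

text \<open>The common extension of the maps \<open>ev_left N v\<close> for all \<open>N\<close>.\<close>

definition contr :: "'w::star_dga vec \<Rightarrow> 'w tensor \<Rightarrow> 'w tensor" where
  "contr v x = ext_id Fields_Forms1 ev (vfield v * x)"

abbreviation Forms1_T :: "'w::star_dga tensor set" where
  "Forms1_T \<equiv> Forms1 \<otimes>\<^sub>A UNIV"

lemma Forms1_T: "x \<in> Forms1 \<otimes>\<^sub>A N \<Longrightarrow> x \<in> Forms1_T"
  using tprod_mono[of Forms1 Forms1 N UNIV] by auto

lemma vfield_mult_FT: "x \<in> Forms1_T \<Longrightarrow> vfield v * x \<in> Fields_Forms1 \<otimes>\<^sub>A UNIV"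
  by (simp add: tprod_assoc tprodI)

lemma contr_add: "additive_on Forms1_T (contr v)"
  unfolding contr_def
  by (rule additive_on_compose[OF additive_on_mult_left ext_id_add[OF ev_rlin]]) (rule vfield_mult_FT)

lemma contr_mult: "\<xi> \<in> forms 1 \<Longrightarrow> contr v (form \<xi> * y) = form (vec_apply v \<xi>) * y"
  by (simp add: contr_def mult.assoc[symmetric] ext_id_mult[OF ev_rlin] tprodI ev_mult)

lemma contr_form: "\<xi> \<in> forms 1 \<Longrightarrow> contr v (form \<xi>) = form (vec_apply v \<xi>)"
  using contr_mult[of \<xi> v 1] by simp

lemma contr_mult_right: "x \<in> Forms1_T \<Longrightarrow> contr v (x * y) = contr v x * y"
  by (simp add: contr_def ext_id_mult_right[OF ev_rlin vfield_mult_FT, symmetric] mult.assoc)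

lemma contr_vec_rmult: "a \<in> forms 0 \<Longrightarrow> contr (vec_rmult v a) x = contr v (form a * x)"
  by (simp add: contr_def vfield_rmult[symmetric] mult.assoc)

lemma contr_vec_lmult: "a \<in> forms 0 \<Longrightarrow> x \<in> Forms1_T \<Longrightarrow> contr (vec_lmult a v) x = form a * contr v x"
  by (erule tprod_eqI)
    (auto simp: contr_add additive_on_mult_left' contr_mult vec_apply_lmult form_lmult[symmetric] mult.assoc)

lemma contr_vec_add: "x \<in> Forms1_T \<Longrightarrow> contr (u + v) x = contr u x + contr v x"
  by (erule tprod_eqI)
    (auto simp: contr_add additive_on_plus contr_mult vec_apply_plus form_add distrib_right)

lemma contr_in: "x \<in> Forms1 \<otimes>\<^sub>A N \<Longrightarrow> lmod N \<Longrightarrow> contr v x \<in> N"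
  by (rule additive_image_in[OF _ additive_on_subset[OF contr_add]])
    (auto simp: contr_mult Forms1_T lmod_subgrp intro!: lmod_mult vec_apply_forms)

lemma ev_left_eq_contr: "lsummand N \<Longrightarrow> x \<in> Forms1 \<otimes>\<^sub>A N \<Longrightarrow> ev_left N v x = contr v x"
  unfolding ev_left_def contr_def
  by (rule tmap_id_eq_ext_id[OF ev_rlin]) (simp_all add: tprod_assoc tprodI)

lemma ev_vfield: "x \<in> Forms1 \<Longrightarrow> ev (vfield v * x) = contr v x"
  by (auto simp: ev_mult contr_form)

text \<open>\<open>(id \<otimes> ev)(X \<otimes> \<xi>)\<close>\<close>

definition rev_ev :: "'w::star_dga \<Rightarrow> 'w tensor \<Rightarrow> 'w tensor" where
  "rev_ev \<xi> X = tensor_map Forms1 id Fields_Forms1 ev (X * form \<xi>)"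

lemma rev_ev_add: "\<xi> \<in> forms 1 \<Longrightarrow> additive_on (Forms1 \<otimes>\<^sub>A Fields) (rev_ev \<xi>)"
  unfolding rev_ev_def
  by (rule additive_on_compose[OF additive_on_mult_right tmap_add[OF rlin_id[OF tmod_Forms1] ev_llin]])
    (simp add: tprod_assoc[symmetric] tprodI)

lemma rev_ev_mult:
  "\<xi> \<in> forms 1 \<Longrightarrow> \<omega> \<in> forms 1 \<Longrightarrow> rev_ev \<xi> (form \<omega> * vfield v) = form \<omega> * form (vec_apply v \<xi>)"
  unfolding rev_ev_def
  by (simp add: mult.assoc tmap_mult[OF rlin_id[OF tmod_Forms1] ev_llin] tprodI ev_mult)

lemma rev_ev_lmult: "a \<in> forms 0 \<Longrightarrow> rev_ev (a * \<xi>) X = rev_ev \<xi> (X * form a)"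
  by (simp add: rev_ev_def mult.assoc form_lmult)

lemma rev_ev_left:
  assumes \<xi>: "\<xi> \<in> forms 1" and a: "a \<in> forms 0" and X: "X \<in> Forms1 \<otimes>\<^sub>A Fields"
  shows "rev_ev \<xi> (form a * X) = form a * rev_ev \<xi> X"
proof (rule tprod_eqI[OF X])
  show "additive_on (Forms1 \<otimes>\<^sub>A Fields) (\<lambda>X. rev_ev \<xi> (form a * X))"
    by (rule additive_on_compose[OF additive_on_mult_left rev_ev_add[OF \<xi>]])
      (rule lmod_mult[OF tmod_lmod[OF tmod_FV] a])
qed (auto simp: rev_ev_add \<xi> a additive_on_mult_left' rev_ev_mult mult.assoc[symmetric] form_lmult forms_0_mult)

subsection \<open>Dual bases\<close>

definition dual_basis :: "nat \<Rightarrow> (nat \<Rightarrow> 'w::star_dga) \<Rightarrow> (nat \<Rightarrow> 'w vec) \<Rightarrow> bool" where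
  "dual_basis n \<xi> u \<longleftrightarrow> (\<forall>i<n. \<xi> i \<in> forms 1) \<and>
     (\<forall>\<eta>\<in>forms 1. \<eta> = (\<Sum>i<n. \<xi> i * vec_apply (u i) \<eta>))"

text \<open>For a retraction p of a free module with section i, the elements p(e_j), with e_j the
  standard basis, together with the coordinates of i form a dual basis.\<close>

lemma ex_dual_basis:
  assumes "fg_projective (forms 1 :: 'w::star_dga set)"
  shows "\<exists>n (\<xi> :: nat \<Rightarrow> 'w) u. dual_basis n \<xi> u"
proof -
  obtain n and i :: "'w \<Rightarrow> nat \<Rightarrow> 'w" and p where
    i: "\<forall>\<xi>\<in>forms 1. i \<xi> \<in> free_module n"
      "\<forall>\<xi>\<in>forms 1. \<forall>\<eta>\<in>forms 1. i (\<xi> + \<eta>) = (\<lambda>k. i \<xi> k + i \<eta> k)"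
      "\<forall>\<xi>\<in>forms 1. \<forall>a\<in>forms 0. i (\<xi> * a) = (\<lambda>k. i \<xi> k * a)" and
    p: "\<forall>x\<in>free_module n. p x \<in> forms 1"
      "\<forall>x\<in>free_module n. \<forall>y\<in>free_module n. p (\<lambda>k. x k + y k) = p x + p y"
      "\<forall>x\<in>free_module n. \<forall>a\<in>forms 0. p (\<lambda>k. x k * a) = p x * a" and
    pi: "\<forall>\<xi>\<in>forms 1. p (i \<xi>) = \<xi>"
    using assms unfolding fg_projective_def by (elim exE conjE) (rule that)
  note i = i[rule_format] and p = p[rule_format] and pi = pi[rule_format]
  define e :: "nat \<Rightarrow> nat \<Rightarrow> 'w" where "e = (\<lambda>j k. if k = j then 1 else 0)"
  have e: "e j \<in> free_module n" if "j < n" for j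
    using that by (auto simp: e_def free_module_def forms_one forms_zero)
  \<comment> \<open>The value 0 outside the 1-forms is what the representation of \<open>vec\<close>
    requires.\<close>
  define c where "c = (\<lambda>j \<xi>. if \<xi> \<in> forms 1 then i \<xi> j else 0)"
  have i0: "i \<xi> j \<in> forms 0" if "\<xi> \<in> forms 1" for \<xi> j
    using i(1)[OF that] by (cases "j < n") (auto simp: free_module_def forms_zero)
  have c: "vec_apply (Abs_vec (c j)) = c j" for j
    by (rule Abs_vec_inverse) (auto simp: c_def i i0 forms_add forms_mult_0)
  have free: "(\<lambda>k. if k < m then x k else 0) \<in> free_module n"
    if "x \<in> free_module n" for x :: "nat \<Rightarrow> 'w" and m
    using that by (auto simp: free_module_def forms_zero)
  have p0: "p (\<lambda>k. 0) = 0"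
  proof -
    have "(\<lambda>k. 0) \<in> (free_module n :: (nat \<Rightarrow> 'w) set)" by (simp add: free_module_def forms_zero)
    from p(2)[OF this this] show ?thesis by simp
  qed
  \<comment> \<open>The retraction is additive only on pairs from the free module, so the expansion
    in the standard basis is built up by truncating after m coordinates.\<close>
  have sum: "p (\<lambda>k. if k < m then x k else 0) = (\<Sum>j<m. p (e j) * x j)"
    if x: "x \<in> free_module n" and "m \<le> n" for x m
    using that(2)
  proof (induction m)
    case 0
    then show ?case by (simp add: p0)
  next
    case (Suc m)
    have "(\<lambda>k. if k < Suc m then x k else 0) = (\<lambda>k. (if k < m then x k else 0) + e m k * x m)"
      by (auto simp: e_def less_Suc_eq)
    moreover have xm: "x m \<in> forms 0" using x Suc.prems by (auto simp: free_module_def)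
    moreover have "(\<lambda>k. e m k * x m) \<in> free_module n"
      using e[of m] Suc.prems xm by (auto simp: free_module_def forms_mult_0)
    ultimately show ?case using Suc by (simp add: p free[OF x] e)
  qed
  have "\<eta> = (\<Sum>j<n. p (e j) * vec_apply (Abs_vec (c j)) \<eta>)" if \<eta>: "\<eta> \<in> forms 1" for \<eta>
  proof -
    have "(\<lambda>k. if k < n then i \<eta> k else 0) = i \<eta>"
      using i(1)[OF \<eta>] by (auto simp: free_module_def)
    then show ?thesis using sum[OF i(1)[OF \<eta>], of n] pi[OF \<eta>] by (simp add: c, simp add: c_def \<eta>)
  qed
  then have "dual_basis n (\<lambda>j. p (e j)) (\<lambda>j. Abs_vec (c j))"
    by (auto simp: dual_basis_def p(1) e)
  then show ?thesis by blast
qed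

lemma vec_apply_zero: "vec_apply 0 \<xi> = 0"
  by (simp add: zero_vec.rep_eq)

lemma vec_apply_sum: "vec_apply (sum u I) \<xi> = (\<Sum>i\<in>I. vec_apply (u i) \<xi>)"
  by (induction I rule: infinite_finite_induct) (simp_all add: vec_apply_zero vec_apply_plus)

lemma vfield_sum: "vfield (sum u I) = (\<Sum>i\<in>I. vfield (u i))"
  by (induction I rule: infinite_finite_induct) (simp_all add: vfield_zero vfield_add)

lemma vec_apply_sum_right:
  "(\<And>i. i \<in> I \<Longrightarrow> f i \<in> forms 1) \<Longrightarrow> vec_apply v (sum f I) = (\<Sum>i\<in>I. vec_apply v (f i))"
proof (induction I rule: infinite_finite_induct)
  case empty
  then show ?case using vec_apply_add[OF forms_zero forms_zero, of v] by simp
next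
  case (insert x F)
  then show ?case by (simp add: vec_apply_add subgrp_sum[OF subgrp_forms])
next
  case (infinite I)
  then show ?case using vec_apply_add[OF forms_zero forms_zero, of v] by simp
qed

lemma dual_basis_forms: "dual_basis n \<xi> u \<Longrightarrow> i < n \<Longrightarrow> \<xi> i \<in> forms 1"
  and dual_basis_eq: "dual_basis n \<xi> u \<Longrightarrow> \<eta> \<in> forms 1 \<Longrightarrow> (\<Sum>i<n. \<xi> i * vec_apply (u i) \<eta>) = \<eta>"
  by (auto simp: dual_basis_def)

lemma dual_basis_vec:
  assumes b: "dual_basis n \<xi> u"
  shows "vfield v = (\<Sum>i<n. form (vec_apply v (\<xi> i)) * vfield (u i))"
proof -
  have "v = (\<Sum>i<n. vec_lmult (vec_apply v (\<xi> i)) (u i))"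
  proof (rule vec_eqI)
    fix \<eta> :: 'a assume \<eta>: "\<eta> \<in> forms 1"
    have "vec_apply v \<eta> = vec_apply v (\<Sum>i<n. \<xi> i * vec_apply (u i) \<eta>)"
      by (simp add: dual_basis_eq[OF b \<eta>])
    also have "\<dots> = (\<Sum>i<n. vec_apply v (\<xi> i * vec_apply (u i) \<eta>))"
      by (rule vec_apply_sum_right) (auto intro!: forms_mult_0 dual_basis_forms[OF b] vec_apply_forms \<eta>)
    also have "\<dots> = vec_apply (\<Sum>i<n. vec_lmult (vec_apply v (\<xi> i)) (u i)) \<eta>"
      by (simp add: vec_apply_sum vec_apply_lmult vec_apply_mult vec_apply_forms dual_basis_forms[OF b] \<eta>)
    finally show "vec_apply v \<eta> = vec_apply (\<Sum>i<n. vec_lmult (vec_apply v (\<xi> i)) (u i)) \<eta>" .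
  qed
  then have "vfield v = vfield (\<Sum>i<n. vec_lmult (vec_apply v (\<xi> i)) (u i))" by (rule arg_cong)
  then show ?thesis by (simp add: vfield_sum vfield_lmult vec_apply_forms dual_basis_forms[OF b])
qed

lemma dual_basis_rev_ev:
  assumes b: "dual_basis n \<xi> u" and X: "X \<in> Forms1 \<otimes>\<^sub>A Fields"
  shows "(\<Sum>i<n. rev_ev (\<xi> i) X * vfield (u i)) = X"
proof (rule tprod_eqI[OF X])
  show "additive_on (Forms1 \<otimes>\<^sub>A Fields) (\<lambda>X. \<Sum>i<n. rev_ev (\<xi> i) X * vfield (u i))"
    using rev_ev_add[OF dual_basis_forms[OF b]]
    by (simp add: additive_on_def distrib_right sum.distrib)
  show "additive_on (Forms1 \<otimes>\<^sub>A Fields) (\<lambda>x. x)" by (rule additive_on_id)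
  fix x y :: "'a tensor" assume "x \<in> Forms1" "y \<in> Fields"
  then obtain \<omega> v where *: "\<omega> \<in> forms 1" "x = form \<omega>" "y = vfield v" by auto
  have "(\<Sum>i<n. rev_ev (\<xi> i) (x * y) * vfield (u i)) = x * (\<Sum>i<n. form (vec_apply v (\<xi> i)) * vfield (u i))"
    by (simp add: * rev_ev_mult dual_basis_forms[OF b] sum_distrib_left mult.assoc)
  also have "\<dots> = x * y" by (simp add: dual_basis_vec[OF b, symmetric] *)
  finally show "(\<Sum>i<n. rev_ev (\<xi> i) (x * y) * vfield (u i)) = x * y" .
qed

text \<open>A dual basis makes the pairing with 1-forms nondegenerate: the contractions with its
  forms, put in front of its fields, give the tensor back. Identities for the dual derivative and
  for \<open>sigma\<close> are all verified by pairing with an arbitrary 1-form.\<close>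

lemma rev_ev_eqI:
  fixes X Y :: "'w::star_dga tensor" and \<xi> :: "nat \<Rightarrow> 'w"
  assumes b: "dual_basis n \<xi> u" and "X \<in> Forms1 \<otimes>\<^sub>A Fields" "Y \<in> Forms1 \<otimes>\<^sub>A Fields"
    and "\<And>\<eta>. \<eta> \<in> forms 1 \<Longrightarrow> rev_ev \<eta> X = rev_ev \<eta> Y"
  shows "X = Y"
proof -
  have "(\<Sum>i<n. rev_ev (\<xi> i) X * vfield (u i)) = (\<Sum>i<n. rev_ev (\<xi> i) Y * vfield (u i))"
    by (rule sum.cong) (simp_all add: assms(4) dual_basis_forms[OF b])
  then show ?thesis
    unfolding dual_basis_rev_ev[OF b assms(2)] dual_basis_rev_ev[OF b assms(3)] .
qed

section \<open>The dual derivative and its extension to tensor powers\<close>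

lemma ext_deriv_0: "a \<in> forms 0 \<Longrightarrow> ext_deriv a \<in> forms 1"
  using ext_deriv_forms[of a 0] by (simp add: One_nat_def)

lemma ext_deriv_mult_0: "a \<in> forms 0 \<Longrightarrow> ext_deriv (a * b) = ext_deriv a * b + a * ext_deriv b"
  using ext_deriv_mult[of a 0 b] by simp

lemma additive_on_form: "additive_on M f \<Longrightarrow> additive_on M (\<lambda>x. form (f x))"
  by (simp add: additive_on_def form_add)

lemma rev_ev_form: "x \<in> Forms1 \<Longrightarrow> \<eta> \<in> forms 1 \<Longrightarrow> rev_ev \<eta> (x * vfield v) = x * form (vec_apply v \<eta>)"
  by (auto simp: rev_ev_mult)

lemma rev_ev_sum: "\<eta> \<in> forms 1 \<Longrightarrow> (\<And>i. i \<in> I \<Longrightarrow> X i \<in> Forms1 \<otimes>\<^sub>A Fields) \<Longrightarrow>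
    rev_ev \<eta> (sum X I) = (\<Sum>i\<in>I. rev_ev \<eta> (X i))"
  by (rule additive_on_sum[OF rev_ev_add]) (auto simp: tmod_subgrp tmod_FV)

locale conn =
  fixes sq :: "'w::star_dga \<Rightarrow> 'w tensor" and si :: "'w tensor \<Rightarrow> 'w tensor"
  assumes fgp: "fg_projective (forms 1 :: 'w set)" and conn: "right_bimodule_connection sq si"
begin

lemma sq_in: "\<xi> \<in> forms 1 \<Longrightarrow> sq \<xi> \<in> Forms1 \<otimes>\<^sub>A Forms1"
  and sq_add: "\<xi> \<in> forms 1 \<Longrightarrow> \<eta> \<in> forms 1 \<Longrightarrow> sq (\<xi> + \<eta>) = sq \<xi> + sq \<eta>"
  and sq_rmult: "\<xi> \<in> forms 1 \<Longrightarrow> a \<in> forms 0 \<Longrightarrow> sq (\<xi> * a) = sq \<xi> * form a + form \<xi> * form (ext_deriv a)"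
  and sq_lmult: "\<xi> \<in> forms 1 \<Longrightarrow> a \<in> forms 0 \<Longrightarrow> sq (a * \<xi>) = form a * sq \<xi> + si (form (ext_deriv a) * form \<xi>)"
  and si_in: "x \<in> Forms1 \<otimes>\<^sub>A Forms1 \<Longrightarrow> si x \<in> Forms1 \<otimes>\<^sub>A Forms1"
  and si_add: "additive_on (Forms1 \<otimes>\<^sub>A Forms1) si"
  and si_lmult: "x \<in> Forms1 \<otimes>\<^sub>A Forms1 \<Longrightarrow> a \<in> forms 0 \<Longrightarrow> si (form a * x) = form a * si x"
  and si_rmult: "x \<in> Forms1 \<otimes>\<^sub>A Forms1 \<Longrightarrow> a \<in> forms 0 \<Longrightarrow> si (x * form a) = si x * form a"
  using conn unfolding right_bimodule_connection_def by blast+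

lemma coev: "\<exists>n \<xi> u. dual_basis n \<xi> u \<and> coev_one = (\<Sum>i<n. form (\<xi> i) * vfield (u i) :: 'w tensor)"
proof -
  have "\<exists>K n (\<xi> :: nat \<Rightarrow> 'w) u. dual_basis n \<xi> u \<and> K = (\<Sum>i<n. form (\<xi> i) * vfield (u i))"
    using ex_dual_basis[OF fgp] by blast
  from someI_ex[OF this] show ?thesis
    unfolding coev_one_def dual_basis_def by (simp add: conj_assoc)
qed

lemma si_rlin: "rlin (Forms1 \<otimes>\<^sub>A Forms1) si"
  by (simp add: rlin_def tmod_FF si_add si_rmult)

lemma FV_eqI:
  assumes "X \<in> Forms1 \<otimes>\<^sub>A Fields" "Y \<in> Forms1 \<otimes>\<^sub>A Fields"
    and "\<And>\<eta> :: 'w. \<eta> \<in> forms 1 \<Longrightarrow> rev_ev \<eta> X = rev_ev \<eta> Y"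
  shows "X = Y"
  using rev_ev_eqI[OF _ assms] coev by blast

lemma form_FF: "\<xi> \<in> forms 1 \<Longrightarrow> \<eta> \<in> forms 1 \<Longrightarrow> form \<xi> * form \<eta> \<in> Forms1 \<otimes>\<^sub>A Forms1"
  by (auto intro: tprodI)

text \<open>Evaluates the three nested maps in \<open>sigma\<close> once, on the dual basis hidden
  in \<open>coev_one\<close>; the membership facts in the proof check that each map is applied
  within the module on which it is determined. Later arguments reach \<open>sigma\<close> through
  additivity, \<open>sigma_in\<close> and \<open>rev_ev_sigma\<close>.\<close>

lemma
  shows sigma_add: "additive_on Fields_Forms1 (sigma si)"
  and sigma_mult: "\<omega> \<in> forms 1 \<Longrightarrow> dual_basis n \<xi> u \<Longrightarrow>
    coev_one = (\<Sum>i<n. form (\<xi> i) * vfield (u i)) \<Longrightarrow>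
    sigma si (vfield v * form \<omega>) = (\<Sum>i<n. contr v (si (form \<omega> * form (\<xi> i))) * vfield (u i))"
proof -
  let ?FFV = "(Forms1 \<otimes>\<^sub>A Forms1) \<otimes>\<^sub>A Fields :: 'w tensor set"
  let ?S = "tensor_map (Forms1 \<otimes>\<^sub>A Forms1) si Fields id"
  let ?R = "tensor_map Fields id ?FFV ?S"
  have S: "llin ?FFV ?S"
    unfolding llin_def
  proof (intro conjI ballI)
    show "lsummand ?FFV" by (intro tmod_lsummand tmod.intros)
    show S_add: "additive_on ?FFV ?S"
      by (intro tmap_add si_rlin llin_id tmod_lsummand tmod_Fields)
    fix x :: "'w tensor" and a :: 'w assume x: "x \<in> ?FFV" and a: "a \<in> forms 0"
    show "?S (form a * x) = form a * ?S x"
    proof (rule tprod_eqI[OF x])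
      show "additive_on ?FFV (\<lambda>x. ?S (form a * x))"
        by (rule additive_on_compose[OF additive_on_mult_left S_add])
          (intro lmod_mult a tmod_lmod tmod.intros)
      show "additive_on ?FFV (\<lambda>x. form a * ?S x)" by (rule additive_on_mult_left'[OF S_add])
      fix x y :: "'w tensor" assume xy: "x \<in> Forms1 \<otimes>\<^sub>A Forms1" "y \<in> Fields"
      have "form a * x \<in> Forms1 \<otimes>\<^sub>A Forms1" using xy by (intro lmod_mult a tmod_lmod tmod.intros)
      then have "?S ((form a * x) * y) = si (form a * x) * id y"
        using xy by (intro tmap_mult si_rlin llin_id tmod_lsummand tmod_Fields)
      moreover have "?S (x * y) = si x * id y"
        using xy by (intro tmap_mult si_rlin llin_id tmod_lsummand tmod_Fields)
      ultimately show "?S (form a * (x * y)) = form a * ?S (x * y)"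
        using xy a by (simp add: mult.assoc si_lmult)
    qed
  qed
  have S_in: "?S x \<in> ?FFV" if "x \<in> ?FFV" for x
  proof (rule additive_image_in[OF that])
    show "additive_on ?FFV ?S" using S by (simp add: llin_def)
    show "?S (x * y) \<in> ?FFV" if "x \<in> Forms1 \<otimes>\<^sub>A Forms1" "y \<in> Fields" for x y
      using that tmap_mult[OF si_rlin llin_id[OF tmod_lsummand[OF tmod_Fields]] that]
      by (simp add: tprodI si_in)
  qed (rule subgrp_tprod)
  have R_add: "additive_on (Fields \<otimes>\<^sub>A ?FFV) ?R"
    by (intro tmap_add rlin_id tmod_Fields S)
  have R_mult: "?R (x * y) = x * ?S y" if "x \<in> Fields" "y \<in> ?FFV" for x y
    using tmap_mult[OF rlin_id[OF tmod_Fields] S that] by simp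
  have R_in: "?R x \<in> Fields_Forms1 \<otimes>\<^sub>A (Forms1 \<otimes>\<^sub>A Fields)" if "x \<in> Fields \<otimes>\<^sub>A ?FFV" for x
  proof (rule additive_image_in[OF that R_add subgrp_tprod])
    fix x y :: "'w tensor" assume xy: "x \<in> Fields" "y \<in> ?FFV"
    show "?R (x * y) \<in> Fields_Forms1 \<otimes>\<^sub>A (Forms1 \<otimes>\<^sub>A Fields)"
      unfolding R_mult[OF xy] using tprodI[OF xy(1) S_in[OF xy(2)]] by (simp only: tprod_assoc)
  qed
  have x_in: "x * coev_one \<in> Fields \<otimes>\<^sub>A ?FFV" if "x \<in> Fields_Forms1" for x
  proof -
    obtain n and \<xi> :: "nat \<Rightarrow> 'w" and u where b: "dual_basis n \<xi> u"
      and c: "coev_one = (\<Sum>i<n. form (\<xi> i) * vfield (u i))" using coev by blast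
    have "(coev_one :: 'w tensor) \<in> Forms1 \<otimes>\<^sub>A Fields"
      unfolding c by (intro subgrp_sum subgrp_tprod tprodI) (auto simp: dual_basis_forms[OF b])
    from tprodI[OF that this] show ?thesis by (simp add: tprod_assoc)
  qed
  have eq: "sigma si x = ext_id Fields_Forms1 ev (?R (x * coev_one))" if "x \<in> Fields_Forms1" for x
    unfolding sigma_def
    by (rule tmap_id_eq_ext_id[OF ev_rlin tmod_lsummand[OF tmod_FV]]) (rule R_in[OF x_in[OF that]])
  have "additive_on Fields_Forms1 (\<lambda>x. ext_id Fields_Forms1 ev (?R (x * coev_one)))"
    by (rule additive_on_compose[OF additive_on_compose[OF additive_on_mult_right R_add] ext_id_add[OF ev_rlin]])
      (auto intro: x_in dest!: x_in R_in simp: tprod_mono[THEN subsetD, OF subset_refl subset_UNIV])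
  then show "additive_on Fields_Forms1 (sigma si)"
    by (rule additive_on_cong) (auto simp: subgrp_tprod eq)
  assume \<omega>: "\<omega> \<in> forms 1" and b: "dual_basis n \<xi> u" and c: "coev_one = (\<Sum>i<n. form (\<xi> i) * vfield (u i))"
  note \<xi> = dual_basis_forms[OF b]
  have z: "form \<omega> * form (\<xi> i) * vfield (u i) \<in> ?FFV" if "i < n" for i
    using that by (auto intro!: tprodI \<omega> \<xi>)
  have Sz: "?S (form \<omega> * form (\<xi> i) * vfield (u i)) = si (form \<omega> * form (\<xi> i)) * vfield (u i)" if "i < n" for i
    using tmap_mult[OF si_rlin llin_id[OF tmod_lsummand[OF tmod_Fields]], of "form \<omega> * form (\<xi> i)" "vfield (u i)"] that
    by (simp add: form_FF \<omega> \<xi>)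
  have "?R (vfield v * form \<omega> * coev_one) = ?R (\<Sum>i<n. vfield v * (form \<omega> * form (\<xi> i) * vfield (u i)))"
    by (simp add: c sum_distrib_left mult.assoc)
  also have "\<dots> = (\<Sum>i<n. vfield v * (si (form \<omega> * form (\<xi> i)) * vfield (u i)))"
    by (subst additive_on_sum[OF R_add subgrp_tprod]) (auto intro!: sum.cong tprodI[OF _ z] simp: R_mult[OF _ z] Sz)
  finally have R: "?R (vfield v * form \<omega> * coev_one) = (\<Sum>i<n. vfield v * (si (form \<omega> * form (\<xi> i)) * vfield (u i)))" .
  have si_FT: "si (form \<omega> * form (\<xi> i)) \<in> Forms1_T" if "i < n" for i
    using si_in[OF form_FF[OF \<omega> \<xi>[OF that]]] by (rule Forms1_T)
  have "sigma si (vfield v * form \<omega>) = ext_id Fields_Forms1 ev (\<Sum>i<n. vfield v * (si (form \<omega> * form (\<xi> i)) * vfield (u i)))"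
    by (subst eq) (auto intro: tprodI \<omega> simp: R)
  also have "\<dots> = (\<Sum>i<n. contr v (si (form \<omega> * form (\<xi> i)) * vfield (u i)))"
    unfolding contr_def
  proof (rule additive_on_sum[OF ext_id_add[OF ev_rlin] subgrp_tprod])
    fix i assume "i \<in> {..<n}"
    then have "si (form \<omega> * form (\<xi> i)) * vfield (u i) \<in> (Forms1 \<otimes>\<^sub>A Forms1) \<otimes>\<^sub>A Fields"
      by (intro tprodI si_in form_FF \<omega> \<xi>) auto
    then have "si (form \<omega> * form (\<xi> i)) * vfield (u i) \<in> Forms1_T" by (simp add: tprod_assoc Forms1_T)
    then show "vfield v * (si (form \<omega> * form (\<xi> i)) * vfield (u i)) \<in> Fields_Forms1 \<otimes>\<^sub>A UNIV"
      by (rule vfield_mult_FT)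
  qed
  also have "\<dots> = (\<Sum>i<n. contr v (si (form \<omega> * form (\<xi> i))) * vfield (u i))"
    by (intro sum.cong) (simp_all add: contr_mult_right si_FT)
  finally show "sigma si (vfield v * form \<omega>) = (\<Sum>i<n. contr v (si (form \<omega> * form (\<xi> i))) * vfield (u i))" .
qed

lemma contr_FF: "x \<in> Forms1 \<otimes>\<^sub>A Forms1 \<Longrightarrow> contr v x \<in> Forms1"
  by (rule contr_in) (auto intro: tmod_lmod tmod_Forms1)

lemma sigma_in: "x \<in> Fields_Forms1 \<Longrightarrow> sigma si x \<in> Forms1 \<otimes>\<^sub>A Fields"
proof (rule additive_image_in[OF _ sigma_add subgrp_tprod])
  fix x y :: "'w tensor" assume "x \<in> Fields" "y \<in> Forms1"
  then obtain v \<omega> where *: "x = vfield v" "y = form \<omega>" "\<omega> \<in> forms 1" by auto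
  obtain n and \<xi> :: "nat \<Rightarrow> 'w" and u where b: "dual_basis n \<xi> u"
    and c: "coev_one = (\<Sum>i<n. form (\<xi> i) * vfield (u i))" using coev by blast
  show "sigma si (x * y) \<in> Forms1 \<otimes>\<^sub>A Fields"
    unfolding * sigma_mult[OF *(3) b c]
    by (intro subgrp_sum subgrp_tprod tprodI contr_FF si_in form_FF *) (auto intro: dual_basis_forms[OF b])
qed

text \<open>Because \<open>si\<close> is right linear, the coefficients produced by the pairing can
  be moved inside it, where they recombine the dual basis to \<eta>. So \<open>sigma si\<close> is
  the transpose of \<open>si\<close>, independently of the dual basis chosen.\<close>

lemma rev_ev_sigma:
  assumes \<omega>: "\<omega> \<in> forms 1" and \<eta>: "\<eta> \<in> forms 1"
  shows "rev_ev \<eta> (sigma si (vfield v * form \<omega>)) = contr v (si (form \<omega> * form \<eta>))"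
proof -
  obtain n and \<xi> :: "nat \<Rightarrow> 'w" and u where b: "dual_basis n \<xi> u"
    and c: "coev_one = (\<Sum>i<n. form (\<xi> i) * vfield (u i))" using coev by blast
  note \<xi> = dual_basis_forms[OF b]
  have FF: "form \<omega> * form (\<xi> i) \<in> Forms1 \<otimes>\<^sub>A Forms1" if "i < n" for i using that by (intro form_FF \<omega> \<xi>)
  have FT: "si (form \<omega> * form (\<xi> i)) \<in> Forms1_T" if "i < n" for i
    by (rule Forms1_T[OF si_in[OF FF[OF that]]])
  have "rev_ev \<eta> (sigma si (vfield v * form \<omega>)) =
      (\<Sum>i<n. rev_ev \<eta> (contr v (si (form \<omega> * form (\<xi> i))) * vfield (u i)))"
    unfolding sigma_mult[OF \<omega> b c]
    by (rule rev_ev_sum[OF \<eta>]) (auto intro!: tprodI contr_FF si_in FF)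
  also have "\<dots> = (\<Sum>i<n. contr v (si (form \<omega> * form (\<xi> i) * form (vec_apply (u i) \<eta>))))"
    by (intro sum.cong) (simp_all add: rev_ev_form contr_FF si_in FF \<eta> si_rmult vec_apply_forms contr_mult_right FT)
  also have "\<dots> = contr v (\<Sum>i<n. si (form \<omega> * form (\<xi> i) * form (vec_apply (u i) \<eta>)))"
    by (rule additive_on_sum[OF contr_add subgrp_tprod, symmetric])
      (auto intro!: Forms1_T[OF si_in] bimod_rmult tmod_bimod tmod_FF FF vec_apply_forms \<eta>)
  also have "(\<Sum>i<n. si (form \<omega> * form (\<xi> i) * form (vec_apply (u i) \<eta>))) =
      si (\<Sum>i<n. form \<omega> * form (\<xi> i) * form (vec_apply (u i) \<eta>))"
    by (rule additive_on_sum[OF si_add subgrp_tprod, symmetric])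
      (auto intro!: bimod_rmult tmod_bimod tmod_FF FF vec_apply_forms \<eta>)
  also have "(\<Sum>i<n. form \<omega> * form (\<xi> i) * form (vec_apply (u i) \<eta>)) =
      form \<omega> * form (\<Sum>i<n. \<xi> i * vec_apply (u i) \<eta>)"
    by (simp add: form_sum sum_distrib_left mult.assoc form_rmult vec_apply_forms \<eta>)
  finally show ?thesis by (simp add: dual_basis_eq[OF b \<eta>])
qed

lemma sigma_rmult:
  assumes x: "x \<in> Fields_Forms1" and a: "a \<in> forms 0"
  shows "sigma si (x * form a) = sigma si x * form a"
proof (rule tprod_eqI[OF x])
  show "additive_on Fields_Forms1 (\<lambda>x. sigma si (x * form a))"
    by (intro additive_on_compose[OF additive_on_mult_right sigma_add] bimod_rmult tmod_bimod tmod_VF a)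
  show "additive_on Fields_Forms1 (\<lambda>x. sigma si x * form a)" by (rule additive_on_mult_right'[OF sigma_add])
  fix x y :: "'w tensor" assume xy: "x \<in> Fields" "y \<in> Forms1"
  then obtain v \<omega> where *: "x = vfield v" "y = form \<omega>" "\<omega> \<in> forms 1" by auto
  have \<omega>a: "\<omega> * a \<in> forms 1" using * a by (simp add: forms_mult_0)
  show "sigma si (x * y * form a) = sigma si (x * y) * form a"
  proof (rule FV_eqI)
    show "sigma si (x * y * form a) \<in> Forms1 \<otimes>\<^sub>A Fields"
      by (intro sigma_in bimod_rmult tmod_bimod tmod_VF a tprodI xy)
    show "sigma si (x * y) * form a \<in> Forms1 \<otimes>\<^sub>A Fields"
      by (intro sigma_in bimod_rmult tmod_bimod tmod_FV a tprodI xy)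
    fix \<eta> :: 'w assume \<eta>: "\<eta> \<in> forms 1"
    show "rev_ev \<eta> (sigma si (x * y * form a)) = rev_ev \<eta> (sigma si (x * y) * form a)"
      using * a \<eta> \<omega>a by (simp add: mult.assoc form_rmult rev_ev_lmult[symmetric] rev_ev_sigma forms_0_mult)
        (simp add: form_rmult[symmetric] form_lmult[symmetric] mult.assoc)
  qed
qed

lemma sigma_lmult:
  assumes x: "x \<in> Fields_Forms1" and a: "a \<in> forms 0"
  shows "sigma si (form a * x) = form a * sigma si x"
proof (rule tprod_eqI[OF x])
  show "additive_on Fields_Forms1 (\<lambda>x. sigma si (form a * x))"
    by (intro additive_on_compose[OF additive_on_mult_left sigma_add] lmod_mult tmod_lmod tmod_VF a)
  show "additive_on Fields_Forms1 (\<lambda>x. form a * sigma si x)" by (rule additive_on_mult_left'[OF sigma_add])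
  fix x y :: "'w tensor" assume xy: "x \<in> Fields" "y \<in> Forms1"
  then obtain v \<omega> where *: "x = vfield v" "y = form \<omega>" "\<omega> \<in> forms 1" by auto
  show "sigma si (form a * (x * y)) = form a * sigma si (x * y)"
  proof (rule FV_eqI)
    show "sigma si (form a * (x * y)) \<in> Forms1 \<otimes>\<^sub>A Fields"
      by (intro sigma_in lmod_mult tmod_lmod tmod_VF a tprodI xy)
    show "form a * sigma si (x * y) \<in> Forms1 \<otimes>\<^sub>A Fields"
      by (intro sigma_in lmod_mult tmod_lmod tmod_FV a tprodI xy)
    fix \<eta> :: 'w assume \<eta>: "\<eta> \<in> forms 1"
    have "rev_ev \<eta> (form a * sigma si (x * y)) = form a * rev_ev \<eta> (sigma si (x * y))"
      by (rule rev_ev_left[OF \<eta> a]) (intro sigma_in tprodI xy)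
    then show "rev_ev \<eta> (sigma si (form a * (x * y))) = rev_ev \<eta> (form a * sigma si (x * y))"
      using * a \<eta> by (simp add: mult.assoc[symmetric] vfield_lmult rev_ev_sigma contr_vec_lmult Forms1_T[OF si_in[OF form_FF]])
  qed
qed

lemma sigma_rlin: "rlin Fields_Forms1 (sigma si)"
  by (simp add: rlin_def tmod_VF sigma_add sigma_rmult)

text \<open>The expression d(v(\<xi>)) minus the contraction of v with the derivative of \<xi> is
  right linear in \<xi>, although neither term is. It is therefore the pairing with a tensor whose
  coefficients are its values at the dual basis. Uniqueness is nondegeneracy of the pairing.\<close>

lemma sq_vec_ex1:
  "\<exists>!X. X \<in> Forms1 \<otimes>\<^sub>A Fields \<and>
     (\<forall>\<xi>\<in>forms 1. form (ext_deriv (vec_apply v \<xi>)) = rev_ev \<xi> X + contr v (sq \<xi>))"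
proof (rule ex_ex1I)
  obtain n and \<xi> :: "nat \<Rightarrow> 'w" and u where b: "dual_basis n \<xi> u" using coev by blast
  note \<xi> = dual_basis_forms[OF b]
  define Y where "Y = (\<lambda>i. form (ext_deriv (vec_apply v (\<xi> i))) - contr v (sq (\<xi> i)))"
  have Y: "Y i \<in> Forms1" if "i < n" for i
    unfolding Y_def using that
    by (intro subgrp_diff tmod_subgrp tmod_Forms1 imageI ext_deriv_0 vec_apply_forms \<xi> contr_FF sq_in)
  have YV: "Y i * vfield (u i) \<in> Forms1 \<otimes>\<^sub>A Fields" if "i < n" for i
    using that by (intro tprodI Y) auto
  define X where "X = (\<Sum>i<n. Y i * vfield (u i))"
  have "X \<in> Forms1 \<otimes>\<^sub>A Fields" unfolding X_def using YV by (intro subgrp_sum subgrp_tprod) auto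
  moreover have "form (ext_deriv (vec_apply v \<eta>)) = rev_ev \<eta> X + contr v (sq \<eta>)" if \<eta>: "\<eta> \<in> forms 1" for \<eta>
  proof -
    let ?c = "\<lambda>i. vec_apply (u i) \<eta>"
    have c: "?c i \<in> forms 0" for i using \<eta> by (rule vec_apply_forms)
    have \<xi>c: "\<xi> i * ?c i \<in> forms 1" if "i < n" for i using that by (intro forms_mult_0 \<xi> c)
    have X: "rev_ev \<eta> X = (\<Sum>i<n. Y i * form (?c i))"
      unfolding X_def by (subst rev_ev_sum[OF \<eta>]) (auto intro!: sum.cong YV rev_ev_form Y \<eta>)
    \<comment> \<open>Both sides will be expanded along the dual basis, so this is stated for any
      map that is additive on 1-forms.\<close>
    have sum: "g \<eta> = (\<Sum>i<n. g (\<xi> i * ?c i))"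
      if g: "\<And>x y. x \<in> forms 1 \<Longrightarrow> y \<in> forms 1 \<Longrightarrow> g (x + y) = g x + g y" for g :: "'w \<Rightarrow> 'w tensor"
    proof -
      have g0: "g 0 = 0" using g[OF forms_zero forms_zero] by simp
      have "g (\<Sum>i<m. \<xi> i * ?c i) = (\<Sum>i<m. g (\<xi> i * ?c i))" if "m \<le> n" for m
        using that
      proof (induction m)
        case (Suc m)
        have "(\<Sum>i<m. \<xi> i * ?c i) \<in> forms 1"
          using Suc.prems by (intro subgrp_sum subgrp_forms \<xi>c) auto
        then show ?case using Suc by (simp add: g \<xi>c)
      qed (simp add: g0)
      from this[of n] show ?thesis using dual_basis_eq[OF b \<eta>] by simp
    qed
    have 1: "form (ext_deriv (vec_apply v \<eta>)) = (\<Sum>i<n. form (ext_deriv (vec_apply v (\<xi> i * ?c i))))"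
      by (rule sum) (simp add: vec_apply_add ext_deriv_add form_add)
    have 2: "contr v (sq \<eta>) = (\<Sum>i<n. contr v (sq (\<xi> i * ?c i)))"
      by (rule sum) (simp add: sq_add additive_on_add[OF contr_add] Forms1_T[OF sq_in])
    \<comment> \<open>The two Leibniz rules contribute the same term v(\<xi>_i) d c_i, which
      cancels; this is the right linearity on which the existence of the tensor rests.\<close>
    have "form (ext_deriv (vec_apply v (\<xi> i * ?c i))) - contr v (sq (\<xi> i * ?c i)) = Y i * form (?c i)" if i: "i < n" for i
    proof -
      have "contr v (sq (\<xi> i * ?c i)) = contr v (sq (\<xi> i) * form (?c i)) + contr v (form (\<xi> i) * form (ext_deriv (?c i)))"
        using i c \<xi> by (subst sq_rmult) (auto intro!: additive_on_add[OF contr_add] Forms1_T[where N = Forms1]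
            bimod_rmult tmod_bimod tmod_FF sq_in form_FF ext_deriv_0)
      also have "\<dots> = contr v (sq (\<xi> i)) * form (?c i) + form (vec_apply v (\<xi> i)) * form (ext_deriv (?c i))"
        using i \<xi> by (simp add: contr_mult_right Forms1_T[OF sq_in] contr_mult)
      finally show ?thesis
        using i \<xi> c by (simp add: Y_def vec_apply_mult ext_deriv_mult_0 vec_apply_forms form_add form_rmult[symmetric]
            form_lmult[symmetric] algebra_simps)
    qed
    then have "(\<Sum>i<n. form (ext_deriv (vec_apply v (\<xi> i * ?c i)))) - (\<Sum>i<n. contr v (sq (\<xi> i * ?c i)))
        = (\<Sum>i<n. Y i * form (?c i))"
      by (simp add: sum_subtractf[symmetric])
    then show ?thesis unfolding X 1 2 by (simp add: algebra_simps)
  qed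
  ultimately show "\<exists>X. X \<in> Forms1 \<otimes>\<^sub>A Fields \<and>
     (\<forall>\<xi>\<in>forms 1. form (ext_deriv (vec_apply v \<xi>)) = rev_ev \<xi> X + contr v (sq \<xi>))" by blast
next
  fix X Y :: "'w tensor"
  assume X: "X \<in> Forms1 \<otimes>\<^sub>A Fields \<and> (\<forall>\<xi>\<in>forms 1. form (ext_deriv (vec_apply v \<xi>)) = rev_ev \<xi> X + contr v (sq \<xi>))"
    and Y: "Y \<in> Forms1 \<otimes>\<^sub>A Fields \<and> (\<forall>\<xi>\<in>forms 1. form (ext_deriv (vec_apply v \<xi>)) = rev_ev \<xi> Y + contr v (sq \<xi>))"
  show "X = Y"
  proof (rule FV_eqI)
    fix \<eta> :: 'w assume \<eta>: "\<eta> \<in> forms 1"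
    have "rev_ev \<eta> X + contr v (sq \<eta>) = rev_ev \<eta> Y + contr v (sq \<eta>)"
      using X Y \<eta> by (metis (no_types))
    then show "rev_ev \<eta> X = rev_ev \<eta> Y" by simp
  qed (use X Y in blast)+
qed

lemma sq_vec_alt: "sq_vec sq v = (THE X. X \<in> Forms1 \<otimes>\<^sub>A Fields \<and>
     (\<forall>\<xi>\<in>forms 1. form (ext_deriv (vec_apply v \<xi>)) = rev_ev \<xi> X + contr v (sq \<xi>)))"
  unfolding sq_vec_def rev_ev_def[symmetric]
  by (intro arg_cong[where f = The] ext conj_cong refl ball_cong)
    (simp_all add: ev_left_eq_contr tmod_lsummand tmod_Forms1 sq_in)

lemma sq_vec_in: "sq_vec sq v \<in> Forms1 \<otimes>\<^sub>A Fields"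
  and sq_vec_eq: "\<xi> \<in> forms 1 \<Longrightarrow> form (ext_deriv (vec_apply v \<xi>)) = rev_ev \<xi> (sq_vec sq v) + contr v (sq \<xi>)"
  using theI'[OF sq_vec_ex1[of v]] unfolding sq_vec_alt by blast+

lemma sq_vecI:
  assumes "X \<in> Forms1 \<otimes>\<^sub>A Fields"
    and "\<And>\<xi>. \<xi> \<in> forms 1 \<Longrightarrow> form (ext_deriv (vec_apply v \<xi>)) = rev_ev \<xi> X + contr v (sq \<xi>)"
  shows "sq_vec sq v = X"
  unfolding sq_vec_alt by (rule the1_equality[OF sq_vec_ex1]) (use assms in blast)

lemma sq_vec_add: "sq_vec sq (u + v) = sq_vec sq u + sq_vec sq v"
  by (rule sq_vecI)
    (simp_all add: subgrp_add subgrp_tprod sq_vec_in vec_apply_plus ext_deriv_add form_add sq_vec_eq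
      additive_on_add[OF rev_ev_add] contr_vec_add Forms1_T[OF sq_in] algebra_simps)

lemma sq_vec_lmult:
  assumes a: "a \<in> forms 0"
  shows "sq_vec sq (vec_lmult a v) = form (ext_deriv a) * vfield v + form a * sq_vec sq v"
proof (rule sq_vecI)
  have 1: "form (ext_deriv a) * vfield v \<in> Forms1 \<otimes>\<^sub>A Fields" by (intro tprodI imageI ext_deriv_0 a) auto
  have 2: "form a * sq_vec sq v \<in> Forms1 \<otimes>\<^sub>A Fields" by (intro lmod_mult tmod_lmod tmod_FV a sq_vec_in)
  show "form (ext_deriv a) * vfield v + form a * sq_vec sq v \<in> Forms1 \<otimes>\<^sub>A Fields"
    by (rule subgrp_add[OF subgrp_tprod 1 2])
  fix \<xi> :: 'w assume \<xi>: "\<xi> \<in> forms 1"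
  have "form (ext_deriv (vec_apply (vec_lmult a v) \<xi>)) =
      form (ext_deriv a) * form (vec_apply v \<xi>) + form a * form (ext_deriv (vec_apply v \<xi>))"
    by (simp add: vec_apply_lmult a ext_deriv_mult_0 form_add form_lmult form_rmult vec_apply_forms \<xi>)
  then show "form (ext_deriv (vec_apply (vec_lmult a v) \<xi>)) =
     rev_ev \<xi> (form (ext_deriv a) * vfield v + form a * sq_vec sq v) + contr (vec_lmult a v) (sq \<xi>)"
    unfolding additive_on_add[OF rev_ev_add[OF \<xi>] 1 2]
    by (simp add: rev_ev_mult \<xi> ext_deriv_0 a rev_ev_left sq_vec_in
        contr_vec_lmult Forms1_T[OF sq_in] sq_vec_eq algebra_simps)
qed

text \<open>Pairing v.a with \<xi> is pairing v with a \<xi>, and the left Leibniz rule on forms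
  then produces \<open>si\<close> of da \<otimes> \<xi>. Transposition turns this into the
  \<open>sigma\<close> term.\<close>

lemma sq_vec_rmult:
  assumes a: "a \<in> forms 0"
  shows "sq_vec sq (vec_rmult v a) = sq_vec sq v * form a + sigma si (vfield v * form (ext_deriv a))"
proof (rule sq_vecI)
  have 1: "sq_vec sq v * form a \<in> Forms1 \<otimes>\<^sub>A Fields" by (intro bimod_rmult tmod_bimod tmod_FV a sq_vec_in)
  have 2: "sigma si (vfield v * form (ext_deriv a)) \<in> Forms1 \<otimes>\<^sub>A Fields"
    by (intro sigma_in tprodI imageI ext_deriv_0 a) auto
  show "sq_vec sq v * form a + sigma si (vfield v * form (ext_deriv a)) \<in> Forms1 \<otimes>\<^sub>A Fields"
    by (rule subgrp_add[OF subgrp_tprod 1 2])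
  fix \<xi> :: 'w assume \<xi>: "\<xi> \<in> forms 1"
  have a\<xi>: "a * \<xi> \<in> forms 1" using a \<xi> by (rule forms_0_mult)
  have "form (ext_deriv (vec_apply (vec_rmult v a) \<xi>)) = rev_ev (a * \<xi>) (sq_vec sq v) + contr v (sq (a * \<xi>))"
    by (simp add: vec_apply_rmult a \<xi> sq_vec_eq a\<xi>)
  also have "contr v (sq (a * \<xi>)) = contr v (form a * sq \<xi>) + contr v (si (form (ext_deriv a) * form \<xi>))"
    unfolding sq_lmult[OF \<xi> a]
    by (rule additive_on_add[OF contr_add])
      (intro Forms1_T[where N = Forms1] lmod_mult tmod_lmod tmod_FF a sq_in \<xi> si_in form_FF ext_deriv_0)+
  finally show "form (ext_deriv (vec_apply (vec_rmult v a) \<xi>)) =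
     rev_ev \<xi> (sq_vec sq v * form a + sigma si (vfield v * form (ext_deriv a))) + contr (vec_rmult v a) (sq \<xi>)"
    unfolding additive_on_add[OF rev_ev_add[OF \<xi>] 1 2]
    by (simp add: rev_ev_lmult a \<xi> rev_ev_sigma ext_deriv_0 contr_vec_rmult algebra_simps)
qed

end

section \<open>Extension of the dual derivative to tensor powers of fields\<close>

abbreviation TV :: "'w::star_dga tensor set" where
  "TV \<equiv> tensor_algebra Fields"

lemma tmod_tpow: "tmod (tpower Fields n)"
  by (rule tmod_tpower[OF tmod_Fields])

lemma lsummand_tpow: "lsummand (tpower Fields n)"
  by (rule tmod_lsummand[OF tmod_tpow])

lemma lmod_TV: "lmod TV"
  by (rule lsummand_lmod[OF lsummand_tensor_algebra])

lemma tpow_TV: "x \<in> tpower Fields n \<Longrightarrow> x \<in> TV"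
  using tpower_tensor_algebra[of Fields n] by blast

definition the_field :: "'w::star_dga tensor \<Rightarrow> 'w vec" where
  "the_field x = inv vfield x"

lemma the_field_vfield [simp]: "the_field (vfield v) = v"
  unfolding the_field_def by (rule inv_f_f) (simp add: inj_on_def vfield_inject)

lemma ext_id_left:
  assumes f: "rlin M f" and l: "\<And>x. x \<in> M \<Longrightarrow> f (form a * x) = form a * f x"
    and a: "a \<in> forms 0" and z: "z \<in> M \<otimes>\<^sub>A UNIV"
  shows "ext_id M f (form a * z) = form a * ext_id M f z"
proof (rule tprod_eqI[OF z])
  have M: "lmod M" using f by (simp add: rlin_def tmod_lmod)
  show "additive_on (M \<otimes>\<^sub>A UNIV) (\<lambda>z. ext_id M f (form a * z))"
    by (rule additive_on_compose[OF additive_on_mult_left ext_id_add[OF f]]) (rule lmod_mult[OF lmod_tprod[OF M] a])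
  show "additive_on (M \<otimes>\<^sub>A UNIV) (\<lambda>z. form a * ext_id M f z)"
    by (rule additive_on_mult_left'[OF ext_id_add[OF f]])
  fix x y assume "x \<in> M"
  then show "ext_id M f (form a * (x * y)) = form a * ext_id M f (x * y)"
    using ext_id_mult[OF f lmod_mult[OF M a], of x y] ext_id_mult[OF f, of x y] by (simp add: mult.assoc l)
qed

context conn
begin

definition sigma_id :: "'w tensor \<Rightarrow> 'w tensor" where
  "sigma_id = ext_id Fields_Forms1 (sigma si)"

lemma sigma_id_add: "additive_on (Fields_Forms1 \<otimes>\<^sub>A UNIV) sigma_id"
  unfolding sigma_id_def by (rule ext_id_add[OF sigma_rlin])

lemma sigma_id_mult: "\<omega> \<in> forms 1 \<Longrightarrow> sigma_id (vfield v * (form \<omega> * y)) = sigma si (vfield v * form \<omega>) * y"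
  unfolding sigma_id_def mult.assoc[symmetric] by (rule ext_id_mult[OF sigma_rlin]) (auto intro: tprodI)

lemma sigma_id_lmult: "a \<in> forms 0 \<Longrightarrow> z \<in> Fields_Forms1 \<otimes>\<^sub>A UNIV \<Longrightarrow> sigma_id (form a * z) = form a * sigma_id z"
  unfolding sigma_id_def by (rule ext_id_left[OF sigma_rlin]) (auto simp: sigma_lmult)

lemma sigma_id_in: "z \<in> Forms1 \<otimes>\<^sub>A N \<Longrightarrow> sigma_id (vfield v * z) \<in> Forms1 \<otimes>\<^sub>A (Fields \<otimes>\<^sub>A N)"
proof -
  assume z: "z \<in> Forms1 \<otimes>\<^sub>A N"
  have "vfield v * z \<in> Fields_Forms1 \<otimes>\<^sub>A N" unfolding tprod_assoc by (intro tprodI z) auto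
  from ext_id_in[OF sigma_rlin this sigma_in] show ?thesis by (simp add: sigma_id_def tprod_assoc)
qed

definition sq_vecs_ok :: "nat \<Rightarrow> bool" where
  "sq_vecs_ok n \<longleftrightarrow> additive_on (tpower Fields n) (sq_vecs sq si n) \<and>
     (\<forall>y\<in>tpower Fields n. sq_vecs sq si n y \<in> Forms1 \<otimes>\<^sub>A tpower Fields n) \<and>
     (\<forall>a\<in>forms 0. \<forall>y\<in>tpower Fields n.
        sq_vecs sq si n (form a * y) = form (ext_deriv a) * y + form a * sq_vecs sq si n y)"

text \<open>Moving a from the field v to the tensor y changes the first summand by
  \<open>sigma si\<close> of v \<otimes> da, times y. The Leibniz rule of the previous derivative
  changes the second by the opposite amount. Only the sum is balanced, which is why that rule
  belongs to \<open>sq_vecs_ok\<close>.\<close>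

lemma sq_vecs_Suc:
  assumes n: "sq_vecs_ok n"
  shows "additive_on (tpower Fields (Suc n)) (sq_vecs sq si (Suc n))"
    and "y \<in> tpower Fields n \<Longrightarrow> sq_vecs sq si (Suc n) (vfield v * y) =
      sq_vec sq v * y + sigma_id (vfield v * sq_vecs sq si n y)"
proof -
  let ?S = "sq_vecs sq si n"
  have S_add: "additive_on (tpower Fields n) ?S"
    and S_in: "\<And>y. y \<in> tpower Fields n \<Longrightarrow> ?S y \<in> Forms1 \<otimes>\<^sub>A tpower Fields n"
    and S_l: "\<And>a y. a \<in> forms 0 \<Longrightarrow> y \<in> tpower Fields n \<Longrightarrow> ?S (form a * y) = form (ext_deriv a) * y + form a * ?S y"
    using n unfolding sq_vecs_ok_def by blast+
  note S_FT = Forms1_T[OF S_in]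
  define f where "f = (\<lambda>x y. sq_vec sq (the_field x) * y + sigma_id (x * ?S y))"
  have FT: "x * ?S y \<in> Fields_Forms1 \<otimes>\<^sub>A UNIV" if "x \<in> Fields" "y \<in> tpower Fields n" for x y
    using that vfield_mult_FT[OF S_FT] by auto
  have bal: "balanced Fields (tpower Fields n) f"
    unfolding balanced_def
  proof (intro conjI ballI)
    fix x :: "'w tensor" assume "x \<in> Fields"
    then show "additive_on (tpower Fields n) (f x)"
      unfolding f_def
      by (intro additive_on_plus additive_on_mult_left
          additive_on_compose[OF additive_on_mult_left'[OF S_add] sigma_id_add] FT)
  next
    fix y :: "'w tensor" assume y: "y \<in> tpower Fields n"
    have "additive_on Fields (\<lambda>x. sq_vec sq (the_field x) * y)"
      by (auto simp: additive_on_def vfield_add[symmetric] sq_vec_add distrib_right)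
    moreover have "additive_on Fields (\<lambda>x. sigma_id (x * ?S y))"
      by (intro additive_on_compose[OF additive_on_mult_right sigma_id_add] FT y)
    ultimately show "additive_on Fields (\<lambda>x. f x y)"
      unfolding f_def by (rule additive_on_plus)
  next
    fix x y :: "'w tensor" and a :: 'w
    assume x: "x \<in> Fields" and a: "a \<in> forms 0" and y: "y \<in> tpower Fields n"
    obtain v where v: "x = vfield v" using x by auto
    have da: "ext_deriv a \<in> forms 1" by (rule ext_deriv_0[OF a])
    have "f x (form a * y) = sq_vec sq v * form a * y + sigma_id (vfield v * (form (ext_deriv a) * y + form a * ?S y))"
      by (simp add: f_def v S_l a y mult.assoc)
    also have "sigma_id (vfield v * (form (ext_deriv a) * y + form a * ?S y)) =
        sigma_id (vfield v * (form (ext_deriv a) * y)) + sigma_id (vfield v * (form a * ?S y))"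
      unfolding distrib_left
      by (intro additive_on_add[OF sigma_id_add] vfield_mult_FT tprodI lmod_mult[OF lmod_tprod[OF tmod_lmod[OF tmod_Forms1]] a S_FT[OF y]])
        (use da in auto)
    finally show "f (x * form a) y = f x (form a * y)"
      using a da by (simp add: f_def v vfield_rmult sq_vec_rmult sigma_id_mult distrib_right)
        (simp add: vfield_rmult[symmetric] mult.assoc add.assoc)
  qed
  have eq: "tensor_map Fields_Forms1 (sigma si) (tpower Fields n) id (vfield v * ?S y) = sigma_id (vfield v * ?S y)"
    if y: "y \<in> tpower Fields n" for v y
    unfolding sigma_id_def
    by (rule tmap_id_eq_ext_id[OF sigma_rlin lsummand_tpow]) (auto simp: tprod_assoc intro!: tprodI S_in y)
  have "\<exists>g. additive_on (tpower Fields (Suc n)) g \<and> (\<forall>v. \<forall>y\<in>tpower Fields n. g (vfield v * y) =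
           sq_vec sq v * y + tensor_map Fields_Forms1 (sigma si) (tpower Fields n) id (vfield v * ?S y))"
    using ex_tensor_lift[OF tmod_Fields lsummand_tpow bal] by (auto simp: f_def eq)
  from someI_ex[OF this]
  show "additive_on (tpower Fields (Suc n)) (sq_vecs sq si (Suc n))"
    and "y \<in> tpower Fields n \<Longrightarrow> sq_vecs sq si (Suc n) (vfield v * y) =
      sq_vec sq v * y + sigma_id (vfield v * sq_vecs sq si n y)"
    unfolding sq_vecs.simps by (auto simp: eq)
qed

lemma sq_vecs_ok: "sq_vecs_ok n"
proof (induction n)
  case 0
  show ?case
    by (auto simp: sq_vecs_ok_def additive_on_def on_forms_def wedge_add wedge_mult ext_deriv_add form_add ext_deriv_mult_0
        tprod_Alg bimod_forms ext_deriv_0 form_lmult form_rmult)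
next
  case (Suc n)
  let ?S = "sq_vecs sq si n" and ?T = "sq_vecs sq si (Suc n)"
  have S_in: "\<And>y. y \<in> tpower Fields n \<Longrightarrow> ?S y \<in> Forms1 \<otimes>\<^sub>A tpower Fields n"
    using Suc unfolding sq_vecs_ok_def by blast
  note S_FT = Forms1_T[OF S_in]
  note T = sq_vecs_Suc[OF Suc]
  have tpow: "lmod (tpower Fields (Suc n) :: 'w tensor set)" by (rule tmod_lmod[OF tmod_tpow])
  show ?case
    unfolding sq_vecs_ok_def
  proof (intro conjI ballI T(1))
    fix y :: "'w tensor" assume y: "y \<in> tpower Fields (Suc n)"
    show "?T y \<in> Forms1 \<otimes>\<^sub>A tpower Fields (Suc n)"
    proof (rule additive_image_in[OF y[unfolded tpower.simps] T(1)[unfolded tpower.simps] subgrp_tprod])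
      fix x y :: "'w tensor" assume x: "x \<in> Fields" and y: "y \<in> tpower Fields n"
      obtain v where v: "x = vfield v" using x by auto
      have "sq_vec sq v * y \<in> (Forms1 \<otimes>\<^sub>A Fields) \<otimes>\<^sub>A tpower Fields n" by (intro tprodI sq_vec_in y)
      then show "?T (x * y) \<in> Forms1 \<otimes>\<^sub>A tpower Fields (Suc n)"
        unfolding v T(2)[OF y] using sigma_id_in[OF S_in[OF y], of v]
        by (simp add: tprod_assoc subgrp_add[OF subgrp_tprod])
    qed
    fix a :: 'w assume a: "a \<in> forms 0"
    show "?T (form a * y) = form (ext_deriv a) * y + form a * ?T y"
    proof (rule tprod_eqI[OF y[unfolded tpower.simps]])
      show "additive_on (Fields \<otimes>\<^sub>A tpower Fields n) (\<lambda>y. ?T (form a * y))"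
        using tpow by (intro additive_on_compose[OF additive_on_mult_left T(1)] lmod_mult a) auto
      show "additive_on (Fields \<otimes>\<^sub>A tpower Fields n) (\<lambda>y. form (ext_deriv a) * y + form a * ?T y)"
        using T(1) by (intro additive_on_plus additive_on_mult_left additive_on_mult_left') simp
      fix x y :: "'w tensor" assume x: "x \<in> Fields" and y: "y \<in> tpower Fields n"
      obtain v where v: "x = vfield v" using x by auto
      have e: "form a * (vfield v * z) = vfield (vec_lmult a v) * z" for z
        by (simp add: vfield_lmult[OF a, symmetric] mult.assoc)
      have "?T (form a * (x * y)) = (form (ext_deriv a) * vfield v + form a * sq_vec sq v) * y + sigma_id (form a * (vfield v * ?S y))"
        unfolding v e T(2)[OF y] sq_vec_lmult[OF a] ..
      also have "sigma_id (form a * (vfield v * ?S y)) = form a * sigma_id (vfield v * ?S y)"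
        by (rule sigma_id_lmult[OF a vfield_mult_FT[OF S_FT[OF y]]])
      finally show "?T (form a * (x * y)) = form (ext_deriv a) * (x * y) + form a * ?T (x * y)"
        by (simp add: v T(2)[OF y] algebra_simps del: sq_vecs.simps)
    qed
  qed
qed

lemma sq_vecs_add: "additive_on (tpower Fields n) (sq_vecs sq si n)"
  and sq_vecs_in: "y \<in> tpower Fields n \<Longrightarrow> sq_vecs sq si n y \<in> Forms1 \<otimes>\<^sub>A tpower Fields n"
  and sq_vecs_lmult: "a \<in> forms 0 \<Longrightarrow> y \<in> tpower Fields n \<Longrightarrow>
    sq_vecs sq si n (form a * y) = form (ext_deriv a) * y + form a * sq_vecs sq si n y"
  using sq_vecs_ok[of n] unfolding sq_vecs_ok_def by blast+

lemmas sq_vecs_mult = sq_vecs_Suc(2)[OF sq_vecs_ok]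

section \<open>The total derivative and the product of differential operators\<close>

definition sq_all :: "'w tensor \<Rightarrow> 'w tensor" where
  "sq_all = (SOME h. additive_on TV h \<and> (\<forall>n. \<forall>x\<in>tpower Fields n. h x = sq_vecs sq si n x))"

lemma sq_all_add: "additive_on TV sq_all"
  and sq_all_tpower: "x \<in> tpower Fields n \<Longrightarrow> sq_all x = sq_vecs sq si n x"
  using someI_ex[OF ex_glue[OF sq_vecs_add]] unfolding sq_all_def by blast+

lemma sq_all_tpower_in: "x \<in> tpower Fields n \<Longrightarrow> sq_all x \<in> Forms1 \<otimes>\<^sub>A tpower Fields n"
  by (simp add: sq_all_tpower sq_vecs_in)

lemma sq_all_in: "x \<in> TV \<Longrightarrow> sq_all x \<in> Forms1 \<otimes>\<^sub>A TV"
proof (rule tensor_algebra_image_in[OF _ sq_all_add subgrp_tprod])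
  fix n and x :: "'w tensor" assume "x \<in> tpower Fields n"
  from sq_all_tpower_in[OF this] show "sq_all x \<in> Forms1 \<otimes>\<^sub>A TV"
    using tprod_mono[OF subset_refl tpower_tensor_algebra] by blast
qed

lemma sq_all_FT: "x \<in> TV \<Longrightarrow> sq_all x \<in> Forms1_T"
  by (rule Forms1_T[OF sq_all_in])

lemma sq_all_lmult:
  assumes a: "a \<in> forms 0" and x: "x \<in> TV"
  shows "sq_all (form a * x) = form (ext_deriv a) * x + form a * sq_all x"
proof (rule tensor_algebra_eqI[OF x])
  show "additive_on TV (\<lambda>x. sq_all (form a * x))"
    by (intro additive_on_compose[OF additive_on_mult_left sq_all_add] lmod_mult lmod_TV a)
  show "additive_on TV (\<lambda>x. form (ext_deriv a) * x + form a * sq_all x)"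
    by (intro additive_on_plus additive_on_mult_left additive_on_mult_left' sq_all_add)
  fix n and x :: "'w tensor" assume x: "x \<in> tpower Fields n"
  show "sq_all (form a * x) = form (ext_deriv a) * x + form a * sq_all x"
    using lmod_mult[OF tmod_lmod[OF tmod_tpow] a x] x by (simp add: sq_all_tpower sq_vecs_lmult a)
qed

lemma sq_all_form: "a \<in> forms 0 \<Longrightarrow> sq_all (form a) = form (ext_deriv a)"
  using sq_all_tpower[of "form a" 0] by (simp add: on_forms_def)

lemma sq_all_one: "sq_all 1 = 0"
proof -
  have "ext_deriv (1 * 1) = ext_deriv 1 + (ext_deriv 1 :: 'w)"
    by (subst ext_deriv_mult_0) (simp_all add: forms_one)
  then show ?thesis using sq_all_form[OF forms_one] by (simp add: form_one form_zero)
qed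

text \<open>Left multiplication by a vector field in the algebra of differential operators.\<close>

definition lmul :: "'w vec \<Rightarrow> 'w tensor \<Rightarrow> 'w tensor" where
  "lmul u y = vfield u * y + contr u (sq_all y)"

lemma contr_sq_all_in: "x \<in> TV \<Longrightarrow> contr u (sq_all x) \<in> TV"
  by (rule contr_in[OF sq_all_in lmod_TV])

lemma contr_sq_all_tpower_in: "x \<in> tpower Fields n \<Longrightarrow> contr u (sq_all x) \<in> tpower Fields n"
  by (rule contr_in[OF sq_all_tpower_in tmod_lmod[OF tmod_tpow]])

lemma vfield_TV: "x \<in> TV \<Longrightarrow> vfield u * x \<in> TV"
  by (rule tensor_algebra_mult[OF bimod_lmod[OF bimod_Fields] generator_tensor_algebra]) auto

lemma lmul_in: "y \<in> TV \<Longrightarrow> lmul u y \<in> TV"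
  unfolding lmul_def by (intro subgrp_add subgrp_tensor_algebra contr_sq_all_in vfield_TV)

lemma contr_sq_all_add: "additive_on TV (\<lambda>y. contr u (sq_all y))"
  by (rule additive_on_compose[OF sq_all_add contr_add sq_all_FT])

lemma lmul_add: "additive_on TV (lmul u)"
  unfolding lmul_def by (intro additive_on_plus additive_on_mult_left contr_sq_all_add)

lemma lmul_vec_add: "y \<in> TV \<Longrightarrow> lmul (u + v) y = lmul u y + lmul v y"
  by (simp add: lmul_def vfield_add distrib_right contr_vec_add sq_all_FT)

lemma lmul_vec_lmult: "a \<in> forms 0 \<Longrightarrow> y \<in> TV \<Longrightarrow> lmul (vec_lmult a u) y = form a * lmul u y"
  by (simp add: lmul_def vfield_lmult[symmetric] contr_vec_lmult sq_all_FT distrib_left mult.assoc)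

lemma contr_sq_all_lmult:
  assumes a: "a \<in> forms 0" and y: "y \<in> TV"
  shows "contr u (sq_all (form a * y)) = form (vec_apply u (ext_deriv a)) * y + contr (vec_rmult u a) (sq_all y)"
proof -
  have "contr u (sq_all (form a * y)) = contr u (form (ext_deriv a) * y) + contr u (form a * sq_all y)"
    unfolding sq_all_lmult[OF a y]
    by (rule additive_on_add[OF contr_add])
      (auto intro!: tprodI ext_deriv_0 a lmod_mult[OF lmod_tprod[OF tmod_lmod[OF tmod_Forms1]] a] sq_all_FT y)
  then show ?thesis by (simp add: contr_mult ext_deriv_0 a contr_vec_rmult)
qed

lemma lmul_lmult: "a \<in> forms 0 \<Longrightarrow> y \<in> TV \<Longrightarrow>
    lmul u (form a * y) = lmul (vec_rmult u a) y + form (vec_apply u (ext_deriv a)) * y"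
  by (simp add: lmul_def contr_sq_all_lmult vfield_rmult[symmetric] mult.assoc)

primrec bmul_rec :: "nat \<Rightarrow> 'w tensor \<Rightarrow> 'w tensor \<Rightarrow> 'w tensor" where
  "bmul_rec 0 x y = x * y"
| "bmul_rec (Suc n) x y = tensor_lift Fields (tpower Fields n)
     (\<lambda>w z. lmul (the_field w) (bmul_rec n z y) - bmul_rec n (contr (the_field w) (sq_all z)) y) x"

definition bmul_rec_ok :: "nat \<Rightarrow> bool" where
  "bmul_rec_ok n \<longleftrightarrow> (\<forall>y\<in>TV. additive_on (tpower Fields n) (\<lambda>x. bmul_rec n x y) \<and>
     (\<forall>x\<in>tpower Fields n. bmul_rec n x y \<in> TV \<and> (\<forall>a\<in>forms 0. bmul_rec n (form a * x) y = form a * bmul_rec n x y)))"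

text \<open>The two terms of the recursion fail to be balanced by the same amount, the function
  u(da) times the product of z and y. The failure of the first is computed in
  \<open>lmul_lmult\<close>, that of the second in \<open>contr_sq_all_lmult\<close>.\<close>

lemma bmul_rec_Suc:
  assumes n: "bmul_rec_ok n" and y: "y \<in> TV"
  shows "additive_on (tpower Fields (Suc n)) (\<lambda>x. bmul_rec (Suc n) x y)"
    and "x \<in> tpower Fields n \<Longrightarrow> bmul_rec (Suc n) (vfield u * x) y = lmul u (bmul_rec n x y) - bmul_rec n (contr u (sq_all x)) y"
proof -
  have m_add: "additive_on (tpower Fields n) (\<lambda>x. bmul_rec n x y)"
    and m_in: "\<And>x. x \<in> tpower Fields n \<Longrightarrow> bmul_rec n x y \<in> TV"
    and m_l: "\<And>x a. x \<in> tpower Fields n \<Longrightarrow> a \<in> forms 0 \<Longrightarrow> bmul_rec n (form a * x) y = form a * bmul_rec n x y"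
    using n y unfolding bmul_rec_ok_def by blast+
  note tpow = tmod_lmod[OF tmod_tpow[of n]]
  let ?f = "\<lambda>w z. lmul (the_field w) (bmul_rec n z y) - bmul_rec n (contr (the_field w) (sq_all z)) y"
  have c_add: "additive_on (tpower Fields n) (\<lambda>z. contr u (sq_all z))" for u
    by (rule additive_on_subset[OF contr_sq_all_add tpower_tensor_algebra])
  have bal: "balanced Fields (tpower Fields n) ?f"
    unfolding balanced_def
  proof (intro conjI ballI)
    fix w :: "'w tensor" assume "w \<in> Fields"
    show "additive_on (tpower Fields n) (?f w)"
      by (intro additive_on_minus additive_on_compose[OF m_add lmul_add] m_in
          additive_on_compose[OF c_add m_add] contr_sq_all_tpower_in)
  next
    fix z :: "'w tensor" assume z: "z \<in> tpower Fields n"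
    note zT = sq_all_FT[OF tpow_TV[OF z]]
    show "additive_on Fields (\<lambda>w. ?f w z)"
      by (auto simp: additive_on_def vfield_add[symmetric] lmul_vec_add m_in z contr_vec_add zT
          additive_on_add[OF m_add] contr_sq_all_tpower_in)
  next
    fix w z :: "'w tensor" and a :: 'w
    assume w: "w \<in> Fields" and a: "a \<in> forms 0" and z: "z \<in> tpower Fields n"
    obtain u where u: "w = vfield u" using w by auto
    have ua: "vec_apply u (ext_deriv a) \<in> forms 0" by (rule vec_apply_forms[OF ext_deriv_0[OF a]])
    show "?f (w * form a) z = ?f w (form a * z)"
      using z a ua
      by (simp add: u vfield_rmult m_l lmul_lmult m_in contr_sq_all_lmult tpow_TV additive_on_add[OF m_add]
          lmod_mult[OF tpow] contr_sq_all_tpower_in)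
  qed
  note lift = tensor_lift[OF tmod_Fields lsummand_tpow bal]
  show "additive_on (tpower Fields (Suc n)) (\<lambda>x. bmul_rec (Suc n) x y)"
    using lift(1) by simp
  show "x \<in> tpower Fields n \<Longrightarrow> bmul_rec (Suc n) (vfield u * x) y = lmul u (bmul_rec n x y) - bmul_rec n (contr u (sq_all x)) y"
    using lift(2)[of "vfield u" x] by simp
qed

lemma bmul_rec_ok: "bmul_rec_ok n"
proof (induction n)
  case 0
  show ?case
    by (auto simp: bmul_rec_ok_def additive_on_mult_right form_lmult mult.assoc[symmetric] intro!: lmod_mult[OF lmod_TV])
next
  case (Suc n)
  have m_add: "additive_on (tpower Fields n) (\<lambda>x. bmul_rec n x y)"
    and m_in: "x \<in> tpower Fields n \<Longrightarrow> bmul_rec n x y \<in> TV"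
    and m_l: "x \<in> tpower Fields n \<Longrightarrow> a \<in> forms 0 \<Longrightarrow> bmul_rec n (form a * x) y = form a * bmul_rec n x y"
    if "y \<in> TV" for x y a
    using Suc that unfolding bmul_rec_ok_def by blast+
  note m = bmul_rec_Suc[OF Suc]
  show ?case
    unfolding bmul_rec_ok_def
  proof (intro ballI conjI)
    fix y :: "'w tensor" assume y: "y \<in> TV"
    show "additive_on (tpower Fields (Suc n)) (\<lambda>x. bmul_rec (Suc n) x y)" by (rule m(1)[OF y])
    fix x :: "'w tensor" assume x: "x \<in> tpower Fields (Suc n)"
    show "bmul_rec (Suc n) x y \<in> TV"
    proof (rule additive_image_in[OF x[unfolded tpower.simps] m(1)[OF y, unfolded tpower.simps] subgrp_tensor_algebra])
      fix w z :: "'w tensor" assume "w \<in> Fields" and z: "z \<in> tpower Fields n"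
      then obtain u where u: "w = vfield u" by auto
      show "bmul_rec (Suc n) (w * z) y \<in> TV"
        unfolding u m(2)[OF y z]
        by (intro subgrp_diff subgrp_tensor_algebra lmul_in m_in y z contr_sq_all_tpower_in)
    qed
    fix a :: 'w assume a: "a \<in> forms 0"
    show "bmul_rec (Suc n) (form a * x) y = form a * bmul_rec (Suc n) x y"
    proof (rule tprod_eqI[OF x[unfolded tpower.simps]])
      have tpow: "lmod (tpower Fields (Suc n) :: 'w tensor set)" by (rule tmod_lmod[OF tmod_tpow])
      show "additive_on (Fields \<otimes>\<^sub>A tpower Fields n) (\<lambda>x. bmul_rec (Suc n) (form a * x) y)"
        using tpow by (intro additive_on_compose[OF additive_on_mult_left m(1)[OF y]] lmod_mult a) auto
      show "additive_on (Fields \<otimes>\<^sub>A tpower Fields n) (\<lambda>x. form a * bmul_rec (Suc n) x y)"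
        using m(1)[OF y] by (intro additive_on_mult_left') simp
      fix w z :: "'w tensor" assume "w \<in> Fields" and z: "z \<in> tpower Fields n"
      then obtain u where u: "w = vfield u" by auto
      have "bmul_rec (Suc n) (form a * (w * z)) y = bmul_rec (Suc n) (vfield (vec_lmult a u) * z) y"
        by (simp add: u vfield_lmult[OF a, symmetric] mult.assoc del: bmul_rec.simps)
      also have "\<dots> = form a * bmul_rec (Suc n) (w * z) y"
        unfolding u m(2)[OF y z]
        by (simp add: lmul_vec_lmult a m_in y z contr_vec_lmult sq_all_FT[OF tpow_TV[OF z]] m_l contr_sq_all_tpower_in right_diff_distrib)
      finally show "bmul_rec (Suc n) (form a * (w * z)) y = form a * bmul_rec (Suc n) (w * z) y" .
    qed
  qed
qed

definition bmul :: "'w tensor \<Rightarrow> 'w tensor \<Rightarrow> 'w tensor" where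
  "bmul x y = (SOME h. additive_on TV h \<and> (\<forall>n. \<forall>x\<in>tpower Fields n. h x = bmul_rec n x y)) x"

lemma
  assumes y: "y \<in> TV"
  shows bmul_add_left: "additive_on TV (\<lambda>x. bmul x y)"
    and bmul_tpower: "x \<in> tpower Fields n \<Longrightarrow> bmul x y = bmul_rec n x y"
proof -
  have "\<exists>h. additive_on TV h \<and> (\<forall>n. \<forall>x\<in>tpower Fields n. h x = bmul_rec n x y)"
    by (rule ex_glue) (use bmul_rec_ok y in \<open>unfold bmul_rec_ok_def, blast\<close>)
  from someI_ex[OF this] show "additive_on TV (\<lambda>x. bmul x y)"
    and "x \<in> tpower Fields n \<Longrightarrow> bmul x y = bmul_rec n x y"
    unfolding bmul_def by blast+
qed

lemma bmul_in: "x \<in> TV \<Longrightarrow> y \<in> TV \<Longrightarrow> bmul x y \<in> TV"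
proof (rule tensor_algebra_image_in[OF _ bmul_add_left subgrp_tensor_algebra])
  fix n and x :: "'w tensor" assume "x \<in> tpower Fields n" "y \<in> TV"
  then show "bmul x y \<in> TV" using bmul_rec_ok[of n] by (simp add: bmul_tpower bmul_rec_ok_def)
qed

lemma bmul_form: "a \<in> forms 0 \<Longrightarrow> y \<in> TV \<Longrightarrow> bmul (form a) y = form a * y"
  using bmul_tpower[of y "form a" 0] by simp

lemma bmul_vfield_mult:
  assumes x: "x \<in> TV" and y: "y \<in> TV"
  shows "bmul (vfield u * x) y = lmul u (bmul x y) - bmul (contr u (sq_all x)) y"
proof (rule tensor_algebra_eqI[OF x])
  show "additive_on TV (\<lambda>x. bmul (vfield u * x) y)"
    by (rule additive_on_compose[OF additive_on_mult_left bmul_add_left[OF y]]) (rule vfield_TV)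
  show "additive_on TV (\<lambda>x. lmul u (bmul x y) - bmul (contr u (sq_all x)) y)"
    by (intro additive_on_minus additive_on_compose[OF bmul_add_left[OF y] lmul_add] bmul_in y
        additive_on_compose[OF contr_sq_all_add bmul_add_left[OF y]] contr_sq_all_in)
  fix n and x :: "'w tensor" assume x: "x \<in> tpower Fields n"
  have "vfield u * x \<in> tpower Fields (Suc n)" using x by (auto intro: tprodI)
  then show "bmul (vfield u * x) y = lmul u (bmul x y) - bmul (contr u (sq_all x)) y"
    using x y bmul_rec_Suc(2)[OF bmul_rec_ok y x, of u] contr_sq_all_tpower_in[OF x, of u]
    by (simp add: bmul_tpower del: bmul_rec.simps tpower.simps)
qed

lemma bmul_lmul: "x \<in> TV \<Longrightarrow> y \<in> TV \<Longrightarrow> bmul (lmul u x) y = lmul u (bmul x y)"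
  unfolding lmul_def[of u x]
  by (subst additive_on_add[OF bmul_add_left]) (simp_all add: vfield_TV contr_sq_all_in bmul_vfield_mult)

text \<open>In the product step the hypothesis is available for all elements of the same tensor
  power, because the recursion for u \<otimes> x also refers to the contraction of u with the
  derivative of x, an element of the same degree as x.\<close>

lemma tpower_Fields_induct [consumes 1, case_names form mult diff]:
  assumes "x \<in> tpower Fields n"
    and "\<And>a. a \<in> forms 0 \<Longrightarrow> P (form a)"
    and "\<And>n u x. x \<in> tpower Fields n \<Longrightarrow> (\<And>y. y \<in> tpower Fields n \<Longrightarrow> P y) \<Longrightarrow> P (vfield u * x)"
    and "\<And>x y. x \<in> TV \<Longrightarrow> y \<in> TV \<Longrightarrow> P x \<Longrightarrow> P y \<Longrightarrow> P (x - y)"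
  shows "P (x :: 'w tensor)"
  using assms(1)
proof (induction n arbitrary: x)
  case 0
  then show ?case using assms(2) by auto
next
  case (Suc n)
  have P0: "P 0" using assms(2)[OF forms_zero] by (simp add: form_zero)
  show ?case
    using Suc.prems[unfolded tpower.simps]
  proof (induction rule: tprod_induct)
    case (mult x y)
    then show ?case using assms(3) Suc.IH by auto
  next
    case (diff x y)
    then show ?case using assms(4) tpow_TV[of _ "Suc n"] by auto
  qed (rule P0)
qed

lemma TV_induct [consumes 1, case_names form mult diff]:
  assumes x: "x \<in> TV"
    and "\<And>a. a \<in> forms 0 \<Longrightarrow> P (form a)"
    and "\<And>n u x. x \<in> tpower Fields n \<Longrightarrow> (\<And>y. y \<in> tpower Fields n \<Longrightarrow> P y) \<Longrightarrow> P (vfield u * x)"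
    and "\<And>x y. x \<in> TV \<Longrightarrow> y \<in> TV \<Longrightarrow> P x \<Longrightarrow> P y \<Longrightarrow> P (x - y)"
  shows "P (x :: 'w tensor)"
  using x
proof (induction rule: tensor_algebra_induct)
  case zero
  show ?case using assms(2)[OF forms_zero] by (simp add: form_zero)
next
  case (tpower n x)
  then show ?case using assms(2,3,4) by (rule tpower_Fields_induct)
next
  case (diff x y)
  then show ?case by (rule assms(4))
qed

lemma bmul_add_right: "x \<in> TV \<Longrightarrow> additive_on TV (bmul x)"
proof (induction rule: TV_induct)
  case (form a)
  then show ?case by (simp add: additive_on_def bmul_form subgrp_add[OF subgrp_tensor_algebra] distrib_left)
next
  case (mult n u x)
  have "additive_on TV (\<lambda>y. lmul u (bmul x y) - bmul (contr u (sq_all x)) y)"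
    using mult by (intro additive_on_minus additive_on_compose[OF _ lmul_add] bmul_in tpow_TV[of x n]) (auto simp: contr_sq_all_tpower_in)
  then show ?case
    by (rule additive_on_cong) (use mult in \<open>auto simp: subgrp_tensor_algebra bmul_vfield_mult tpow_TV\<close>)
next
  case (diff x y)
  have "additive_on TV (\<lambda>z. bmul x z - bmul y z)" using diff by (intro additive_on_minus)
  then show ?case
    by (rule additive_on_cong)
      (use diff in \<open>auto simp: subgrp_tensor_algebra additive_on_diff[OF bmul_add_left subgrp_tensor_algebra]\<close>)
qed

lemma bmul_one_right: "x \<in> TV \<Longrightarrow> bmul x 1 = x"
proof (induction rule: TV_induct)
  case (mult n u x)
  then show ?case
    by (simp add: bmul_vfield_mult tpow_TV one_tensor_algebra contr_sq_all_tpower_in lmul_def)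
qed (simp_all add: bmul_form one_tensor_algebra additive_on_diff[OF bmul_add_left subgrp_tensor_algebra])

text \<open>Right multiplication commutes with \<open>lmul u\<close> by \<open>bmul_lmul\<close>.
  The recursion for the first factor can therefore be unfolded under both bracketings, and the
  induction hypothesis applies to x and to the contraction in the correction term.\<close>

lemma bmul_assoc: "x \<in> TV \<Longrightarrow> y \<in> TV \<Longrightarrow> z \<in> TV \<Longrightarrow> bmul (bmul x y) z = bmul x (bmul y z)"
proof (induction rule: TV_induct)
  case (form a)
  have "bmul (form a * y) z = form a * bmul y z"
    using form(2,3)
  proof (rule_tac tensor_algebra_eqI[of y Fields "\<lambda>y. bmul (form a * y) z" "\<lambda>y. form a * bmul y z"])
    show "additive_on TV (\<lambda>y. bmul (form a * y) z)"
      by (intro additive_on_compose[OF additive_on_mult_left bmul_add_left] lmod_mult[OF lmod_TV] form)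
    show "additive_on TV (\<lambda>y. form a * bmul y z)"
      by (intro additive_on_mult_left' bmul_add_left form)
    fix n and y :: "'w tensor" assume y: "y \<in> tpower Fields n"
    then show "bmul (form a * y) z = form a * bmul y z"
      using bmul_rec_ok[of n] lmod_mult[OF tmod_lmod[OF tmod_tpow] form(1) y] form
      by (simp add: bmul_tpower bmul_rec_ok_def)
  qed
  then show ?case using form by (simp add: bmul_form bmul_in)
next
  case (mult n u x)
  have x: "x \<in> TV" and c: "contr u (sq_all x) \<in> TV" using mult by (auto simp: tpow_TV contr_sq_all_in)
  have IH: "bmul (bmul x y) z = bmul x (bmul y z)" "bmul (bmul (contr u (sq_all x)) y) z = bmul (contr u (sq_all x)) (bmul y z)"
    using mult by (auto intro: contr_sq_all_tpower_in)
  have "bmul (bmul (vfield u * x) y) z = bmul (lmul u (bmul x y)) z - bmul (bmul (contr u (sq_all x)) y) z"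
    using mult x c by (simp add: bmul_vfield_mult additive_on_diff[OF bmul_add_left subgrp_tensor_algebra] lmul_in bmul_in)
  also have "\<dots> = bmul (vfield u * x) (bmul y z)"
    using mult x c by (simp add: bmul_vfield_mult bmul_in bmul_lmul IH)
  finally show ?case .
next
  case (diff x x')
  then show ?case by (simp add: additive_on_diff[OF bmul_add_left subgrp_tensor_algebra] bmul_in)
qed

lemma bmul_vfield: "y \<in> TV \<Longrightarrow> bmul (vfield u) y = lmul u y"
proof -
  assume y: "y \<in> TV"
  have "bmul (vfield u * 1) y = lmul u (bmul 1 y) - bmul 0 y"
    using bmul_vfield_mult[OF one_tensor_algebra y, of u] additive_on_zero[OF contr_add subgrp_tprod, of u]
    by (simp add: sq_all_one)
  also have "bmul 0 y = 0" by (rule additive_on_zero[OF bmul_add_left[OF y] subgrp_tensor_algebra])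
  finally show ?thesis using bmul_form[OF forms_one y] by (simp add: form_one)
qed

lemma ev_left_tpower: "x \<in> tpower Fields n \<Longrightarrow> ev_left (tpower Fields n) u (sq_vecs sq si n x) = contr u (sq_all x)"
  by (simp add: ev_left_eq_contr lsummand_tpow sq_vecs_in sq_all_tpower)

lemma is_bullet_bmul: "is_bullet sq si bmul"
  unfolding is_bullet_def
  using bmul_form[OF forms_one]
  by (auto simp: bmul_in bmul_add_left bmul_add_right bmul_one_right bmul_assoc bmul_form bmul_vfield bmul_vfield_mult tpow_TV
      ev_left_tpower lmul_def[of _ "_ :: 'w tensor"] form_one generator_tensor_algebra simp del: sq_vecs.simps)

text \<open>Having constructed one product that satisfies all clauses, the chosen
  \<open>bullet\<close> satisfies them too. Below, only these clauses are used and
  \<open>bmul\<close> does not occur again.\<close>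

lemma is_bullet_bullet: "is_bullet sq si (bullet sq si)"
  unfolding bullet_def by (rule someI[of "is_bullet sq si", OF is_bullet_bmul])

lemma bullet_in: "x \<in> TV \<Longrightarrow> y \<in> TV \<Longrightarrow> bullet sq si x y \<in> TV"
  and bullet_add_left: "y \<in> TV \<Longrightarrow> additive_on TV (\<lambda>x. bullet sq si x y)"
  and bullet_add_right: "x \<in> TV \<Longrightarrow> additive_on TV (bullet sq si x)"
  and bullet_assoc: "x \<in> TV \<Longrightarrow> y \<in> TV \<Longrightarrow> z \<in> TV \<Longrightarrow>
    bullet sq si (bullet sq si x y) z = bullet sq si x (bullet sq si y z)"
  and bullet_form: "a \<in> forms 0 \<Longrightarrow> y \<in> TV \<Longrightarrow> bullet sq si (form a) y = form a * y"
  using is_bullet_bullet unfolding is_bullet_def by blast+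

lemma bullet_vfield:
  assumes y: "y \<in> TV" shows "bullet sq si (vfield u) y = lmul u y"
proof (rule tensor_algebra_eqI[OF y bullet_add_right lmul_add])
  show "vfield u \<in> TV" by (rule generator_tensor_algebra) simp
  fix n and y :: "'w tensor" assume y: "y \<in> tpower Fields n"
  then have "bullet sq si (vfield u) y = vfield u * y + ev_left (tpower Fields n) u (sq_vecs sq si n y)"
    using is_bullet_bullet unfolding is_bullet_def by blast
  then show "bullet sq si (vfield u) y = lmul u y" by (simp add: ev_left_tpower[OF y] lmul_def)
qed

lemma bullet_lmult:
  assumes "a \<in> forms 0" "x \<in> TV" "y \<in> TV"
  shows "bullet sq si (form a * x) y = form a * bullet sq si x y"
  using bullet_assoc[of "form a" x y] assms by (simp add: bullet_form bullet_in Alg_tensor_algebra)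

end

section \<open>The action on the algebra\<close>

abbreviation VFn :: "nat \<Rightarrow> 'w::star_dga tensor set" where
  "VFn n \<equiv> tpower Fields n \<otimes>\<^sub>A tpower Forms1 n"

lemma tmod_Fn: "tmod (tpower Forms1 n)"
  by (rule tmod_tpower[OF tmod_Forms1])

lemma tmod_VFn: "tmod (VFn n)"
  by (intro tmod_tprod tmod_tpow tmod_Fn)

lemma Fn_Suc: "tpower Forms1 (Suc n) = tpower Forms1 n \<otimes>\<^sub>A Forms1"
  by (rule tpower_Suc_right[OF bimod_forms])

lemma VFn_1: "VFn (Suc 0) = Fields_Forms1"
  by (simp only: tpower_1[OF bimod_forms] tpower_1[OF bimod_Fields])

text \<open>This bracketing mirrors the nested evaluation: the inner pairs are contracted first and
  leave the outermost field facing the last form.\<close>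

lemma VFn_Suc: "VFn (Suc n) = Fields \<otimes>\<^sub>A (VFn n \<otimes>\<^sub>A Forms1)"
  unfolding Fn_Suc by (simp add: tprod_assoc)

lemma VFn_Forms1: "x \<in> tpower Fields n \<Longrightarrow> z \<in> tpower Forms1 (Suc n) \<Longrightarrow> x * z \<in> VFn n \<otimes>\<^sub>A Forms1"
  unfolding Fn_Suc tprod_assoc by (rule tprodI)

lemma Alg_Forms1: "Alg \<otimes>\<^sub>A Forms1 = Forms1"
  by (rule Alg_tprod[OF tmod_lmod[OF tmod_Forms1]])

text \<open>What the nested evaluation must satisfy for the next stage to be well defined. The dummy
  type argument names the algebra, which the number n does not determine.\<close>

definition ev_ok :: "nat \<Rightarrow> 'w::star_dga itself \<Rightarrow> bool" where
  "ev_ok n (_ :: 'w itself) \<longleftrightarrow> rlin (VFn n) (ev_iter n :: 'w tensor \<Rightarrow> 'w tensor) \<and> llin (VFn n) (ev_iter n :: 'w tensor \<Rightarrow> 'w tensor)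
     \<and> (\<forall>x \<in> (VFn n :: 'w tensor set). ev_iter n x \<in> Alg)"

lemma contr_Forms1: "x \<in> Forms1 \<Longrightarrow> contr v x \<in> Alg"
  by (auto simp: contr_form vec_apply_forms)

lemma Forms1_FT: "x \<in> Forms1 \<Longrightarrow> x \<in> Forms1_T"
  using tprodI[of x Forms1 1 UNIV] by simp

text \<open>Once A has contracted the inner pairs a single 1-form is left, to which the outer field
  is applied. The properties of the longer evaluation follow from those of A.\<close>

lemma ev_iter_Suc_Suc:
  fixes q :: "'w::star_dga tensor"
  assumes ok: "ev_ok (Suc n) TYPE('w)"
  defines "A \<equiv> ext_id (VFn (Suc n)) (ev_iter (Suc n))"
  shows "q \<in> VFn (Suc n) \<otimes>\<^sub>A Forms1 \<Longrightarrow> ev_iter (Suc (Suc n)) (vfield v * q) = contr v (A q)"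
    and "additive_on (VFn (Suc (Suc n)) :: 'w tensor set) (ev_iter (Suc (Suc n)))"
    and "q \<in> VFn (Suc n) \<otimes>\<^sub>A Forms1 \<Longrightarrow> A q \<in> Forms1"
    and "additive_on (VFn (Suc n) \<otimes>\<^sub>A Forms1) A"
    and "q \<in> VFn (Suc n) \<otimes>\<^sub>A Forms1 \<Longrightarrow> a \<in> forms 0 \<Longrightarrow> A (q * form a) = A q * form a"
proof -
  have r: "rlin (VFn (Suc n)) (ev_iter (Suc n) :: 'w tensor \<Rightarrow> 'w tensor)"
    and l: "\<And>x a. x \<in> VFn (Suc n) \<Longrightarrow> a \<in> forms 0 \<Longrightarrow> ev_iter (Suc n) (form a * x) = form a * ev_iter (Suc n) (x :: 'w tensor)"
    and A: "\<And>x. x \<in> VFn (Suc n) \<Longrightarrow> ev_iter (Suc n) (x :: 'w tensor) \<in> Alg"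
    using ok unfolding ev_ok_def llin_def by blast+
  have sub: "VFn (Suc n) \<otimes>\<^sub>A Forms1 \<subseteq> VFn (Suc n) \<otimes>\<^sub>A UNIV" by (rule tprod_mono) auto
  show A_add: "additive_on (VFn (Suc n) \<otimes>\<^sub>A Forms1) A"
    unfolding A_def by (rule additive_on_subset[OF ext_id_add[OF r] sub])
  have A_in: "A q \<in> Forms1" if "q \<in> VFn (Suc n) \<otimes>\<^sub>A Forms1" for q
    using ext_id_in[OF r that A] unfolding A_def Alg_Forms1 .
  then show "q \<in> VFn (Suc n) \<otimes>\<^sub>A Forms1 \<Longrightarrow> A q \<in> Forms1" .
  show "q \<in> VFn (Suc n) \<otimes>\<^sub>A Forms1 \<Longrightarrow> a \<in> forms 0 \<Longrightarrow> A (q * form a) = A q * form a"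
    unfolding A_def by (rule ext_id_mult_right[OF r]) (use sub in blast)
  let ?A = "tensor_map (VFn (Suc n)) (ev_iter (Suc n)) Forms1 id :: 'w tensor \<Rightarrow> 'w tensor"
  have A_eq: "?A q = A q" if "q \<in> VFn (Suc n) \<otimes>\<^sub>A Forms1" for q
    unfolding A_def by (rule tmap_id_eq_ext_id[OF r tmod_lsummand[OF tmod_Forms1] that])
  have tm: "tmod (VFn (Suc n) \<otimes>\<^sub>A Forms1 :: 'w tensor set)"
    by (intro tmod_tprod tmod_VFn tmod_Forms1)
  have A_llin: "llin (VFn (Suc n) \<otimes>\<^sub>A Forms1) ?A"
    unfolding llin_def
  proof (intro conjI ballI)
    show "lsummand (VFn (Suc n) \<otimes>\<^sub>A Forms1 :: 'w tensor set)" by (rule tmod_lsummand[OF tm])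
    show "additive_on (VFn (Suc n) \<otimes>\<^sub>A Forms1) ?A"
      by (rule tmap_add[OF r llin_id[OF tmod_lsummand[OF tmod_Forms1]]])
    fix x :: "'w tensor" and a :: 'w assume x: "x \<in> VFn (Suc n) \<otimes>\<^sub>A Forms1" and a: "a \<in> forms 0"
    have "A (form a * x) = form a * A x"
      unfolding A_def by (rule ext_id_left[OF r l[OF _ a] a]) (use x sub in auto)
    then show "?A (form a * x) = form a * ?A x"
      using lmod_mult[OF tmod_lmod[OF tm] a x] x by (simp only: A_eq)
  qed
  let ?B = "tensor_map Fields id (VFn (Suc n) \<otimes>\<^sub>A Forms1) ?A"
  have B_mult: "?B (x * q) = x * A q" if "x \<in> Fields" "q \<in> VFn (Suc n) \<otimes>\<^sub>A Forms1" for x q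
    using tmap_mult[OF rlin_id[OF tmod_Fields] A_llin that] that by (simp only: A_eq id_apply)
  have B_add: "additive_on (VFn (Suc (Suc n))) ?B"
    unfolding VFn_Suc[of "Suc n"] by (rule tmap_add[OF rlin_id[OF tmod_Fields] A_llin])
  have B_in: "?B x \<in> Fields_Forms1" if "x \<in> VFn (Suc (Suc n))" for x
    by (rule additive_image_in[OF that[unfolded VFn_Suc[of "Suc n"]] B_add[unfolded VFn_Suc[of "Suc n"]] subgrp_tprod])
      (simp only: B_mult, intro tprodI A_in)
  show "additive_on (VFn (Suc (Suc n)) :: 'w tensor set) (ev_iter (Suc (Suc n)))"
    unfolding ev_iter.simps by (rule additive_on_compose[OF B_add ev_add B_in])
  show "q \<in> VFn (Suc n) \<otimes>\<^sub>A Forms1 \<Longrightarrow> ev_iter (Suc (Suc n)) (vfield v * q) = contr v (A q)"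
    unfolding ev_iter.simps by (simp only: B_mult[OF rangeI] ev_vfield A_in)
qed

lemma ev_ok: "ev_ok (Suc n) TYPE('w::star_dga)"
proof (induction n)
  case 0
  show ?case
    using ev_rlin ev_llin ev_Alg unfolding ev_ok_def VFn_1 ev_iter.simps by blast
next
  case (Suc n)
  note E = ev_iter_Suc_Suc[OF Suc]
  let ?V = "VFn (Suc (Suc n)) :: 'w tensor set"
  let ?A = "ext_id (VFn (Suc n)) (ev_iter (Suc n)) :: 'w tensor \<Rightarrow> 'w tensor"
  show ?case
    unfolding ev_ok_def rlin_def llin_def
  proof (intro conjI ballI tmod_VFn E(2) tmod_lsummand)
    fix x :: "'w tensor" assume x: "x \<in> ?V"
    note x' = x[unfolded VFn_Suc[of "Suc n"]] and Eadd = E(2)[unfolded VFn_Suc[of "Suc n"]]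
    have tm: "bimod (Fields \<otimes>\<^sub>A (VFn (Suc n) \<otimes>\<^sub>A Forms1) :: 'w tensor set)"
      "bimod (VFn (Suc n) \<otimes>\<^sub>A Forms1 :: 'w tensor set)"
      by (intro tmod_bimod tmod_tprod tmod_VFn tmod_Forms1 tmod_Fields)+
    show "ev_iter (Suc (Suc n)) x \<in> Alg"
      by (rule additive_image_in[OF x' Eadd tmod_subgrp[OF tmod_Alg]])
        (auto simp: E(1,3) simp del: ev_iter.simps tpower.simps intro!: contr_Forms1)
    fix a :: 'w assume a: "a \<in> forms 0"
    show "ev_iter (Suc (Suc n)) (x * form a) = ev_iter (Suc (Suc n)) x * form a"
    proof (rule tprod_eqI[OF x' additive_on_compose[OF additive_on_mult_right Eadd] additive_on_mult_right'[OF Eadd]])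
      fix w q :: "'w tensor" assume "w \<in> Fields" and q: "q \<in> VFn (Suc n) \<otimes>\<^sub>A Forms1"
      then obtain v where v: "w = vfield v" by auto
      show "ev_iter (Suc (Suc n)) (w * q * form a) = ev_iter (Suc (Suc n)) (w * q) * form a"
        unfolding v mult.assoc E(1)[OF q] E(1)[OF bimod_rmult[OF tm(2) a q]] E(5)[OF q a]
        by (rule contr_mult_right[OF Forms1_FT[OF E(3)[OF q]]])
    qed (rule bimod_rmult[OF tm(1) a])
    show "ev_iter (Suc (Suc n)) (form a * x) = form a * ev_iter (Suc (Suc n)) x"
    proof (rule tprod_eqI[OF x' additive_on_compose[OF additive_on_mult_left Eadd] additive_on_mult_left'[OF Eadd]])
      fix w q :: "'w tensor" assume "w \<in> Fields" and q: "q \<in> VFn (Suc n) \<otimes>\<^sub>A Forms1"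
      then obtain v where v: "w = vfield v" by auto
      show "ev_iter (Suc (Suc n)) (form a * (w * q)) = form a * ev_iter (Suc (Suc n)) (w * q)"
        unfolding v mult.assoc[symmetric] vfield_lmult[OF a] E(1)[OF q]
        by (rule contr_vec_lmult[OF a Forms1_FT[OF E(3)[OF q]]])
    qed (rule lmod_mult[OF bimod_lmod[OF tm(1)] a])
  qed
qed

lemma ev_iter_rlin: "rlin (VFn (Suc n)) (ev_iter (Suc n) :: 'w::star_dga tensor \<Rightarrow> _)"
  and ev_iter_llin: "llin (VFn (Suc n)) (ev_iter (Suc n) :: 'w tensor \<Rightarrow> _)"
  and ev_iter_Alg: "x \<in> VFn (Suc n) \<Longrightarrow> ev_iter (Suc n) (x :: 'w tensor) \<in> Alg"
  using ev_ok[of n, where 'w = 'w] unfolding ev_ok_def by blast+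

lemma ev_iter_add: "additive_on (VFn (Suc n)) (ev_iter (Suc n))"
  and ev_iter_lmult: "x \<in> VFn (Suc n) \<Longrightarrow> a \<in> forms 0 \<Longrightarrow> ev_iter (Suc n) (form a * x) = form a * ev_iter (Suc n) x"
  using ev_iter_llin[of n] unfolding llin_def by blast+

text \<open>Evaluation of n + 1 pairs with further factors standing on the right;
  \<open>idev\<close> below has a 1-form standing on the left instead. The shift of the index keeps
  away from the conventional value at 0.\<close>

abbreviation evi :: "nat \<Rightarrow> 'w::star_dga tensor \<Rightarrow> 'w tensor" where
  "evi n \<equiv> ext_id (VFn (Suc n)) (ev_iter (Suc n))"

lemmas ev_iter_mult = ev_iter_Suc_Suc(1)[OF ev_ok]
  and evi_in = ev_iter_Suc_Suc(3)[OF ev_ok]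

lemma evi_add: "additive_on (VFn (Suc n) \<otimes>\<^sub>A UNIV) (evi n)"
  by (rule ext_id_add[OF ev_iter_rlin])

lemma evi_mult: "x \<in> VFn (Suc n) \<Longrightarrow> evi n (x * y) = ev_iter (Suc n) x * y"
  by (rule ext_id_mult[OF ev_iter_rlin])

lemma evi_mult_right: "z \<in> VFn (Suc n) \<otimes>\<^sub>A UNIV \<Longrightarrow> evi n (z * y) = evi n z * y"
  by (rule ext_id_mult_right[OF ev_iter_rlin])

definition idev :: "nat \<Rightarrow> 'w::star_dga tensor \<Rightarrow> 'w tensor" where
  "idev n = tensor_map Forms1 id (VFn (Suc n)) (ev_iter (Suc n))"

lemma idev_add: "additive_on (Forms1 \<otimes>\<^sub>A VFn (Suc n)) (idev n)"
  unfolding idev_def by (rule tmap_add[OF rlin_id[OF tmod_Forms1] ev_iter_llin])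

lemma idev_mult: "x \<in> Forms1 \<Longrightarrow> y \<in> VFn (Suc n) \<Longrightarrow> idev n (x * y) = x * ev_iter (Suc n) y"
  unfolding idev_def by (simp only: tmap_mult[OF rlin_id[OF tmod_Forms1] ev_iter_llin] id_apply)

lemma idev_in: "x \<in> Forms1 \<otimes>\<^sub>A VFn (Suc n) \<Longrightarrow> idev n x \<in> Forms1"
proof (rule additive_image_in[OF _ idev_add tmod_subgrp[OF tmod_Forms1]])
  fix x y :: "'a tensor" assume x: "x \<in> Forms1" and y: "y \<in> VFn (Suc n)"
  obtain c where "ev_iter (Suc n) y = form c" "c \<in> forms 0" using ev_iter_Alg[OF y] by auto
  then show "idev n (x * y) \<in> Forms1" using idev_mult[OF x y] bimod_rmult[OF bimod_forms _ x] by simp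
qed

context conn
begin

section \<open>The iterated derivative on tensor powers of forms\<close>

lemma si_llin: "llin (Forms1 \<otimes>\<^sub>A Forms1) si"
  by (simp add: llin_def tmod_lsummand tmod_FF si_add si_lmult)

definition idsi :: "nat \<Rightarrow> 'w tensor \<Rightarrow> 'w tensor" where
  "idsi n = tensor_map (tpower Forms1 (Suc n)) id (Forms1 \<otimes>\<^sub>A Forms1) si"

lemma Fn_Suc_Suc: "tpower Forms1 (Suc (Suc n)) = tpower Forms1 n \<otimes>\<^sub>A (Forms1 \<otimes>\<^sub>A Forms1 :: 'w tensor set)"
  by (simp only: Fn_Suc tprod_assoc)

lemma idsi_add: "additive_on (tpower Forms1 (Suc (Suc (Suc n)))) (idsi n)"
  unfolding idsi_def Fn_Suc_Suc[of "Suc n"] by (rule tmap_add[OF rlin_id[OF tmod_Fn] si_llin])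

lemma idsi_mult: "x \<in> tpower Forms1 (Suc n) \<Longrightarrow> y \<in> Forms1 \<otimes>\<^sub>A Forms1 \<Longrightarrow> idsi n (x * y) = x * si y"
  unfolding idsi_def by (simp only: tmap_mult[OF rlin_id[OF tmod_Fn] si_llin] id_apply)

lemma idsi_in: "x \<in> tpower Forms1 (Suc (Suc (Suc n))) \<Longrightarrow> idsi n x \<in> tpower Forms1 (Suc (Suc (Suc n)))"
  unfolding Fn_Suc_Suc[of "Suc n"]
  by (rule additive_image_in[OF _ idsi_add[of n, unfolded Fn_Suc_Suc[of "Suc n"]] subgrp_tprod])
    (simp_all only: idsi_mult tprodI si_in)

lemma idsi_rmult:
  assumes x: "x \<in> tpower Forms1 (Suc (Suc (Suc n)))" and a: "a \<in> forms 0"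
  shows "idsi n (x * form a) = idsi n x * form a"
proof -
  note add = idsi_add[of n, unfolded Fn_Suc_Suc[of "Suc n"]]
  have bm: "bimod (tpower Forms1 (Suc n) \<otimes>\<^sub>A (Forms1 \<otimes>\<^sub>A Forms1) :: 'w tensor set)"
    by (intro tmod_bimod tmod_tprod tmod_Fn tmod_FF)
  show ?thesis
  proof (rule tprod_eqI[OF x[unfolded Fn_Suc_Suc[of "Suc n"]]
        additive_on_compose[OF additive_on_mult_right add] additive_on_mult_right'[OF add]])
    fix x y :: "'w tensor" assume xy: "x \<in> tpower Forms1 (Suc n)" "y \<in> Forms1 \<otimes>\<^sub>A Forms1"
    have "y * form a \<in> Forms1 \<otimes>\<^sub>A Forms1" by (rule bimod_rmult[OF tmod_bimod[OF tmod_FF] a xy(2)])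
    with xy show "idsi n (x * y * form a) = idsi n (x * y) * form a"
      by (simp only: mult.assoc idsi_mult si_rmult a)
  qed (rule bimod_rmult[OF bm a])
qed

definition sq_forms_ok :: "nat \<Rightarrow> bool" where
  "sq_forms_ok n \<longleftrightarrow> additive_on (tpower Forms1 n) (sq_forms sq si n) \<and>
     (\<forall>x\<in>tpower Forms1 n. sq_forms sq si n x \<in> tpower Forms1 (Suc n)) \<and>
     (\<forall>x\<in>tpower Forms1 n. \<forall>a\<in>forms 0.
        sq_forms sq si n (x * form a) = sq_forms sq si n x * form a + x * form (ext_deriv a))"

text \<open>The mirror image of the situation for fields. Moving a from x to y costs x times
  \<open>si\<close> of da \<otimes> y in the first summand, by the left Leibniz rule of
  \<open>sq\<close>, and the second summand supplies it through the right Leibniz rule of the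
  previous derivative.\<close>

lemma sq_forms_Suc_Suc:
  assumes ok: "sq_forms_ok (Suc n)"
  shows "additive_on (tpower Forms1 (Suc (Suc n))) (sq_forms sq si (Suc (Suc n)))"
    and "x \<in> tpower Forms1 (Suc n) \<Longrightarrow> \<xi> \<in> forms 1 \<Longrightarrow> sq_forms sq si (Suc (Suc n)) (x * form \<xi>) =
       x * sq \<xi> + idsi n (sq_forms sq si (Suc n) x * form \<xi>)"
proof -
  let ?S = "sq_forms sq si (Suc n)"
  have S_add: "additive_on (tpower Forms1 (Suc n)) ?S"
    and S_in: "\<And>x. x \<in> tpower Forms1 (Suc n) \<Longrightarrow> ?S x \<in> tpower Forms1 (Suc (Suc n))"
    and S_r: "\<And>x a. x \<in> tpower Forms1 (Suc n) \<Longrightarrow> a \<in> forms 0 \<Longrightarrow> ?S (x * form a) = ?S x * form a + x * form (ext_deriv a)"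
    using ok unfolding sq_forms_ok_def by blast+
  let ?f = "\<lambda>x y. x * sq (wedge y) + idsi n (?S x * y)"
  have Sy: "?S x * y \<in> tpower Forms1 (Suc (Suc (Suc n)))" if "x \<in> tpower Forms1 (Suc n)" "y \<in> Forms1" for x y
    unfolding Fn_Suc[of "Suc (Suc n)"] by (intro tprodI S_in that)
  have bal: "balanced (tpower Forms1 (Suc n)) Forms1 ?f"
    unfolding balanced_def
  proof (intro conjI ballI)
    fix x :: "'w tensor" assume x: "x \<in> tpower Forms1 (Suc n)"
    have "additive_on Forms1 (\<lambda>y. sq (wedge y))"
      by (auto simp: additive_on_def wedge_add sq_add)
    then show "additive_on Forms1 (?f x)"
      by (intro additive_on_plus additive_on_mult_left' additive_on_compose[OF additive_on_mult_left idsi_add] Sy x)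
  next
    fix y :: "'w tensor" assume y: "y \<in> Forms1"
    show "additive_on (tpower Forms1 (Suc n)) (\<lambda>x. ?f x y)"
      by (intro additive_on_plus additive_on_mult_right
          additive_on_compose[OF additive_on_mult_right'[OF S_add] idsi_add] Sy y)
  next
    fix x y :: "'w tensor" and a :: 'w
    assume x: "x \<in> tpower Forms1 (Suc n)" and a: "a \<in> forms 0" and y: "y \<in> Forms1"
    obtain \<xi> where \<xi>: "y = form \<xi>" "\<xi> \<in> forms 1" using y by auto
    have ay: "form a * y \<in> Forms1" using \<xi> a by (auto simp: form_lmult forms_0_mult)
    have FF: "form (ext_deriv a) * y \<in> Forms1 \<otimes>\<^sub>A Forms1" using a y by (auto intro!: tprodI ext_deriv_0)
    have "?S (x * form a) * y = ?S x * (form a * y) + x * (form (ext_deriv a) * y)"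
      by (simp only: S_r[OF x a] distrib_right mult.assoc)
    moreover have "idsi n (?S x * (form a * y) + x * (form (ext_deriv a) * y)) =
        idsi n (?S x * (form a * y)) + idsi n (x * (form (ext_deriv a) * y))"
      by (rule additive_on_add[OF idsi_add Sy[OF x ay]]) (unfold Fn_Suc_Suc[of "Suc n"], intro tprodI x FF)
    ultimately have "?f (x * form a) y = x * form a * sq (wedge y) + idsi n (?S x * (form a * y)) + x * si (form (ext_deriv a) * y)"
      by (simp only: idsi_mult[OF x FF] add.assoc)
    also have "\<dots> = ?f x (form a * y)"
      using \<xi> a by (simp add: wedge_mult sq_lmult algebra_simps del: sq_forms.simps tpower.simps)
    finally show "?f (x * form a) y = ?f x (form a * y)" .
  qed
  have eq: "sq_forms sq si (Suc (Suc n)) = tensor_lift (tpower Forms1 (Suc n)) Forms1 ?f"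
    by (simp only: sq_forms.simps idsi_def)
  note lift = tensor_lift[OF tmod_Fn tmod_lsummand[OF tmod_Forms1] bal]
  show "additive_on (tpower Forms1 (Suc (Suc n))) (sq_forms sq si (Suc (Suc n)))"
    unfolding eq Fn_Suc[of "Suc n"] by (rule lift(1))
  show "x \<in> tpower Forms1 (Suc n) \<Longrightarrow> \<xi> \<in> forms 1 \<Longrightarrow> sq_forms sq si (Suc (Suc n)) (x * form \<xi>) =
       x * sq \<xi> + idsi n (sq_forms sq si (Suc n) x * form \<xi>)"
    unfolding eq by (subst lift(2)) (auto simp del: sq_forms.simps)
qed

lemma sq_forms_ok: "sq_forms_ok (Suc n)"
proof (induction n)
  case 0
  have F1: "tpower Forms1 (Suc 0) = (Forms1 :: 'w tensor set)" by (rule tpower_1[OF bimod_forms])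
  have F2: "tpower Forms1 (Suc (Suc 0)) = (Forms1 \<otimes>\<^sub>A Forms1 :: 'w tensor set)" unfolding Fn_Suc[of "Suc 0"] F1 ..
  show ?case
    unfolding sq_forms_ok_def F1 F2
    by (auto simp: additive_on_def wedge_add wedge_mult sq_add sq_in sq_rmult)
next
  case (Suc n)
  let ?S = "sq_forms sq si (Suc n)" and ?T = "sq_forms sq si (Suc (Suc n))"
  have S_in: "\<And>x. x \<in> tpower Forms1 (Suc n) \<Longrightarrow> ?S x \<in> tpower Forms1 (Suc (Suc n))"
    using Suc unfolding sq_forms_ok_def by blast+
  have Sy: "?S x * y \<in> tpower Forms1 (Suc (Suc (Suc n)))" if "x \<in> tpower Forms1 (Suc n)" "y \<in> Forms1" for x y
    unfolding Fn_Suc[of "Suc (Suc n)"] by (intro tprodI S_in that)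
  note T = sq_forms_Suc_Suc[OF Suc]
  have bm: "bimod (tpower Forms1 (Suc (Suc n)) :: 'w tensor set)" by (rule tmod_bimod[OF tmod_Fn])
  show ?case
    unfolding sq_forms_ok_def
  proof (intro conjI ballI T(1))
    fix x :: "'w tensor" assume x: "x \<in> tpower Forms1 (Suc (Suc n))"
    note x' = x[unfolded Fn_Suc[of "Suc n"]] and add = T(1)[unfolded Fn_Suc[of "Suc n"]]
    show "?T x \<in> tpower Forms1 (Suc (Suc (Suc n)))"
    proof (rule additive_image_in[OF x' add tmod_subgrp[OF tmod_Fn]])
      fix x y :: "'w tensor" assume x: "x \<in> tpower Forms1 (Suc n)" and y: "y \<in> Forms1"
      then obtain \<xi> where \<xi>: "y = form \<xi>" "\<xi> \<in> forms 1" by auto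
      have "x * sq \<xi> \<in> tpower Forms1 (Suc (Suc (Suc n)))"
        unfolding Fn_Suc_Suc[of "Suc n"] by (intro tprodI x sq_in \<xi>)
      then show "?T (x * y) \<in> tpower Forms1 (Suc (Suc (Suc n)))"
        unfolding \<xi>(1) T(2)[OF x \<xi>(2)] using Sy[OF x y] \<xi>(1)
        by (intro subgrp_add tmod_subgrp[OF tmod_Fn] idsi_in) auto
    qed
    fix a :: 'w assume a: "a \<in> forms 0"
    show "?T (x * form a) = ?T x * form a + x * form (ext_deriv a)"
    proof (rule tprod_eqI[OF x' additive_on_compose[OF additive_on_mult_right add]
          additive_on_plus[OF additive_on_mult_right'[OF add] additive_on_mult_right]])
      fix x y :: "'w tensor" assume x: "x \<in> tpower Forms1 (Suc n)" and y: "y \<in> Forms1"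
      then obtain \<xi> where \<xi>: "y = form \<xi>" "\<xi> \<in> forms 1" by auto
      have "?T (x * y * form a) = ?T (x * form (\<xi> * a))" by (simp only: \<xi>(1) mult.assoc form_rmult[OF a])
      also have "\<dots> = x * sq (\<xi> * a) + idsi n (?S x * y * form a)"
        unfolding T(2)[OF x forms_mult_0[OF \<xi>(2) a]] by (simp only: \<xi>(1) mult.assoc form_rmult[OF a])
      also have "\<dots> = ?T (x * y) * form a + x * y * form (ext_deriv a)"
        unfolding \<xi>(1) T(2)[OF x \<xi>(2)] idsi_rmult[OF Sy[OF x y, unfolded \<xi>(1)] a] sq_rmult[OF \<xi>(2) a]
        by (simp add: algebra_simps del: sq_forms.simps tpower.simps)
      finally show "?T (x * y * form a) = ?T (x * y) * form a + x * y * form (ext_deriv a)" .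
    qed (use bm in \<open>unfold Fn_Suc[of "Suc n"], intro bimod_rmult a\<close>)
  qed
qed

lemma sq_forms_add: "additive_on (tpower Forms1 (Suc n)) (sq_forms sq si (Suc n))"
  and sq_forms_in: "x \<in> tpower Forms1 (Suc n) \<Longrightarrow> sq_forms sq si (Suc n) x \<in> tpower Forms1 (Suc (Suc n))"
  using sq_forms_ok[of n] unfolding sq_forms_ok_def by blast+

lemmas sq_forms_mult = sq_forms_Suc_Suc(2)[OF sq_forms_ok]

lemma nabla_Suc_0: "nabla sq si (Suc 0) a = form (ext_deriv a)"
  by (simp add: on_forms_def)

lemma nabla_in: "a \<in> forms 0 \<Longrightarrow> nabla sq si n a \<in> tpower Forms1 n"
proof (induction n)
  case (Suc n)
  show ?case
  proof (cases n)
    case 0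
    show ?thesis unfolding 0 nabla_Suc_0 tpower_1[OF bimod_forms] using Suc.prems by (auto intro: ext_deriv_0)
  next
    case (Suc m)
    then show ?thesis using sq_forms_in[of _ m] Suc.IH Suc.prems unfolding nabla.simps by blast
  qed
qed simp

lemma sq_all_mult: "y \<in> tpower Fields n \<Longrightarrow> sq_all (vfield v * y) = sq_vec sq v * y + sigma_id (vfield v * sq_all y)"
proof -
  assume y: "y \<in> tpower Fields n"
  then have "vfield v * y \<in> tpower Fields (Suc n)" by (auto intro: tprodI)
  then show ?thesis by (simp only: sq_all_tpower sq_vecs_mult[OF y] sq_all_tpower[OF y])
qed

lemma sq_all_vfield: "sq_all (vfield v) = sq_vec sq v"
proof -
  have "(1 :: 'w tensor) \<in> tpower Fields 0" using forms_one by (auto simp: form_one[symmetric])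
  from sq_all_mult[OF this, of v] show ?thesis
    using additive_on_zero[OF sigma_id_add subgrp_tprod] by (simp add: sq_all_one)
qed

end

section \<open>Duality for n factors: the differential of a nested evaluation\<close>

lemma VFn_mult: "x \<in> tpower Fields n \<Longrightarrow> z \<in> tpower Forms1 n \<Longrightarrow> x * z \<in> VFn n"
  by (rule tprodI)

lemma VFn_FF: "x \<in> tpower Fields n \<Longrightarrow> z \<in> tpower Forms1 n \<otimes>\<^sub>A N \<Longrightarrow> x * z \<in> VFn n \<otimes>\<^sub>A N"
  unfolding tprod_assoc by (rule tprodI)

lemma evi_Suc_mult:
  fixes q :: "'w::star_dga tensor"
  assumes q: "q \<in> VFn (Suc n) \<otimes>\<^sub>A (Forms1 \<otimes>\<^sub>A Forms1)"
  shows "evi (Suc n) (vfield v * q) = contr v (evi n q)"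
proof -
  let ?D = "VFn (Suc n) \<otimes>\<^sub>A Forms1 :: 'w tensor set"
  have q': "q \<in> ?D \<otimes>\<^sub>A Forms1" using q by (simp only: tprod_assoc)
  have V: "vfield v * p \<in> VFn (Suc (Suc n)) \<otimes>\<^sub>A Forms1" if "p \<in> ?D \<otimes>\<^sub>A Forms1" for p
    unfolding VFn_Suc[of "Suc n"] tprod_assoc using that by (intro tprodI) (auto simp: tprod_assoc)
  have U: "VFn (Suc (Suc n)) \<otimes>\<^sub>A Forms1 \<subseteq> (VFn (Suc (Suc n)) \<otimes>\<^sub>A UNIV :: 'w tensor set)"
    and U': "?D \<otimes>\<^sub>A Forms1 \<subseteq> VFn (Suc n) \<otimes>\<^sub>A UNIV"
    unfolding tprod_assoc by (intro tprod_mono; auto)+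
  have inF: "evi n p \<in> Forms1_T" if "p \<in> ?D \<otimes>\<^sub>A Forms1" for p
  proof (rule additive_image_in[OF that additive_on_subset[OF evi_add U'] subgrp_tprod])
    fix p y :: "'w tensor" assume p: "p \<in> ?D" and "y \<in> Forms1"
    have "p \<in> VFn (Suc n) \<otimes>\<^sub>A UNIV" using p tprod_mono[of "VFn (Suc n)" "VFn (Suc n)" Forms1 UNIV] by blast
    then show "evi n (p * y) \<in> Forms1_T"
      using evi_in[OF p] by (simp only: evi_mult_right) (rule tprodI, auto)
  qed
  show ?thesis
  proof (rule tprod_eqI[OF q'])
    show "additive_on (?D \<otimes>\<^sub>A Forms1) (\<lambda>q. evi (Suc n) (vfield v * q))"
      by (rule additive_on_compose[OF additive_on_mult_left evi_add]) (use V U in blast)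
    show "additive_on (?D \<otimes>\<^sub>A Forms1) (\<lambda>q. contr v (evi n q))"
      by (rule additive_on_compose[OF additive_on_subset[OF evi_add U'] contr_add inF])
    fix p y :: "'w tensor" assume p: "p \<in> ?D" and y: "y \<in> Forms1"
    have p': "p \<in> VFn (Suc n) \<otimes>\<^sub>A UNIV" using p tprod_mono[of "VFn (Suc n)" "VFn (Suc n)" Forms1 UNIV] by blast
    have vp: "vfield v * p \<in> VFn (Suc (Suc n))" unfolding VFn_Suc[of "Suc n"] using p by (intro tprodI) auto
    show "evi (Suc n) (vfield v * (p * y)) = contr v (evi n (p * y))"
      unfolding mult.assoc[symmetric] evi_mult[OF vp] ev_iter_mult[OF p] evi_mult_right[OF p']
      by (rule contr_mult_right[OF Forms1_FT[OF evi_in[OF p]], symmetric])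
  qed
qed

context conn
begin

text \<open>\<open>si\<close> acts on the last two forms and the evaluation consumes those before
  them. The result of the evaluation is a coefficient in A, through which \<open>si\<close> is left
  linear.\<close>

lemma evi_idsi:
  assumes y: "y \<in> tpower Fields (Suc n)" and w: "w \<in> tpower Forms1 (Suc (Suc (Suc n)))"
  shows "evi n (y * idsi n w) = si (evi n (y * w))"
proof -
  have in_FF: "evi n (y * w) \<in> Forms1 \<otimes>\<^sub>A Forms1" if w: "w \<in> tpower Forms1 (Suc (Suc (Suc n)))" for w
  proof -
    have "y * w \<in> VFn (Suc n) \<otimes>\<^sub>A (Forms1 \<otimes>\<^sub>A Forms1)"
      using VFn_FF[OF y w[unfolded Fn_Suc_Suc[of "Suc n"]]] .
    from ext_id_in[OF ev_iter_rlin this ev_iter_Alg] show ?thesis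
      by (simp only: Alg_tprod[OF tmod_lmod[OF tmod_FF]])
  qed
  have T: "y * w \<in> VFn (Suc n) \<otimes>\<^sub>A UNIV" if "w \<in> tpower Forms1 (Suc (Suc (Suc n)))" for w
    using VFn_FF[OF y that[unfolded Fn_Suc_Suc[of "Suc n"]]] tprod_mono[OF subset_refl subset_UNIV] by blast
  have add: "additive_on (tpower Forms1 (Suc (Suc (Suc n)))) (\<lambda>w. evi n (y * idsi n w))"
    by (rule additive_on_compose[OF additive_on_mult_left'[OF idsi_add] evi_add]) (rule T[OF idsi_in])
  have add': "additive_on (tpower Forms1 (Suc (Suc (Suc n)))) (\<lambda>w. si (evi n (y * w)))"
    by (rule additive_on_compose[OF additive_on_compose[OF additive_on_mult_left evi_add] si_add])
      (fact T in_FF)+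
  show ?thesis
  proof (rule tprod_eqI[OF w[unfolded Fn_Suc_Suc[of "Suc n"]] add[unfolded Fn_Suc_Suc[of "Suc n"]] add'[unfolded Fn_Suc_Suc[of "Suc n"]]])
    fix w t :: "'w tensor" assume w: "w \<in> tpower Forms1 (Suc n)" and t: "t \<in> Forms1 \<otimes>\<^sub>A Forms1"
    have yw: "y * w \<in> VFn (Suc n)" by (rule VFn_mult[OF y w])
    obtain c where c: "ev_iter (Suc n) (y * w) = form c" "c \<in> forms 0" using ev_iter_Alg[OF yw] by auto
    show "evi n (y * idsi n (w * t)) = si (evi n (y * (w * t)))"
      unfolding idsi_mult[OF w t] mult.assoc[symmetric] evi_mult[OF yw] c(1) by (rule si_lmult[OF t c(2), symmetric])
  qed
qed

lemma idev_rev_ev: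
  fixes X p :: "'w tensor" and \<xi> :: 'w
  assumes X: "X \<in> Forms1 \<otimes>\<^sub>A Fields" and y: "p \<in> VFn (Suc n)" and \<xi>: "\<xi> \<in> forms 1"
    and \<epsilon>: "ev_iter (Suc n) p = form \<epsilon>" "\<epsilon> \<in> forms 0"
  shows "idev (Suc n) (X * (p * form \<xi>)) = rev_ev (\<epsilon> * \<xi>) X"
proof (rule tprod_eqI[OF X _ rev_ev_add])
  have pF: "p * form \<xi> \<in> VFn (Suc n) \<otimes>\<^sub>A Forms1" using y \<xi> by (auto intro: tprodI)
  have Vp: "v * (p * form \<xi>) \<in> VFn (Suc (Suc n))" if "v \<in> Fields" for v
    unfolding VFn_Suc[of "Suc n"] by (rule tprodI[OF that pF])
  show \<epsilon>\<xi>: "\<epsilon> * \<xi> \<in> forms 1" by (rule forms_0_mult[OF \<epsilon>(2) \<xi>])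
  show "additive_on (Forms1 \<otimes>\<^sub>A Fields) (\<lambda>X. idev (Suc n) (X * (p * form \<xi>)))"
  proof (rule additive_on_compose[OF additive_on_mult_right idev_add])
    fix X :: "'w tensor" assume "X \<in> Forms1 \<otimes>\<^sub>A Fields"
    then have "X * (p * form \<xi>) \<in> (Forms1 \<otimes>\<^sub>A Fields) \<otimes>\<^sub>A (VFn (Suc n) \<otimes>\<^sub>A Forms1)" by (rule tprodI[OF _ pF])
    then show "X * (p * form \<xi>) \<in> Forms1 \<otimes>\<^sub>A VFn (Suc (Suc n))" by (simp only: tprod_assoc VFn_Suc[of "Suc n"])
  qed
  fix x w :: "'w tensor" assume x: "x \<in> Forms1" and w: "w \<in> Fields"
  then obtain \<omega> v where *: "x = form \<omega>" "\<omega> \<in> forms 1" "w = vfield v" by auto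
  have "idev (Suc n) (x * w * (p * form \<xi>)) = x * contr v (evi n (p * form \<xi>))"
    unfolding mult.assoc idev_mult[OF x Vp[OF w]] unfolding *(3) ev_iter_mult[OF pF] ..
  also have "\<dots> = rev_ev (\<epsilon> * \<xi>) (x * w)"
    unfolding evi_mult[OF y] \<epsilon>(1) form_lmult[OF \<epsilon>(2)] * rev_ev_mult[OF \<epsilon>\<xi> *(2)] contr_form[OF \<epsilon>\<xi>] ..
  finally show "idev (Suc n) (x * w * (p * form \<xi>)) = rev_ev (\<epsilon> * \<xi>) (x * w)" .
qed

text \<open>On simple tensors the evaluation of the inner pairs is an element c of A. Absorbed in
  the last form, it leaves \<open>sigma si\<close> of v \<otimes> \<omega> paired with c \<xi>,
  where transposition applies; afterwards c is attached to \<omega> again.\<close>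

lemma idev_sigma_id:
  assumes Y: "Y \<in> Forms1 \<otimes>\<^sub>A tpower Fields (Suc n)" and z: "z \<in> tpower Forms1 (Suc n)" and \<xi>: "\<xi> \<in> forms 1"
  shows "idev (Suc n) (sigma_id (vfield v * Y) * (z * form \<xi>)) = contr v (si (idev n (Y * z) * form \<xi>))"
proof -
  have Yz: "Y * z \<in> Forms1 \<otimes>\<^sub>A VFn (Suc n)" if "Y \<in> Forms1 \<otimes>\<^sub>A tpower Fields (Suc n)" for Y
    using tprodI[OF that z] by (simp only: tprod_assoc)
  have sTz: "sigma_id (vfield v * Y) * (z * form \<xi>) \<in> Forms1 \<otimes>\<^sub>A VFn (Suc (Suc n))"
    if "Y \<in> Forms1 \<otimes>\<^sub>A tpower Fields (Suc n)" for Y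
  proof -
    have "z * form \<xi> \<in> tpower Forms1 (Suc n) \<otimes>\<^sub>A Forms1" using z \<xi> by (auto intro: tprodI)
    from tprodI[OF sigma_id_in[OF that] this] show ?thesis by (simp only: tprod_assoc VFn_Suc[of "Suc n"])
  qed
  have FF: "idev n (Y * z) * form \<xi> \<in> Forms1 \<otimes>\<^sub>A Forms1" if "Y \<in> Forms1 \<otimes>\<^sub>A tpower Fields (Suc n)" for Y
    using idev_in[OF Yz[OF that]] \<xi> by (intro tprodI) auto
  show ?thesis
  proof (rule tprod_eqI[OF Y])
    show "additive_on (Forms1 \<otimes>\<^sub>A tpower Fields (Suc n)) (\<lambda>Y. idev (Suc n) (sigma_id (vfield v * Y) * (z * form \<xi>)))"
      by (rule additive_on_compose[OF additive_on_mult_right'[OF additive_on_compose[OF additive_on_mult_left sigma_id_add]] idev_add])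
        (fact vfield_mult_FT[OF Forms1_T] sTz)+
    show "additive_on (Forms1 \<otimes>\<^sub>A tpower Fields (Suc n)) (\<lambda>Y. contr v (si (idev n (Y * z) * form \<xi>)))"
      by (rule additive_on_compose[OF additive_on_compose[OF additive_on_mult_right'[OF
          additive_on_compose[OF additive_on_mult_right idev_add]] si_add] contr_add])
        (fact Yz FF Forms1_T[OF si_in[OF FF]])+
    fix x y :: "'w tensor" assume x: "x \<in> Forms1" and y: "y \<in> tpower Fields (Suc n)"
    obtain \<omega> where \<omega>: "x = form \<omega>" "\<omega> \<in> forms 1" using x by auto
    have yz: "y * z \<in> VFn (Suc n)" by (rule VFn_mult[OF y z])
    obtain c where c: "ev_iter (Suc n) (y * z) = form c" "c \<in> forms 0" using ev_iter_Alg[OF yz] by auto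
    have V: "vfield v * form \<omega> \<in> Fields_Forms1" using \<omega> by (auto intro: tprodI)
    have "idev (Suc n) (sigma_id (vfield v * (x * y)) * (z * form \<xi>)) =
        idev (Suc n) (sigma si (vfield v * form \<omega>) * ((y * z) * form \<xi>))"
      unfolding \<omega>(1) sigma_id_mult[OF \<omega>(2)] by (simp only: mult.assoc)
    also have "\<dots> = contr v (si (form \<omega> * form (c * \<xi>)))"
      unfolding idev_rev_ev[OF sigma_in[OF V] yz \<xi> c] by (rule rev_ev_sigma[OF \<omega>(2) forms_0_mult[OF c(2) \<xi>]])
    also have "form \<omega> * form (c * \<xi>) = idev n (x * y * z) * form \<xi>"
      unfolding mult.assoc[of x] idev_mult[OF x yz] c(1)
      unfolding \<omega>(1) form_lmult[OF c(2), symmetric] mult.assoc ..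
    finally show "idev (Suc n) (sigma_id (vfield v * (x * y)) * (z * form \<xi>)) = contr v (si (idev n (x * y * z) * form \<xi>))" .
  qed
qed

text \<open>The evaluation equals v(\<epsilon> \<xi>), with v the outer field, \<xi> the last form
  and \<epsilon> the evaluation of the inner pairs. Duality for one factor and the left Leibniz rule
  leave \<open>si\<close> of d \<epsilon> \<otimes> \<xi>, to which the induction hypothesis
  applies. The four resulting terms are those of the two recursions, one for fields and one for
  forms.\<close>

lemma d_ev_iter:
  assumes "x \<in> tpower Fields (Suc n)" "z \<in> tpower Forms1 (Suc n)"
  shows "form (ext_deriv (wedge (ev_iter (Suc n) (x * z)))) =
    idev n (sq_all x * z) + evi n (x * sq_forms sq si (Suc n) z)"
  using assms
proof (induction n arbitrary: x z)
  case 0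
  obtain v \<xi> where *: "x = vfield v" "z = form \<xi>" "\<xi> \<in> forms 1"
    using "0.prems" unfolding tpower_1[OF bimod_forms] tpower_1[OF bimod_Fields] by auto
  have evi: "evi 0 (x * sq \<xi>) = contr v (sq \<xi>)"
    unfolding VFn_1 ev_iter.simps contr_def * ..
  have idev: "idev 0 (sq_all x * z) = rev_ev \<xi> (sq_vec sq v)"
    unfolding idev_def VFn_1 ev_iter.simps rev_ev_def * sq_all_vfield ..
  have sq: "sq_forms sq si (Suc 0) z = sq \<xi>" and ev: "ev_iter (Suc 0) (x * z) = form (vec_apply v \<xi>)"
    using * by (simp_all add: ev_mult)
  show ?case unfolding sq ev idev evi wedge_form by (rule sq_vec_eq[OF *(3)])
next
  case (Suc n)
  let ?Vx = "tpower Fields (Suc (Suc n)) :: 'w tensor set" and ?Fz = "tpower Forms1 (Suc (Suc n)) :: 'w tensor set"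
  let ?E = "ev_iter (Suc (Suc n)) :: 'w tensor \<Rightarrow> 'w tensor"
  let ?lmul = "\<lambda>x z. form (ext_deriv (wedge (?E (x * z))))"
  let ?R = "\<lambda>x z. idev (Suc n) (sq_all x * z) + evi (Suc n) (x * sq_forms sq si (Suc (Suc n)) z)"
  have sub: "VFn (Suc (Suc n)) \<otimes>\<^sub>A Forms1 \<subseteq> (VFn (Suc (Suc n)) \<otimes>\<^sub>A UNIV :: 'w tensor set)" by (rule tprod_mono) auto
  have xSz: "x * sq_forms sq si (Suc (Suc n)) z \<in> VFn (Suc (Suc n)) \<otimes>\<^sub>A UNIV" if "x \<in> ?Vx" "z \<in> ?Fz" for x z
    using VFn_Forms1[OF that(1) sq_forms_in[OF that(2)]] sub by blast
  have Qz: "sq_all x * z \<in> Forms1 \<otimes>\<^sub>A VFn (Suc (Suc n))" if "x \<in> ?Vx" "z \<in> ?Fz" for x z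
    using tprodI[OF sq_all_tpower_in[OF that(1)] that(2)] by (simp only: tprod_assoc)
  have add_d: "additive_on UNIV (\<lambda>x. form (ext_deriv (wedge x)))"
    by (simp add: additive_on_def wedge_add ext_deriv_add form_add)
  have sq_all_add': "additive_on ?Vx sq_all" by (rule additive_on_subset[OF sq_all_add tpower_tensor_algebra])
  have addL: "additive_on ?Vx (\<lambda>x. ?lmul x z)" if z: "z \<in> ?Fz" for z
    by (rule additive_on_compose[OF additive_on_compose[OF additive_on_mult_right ev_iter_add] add_d])
      (use z in \<open>auto intro: tprodI simp del: tpower.simps\<close>)
  have addL': "additive_on ?Fz (?lmul x)" if x: "x \<in> ?Vx" for x
    by (rule additive_on_compose[OF additive_on_compose[OF additive_on_mult_left ev_iter_add] add_d])
      (use x in \<open>auto intro: tprodI simp del: tpower.simps\<close>)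
  have addR: "additive_on ?Vx (\<lambda>x. ?R x z)" if z: "z \<in> ?Fz" for z
    by (intro additive_on_plus additive_on_compose[OF additive_on_mult_right'[OF sq_all_add'] idev_add]
        additive_on_compose[OF additive_on_mult_right evi_add] xSz Qz z)
  have addR': "additive_on ?Fz (?R x)" if x: "x \<in> ?Vx" for x
    by (intro additive_on_plus additive_on_compose[OF additive_on_mult_left idev_add]
        additive_on_compose[OF additive_on_mult_left'[OF sq_forms_add] evi_add] xSz Qz x)
  have main: "?lmul (vfield v * y) (z * form \<xi>) = ?R (vfield v * y) (z * form \<xi>)"
    if y: "y \<in> tpower Fields (Suc n)" and z: "z \<in> tpower Forms1 (Suc n)" and \<xi>: "\<xi> \<in> forms 1" for v y z \<xi>
  proof -
    let ?S = "sq_forms sq si (Suc n) z"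
    have yz: "y * z \<in> VFn (Suc n)" by (rule VFn_mult[OF y z])
    obtain \<epsilon> where \<epsilon>: "ev_iter (Suc n) (y * z) = form \<epsilon>" "\<epsilon> \<in> forms 0" using ev_iter_Alg[OF yz] by auto
    have \<epsilon>\<xi>: "\<epsilon> * \<xi> \<in> forms 1" by (rule forms_0_mult[OF \<epsilon>(2) \<xi>])
    have yz\<xi>: "y * z * form \<xi> \<in> VFn (Suc n) \<otimes>\<^sub>A Forms1" using yz \<xi> by (auto intro: tprodI simp del: tpower.simps)
    have yS: "y * ?S \<in> VFn (Suc n) \<otimes>\<^sub>A Forms1" by (rule VFn_Forms1[OF y sq_forms_in[OF z]])
    have yS': "y * ?S \<in> VFn (Suc n) \<otimes>\<^sub>A UNIV" using yS tprod_mono[OF subset_refl subset_UNIV] by blast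
    have S\<xi>: "?S * form \<xi> \<in> tpower Forms1 (Suc (Suc (Suc n)))"
      unfolding Fn_Suc[of "Suc (Suc n)"] using \<xi> by (intro tprodI sq_forms_in z) auto
    have Y: "sq_all y \<in> Forms1 \<otimes>\<^sub>A tpower Fields (Suc n)" by (rule sq_all_tpower_in[OF y])
    have Yz: "sq_all y * z \<in> Forms1 \<otimes>\<^sub>A VFn (Suc n)" using tprodI[OF Y z] by (simp only: tprod_assoc)
    \<comment> \<open>The two halves of d \<epsilon> are kept apart: the one that differentiates the
      fields enters the derivative of the fields through \<open>sigma\<close>, the one that
      differentiates the forms enters the derivative of the forms through \<open>si\<close>.\<close>
    define a1 where "a1 = idev n (sq_all y * z)"
    define a2 where "a2 = evi n (y * ?S)"
    have a1: "a1 \<in> Forms1" unfolding a1_def by (rule idev_in[OF Yz])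
    have a2: "a2 \<in> Forms1" unfolding a2_def by (rule evi_in[OF yS])
    have IH: "form (ext_deriv \<epsilon>) = a1 + a2"
      using Suc.IH[OF y z] unfolding \<epsilon>(1) a1_def a2_def by simp
    have FF: "a1 * form \<xi> \<in> Forms1 \<otimes>\<^sub>A Forms1" "a2 * form \<xi> \<in> Forms1 \<otimes>\<^sub>A Forms1"
      using \<xi> by (intro tprodI a1 a2; simp)+
    note siFT = FF[THEN si_in, THEN Forms1_T]
    have "?E (vfield v * y * (z * form \<xi>)) = form (vec_apply v (\<epsilon> * \<xi>))"
      using ev_iter_mult[OF yz\<xi>, of v] unfolding evi_mult[OF yz] \<epsilon>(1) form_lmult[OF \<epsilon>(2)] contr_form[OF \<epsilon>\<xi>]
      by (simp only: mult.assoc)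
    then have "?lmul (vfield v * y) (z * form \<xi>) = rev_ev (\<epsilon> * \<xi>) (sq_vec sq v) + contr v (sq (\<epsilon> * \<xi>))"
      using sq_vec_eq[OF \<epsilon>\<xi>, of v] by simp
    also have "contr v (sq (\<epsilon> * \<xi>)) = contr v (form \<epsilon> * sq \<xi>) + contr v (si (a1 * form \<xi>)) + contr v (si (a2 * form \<xi>))"
    proof -
      have "sq (\<epsilon> * \<xi>) = form \<epsilon> * sq \<xi> + (si (a1 * form \<xi>) + si (a2 * form \<xi>))"
        unfolding sq_lmult[OF \<xi> \<epsilon>(2)] IH distrib_right by (simp only: additive_on_add[OF si_add FF])
      moreover have "form \<epsilon> * sq \<xi> \<in> Forms1_T"
        by (rule Forms1_T[OF lmod_mult[OF tmod_lmod[OF tmod_FF] \<epsilon>(2) sq_in[OF \<xi>]]])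
      ultimately show ?thesis
        using siFT by (simp add: additive_on_add[OF contr_add] subgrp_add[OF subgrp_tprod] add.assoc)
    qed
    finally have lmul: "?lmul (vfield v * y) (z * form \<xi>) = rev_ev (\<epsilon> * \<xi>) (sq_vec sq v) +
      (contr v (form \<epsilon> * sq \<xi>) + contr v (si (a1 * form \<xi>)) + contr v (si (a2 * form \<xi>)))" .
    have "sq_all (vfield v * y) * (z * form \<xi>) = sq_vec sq v * (y * z * form \<xi>) + sigma_id (vfield v * sq_all y) * (z * form \<xi>)"
      unfolding sq_all_mult[OF y] by (simp only: distrib_right mult.assoc)
    moreover have "sq_vec sq v * (y * z * form \<xi>) \<in> Forms1 \<otimes>\<^sub>A VFn (Suc (Suc n))"
      using tprodI[OF sq_vec_in[of v] yz\<xi>] by (simp only: tprod_assoc VFn_Suc[of "Suc n"])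
    moreover have "sigma_id (vfield v * sq_all y) * (z * form \<xi>) \<in> Forms1 \<otimes>\<^sub>A VFn (Suc (Suc n))"
    proof -
      have "z * form \<xi> \<in> tpower Forms1 (Suc n) \<otimes>\<^sub>A Forms1" using z \<xi> by (auto intro: tprodI simp del: tpower.simps)
      from tprodI[OF sigma_id_in[OF Y] this] show ?thesis by (simp only: tprod_assoc VFn_Suc[of "Suc n"])
    qed
    ultimately have "idev (Suc n) (sq_all (vfield v * y) * (z * form \<xi>)) =
        idev (Suc n) (sq_vec sq v * (y * z * form \<xi>)) + idev (Suc n) (sigma_id (vfield v * sq_all y) * (z * form \<xi>))"
      by (simp only: additive_on_add[OF idev_add])
    then have R1: "idev (Suc n) (sq_all (vfield v * y) * (z * form \<xi>)) =
        rev_ev (\<epsilon> * \<xi>) (sq_vec sq v) + contr v (si (a1 * form \<xi>))"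
      unfolding idev_rev_ev[OF sq_vec_in yz \<xi> \<epsilon>] idev_sigma_id[OF Y z \<xi>] a1_def .
    have q1: "y * (z * sq \<xi>) \<in> VFn (Suc n) \<otimes>\<^sub>A (Forms1 \<otimes>\<^sub>A Forms1)"
      by (rule VFn_FF[OF y tprodI[OF z sq_in[OF \<xi>]]])
    have q2: "y * idsi n (?S * form \<xi>) \<in> VFn (Suc n) \<otimes>\<^sub>A (Forms1 \<otimes>\<^sub>A Forms1)"
      using VFn_FF[OF y] idsi_in[OF S\<xi>] unfolding Fn_Suc_Suc[of "Suc n"] by blast
    have V: "vfield v * q \<in> VFn (Suc (Suc n)) \<otimes>\<^sub>A UNIV" if "q \<in> VFn (Suc n) \<otimes>\<^sub>A (Forms1 \<otimes>\<^sub>A Forms1)" for q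
    proof -
      have "vfield v * q \<in> Fields \<otimes>\<^sub>A (VFn (Suc n) \<otimes>\<^sub>A (Forms1 \<otimes>\<^sub>A Forms1))" using that by (intro tprodI) auto
      then have "vfield v * q \<in> VFn (Suc (Suc n)) \<otimes>\<^sub>A Forms1" by (simp only: tprod_assoc VFn_Suc[of "Suc n"])
      then show ?thesis using sub by blast
    qed
    have "vfield v * y * sq_forms sq si (Suc (Suc n)) (z * form \<xi>) =
        vfield v * (y * (z * sq \<xi>)) + vfield v * (y * idsi n (?S * form \<xi>))"
      unfolding sq_forms_mult[OF z \<xi>] by (simp only: distrib_left mult.assoc)
    then have "evi (Suc n) (vfield v * y * sq_forms sq si (Suc (Suc n)) (z * form \<xi>)) =
        contr v (evi n (y * (z * sq \<xi>))) + contr v (evi n (y * idsi n (?S * form \<xi>)))"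
      by (simp only: additive_on_add[OF evi_add V[OF q1] V[OF q2]] evi_Suc_mult[OF q1] evi_Suc_mult[OF q2])
    also have "evi n (y * (z * sq \<xi>)) = form \<epsilon> * sq \<xi>"
      unfolding mult.assoc[symmetric] evi_mult[OF yz] \<epsilon>(1) ..
    also have "evi n (y * idsi n (?S * form \<xi>)) = si (a2 * form \<xi>)"
      unfolding evi_idsi[OF y S\<xi>] mult.assoc[symmetric] evi_mult_right[OF yS'] a2_def ..
    finally have R2: "evi (Suc n) (vfield v * y * sq_forms sq si (Suc (Suc n)) (z * form \<xi>)) =
        contr v (form \<epsilon> * sq \<xi>) + contr v (si (a2 * form \<xi>))" .
    show ?thesis unfolding lmul R1 R2 by (simp only: add_ac)
  qed
  \<comment> \<open>The fields are split on the left and the forms on the right, as the nested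
    evaluation pairs them.\<close>
  have eqV: "?Vx = Fields \<otimes>\<^sub>A tpower Fields (Suc n)" by (rule tpower.simps(2))
  have eqF: "?Fz = tpower Forms1 (Suc n) \<otimes>\<^sub>A Forms1" by (rule Fn_Suc)
  have xV: "x \<in> Fields \<otimes>\<^sub>A tpower Fields (Suc n)" using Suc.prems(1) unfolding eqV .
  have zF: "z \<in> tpower Forms1 (Suc n) \<otimes>\<^sub>A Forms1" using Suc.prems(2) unfolding eqF .
  show ?case
  proof (rule tprod_eqI[OF xV])
    show "additive_on (Fields \<otimes>\<^sub>A tpower Fields (Suc n)) (\<lambda>x. ?lmul x z)"
      by (rule back_subst[of "\<lambda>S. additive_on S (\<lambda>x. ?lmul x z)", OF addL[OF Suc.prems(2)] eqV])
    show "additive_on (Fields \<otimes>\<^sub>A tpower Fields (Suc n)) (\<lambda>x. ?R x z)"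
      by (rule back_subst[of "\<lambda>S. additive_on S (\<lambda>x. ?R x z)", OF addR[OF Suc.prems(2)] eqV])
    fix w y :: "'w tensor" assume w: "w \<in> Fields" and y: "y \<in> tpower Fields (Suc n)"
    then obtain v where v: "w = vfield v" by auto
    have wy: "w * y \<in> ?Vx" unfolding eqV by (rule tprodI[OF w y])
    show "?lmul (w * y) z = ?R (w * y) z"
    proof (rule tprod_eqI[OF zF])
      show "additive_on (tpower Forms1 (Suc n) \<otimes>\<^sub>A Forms1) (?lmul (w * y))"
        by (rule back_subst[of "\<lambda>S. additive_on S (?lmul (w * y))", OF addL'[OF wy] eqF])
      show "additive_on (tpower Forms1 (Suc n) \<otimes>\<^sub>A Forms1) (?R (w * y))"
        by (rule back_subst[of "\<lambda>S. additive_on S (?R (w * y))", OF addR'[OF wy] eqF])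
      fix z t :: "'w tensor" assume z: "z \<in> tpower Forms1 (Suc n)" and "t \<in> Forms1"
      then obtain \<xi> where "t = form \<xi>" "\<xi> \<in> forms 1" by auto
      then show "?lmul (w * y) (z * t) = ?R (w * y) (z * t)" using main[OF y z, of \<xi> v] v by (simp only:)
    qed
  qed
qed

section \<open>The action of differential operators and its product rule\<close>

lemma
  assumes a: "a \<in> forms 0"
  shows act_add: "additive_on TV (\<lambda>x. act sq si x a)"
    and act_tpower: "x \<in> tpower Fields n \<Longrightarrow> act sq si x a = wedge (ev_iter n (x * nabla sq si n a))"
proof -
  have "additive_on (tpower Fields n) (\<lambda>y. wedge (ev_iter n (y * nabla sq si n a)))" for n
  proof (cases n)
    case 0
    then show ?thesis by (simp add: additive_on_def distrib_right wedge_add)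
  next
    case (Suc m)
    have w: "additive_on UNIV wedge" by (simp add: additive_on_def wedge_add)
    show ?thesis unfolding Suc
      by (rule additive_on_compose[OF additive_on_compose[OF additive_on_mult_right ev_iter_add] w])
        (auto intro!: tprodI nabla_in a simp del: tpower.simps nabla.simps)
  qed
  note * = someI_ex[OF ex_glue[OF this]]
  show "additive_on TV (\<lambda>x. act sq si x a)"
    and "x \<in> tpower Fields n \<Longrightarrow> act sq si x a = wedge (ev_iter n (x * nabla sq si n a))"
    unfolding act_def using * by blast+
qed

lemma act_form: "a \<in> forms 0 \<Longrightarrow> b \<in> forms 0 \<Longrightarrow> act sq si (form b) a = b * a"
  using act_tpower[of a "form b" 0] by (simp add: form_lmult)

lemma act_forms_0: "a \<in> forms 0 \<Longrightarrow> x \<in> TV \<Longrightarrow> act sq si x a \<in> forms 0"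
proof (rule tensor_algebra_image_in[OF _ act_add subgrp_forms])
  fix n and x :: "'w tensor" assume a: "a \<in> forms 0" and x: "x \<in> tpower Fields n"
  show "act sq si x a \<in> forms 0"
  proof (cases n)
    case 0
    then show ?thesis using a x by (auto simp: act_form forms_0_mult)
  next
    case (Suc m)
    have "ev_iter n (x * nabla sq si n a) \<in> Alg"
      unfolding Suc by (rule ev_iter_Alg, rule VFn_mult[OF x[unfolded Suc] nabla_in[OF a]])
    then show ?thesis unfolding act_tpower[OF a x] by auto
  qed
qed

lemma act_lmult:
  assumes a: "a \<in> forms 0" and b: "b \<in> forms 0" and x: "x \<in> TV"
  shows "act sq si (form b * x) a = b * act sq si x a"
proof (rule tensor_algebra_eqI[OF x])
  show "additive_on TV (\<lambda>x. act sq si (form b * x) a)"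
    by (rule additive_on_compose[OF additive_on_mult_left act_add[OF a]]) (rule lmod_mult[OF lmod_TV b])
  show "additive_on TV (\<lambda>x. b * act sq si x a)"
    by (rule additive_on_mult_left_ring(1)[OF act_add[OF a]])
  fix n and x :: "'w tensor" assume x: "x \<in> tpower Fields n"
  note bx = lmod_mult[OF tmod_lmod[OF tmod_tpow] b x]
  show "act sq si (form b * x) a = b * act sq si x a"
  proof (cases n)
    case 0
    then obtain c where "x = form c" "c \<in> forms 0" using x by auto
    then show ?thesis using a b by (simp add: form_lmult act_form forms_0_mult mult.assoc)
  next
    case (Suc m)
    have "ev_iter n (form b * (x * nabla sq si n a)) = form b * ev_iter n (x * nabla sq si n a)"
      unfolding Suc by (rule ev_iter_lmult[OF VFn_mult[OF x[unfolded Suc] nabla_in[OF a]] b])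
    then show ?thesis unfolding act_tpower[OF a x] act_tpower[OF a bx] by (simp only: mult.assoc wedge_mult wedge_form)
  qed
qed

text \<open>Both sides contract \<open>u\<close> with the leading form and evaluate the remaining
  fields on the iterated derivative of a. This identifies the field term of the duality formula as
  an action.\<close>

lemma act_contr:
  assumes a: "a \<in> forms 0" and Y: "Y \<in> Forms1 \<otimes>\<^sub>A tpower Fields (Suc n)"
  shows "contr u (idev n (Y * nabla sq si (Suc n) a)) = form (act sq si (contr u Y) a)"
proof (rule tprod_eqI[OF Y])
  let ?z = "nabla sq si (Suc n) a"
  note z = nabla_in[OF a, of "Suc n"]
  have Yz: "Y * ?z \<in> Forms1 \<otimes>\<^sub>A VFn (Suc n)" if "Y \<in> Forms1 \<otimes>\<^sub>A tpower Fields (Suc n)" for Y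
    using tprodI[OF that z] by (simp only: tprod_assoc)
  have cY: "contr u Y \<in> tpower Fields (Suc n)" if "Y \<in> Forms1 \<otimes>\<^sub>A tpower Fields (Suc n)" for Y
    by (rule contr_in[OF that tmod_lmod[OF tmod_tpow]])
  show "additive_on (Forms1 \<otimes>\<^sub>A tpower Fields (Suc n)) (\<lambda>Y. contr u (idev n (Y * ?z)))"
    by (rule additive_on_compose[OF additive_on_compose[OF additive_on_mult_right idev_add] contr_add])
      (fact Yz Forms1_FT[OF idev_in[OF Yz]])+
  show "additive_on (Forms1 \<otimes>\<^sub>A tpower Fields (Suc n)) (\<lambda>Y. form (act sq si (contr u Y) a))"
    by (rule additive_on_form[OF additive_on_compose[OF additive_on_subset[OF contr_add] act_add[OF a]]])
      (blast intro: Forms1_T tpow_TV[OF cY])+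
  fix x y :: "'w tensor" assume x: "x \<in> Forms1" and y: "y \<in> tpower Fields (Suc n)"
  then obtain \<omega> where \<omega>: "x = form \<omega>" "\<omega> \<in> forms 1" by auto
  have yz: "y * ?z \<in> VFn (Suc n)" by (rule VFn_mult[OF y z])
  obtain c where c: "ev_iter (Suc n) (y * ?z) = form c" "c \<in> forms 0" using ev_iter_Alg[OF yz] by auto
  have "act sq si y a = c" unfolding act_tpower[OF a y] c(1) by simp
  then have "act sq si (contr u (x * y)) a = vec_apply u \<omega> * c"
    by (simp only: \<omega>(1) contr_mult[OF \<omega>(2)] act_lmult[OF a vec_apply_forms[OF \<omega>(2)] tpow_TV[OF y]])
  moreover have "contr u (idev n (x * y * ?z)) = form (vec_apply u \<omega>) * form c"
    unfolding mult.assoc idev_mult[OF x yz] c(1) unfolding \<omega>(1) by (rule contr_mult[OF \<omega>(2)])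
  ultimately show "contr u (idev n (x * y * ?z)) = form (act sq si (contr u (x * y)) a)"
    by (simp only: form_rmult[OF c(2)])
qed

text \<open>Contract \<open>u\<close> with the duality formula for d(x acting on a). The term that
  differentiates the forms is the action of u \<otimes> x, since it involves the next iterated
  derivative of a; the other is the action of the correction in \<open>lmul\<close>.\<close>

lemma act_lmul:
  assumes a: "a \<in> forms 0" and x: "x \<in> TV"
  shows "act sq si (lmul u x) a = vec_apply u (ext_deriv (act sq si x a))"
proof (rule tensor_algebra_eqI[OF x])
  show "additive_on TV (\<lambda>x. act sq si (lmul u x) a)"
    by (rule additive_on_compose[OF lmul_add act_add[OF a] lmul_in])
  show "additive_on TV (\<lambda>x. vec_apply u (ext_deriv (act sq si x a)))"
    by (simp add: additive_on_def additive_on_add[OF act_add[OF a]] ext_deriv_add vec_apply_add ext_deriv_0 act_forms_0 a)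
  fix n and x :: "'w tensor" assume x: "x \<in> tpower Fields n"
  have "act sq si (lmul u x) a = act sq si (vfield u * x) a + act sq si (contr u (sq_all x)) a"
    unfolding lmul_def by (intro additive_on_add[OF act_add[OF a]] vfield_TV contr_sq_all_in tpow_TV[OF x])
  also have "\<dots> = vec_apply u (ext_deriv (act sq si x a))"
  proof (cases n)
    \<comment> \<open>In degree 0 the formula for n + 1 pairs does not apply. The identity is the
      Leibniz rule for d(b a): the tensor u \<otimes> b contributes u(b da), and the correction
      contributes u(db) a.\<close>
    case 0
    then obtain b where b: "x = form b" "b \<in> forms 0" using x by auto
    have ub: "vfield u * form b \<in> tpower Fields (Suc 0)"
      unfolding tpower_1[OF bimod_Fields] by (rule bimod_rmult[OF bimod_Fields b(2)]) simp
    have "act sq si (vfield u * x) a = vec_apply u (b * ext_deriv a)"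
      using act_tpower[OF a ub] b ext_deriv_0[OF a]
      by (simp add: on_forms_def vfield_rmult ev_mult vec_apply_rmult del: tpower.simps)
    moreover have "act sq si (contr u (sq_all x)) a = vec_apply u (ext_deriv b * a)"
      using b a by (simp add: sq_all_form contr_form ext_deriv_0 act_form vec_apply_forms vec_apply_mult)
    moreover have "act sq si x a = b * a" using a b by (simp add: act_form)
    ultimately show ?thesis
      using a b by (simp add: ext_deriv_mult_0 vec_apply_add ext_deriv_0 forms_0_mult forms_mult_0 add.commute)
  next
    case (Suc m)
    note x = x[unfolded Suc]
    let ?z = "nabla sq si (Suc m) a"
    note z = nabla_in[OF a, of "Suc m"]
    have ux: "vfield u * x \<in> tpower Fields (Suc (Suc m))" using x by (simp only: tpower.simps(2)[of _ "Suc m"] tprodI rangeI)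
    have xS: "x * sq_forms sq si (Suc m) ?z \<in> VFn (Suc m) \<otimes>\<^sub>A Forms1" by (rule VFn_Forms1[OF x sq_forms_in[OF z]])
    have Qz: "sq_all x * ?z \<in> Forms1 \<otimes>\<^sub>A VFn (Suc m)" using tprodI[OF sq_all_tpower_in[OF x] z] by (simp only: tprod_assoc)
    have "form (act sq si (vfield u * x) a) = contr u (evi m (x * sq_forms sq si (Suc m) ?z))"
    proof -
      have "ev_iter (Suc (Suc m)) (vfield u * x * nabla sq si (Suc (Suc m)) a) = contr u (evi m (x * sq_forms sq si (Suc m) ?z))"
        unfolding nabla.simps(2)[of _ _ "Suc m"] mult.assoc by (rule ev_iter_mult[OF xS])
      moreover have "\<dots> \<in> Alg" by (rule contr_Forms1[OF evi_in[OF xS]])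
      ultimately show ?thesis unfolding act_tpower[OF a ux] by auto
    qed
    \<comment> \<open>The duality formula, solved for the term that differentiates the
      forms.\<close>
    also have "evi m (x * sq_forms sq si (Suc m) ?z) = form (ext_deriv (act sq si x a)) - idev m (sq_all x * ?z)"
      using d_ev_iter[OF x z] unfolding act_tpower[OF a x] by simp
    also have "contr u \<dots> = contr u (form (ext_deriv (act sq si x a))) - contr u (idev m (sq_all x * ?z))"
      by (intro additive_on_diff[OF contr_add subgrp_tprod] Forms1_FT idev_in Qz imageI ext_deriv_0 act_forms_0 a tpow_TV[OF x])
    finally have "form (act sq si (vfield u * x) a) =
        form (vec_apply u (ext_deriv (act sq si x a)) - act sq si (contr u (sq_all x)) a)"
      by (simp only: act_contr[OF a sq_all_tpower_in[OF x]] contr_form ext_deriv_0 act_forms_0 a tpow_TV[OF x] form_diff)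
    then show ?thesis by (metis wedge_form diff_add_cancel)
  qed
  finally show "act sq si (lmul u x) a = vec_apply u (ext_deriv (act sq si x a))" .
qed

end

section \<open>The decomposition of forms by type\<close>

lemma scaleC_zero_left: "0 *\<^sub>C x = (0 :: 'a::complex_algebra)"
  using scaleC_add_left[of 0 0 x] by simp

lemma scaleC_zero_right: "c *\<^sub>C 0 = (0 :: 'a::complex_algebra)"
  using scaleC_add_right[of c 0 0] by simp

lemma scaleC_minus_left: "(- c) *\<^sub>C x = - (c *\<^sub>C (x :: 'a::complex_algebra))"
  using scaleC_add_left[of "- c" c x] by (simp add: scaleC_zero_left eq_neg_iff_add_eq_0)

lemma scaleC_minus_right: "c *\<^sub>C (- x) = - (c *\<^sub>C (x :: 'a::complex_algebra))"
  using scaleC_add_right[of c "- x" x] by (simp add: scaleC_zero_right eq_neg_iff_add_eq_0)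

lemma scaleC_diff_right: "c *\<^sub>C (x - y) = c *\<^sub>C x - c *\<^sub>C (y :: 'a::complex_algebra)"
  using scaleC_add_right[of c x "- y"] by (simp add: scaleC_minus_right)

lemma scaleC_eq_mult: "c *\<^sub>C x = (c *\<^sub>C 1) * (x :: 'a::complex_algebra)"
  by (simp add: mult_scaleC_left)

lemma scaleC_eq_mult_right: "c *\<^sub>C x = x * (c *\<^sub>C (1 :: 'a::complex_algebra))"
  by (simp add: mult_scaleC_right)

lemma scaleC_eq_0D: "c \<noteq> 0 \<Longrightarrow> c *\<^sub>C x = 0 \<Longrightarrow> x = (0 :: 'a::complex_algebra)"
  using scaleC_scaleC[of "inverse c" c x] by (simp add: scaleC_zero_right scaleC_one)

lemma scaleC_forms_0: "c *\<^sub>C (1 :: 'w::star_dga) \<in> forms 0"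
  by (rule forms_scaleC[OF forms_one])

text \<open>A complex scalar acts as the element c 1 of A, so that linearity over A includes complex
  linearity; the same argument serves for J on 1-forms.\<close>

lemma vec_apply_scaleC: "\<xi> \<in> forms 1 \<Longrightarrow> vec_apply v (c *\<^sub>C \<xi>) = c *\<^sub>C vec_apply v \<xi>"
  by (metis scaleC_eq_mult_right vec_apply_mult scaleC_forms_0)

locale acs = conn sq si for sq :: "'w::star_dga \<Rightarrow> 'w tensor" and si +
  fixes J :: "'w \<Rightarrow> 'w"
  assumes acs: "almost_complex J"
    and wedge_bij: "bij_betw wedge (PQ_Forms J 1 0 \<otimes>\<^sub>A PQ_Forms J 0 1) (pq_forms J 1 1)"
    and sq_J: "\<forall>\<xi>\<in>forms 1. tensor_map Forms1 (on_forms J) Forms1 id (sq \<xi>) = sq (J \<xi>)"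
    and torsion: "\<forall>\<xi>\<in>forms 1. proj J 1 1 (torsion sq \<xi>) = 0"
begin

lemma J_add: "J (\<xi> + \<eta>) = J \<xi> + J \<eta>"
  and J_forms: "\<xi> \<in> forms n \<Longrightarrow> J \<xi> \<in> forms n"
  and J_lmult: "\<xi> \<in> forms 1 \<Longrightarrow> a \<in> forms 0 \<Longrightarrow> J (a * \<xi>) = a * J \<xi>"
  and J_rmult: "\<xi> \<in> forms 1 \<Longrightarrow> a \<in> forms 0 \<Longrightarrow> J (\<xi> * a) = J \<xi> * a"
  and J_J: "\<xi> \<in> forms 1 \<Longrightarrow> J (J \<xi>) = - \<xi>"
  using acs unfolding almost_complex_def by blast+

lemma J_mult: "\<xi> \<in> forms 1 \<Longrightarrow> \<eta> \<in> forms 1 \<Longrightarrow> J (\<xi> * \<eta>) = J \<xi> * \<eta> + \<xi> * J \<eta>"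
proof -
  assume *: "\<xi> \<in> forms 1" "\<eta> \<in> forms 1"
  have "\<forall>\<xi>s. \<xi>s \<noteq> [] \<and> set \<xi>s \<subseteq> forms 1 \<longrightarrow>
      J (prod_list \<xi>s) = (\<Sum>i<length \<xi>s. prod_list (\<xi>s[i := J (\<xi>s ! i)]))"
    using acs unfolding almost_complex_def by blast
  from this[rule_format, of "[\<xi>, \<eta>]"] * show ?thesis
    by (simp add: numeral_2_eq_2 lessThan_Suc add.commute)
qed

lemma J_zero: "J 0 = 0"
  using J_add[of 0 0] by simp

lemma J_uminus: "J (- \<xi>) = - J \<xi>"
  using J_add[of "- \<xi>" \<xi>] by (simp add: J_zero eq_neg_iff_add_eq_0)

lemma J_diff: "J (\<xi> - \<eta>) = J \<xi> - J \<eta>"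
  using J_add[of \<xi> "- \<eta>"] by (simp add: J_uminus)

lemma J_scaleC: "\<xi> \<in> forms 1 \<Longrightarrow> J (c *\<^sub>C \<xi>) = c *\<^sub>C J \<xi>"
  by (metis scaleC_eq_mult J_lmult scaleC_forms_0)

lemma subgrp_pq: "subgrp (pq_forms J p q)"
  unfolding subgrp_def pq_forms_def
  by (auto simp: forms_zero J_zero scaleC_zero_right J_diff scaleC_diff_right subgrp_diff[OF subgrp_forms])

text \<open>J is a derivation on products of two 1-forms, so eigenvalues add.\<close>

lemma pq_forms_mult:
  assumes "\<xi> \<in> pq_forms J p q" "\<eta> \<in> pq_forms J r s" "p + q = 1" "r + s = 1"
  shows "\<xi> * \<eta> \<in> pq_forms J (p + r) (q + s)"
proof -
  have \<xi>: "\<xi> \<in> forms 1" "J \<xi> = (\<i> * (of_nat p - of_nat q)) *\<^sub>C \<xi>"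
    and \<eta>: "\<eta> \<in> forms 1" "J \<eta> = (\<i> * (of_nat r - of_nat s)) *\<^sub>C \<eta>"
    using assms by (auto simp: pq_forms_def)
  have "\<xi> * \<eta> \<in> forms (1 + 1)" by (rule forms_mult[OF \<xi>(1) \<eta>(1)])
  moreover have "p + r + (q + s) = 1 + 1" using assms by simp
  ultimately show ?thesis
    using \<xi> \<eta> by (simp add: pq_forms_def J_mult mult_scaleC_left mult_scaleC_right scaleC_add_left[symmetric]
        algebra_simps)
qed

lemma pq_01: "\<xi> \<in> pq_forms J 0 1 \<longleftrightarrow> \<xi> \<in> forms 1 \<and> J \<xi> = (- \<i>) *\<^sub>C \<xi>"
  and pq_10: "\<xi> \<in> pq_forms J 1 0 \<longleftrightarrow> \<xi> \<in> forms 1 \<and> J \<xi> = \<i> *\<^sub>C \<xi>"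
  by (auto simp: pq_forms_def)

lemma pq_forms_1: "\<xi> \<in> pq_forms J 0 1 \<Longrightarrow> \<xi> \<in> forms 1" "\<xi> \<in> pq_forms J 1 0 \<Longrightarrow> \<xi> \<in> forms 1"
  by (simp_all add: pq_01 pq_10)

text \<open>\<open>pr \<i>\<close> and \<open>pr (- \<i>)\<close> are the projections \<open>\<pi>\<^sup>0\<^sup>,\<^sup>1\<close> and \<open>\<pi>\<^sup>1\<^sup>,\<^sup>0\<close>.\<close>

definition pr :: "complex \<Rightarrow> 'w \<Rightarrow> 'w" where
  "pr s \<xi> = (1/2) *\<^sub>C (\<xi> + s *\<^sub>C J \<xi>)"

lemma pr_forms: "\<xi> \<in> forms 1 \<Longrightarrow> pr s \<xi> \<in> forms 1"
  unfolding pr_def by (intro forms_scaleC forms_add J_forms)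

lemma pr_add: "pr s (\<xi> + \<eta>) = pr s \<xi> + pr s \<eta>"
  by (simp add: pr_def J_add scaleC_add_right add_ac)

lemma pr_lmult: "\<xi> \<in> forms 1 \<Longrightarrow> a \<in> forms 0 \<Longrightarrow> pr s (a * \<xi>) = a * pr s \<xi>"
  by (simp add: pr_def J_lmult mult_scaleC_right distrib_left)

lemma pr_rmult: "\<xi> \<in> forms 1 \<Longrightarrow> a \<in> forms 0 \<Longrightarrow> pr s (\<xi> * a) = pr s \<xi> * a"
  by (simp add: pr_def J_rmult mult_scaleC_left distrib_right)

lemma J_pr: "\<xi> \<in> forms 1 \<Longrightarrow> J (pr s \<xi>) = (1/2) *\<^sub>C (J \<xi> - s *\<^sub>C \<xi>)"
  by (simp add: pr_def J_scaleC forms_add forms_scaleC J_forms J_add J_J scaleC_minus_right)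

lemma pr_01: "\<xi> \<in> forms 1 \<Longrightarrow> pr \<i> \<xi> \<in> pq_forms J 0 1"
  by (simp add: pq_01 pr_forms J_pr) (simp add: pr_def scaleC_add_right scaleC_diff_right scaleC_scaleC scaleC_minus_left)

lemma pr_10: "\<xi> \<in> forms 1 \<Longrightarrow> pr (- \<i>) \<xi> \<in> pq_forms J 1 0"
  by (simp add: pq_10 pr_forms J_pr) (simp add: pr_def scaleC_add_right scaleC_diff_right scaleC_scaleC scaleC_minus_left)

lemma pr_of_01: "\<xi> \<in> pq_forms J 0 1 \<Longrightarrow> pr \<i> \<xi> = \<xi>" "\<xi> \<in> pq_forms J 0 1 \<Longrightarrow> pr (- \<i>) \<xi> = 0"
  and pr_of_10: "\<xi> \<in> pq_forms J 1 0 \<Longrightarrow> pr (- \<i>) \<xi> = \<xi>" "\<xi> \<in> pq_forms J 1 0 \<Longrightarrow> pr \<i> \<xi> = 0"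
  by (simp_all add: pr_def pq_01 pq_10 scaleC_scaleC scaleC_minus_left scaleC_minus_right scaleC_one scaleC_zero_right
      scaleC_add_left[symmetric] scaleC_add_right scaleC_diff_right)

lemma pr_sum: "\<xi> \<in> forms 1 \<Longrightarrow> pr \<i> \<xi> + pr (- \<i>) \<xi> = \<xi>"
  by (simp add: pr_def scaleC_add_right[symmetric] scaleC_minus_left)
    (simp add: scaleC_add_right scaleC_add_left[symmetric] scaleC_one)

lemma proj_unique:
  assumes "\<And>k. k \<le> p + q \<Longrightarrow> c k \<in> pq_forms J k (p + q - k)" "\<omega> = (\<Sum>k\<le>p + q. c k)"
    and "\<And>c'. (\<And>k. k \<le> p + q \<Longrightarrow> c' k \<in> pq_forms J k (p + q - k)) \<Longrightarrow> \<omega> = (\<Sum>k\<le>p + q. c' k) \<Longrightarrow> c' p = c p"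
  shows "proj J p q \<omega> = c p"
  unfolding proj_def by (rule the_equality) (use assms in blast)+

lemma proj_1:
  assumes \<xi>: "\<xi> \<in> forms 1"
  shows "proj J 0 1 \<xi> = pr \<i> \<xi>" and "proj J 1 0 \<xi> = pr (- \<i>) \<xi>"
proof -
  define c where "c = (\<lambda>k::nat. if k = 0 then pr \<i> \<xi> else pr (- \<i>) \<xi>)"
  have c: "c k \<in> pq_forms J k (1 - k)" if "k \<le> 1" for k
    using that pr_01[OF \<xi>] pr_10[OF \<xi>] by (cases k) (auto simp: c_def One_nat_def)
  have sum: "\<xi> = (\<Sum>k\<le>1. c k)"
    by (simp add: One_nat_def c_def pr_sum[unfolded One_nat_def] \<xi>[unfolded One_nat_def])
  have uniq: "c' 0 = c 0 \<and> c' 1 = c 1"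
    if c': "\<And>k. k \<le> 1 \<Longrightarrow> c' k \<in> pq_forms J k (1 - k)" and "\<xi> = (\<Sum>k\<le>1. c' k)" for c'
  proof -
    have "\<xi> = c' 0 + c' 1" using that(2) by (simp add: One_nat_def)
    then have "pr s \<xi> = pr s (c' 0) + pr s (c' 1)" for s by (simp add: pr_add)
    moreover have "c' 0 \<in> pq_forms J 0 1" "c' 1 \<in> pq_forms J 1 0" using c'[of 0] c'[of 1] by simp_all
    ultimately show ?thesis by (simp add: c_def pr_of_01 pr_of_10)
  qed
  have "proj J 0 1 \<xi> = c 0" by (rule proj_unique) (use c sum uniq in auto)
  then show "proj J 0 1 \<xi> = pr \<i> \<xi>" by (simp add: c_def)
  have "proj J 1 0 \<xi> = c 1" by (rule proj_unique) (use c sum uniq in auto)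
  then show "proj J 1 0 \<xi> = pr (- \<i>) \<xi>" by (simp add: c_def)
qed

text \<open>The eigenvalues are -2\<i>, 0 and 2\<i>. Applying J to the relation gives z = x, which
  is then an eigenvector for two different eigenvalues and vanishes. The argument relies on
  additivity of J, as complex linearity has been derived on 1-forms only.\<close>

lemma decompose_2_unique:
  assumes "x \<in> pq_forms J 0 2" "y \<in> pq_forms J 1 1" "z \<in> pq_forms J 2 0" "x + y + z = 0"
  shows "y = 0"
proof -
  have J: "J x = (- (2 * \<i>)) *\<^sub>C x" "J y = 0" "J z = (2 * \<i>) *\<^sub>C z"
    using assms by (auto simp: pq_forms_def scaleC_zero_left mult.commute)
  have "J (x + y + z) = 0" by (simp add: assms J_zero)
  then have "(2 * \<i>) *\<^sub>C (z - x) = 0" by (simp add: J_add J scaleC_minus_left scaleC_diff_right)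
  then have zx: "z = x" using scaleC_eq_0D[of "2 * \<i>" "z - x"] by simp
  then have "(4 * \<i>) *\<^sub>C x = 0"
    using J scaleC_add_left[of "2 * \<i>" "2 * \<i>" x] by (simp add: scaleC_minus_left eq_neg_iff_add_eq_0)
  then have "x = 0" using scaleC_eq_0D[of "4 * \<i>" x] by simp
  then show ?thesis using zx assms by simp
qed

lemma proj_11:
  assumes x: "x \<in> pq_forms J 0 2" and y: "y \<in> pq_forms J 1 1" and z: "z \<in> pq_forms J 2 0"
  shows "proj J 1 1 (x + y + z) = y"
proof -
  define c where "c = (\<lambda>k::nat. if k = 0 then x else if k = 1 then y else z)"
  have two: "{..(1 + 1 :: nat)} = {0, 1, 2}" by auto
  have "proj J 1 1 (x + y + z) = c 1"
  proof (rule proj_unique)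
    fix k :: nat assume "k \<le> 1 + 1"
    then consider "k = 0" | "k = 1" | "k = 2" by linarith
    then show "c k \<in> pq_forms J k (1 + 1 - k)" by cases (use x y z in \<open>simp_all add: c_def numeral_2_eq_2 One_nat_def\<close>)
  next
    show "x + y + z = (\<Sum>k\<le>1 + 1. c k)" unfolding two by (simp add: c_def add.assoc)
  next
    fix c' assume c': "\<And>k. k \<le> 1 + 1 \<Longrightarrow> c' k \<in> pq_forms J k (1 + 1 - k)" and "x + y + z = (\<Sum>k\<le>1 + 1. c' k)"
    then have eq: "x + y + z = c' 0 + c' 1 + c' 2" unfolding two by (simp add: add.assoc)
    have c'': "c' 0 \<in> pq_forms J 0 2" "c' 1 \<in> pq_forms J 1 1" "c' 2 \<in> pq_forms J 2 0"
      using c'[of 0] c'[of 1] c'[of 2] by (simp_all add: numeral_2_eq_2 One_nat_def)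
    have "c' 1 - y = 0"
    proof (rule decompose_2_unique)
      show "c' 0 - x \<in> pq_forms J 0 2" "c' 1 - y \<in> pq_forms J 1 1" "c' 2 - z \<in> pq_forms J 2 0"
        using c'' x y z by (auto intro: subgrp_diff[OF subgrp_pq])
      show "c' 0 - x + (c' 1 - y) + (c' 2 - z) = 0" using eq by (simp add: algebra_simps)
    qed
    then show "c' 1 = c 1" by (simp add: c_def)
  qed
  then show ?thesis by (simp add: c_def)
qed

lemma bimod_PQ:
  assumes "p + q = 1"
  shows "bimod (PQ_Forms J p q)"
proof -
  have *: "a * \<xi> \<in> pq_forms J p q \<and> \<xi> * a \<in> pq_forms J p q" if "a \<in> forms 0" "\<xi> \<in> pq_forms J p q" for a \<xi>
  proof -
    have "\<xi> \<in> forms 1" using that assms by (simp add: pq_forms_def)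
    then show ?thesis using that assms
      by (simp add: pq_forms_def J_lmult J_rmult forms_0_mult forms_mult_0 mult_scaleC_left mult_scaleC_right)
  qed
  then show ?thesis
    unfolding bimod_def lmod_def
    by (auto simp: subgrp_form_image subgrp_pq form_lmult form_rmult)
qed

lemmas bimod_01 = bimod_PQ[of 0 1, simplified] and bimod_10 = bimod_PQ[of 1 0, simplified]

subsection \<open>Projections of tensors\<close>

definition pr_form :: "complex \<Rightarrow> 'w tensor \<Rightarrow> 'w tensor" where
  "pr_form s x = form (pr s (wedge x))"

lemma on_forms_proj: "x \<in> Forms1 \<Longrightarrow> on_forms (proj J 0 1) x = pr_form \<i> x"
  and on_forms_proj': "x \<in> Forms1 \<Longrightarrow> on_forms (proj J 1 0) x = pr_form (- \<i>) x"
  by (auto simp: on_forms_def pr_form_def proj_1)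

lemma pr_form_form: "pr_form s (form \<xi>) = form (pr s \<xi>)"
  by (simp add: pr_form_def)

lemma pr_form_add: "additive_on M (pr_form s)"
  by (simp add: additive_on_def pr_form_def wedge_add pr_add form_add)

lemma pr_form_rlin: "rlin Forms1 (pr_form s)"
  unfolding rlin_def
  by (auto simp: tmod_Forms1 pr_form_add form_rmult pr_form_form pr_rmult)

lemma pr_form_llin: "llin Forms1 (pr_form s)"
  unfolding llin_def
  by (auto simp: tmod_lsummand tmod_Forms1 pr_form_add form_lmult pr_form_form pr_lmult)

text \<open>The specification from which \<open>tensor_map\<close> is chosen mentions the factors
  only through their values on M and N. Equal values give the same specification, hence the same
  choice.\<close>

lemma tensor_map_cong:
  assumes "\<And>x. x \<in> M \<Longrightarrow> f x = f' x" "\<And>y. y \<in> N \<Longrightarrow> g y = g' y"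
  shows "tensor_map M f N g = tensor_map M f' N g'"
proof -
  have "(\<lambda>h. additive_on (M \<otimes>\<^sub>A N) h \<and> (\<forall>x\<in>M. \<forall>y\<in>N. h (x * y) = f x * g y)) =
      (\<lambda>h. additive_on (M \<otimes>\<^sub>A N) h \<and> (\<forall>x\<in>M. \<forall>y\<in>N. h (x * y) = f' x * g' y))"
    using assms by auto
  then show ?thesis unfolding tensor_map_def tensor_lift_def by (rule arg_cong)
qed

text \<open>The argument \<i> selects type (0,1) and -\<i> selects type (1,0), in each
  factor.\<close>

definition pr_tensor :: "complex \<Rightarrow> complex \<Rightarrow> 'w tensor \<Rightarrow> 'w tensor" where
  "pr_tensor s t = tensor_map Forms1 (pr_form s) Forms1 (pr_form t)"

lemma proj_wedge_proj_eq: "proj_wedge_proj J (0, 1) (1, 0) x = wedge (pr_tensor \<i> (- \<i>) x)"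
  unfolding proj_wedge_proj_def pr_tensor_def prod.case
  by (rule arg_cong[where f = "\<lambda>h. wedge (h x)"], rule tensor_map_cong)
    (simp_all add: on_forms_proj on_forms_proj')

lemma pr_tensor_add: "additive_on (Forms1 \<otimes>\<^sub>A Forms1) (pr_tensor s t)"
  unfolding pr_tensor_def by (rule tmap_add[OF pr_form_rlin pr_form_llin])

lemma pr_tensor_mult: "\<xi> \<in> forms 1 \<Longrightarrow> \<eta> \<in> forms 1 \<Longrightarrow> pr_tensor s t (form \<xi> * form \<eta>) = form (pr s \<xi>) * form (pr t \<eta>)"
  unfolding pr_tensor_def by (simp add: tmap_mult[OF pr_form_rlin pr_form_llin] pr_form_form)

lemma additive_wedge: "additive_on M wedge"
  by (simp add: additive_on_def wedge_add)

lemma wedge_pr_tensor_rmult: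
  assumes x: "x \<in> Forms1 \<otimes>\<^sub>A Forms1" and a: "a \<in> forms 0"
  shows "pr_tensor s t (x * form a) = pr_tensor s t x * form a"
proof (rule tprod_eqI[OF x additive_on_compose[OF additive_on_mult_right pr_tensor_add] additive_on_mult_right'[OF pr_tensor_add]])
  fix x y :: "'w tensor" assume "x \<in> Forms1" "y \<in> Forms1"
  then show "pr_tensor s t (x * y * form a) = pr_tensor s t (x * y) * form a"
    using a by (auto simp: mult.assoc form_rmult pr_tensor_mult forms_mult_0 pr_rmult)
qed (rule bimod_rmult[OF tmod_bimod[OF tmod_FF] a])

lemma pr_tensor_in:
  assumes x: "x \<in> Forms1 \<otimes>\<^sub>A Forms1"
    and s: "\<And>\<xi>. \<xi> \<in> forms 1 \<Longrightarrow> pr s \<xi> \<in> pq_forms J p q" and t: "\<And>\<xi>. \<xi> \<in> forms 1 \<Longrightarrow> pr t \<xi> \<in> pq_forms J p' q'"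
  shows "pr_tensor s t x \<in> PQ_Forms J p q \<otimes>\<^sub>A PQ_Forms J p' q'"
  by (rule additive_image_in[OF x pr_tensor_add subgrp_tprod]) (auto simp: pr_tensor_mult intro!: tprodI s t)

lemma wedge_in:
  assumes "x \<in> PQ_Forms J p q \<otimes>\<^sub>A PQ_Forms J r s" "p + q = 1" "r + s = 1"
  shows "wedge x \<in> pq_forms J (p + r) (q + s)"
  by (rule additive_image_in[OF assms(1) additive_wedge subgrp_pq]) (auto simp: wedge_mult intro!: pq_forms_mult assms)

lemma wedge_pr_tensor_in:
  assumes x: "x \<in> Forms1 \<otimes>\<^sub>A Forms1"
  shows "wedge (pr_tensor \<i> \<i> x) \<in> pq_forms J 0 2" "wedge (pr_tensor (- \<i>) \<i> x) \<in> pq_forms J 1 1"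
    "wedge (pr_tensor \<i> (- \<i>) x) \<in> pq_forms J 1 1" "wedge (pr_tensor (- \<i>) (- \<i>) x) \<in> pq_forms J 2 0"
  using wedge_in[OF pr_tensor_in[OF x pr_01 pr_01]] wedge_in[OF pr_tensor_in[OF x pr_10 pr_01]]
    wedge_in[OF pr_tensor_in[OF x pr_01 pr_10]] wedge_in[OF pr_tensor_in[OF x pr_10 pr_10]]
  by (simp_all add: numeral_2_eq_2 One_nat_def)

text \<open>Splitting both factors by type gives four products, of which the two unmixed ones have
  types (0,2) and (2,0).\<close>

lemma proj_11_wedge:
  assumes x: "x \<in> Forms1 \<otimes>\<^sub>A Forms1"
  shows "proj J 1 1 (wedge x) = wedge (pr_tensor (- \<i>) \<i> x) + wedge (pr_tensor \<i> (- \<i>) x)"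
proof -
  have w: "additive_on (Forms1 \<otimes>\<^sub>A Forms1) (\<lambda>x. wedge (pr_tensor s t x))" for s t
    by (rule additive_on_compose[OF pr_tensor_add additive_wedge[of UNIV]]) simp
  have "wedge x = wedge (pr_tensor \<i> \<i> x) + (wedge (pr_tensor (- \<i>) \<i> x) + wedge (pr_tensor \<i> (- \<i>) x)) + wedge (pr_tensor (- \<i>) (- \<i>) x)"
  proof (rule tprod_eqI[OF x additive_wedge])
    show "additive_on (Forms1 \<otimes>\<^sub>A Forms1) (\<lambda>x. wedge (pr_tensor \<i> \<i> x) + (wedge (pr_tensor (- \<i>) \<i> x) + wedge (pr_tensor \<i> (- \<i>) x)) + wedge (pr_tensor (- \<i>) (- \<i>) x))"
      by (intro additive_on_plus w)
    fix x y :: "'w tensor" assume "x \<in> Forms1" "y \<in> Forms1"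
    then obtain \<xi> \<eta> where *: "x = form \<xi>" "\<xi> \<in> forms 1" "y = form \<eta>" "\<eta> \<in> forms 1" by auto
    have "wedge (x * y) = (pr \<i> \<xi> + pr (- \<i>) \<xi>) * (pr \<i> \<eta> + pr (- \<i>) \<eta>)"
      by (simp add: * wedge_mult pr_sum)
    then show "wedge (x * y) = wedge (pr_tensor \<i> \<i> (x * y)) + (wedge (pr_tensor (- \<i>) \<i> (x * y)) + wedge (pr_tensor \<i> (- \<i>) (x * y))) + wedge (pr_tensor (- \<i>) (- \<i>) (x * y))"
      by (simp add: * pr_tensor_mult wedge_mult algebra_simps)
  qed
  then show ?thesis
    using proj_11[OF wedge_pr_tensor_in(1)[OF x] subgrp_add[OF subgrp_pq wedge_pr_tensor_in(2,3)[OF x]] wedge_pr_tensor_in(4)[OF x]] by simp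
qed

subsection \<open>The inverse of the wedge product\<close>

abbreviation PQ11 :: "'w tensor set" where
  "PQ11 \<equiv> PQ_Forms J 1 0 \<otimes>\<^sub>A PQ_Forms J 0 1"

lemma phi_wedge: "z \<in> PQ11 \<Longrightarrow> phi J (wedge z) = z"
  unfolding phi_def using wedge_bij by (intro the_inv_into_f_f) (auto simp: bij_betw_def)

lemma phi_in: "\<omega> \<in> pq_forms J 1 1 \<Longrightarrow> phi J \<omega> \<in> PQ11"
  and wedge_phi: "\<omega> \<in> pq_forms J 1 1 \<Longrightarrow> wedge (phi J \<omega>) = \<omega>"
proof -
  assume "\<omega> \<in> pq_forms J 1 1"
  then have "\<omega> \<in> wedge ` PQ11" using bij_betw_imp_surj_on[OF wedge_bij] by simp
  then obtain z where "z \<in> PQ11" "wedge z = \<omega>" by blast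
  then show "phi J \<omega> \<in> PQ11" "wedge (phi J \<omega>) = \<omega>" using phi_wedge by auto
qed

lemma phi_add: "\<omega> \<in> pq_forms J 1 1 \<Longrightarrow> \<omega>' \<in> pq_forms J 1 1 \<Longrightarrow> phi J (\<omega> + \<omega>') = phi J \<omega> + phi J \<omega>'"
  using phi_wedge[OF subgrp_add[OF subgrp_tprod phi_in phi_in], of \<omega> \<omega>'] by (simp add: wedge_add wedge_phi)

lemma phi_uminus: "\<omega> \<in> pq_forms J 1 1 \<Longrightarrow> phi J (- \<omega>) = - phi J \<omega>"
  using phi_wedge[OF subgrp_uminus[OF subgrp_tprod phi_in], of \<omega>] by (simp add: wedge_uminus wedge_phi)

lemma phi_zero: "phi J 0 = 0"
  using phi_wedge[OF subgrp_zero[OF subgrp_tprod]] by (simp add: wedge_zero)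

lemma phi_sum: "(\<And>i. i \<in> I \<Longrightarrow> f i \<in> pq_forms J 1 1) \<Longrightarrow> phi J (sum f I) = (\<Sum>i\<in>I. phi J (f i))"
  by (induction I rule: infinite_finite_induct) (simp_all add: phi_zero phi_add subgrp_sum[OF subgrp_pq])

lemma phi_rmult: "\<omega> \<in> pq_forms J 1 1 \<Longrightarrow> a \<in> forms 0 \<Longrightarrow> phi J (\<omega> * a) = phi J \<omega> * form a"
  using phi_wedge[OF bimod_rmult[OF bimod_tprod[OF bimod_lmod[OF bimod_10] bimod_01] _ phi_in], of a \<omega>]
  by (simp add: wedge_mult wedge_phi)

text \<open>Through the isomorphism of hypothesis (a), stability under A is transferred from
  \<open>PQ11\<close>, where it only concerns 1-forms.\<close>

lemma pq_11_rmult: "\<omega> \<in> pq_forms J 1 1 \<Longrightarrow> a \<in> forms 0 \<Longrightarrow> \<omega> * a \<in> pq_forms J 1 1"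
proof -
  assume *: "\<omega> \<in> pq_forms J 1 1" "a \<in> forms 0"
  have "phi J \<omega> * form a \<in> PQ11"
    by (rule bimod_rmult[OF bimod_tprod[OF bimod_lmod[OF bimod_10] bimod_01] *(2) phi_in[OF *(1)]])
  from wedge_in[OF this] show ?thesis by (simp add: wedge_mult wedge_phi *)
qed

lemma PQ11_FF: "z \<in> PQ11 \<Longrightarrow> z \<in> Forms1 \<otimes>\<^sub>A Forms1"
  using tprod_mono[of "PQ_Forms J 1 0" Forms1 "PQ_Forms J 0 1" Forms1] pq_forms_1 by blast

lemma PQ11_FPQ: "z \<in> PQ11 \<Longrightarrow> z \<in> Forms1 \<otimes>\<^sub>A PQ_Forms J 0 1"
  using tprod_mono[of "PQ_Forms J 1 0" Forms1 "PQ_Forms J 0 1" "PQ_Forms J 0 1"] pq_forms_1 by blast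

subsection \<open>Compatibility of the connection with the types\<close>

text \<open>Each type projection is a complex combination of the identity and J, and by hypothesis
  (b) the connection commutes with J acting on the first factor.\<close>

lemma sq_pr:
  assumes \<xi>: "\<xi> \<in> forms 1"
  shows "sq (pr s \<xi>) = tensor_map Forms1 (pr_form s) Forms1 id (sq \<xi>)"
proof -
  \<comment> \<open>Complex linearity of the connection: the scalar c 1 lies in A and is killed by
    d, so the twisted term of the left Leibniz rule vanishes.\<close>
  have sqc: "sq (c *\<^sub>C \<eta>) = form (c *\<^sub>C 1) * sq \<eta>" if \<eta>: "\<eta> \<in> forms 1" for c \<eta>
  proof -
    have "ext_deriv (1 * 1) = ext_deriv 1 + (ext_deriv 1 :: 'w)"
      by (subst ext_deriv_mult_0) (simp_all add: forms_one)
    then have "ext_deriv (c *\<^sub>C (1 :: 'w)) = 0" by (simp add: ext_deriv_scaleC scaleC_zero_right)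
    then show ?thesis
      using sq_lmult[OF \<eta> scaleC_forms_0, of c] additive_on_zero[OF si_add subgrp_tprod]
      by (simp add: form_zero flip: scaleC_eq_mult)
  qed
  let ?JJ = "tensor_map Forms1 (on_forms J) Forms1 id"
  have J_rlin: "rlin Forms1 (on_forms J)"
    unfolding rlin_def
    by (auto simp: tmod_Forms1 additive_on_def on_forms_def wedge_add J_add form_add form_rmult J_rmult)
  note id = llin_id[OF tmod_lsummand[OF tmod_Forms1]]
  let ?h = "form ((1/2) *\<^sub>C 1)" and ?s = "form (s *\<^sub>C 1)"
  have "sq (pr s \<xi>) = ?h * (sq \<xi> + ?s * ?JJ (sq \<xi>))"
    unfolding pr_def using \<xi> by (simp add: sqc forms_add forms_scaleC J_forms sq_add sq_J)
  also have "\<dots> = tensor_map Forms1 (pr_form s) Forms1 id (sq \<xi>)"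
  proof (rule tprod_eqI[OF sq_in[OF \<xi>]])
    show "additive_on (Forms1 \<otimes>\<^sub>A Forms1) (\<lambda>x. ?h * (x + ?s * ?JJ x))"
      by (intro additive_on_mult_left' additive_on_plus additive_on_id tmap_add J_rlin id)
    show "additive_on (Forms1 \<otimes>\<^sub>A Forms1) (tensor_map Forms1 (pr_form s) Forms1 id)"
      by (rule tmap_add[OF pr_form_rlin id])
    fix x y :: "'w tensor" assume xy: "x \<in> Forms1" "y \<in> Forms1"
    then obtain \<eta> where \<eta>: "x = form \<eta>" "\<eta> \<in> forms 1" by auto
    have "?h * (x * y + ?s * (on_forms J x * y)) = ?h * (x + ?s * on_forms J x) * y"
      by (simp add: distrib_left distrib_right mult.assoc)
    also have "?h * (x + ?s * on_forms J x) = pr_form s x"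
      using \<eta> by (simp add: on_forms_def pr_form_def pr_def form_lmult scaleC_forms_0 form_add[symmetric]
          mult_scaleC_left)
    finally show "?h * (x * y + ?s * ?JJ (x * y)) = tensor_map Forms1 (pr_form s) Forms1 id (x * y)"
      using xy by (simp add: tmap_mult[OF J_rlin id] tmap_mult[OF pr_form_rlin id])
  qed
  finally show ?thesis .
qed

lemma pr_idem: "\<xi> \<in> forms 1 \<Longrightarrow> pr \<i> (pr \<i> \<xi>) = pr \<i> \<xi>"
  by (rule pr_of_01(1)[OF pr_01])

lemma pr_tensor_sq_pr:
  assumes \<xi>: "\<xi> \<in> forms 1"
  shows "pr_tensor \<i> t (sq (pr \<i> \<xi>)) = pr_tensor \<i> t (sq \<xi>)"
  unfolding sq_pr[OF \<xi>]
proof (rule tprod_eqI[OF sq_in[OF \<xi>] _ pr_tensor_add])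
  note id = llin_id[OF tmod_lsummand[OF tmod_Forms1]]
  have "tensor_map Forms1 (pr_form \<i>) Forms1 id x \<in> Forms1 \<otimes>\<^sub>A Forms1" if "x \<in> Forms1 \<otimes>\<^sub>A Forms1" for x
    by (rule additive_image_in[OF that tmap_add[OF pr_form_rlin id] subgrp_tprod])
      (auto simp: tmap_mult[OF pr_form_rlin id] pr_form_form intro!: tprodI pr_forms)
  then show "additive_on (Forms1 \<otimes>\<^sub>A Forms1) (\<lambda>x. pr_tensor \<i> t (tensor_map Forms1 (pr_form \<i>) Forms1 id x))"
    by (rule additive_on_compose[OF tmap_add[OF pr_form_rlin id] pr_tensor_add])
  fix x y :: "'w tensor" assume "x \<in> Forms1" "y \<in> Forms1"
  then show "pr_tensor \<i> t (tensor_map Forms1 (pr_form \<i>) Forms1 id (x * y)) = pr_tensor \<i> t (x * y)"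
    by (auto simp: tmap_mult[OF pr_form_rlin id] pr_form_form pr_tensor_mult pr_forms pr_idem)
qed

lemma vec10_pr: "u \<in> vec10 J \<Longrightarrow> \<xi> \<in> forms 1 \<Longrightarrow> vec_apply u (pr (- \<i>) \<xi>) = vec_apply u \<xi>"
  by (simp add: pr_def vec_apply_scaleC forms_add forms_scaleC J_forms vec_apply_add vec10_def scaleC_scaleC)
    (simp add: scaleC_add_right scaleC_scaleC scaleC_one scaleC_add_left[symmetric])

lemma pi01_id_eq: "pi01_id J = tensor_map Forms1 (pr_form \<i>) Fields id"
  unfolding pi01_id_def by (rule tensor_map_cong) (simp_all add: on_forms_proj)

lemma pi01_add: "additive_on (Forms1 \<otimes>\<^sub>A Fields) (pi01_id J)"
  unfolding pi01_id_eq by (rule tmap_add[OF pr_form_rlin llin_id[OF tmod_lsummand[OF tmod_Fields]]])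

lemma pi01_mult: "\<omega> \<in> forms 1 \<Longrightarrow> pi01_id J (form \<omega> * vfield v) = form (pr \<i> \<omega>) * vfield v"
  unfolding pi01_id_eq by (simp add: tmap_mult[OF pr_form_rlin llin_id[OF tmod_lsummand[OF tmod_Fields]]] pr_form_form)

lemma pi01_in: "X \<in> Forms1 \<otimes>\<^sub>A N \<Longrightarrow> N \<subseteq> Fields \<Longrightarrow> pi01_id J X \<in> PQ_Forms J 0 1 \<otimes>\<^sub>A N"
proof (rule additive_image_in[OF _ additive_on_subset[OF pi01_add tprod_mono] subgrp_tprod])
  fix x y :: "'w tensor" assume "N \<subseteq> Fields" "x \<in> Forms1" "y \<in> N"
  then obtain \<omega> v where "x = form \<omega>" "\<omega> \<in> forms 1" "y = vfield v" "vfield v \<in> N" by blast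
  then show "pi01_id J (x * y) \<in> PQ_Forms J 0 1 \<otimes>\<^sub>A N" by (auto simp: pi01_mult intro!: tprodI pr_01)
qed auto

lemma pr_form_rev_ev: "X \<in> Forms1 \<otimes>\<^sub>A Fields \<Longrightarrow> \<xi> \<in> forms 1 \<Longrightarrow> pr_form \<i> (rev_ev \<xi> X) = rev_ev \<xi> (pi01_id J X)"
proof (erule tprod_eqI)
  assume \<xi>: "\<xi> \<in> forms 1"
  show "additive_on (Forms1 \<otimes>\<^sub>A Fields) (\<lambda>X. pr_form \<i> (rev_ev \<xi> X))"
    by (rule additive_on_compose[OF rev_ev_add[OF \<xi>] pr_form_add[of UNIV]]) simp
  have "pi01_id J X \<in> Forms1 \<otimes>\<^sub>A Fields" if "X \<in> Forms1 \<otimes>\<^sub>A Fields" for X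
    using pi01_in[OF that] tprod_mono[of "PQ_Forms J 0 1" Forms1 Fields Fields] pq_forms_1 by blast
  then show "additive_on (Forms1 \<otimes>\<^sub>A Fields) (\<lambda>X. rev_ev \<xi> (pi01_id J X))"
    by (rule additive_on_compose[OF pi01_add rev_ev_add[OF \<xi>]])
  fix x y :: "'w tensor" assume "x \<in> Forms1" "y \<in> Fields"
  then show "pr_form \<i> (rev_ev \<xi> (x * y)) = rev_ev \<xi> (pi01_id J (x * y))"
    using \<xi> by (auto simp: rev_ev_mult pi01_mult pr_forms form_rmult vec_apply_forms pr_form_form pr_rmult)
qed

text \<open>A field of type (1,0) sees only the (1,0) part of the first factor, and the projection
  acts on the second. This isolates the component in \<open>PQ11\<close>, the one that can be
  recovered from its wedge product.\<close>

lemma pr_form_contr: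
  assumes u: "u \<in> vec10 J" and z: "z \<in> Forms1 \<otimes>\<^sub>A Forms1"
  shows "pr_form \<i> (contr u z) = contr u (pr_tensor (- \<i>) \<i> z)"
proof (rule tprod_eqI[OF z])
  show "additive_on (Forms1 \<otimes>\<^sub>A Forms1) (\<lambda>z. pr_form \<i> (contr u z))"
    by (rule additive_on_compose[OF additive_on_subset[OF contr_add] pr_form_add[of UNIV]]) (auto intro: Forms1_T)
  show "additive_on (Forms1 \<otimes>\<^sub>A Forms1) (\<lambda>z. contr u (pr_tensor (- \<i>) \<i> z))"
    by (rule additive_on_compose[OF pr_tensor_add contr_add]) (rule Forms1_T[OF PQ11_FF[OF pr_tensor_in[OF _ pr_10 pr_01]]])
  fix x y :: "'w tensor" assume "x \<in> Forms1" "y \<in> Forms1"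
  then show "pr_form \<i> (contr u (x * y)) = contr u (pr_tensor (- \<i>) \<i> (x * y))"
    by (auto simp: contr_mult pr_tensor_mult pr_forms vec10_pr[OF u] form_lmult vec_apply_forms pr_form_form pr_lmult)
qed

lemma dbar_eq: "b \<in> forms 0 \<Longrightarrow> dbar J 0 0 b = pr \<i> (ext_deriv b)"
  using proj_1(1)[OF ext_deriv_0] by (simp add: dbar_def One_nat_def)

lemma dbar_in: "b \<in> forms 0 \<Longrightarrow> dbar J 0 0 b \<in> pq_forms J 0 1"
  by (simp add: dbar_eq pr_01 ext_deriv_0)

lemma dbar_add: "b \<in> forms 0 \<Longrightarrow> c \<in> forms 0 \<Longrightarrow> dbar J 0 0 (b + c) = dbar J 0 0 b + dbar J 0 0 c"
  by (simp add: dbar_eq forms_add ext_deriv_add pr_add)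

lemma dbar_mult: "b \<in> forms 0 \<Longrightarrow> c \<in> forms 0 \<Longrightarrow> dbar J 0 0 (b * c) = dbar J 0 0 b * c + b * dbar J 0 0 c"
  by (simp add: dbar_eq forms_0_mult ext_deriv_mult_0 pr_add pr_lmult pr_rmult ext_deriv_0)

text \<open>
  The core of the argument: as the (1,1) part of the torsion vanishes and \<open>dd = 0\<close>, the two mixed
  parts of \<open>\<square>db\<close> are opposite after the wedge product, and one of them only depends on \<open>\<partial>\<close>-bar of \<open>b\<close>.
\<close>

lemma dbar_vec:
  assumes u: "u \<in> vec10 J" and b: "b \<in> forms 0" and db: "dual_basis10 J r \<eta> e"
    and eq: "dbar J 0 0 b = (\<Sum>k<n::nat. \<xi> k * c k)"
    and \<xi>: "\<And>k. k < n \<Longrightarrow> \<xi> k \<in> pq_forms J 0 1" and c: "\<And>k. k < n \<Longrightarrow> c k \<in> forms 0"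
  shows "form (dbar J 0 0 (vec_apply u (ext_deriv b))) =
    rev_ev (ext_deriv b) (pi01_id J (sq_vec sq u))
    - (\<Sum>k<n. contr u (phi J (wedge (pr_tensor \<i> (- \<i>) (sq (\<xi> k))))) * form (c k))
    - (\<Sum>k<n. \<Sum>i<r. contr u (phi J (\<xi> k * \<eta> i)) * form (vec_apply (e i) (ext_deriv (c k))))"
proof -
  let ?w = "\<lambda>z. wedge (pr_tensor \<i> (- \<i>) z)"
  let ?y = "pr_tensor (- \<i>) \<i> (sq (ext_deriv b))"
  let ?a = "\<lambda>k. ?w (sq (\<xi> k)) * c k" and ?b = "\<lambda>k i. (\<xi> k * \<eta> i) * vec_apply (e i) (ext_deriv (c k))"
  have db1: "ext_deriv b \<in> forms 1" by (rule ext_deriv_0[OF b])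
  have \<xi>1: "\<xi> k \<in> forms 1" if "k < n" for k by (rule pq_forms_1(1)[OF \<xi>[OF that]])
  have dc: "ext_deriv (c k) \<in> forms 1" if "k < n" for k by (rule ext_deriv_0[OF c[OF that]])
  have \<eta>: "\<eta> i \<in> pq_forms J 1 0" and e: "e i \<in> vec10 J" if "i < r" for i
    using db that by (auto simp: dual_basis10_def)
  have sum10: "\<zeta> = (\<Sum>i<r. \<eta> i * vec_apply (e i) \<zeta>)" if "\<zeta> \<in> pq_forms J 1 0" for \<zeta>
    using db that by (simp add: dual_basis10_def)
  have \<xi>\<eta>: "\<xi> k * \<eta> i \<in> pq_forms J 1 1" if "k < n" "i < r" for k i
    using pq_forms_mult[OF \<xi>[OF that(1)] \<eta>[OF that(2)]] by simp
  have ec: "vec_apply (e i) (ext_deriv (c k)) \<in> forms 0" if "k < n" for k i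
    by (rule vec_apply_forms[OF dc[OF that]])
  have a11: "?w (sq (\<xi> k)) \<in> pq_forms J 1 1" if "k < n" for k by (rule wedge_pr_tensor_in(3)[OF sq_in[OF \<xi>1[OF that]]])
  have a11': "?a k \<in> pq_forms J 1 1" if "k < n" for k by (rule pq_11_rmult[OF a11 c]) (rule that)+
  have b11: "?b k i \<in> pq_forms J 1 1" if "k < n" "i < r" for k i by (rule pq_11_rmult[OF \<xi>\<eta> ec]) (rule that)+
  have w_add: "additive_on (Forms1 \<otimes>\<^sub>A Forms1) ?w"
    by (rule additive_on_compose[OF pr_tensor_add additive_wedge[of UNIV]]) simp
  have "proj J 1 1 (wedge (sq (ext_deriv b))) = 0"
    using bspec[OF torsion db1] by (simp add: torsion_def ext_deriv_ext_deriv)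
  then have "wedge ?y = - ?w (sq (ext_deriv b))"
    unfolding proj_11_wedge[OF sq_in[OF db1]] by (simp add: eq_neg_iff_add_eq_0)
  also have "?w (sq (ext_deriv b)) = ?w (sq (\<Sum>k<n. \<xi> k * c k))"
    using pr_tensor_sq_pr[OF db1] dbar_eq[OF b] eq by metis
  also have "\<dots> = (\<Sum>k<n. ?w (sq (\<xi> k * c k)))"
  proof -
    have sq0: "sq 0 = 0" using sq_add[OF forms_zero forms_zero] by simp
    have \<xi>c: "\<xi> k * c k \<in> forms 1" if "k < n" for k using that by (intro forms_mult_0 \<xi>1 c)
    have "sq (\<Sum>k<m. \<xi> k * c k) = (\<Sum>k<m. sq (\<xi> k * c k))" if "m \<le> n" for m
      using that
    proof (induction m)
      case (Suc m)
      have "(\<Sum>k<m. \<xi> k * c k) \<in> forms 1"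
        using Suc.prems by (intro subgrp_sum subgrp_forms \<xi>c) auto
      then show ?case using Suc by (simp add: sq_add \<xi>c)
    qed (simp add: sq0)
    then show ?thesis using additive_on_sum[OF w_add subgrp_tprod, of "{..<n}" "\<lambda>k. sq (\<xi> k * c k)"]
      by (simp add: sq_in \<xi>c)
  qed
  also have "\<dots> = (\<Sum>k<n. ?a k + (\<Sum>i<r. ?b k i))"
  proof (rule sum.cong[OF HOL.refl])
    fix k assume "k \<in> {..<n}"
    then have k: "k < n" by simp
    \<comment> \<open>The right Leibniz rule. In the term with d c_k the left factor already has
      type (0,1), so that only the (1,0) part of d c_k survives.\<close>
    have "?w (sq (\<xi> k * c k)) = ?w (sq (\<xi> k) * form (c k)) + ?w (form (\<xi> k) * form (ext_deriv (c k)))"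
      unfolding sq_rmult[OF \<xi>1[OF k] c[OF k]]
      by (rule additive_on_add[OF w_add bimod_rmult[OF tmod_bimod[OF tmod_FF] c[OF k] sq_in[OF \<xi>1[OF k]]] form_FF[OF \<xi>1[OF k] dc[OF k]]])
    also have "?w (sq (\<xi> k) * form (c k)) = ?a k"
      by (simp add: wedge_pr_tensor_rmult sq_in \<xi>1 k c wedge_mult)
    also have "?w (form (\<xi> k) * form (ext_deriv (c k))) = \<xi> k * pr (- \<i>) (ext_deriv (c k))"
      by (simp add: pr_tensor_mult \<xi>1 k dc wedge_mult pr_of_01 \<xi>)
    also have "pr (- \<i>) (ext_deriv (c k)) = (\<Sum>i<r. \<eta> i * vec_apply (e i) (pr (- \<i>) (ext_deriv (c k))))"
      by (rule sum10[OF pr_10[OF dc[OF k]]])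
    also have "\<dots> = (\<Sum>i<r. \<eta> i * vec_apply (e i) (ext_deriv (c k)))"
      by (rule sum.cong) (simp_all add: vec10_pr e dc k)
    also have "\<xi> k * \<dots> = (\<Sum>i<r. ?b k i)" by (simp add: sum_distrib_left mult.assoc)
    finally show "?w (sq (\<xi> k * c k)) = ?a k + (\<Sum>i<r. ?b k i)" .
  qed
  finally have wy: "wedge ?y = - (\<Sum>k<n. ?a k + (\<Sum>i<r. ?b k i))" .
  have s11: "?a k + (\<Sum>i<r. ?b k i) \<in> pq_forms J 1 1" if "k < n" for k
    by (intro subgrp_add[OF subgrp_pq] subgrp_sum[OF subgrp_pq] a11' b11) (use that in auto)
  have "?y = phi J (wedge ?y)"
    by (rule phi_wedge[OF pr_tensor_in[OF sq_in[OF db1] pr_10 pr_01], symmetric])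
  also have "\<dots> = - (\<Sum>k<n. phi J (?w (sq (\<xi> k))) * form (c k) +
      (\<Sum>i<r. phi J (\<xi> k * \<eta> i) * form (vec_apply (e i) (ext_deriv (c k)))))"
  proof -
    have "phi J (wedge ?y) = - (\<Sum>k<n. phi J (?a k + (\<Sum>i<r. ?b k i)))"
      unfolding wy by (subst phi_uminus, rule subgrp_sum[OF subgrp_pq], use s11 in force, subst phi_sum, use s11 in force) simp
    also have "(\<Sum>k<n. phi J (?a k + (\<Sum>i<r. ?b k i))) = (\<Sum>k<n. phi J (?w (sq (\<xi> k))) * form (c k) +
        (\<Sum>i<r. phi J (\<xi> k * \<eta> i) * form (vec_apply (e i) (ext_deriv (c k)))))"
    proof (rule sum.cong[OF HOL.refl])
      fix k assume "k \<in> {..<n}"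
      then have k: "k < n" by simp
      have "(\<Sum>i<r. ?b k i) \<in> pq_forms J 1 1" using b11[OF k] by (intro subgrp_sum[OF subgrp_pq]) simp
      then have "phi J (?a k + (\<Sum>i<r. ?b k i)) = phi J (?a k) + phi J (\<Sum>i<r. ?b k i)"
        by (rule phi_add[OF a11'[OF k]])
      also have "phi J (\<Sum>i<r. ?b k i) = (\<Sum>i<r. phi J (?b k i))"
        using b11[OF k] by (intro phi_sum) simp
      also have "\<dots> = (\<Sum>i<r. phi J (\<xi> k * \<eta> i) * form (vec_apply (e i) (ext_deriv (c k))))"
        using \<xi>\<eta>[OF k] ec[OF k] by (intro sum.cong) (simp_all add: phi_rmult)
      finally show "phi J (?a k + (\<Sum>i<r. ?b k i)) = phi J (?w (sq (\<xi> k))) * form (c k) +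
          (\<Sum>i<r. phi J (\<xi> k * \<eta> i) * form (vec_apply (e i) (ext_deriv (c k))))"
        by (simp only: phi_rmult[OF a11[OF k] c[OF k]])
    qed
    finally show ?thesis .
  qed
  finally have y: "?y = - (\<Sum>k<n. phi J (?w (sq (\<xi> k))) * form (c k) +
      (\<Sum>i<r. phi J (\<xi> k * \<eta> i) * form (vec_apply (e i) (ext_deriv (c k)))))" .
  have FT: "phi J \<omega> * t \<in> Forms1_T" if "\<omega> \<in> pq_forms J 1 1" for \<omega> t
  proof -
    have "phi J \<omega> * t \<in> (Forms1 \<otimes>\<^sub>A Forms1) \<otimes>\<^sub>A UNIV" by (rule tprodI[OF PQ11_FF[OF phi_in[OF that]]]) simp
    then show ?thesis unfolding tprod_assoc by (rule Forms1_T)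
  qed
  have FT': "phi J \<omega> \<in> Forms1_T" if "\<omega> \<in> pq_forms J 1 1" for \<omega>
    using FT[OF that, of 1] by simp
  let ?A = "\<lambda>k. phi J (?w (sq (\<xi> k))) * form (c k)"
    and ?B = "\<lambda>k i. phi J (\<xi> k * \<eta> i) * form (vec_apply (e i) (ext_deriv (c k)))"
  have A: "?A k \<in> Forms1_T" if "k < n" for k by (rule FT[OF a11[OF that]])
  have B: "?B k i \<in> Forms1_T" if "k < n" "i < r" for k i by (rule FT[OF \<xi>\<eta>[OF that]])
  have sB: "(\<Sum>i<r. ?B k i) \<in> Forms1_T" if "k < n" for k
    using B[OF that] by (intro subgrp_sum[OF subgrp_tprod]) simp
  have sAB: "?A k + (\<Sum>i<r. ?B k i) \<in> Forms1_T" if "k < n" for k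
    by (rule subgrp_add[OF subgrp_tprod A[OF that] sB[OF that]])
  have "contr u ?y = - contr u (\<Sum>k<n. ?A k + (\<Sum>i<r. ?B k i))"
    unfolding y using sAB by (intro additive_on_uminus[OF contr_add subgrp_tprod] subgrp_sum[OF subgrp_tprod]) simp
  also have "contr u (\<Sum>k<n. ?A k + (\<Sum>i<r. ?B k i)) = (\<Sum>k<n. contr u (?A k + (\<Sum>i<r. ?B k i)))"
    using sAB by (intro additive_on_sum[OF contr_add subgrp_tprod]) simp
  also have "\<dots> = (\<Sum>k<n. contr u (phi J (?w (sq (\<xi> k)))) * form (c k) +
      (\<Sum>i<r. contr u (phi J (\<xi> k * \<eta> i)) * form (vec_apply (e i) (ext_deriv (c k)))))"
  proof (rule sum.cong[OF HOL.refl])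
    fix k assume "k \<in> {..<n}"
    then have k: "k < n" by simp
    have "contr u (?A k + (\<Sum>i<r. ?B k i)) = contr u (?A k) + contr u (\<Sum>i<r. ?B k i)"
      by (rule additive_on_add[OF contr_add A[OF k] sB[OF k]])
    also have "contr u (\<Sum>i<r. ?B k i) = (\<Sum>i<r. contr u (?B k i))"
      using B[OF k] by (intro additive_on_sum[OF contr_add subgrp_tprod]) simp
    also have "\<dots> = (\<Sum>i<r. contr u (phi J (\<xi> k * \<eta> i)) * form (vec_apply (e i) (ext_deriv (c k))))"
      using FT'[OF \<xi>\<eta>[OF k]] by (intro sum.cong) (simp_all add: contr_mult_right)
    finally show "contr u (?A k + (\<Sum>i<r. ?B k i)) = contr u (phi J (?w (sq (\<xi> k)))) * form (c k) +
        (\<Sum>i<r. contr u (phi J (\<xi> k * \<eta> i)) * form (vec_apply (e i) (ext_deriv (c k))))"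
      by (simp only: contr_mult_right[OF FT'[OF a11[OF k]]])
  qed
  finally have "contr u ?y = - (\<Sum>k<n. contr u (phi J (?w (sq (\<xi> k)))) * form (c k) +
      (\<Sum>i<r. contr u (phi J (\<xi> k * \<eta> i)) * form (vec_apply (e i) (ext_deriv (c k)))))" .
  then have cy: "contr u ?y = - (\<Sum>k<n. contr u (phi J (?w (sq (\<xi> k)))) * form (c k)) -
      (\<Sum>k<n. \<Sum>i<r. contr u (phi J (\<xi> k * \<eta> i)) * form (vec_apply (e i) (ext_deriv (c k))))"
    by (simp add: sum.distrib)
  have ub: "vec_apply u (ext_deriv b) \<in> forms 0" by (rule vec_apply_forms[OF db1])
  \<comment> \<open>Duality for \<open>u\<close> and db, projected to type (0,1). The contraction
    term becomes that of the component \<open>?y\<close> computed above.\<close>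
  have "form (dbar J 0 0 (vec_apply u (ext_deriv b))) = pr_form \<i> (form (ext_deriv (vec_apply u (ext_deriv b))))"
    by (simp add: pr_form_form dbar_eq[OF ub])
  also have "\<dots> = pr_form \<i> (rev_ev (ext_deriv b) (sq_vec sq u)) + pr_form \<i> (contr u (sq (ext_deriv b)))"
    unfolding sq_vec_eq[OF db1] by (rule additive_on_add[OF pr_form_add[of UNIV]]) simp_all
  also have "\<dots> = rev_ev (ext_deriv b) (pi01_id J (sq_vec sq u)) + contr u ?y"
    by (simp add: pr_form_rev_ev sq_vec_in db1 pr_form_contr[OF u] sq_in)
  finally show ?thesis unfolding cy by simp
qed

end

section \<open>The holomorphic structure\<close>

context acs
begin

lemma
  assumes a: "a \<in> forms 0"
  shows form_act_add: "additive_on (Forms1 \<otimes>\<^sub>A TV) (\<lambda>X. form_act sq si X a)"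
    and form_act_mult: "\<omega> \<in> Forms1 \<Longrightarrow> x \<in> TV \<Longrightarrow> form_act sq si (\<omega> * x) a = wedge \<omega> * act sq si x a"
proof -
  have "balanced Forms1 TV (\<lambda>\<omega> x. wedge \<omega> * act sq si x a)"
    unfolding balanced_def
    by (auto simp: additive_on_def wedge_add distrib_right distrib_left additive_on_add[OF act_add[OF a]]
        wedge_mult act_lmult a mult.assoc)
  note * = tensor_lift[OF tmod_Forms1 lsummand_tensor_algebra this]
  show "additive_on (Forms1 \<otimes>\<^sub>A TV) (\<lambda>X. form_act sq si X a)"
    and "\<omega> \<in> Forms1 \<Longrightarrow> x \<in> TV \<Longrightarrow> form_act sq si (\<omega> * x) a = wedge \<omega> * act sq si x a"
    unfolding form_act_def using * by auto
qed

lemma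
  assumes y: "y \<in> TV"
  shows form_bullet_add: "additive_on (Forms1 \<otimes>\<^sub>A TV) (\<lambda>X. form_bullet sq si X y)"
    and form_bullet_mult: "\<omega> \<in> Forms1 \<Longrightarrow> x \<in> TV \<Longrightarrow> form_bullet sq si (\<omega> * x) y = \<omega> * bullet sq si x y"
proof -
  have "balanced Forms1 TV (\<lambda>\<omega> x. \<omega> * bullet sq si x y)"
    unfolding balanced_def
    by (auto simp: additive_on_def distrib_right distrib_left additive_on_add[OF bullet_add_left[OF y]]
        bullet_lmult y mult.assoc)
  note * = tensor_lift[OF tmod_Forms1 lsummand_tensor_algebra this]
  show "additive_on (Forms1 \<otimes>\<^sub>A TV) (\<lambda>X. form_bullet sq si X y)"
    and "\<omega> \<in> Forms1 \<Longrightarrow> x \<in> TV \<Longrightarrow> form_bullet sq si (\<omega> * x) y = \<omega> * bullet sq si x y"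
    unfolding form_bullet_def using * by auto
qed

lemma Fields_TV: "Fields \<subseteq> (TV :: 'w tensor set)"
  by (auto intro: generator_tensor_algebra)

lemma FV_FTV: "(X :: 'w tensor) \<in> Forms1 \<otimes>\<^sub>A Fields \<Longrightarrow> X \<in> Forms1 \<otimes>\<^sub>A TV"
  using tprod_mono[of Forms1 Forms1, OF subset_refl Fields_TV] by blast

text \<open>By \<open>act_lmul\<close>, the product of \<omega> \<otimes> u with y acts on a as
  \<omega> times u(d(y acting on a)), which is the pairing of \<omega> \<otimes> u with that
  differential.\<close>

lemma form_act_form_bullet:
  assumes a: "a \<in> forms 0" and y: "y \<in> TV" and X: "X \<in> Forms1 \<otimes>\<^sub>A Fields"
  shows "form_bullet sq si X y \<in> Forms1 \<otimes>\<^sub>A TV"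
    and "form_act sq si (form_bullet sq si X y) a = wedge (rev_ev (ext_deriv (act sq si y a)) X)"
proof -
  have bl: "form_bullet sq si (\<omega> * vfield u) y = \<omega> * lmul u y" if "\<omega> \<in> Forms1" for \<omega> u
    using form_bullet_mult[OF y that, of "vfield u"] Fields_TV by (auto simp: bullet_vfield[OF y])
  have add: "additive_on (Forms1 \<otimes>\<^sub>A Fields) (\<lambda>X. form_bullet sq si X y)"
    by (rule additive_on_subset[OF form_bullet_add[OF y]]) (use FV_FTV in blast)
  have in_TV: "form_bullet sq si X y \<in> Forms1 \<otimes>\<^sub>A TV" if "X \<in> Forms1 \<otimes>\<^sub>A Fields" for X
  proof (rule additive_image_in[OF that add subgrp_tprod])
    fix \<omega> w :: "'w tensor" assume "\<omega> \<in> Forms1" "w \<in> Fields"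
    then show "form_bullet sq si (\<omega> * w) y \<in> Forms1 \<otimes>\<^sub>A TV"
      using bl[of \<omega>] tprodI[of \<omega> Forms1 _ TV] lmul_in[OF y] by auto
  qed
  show "form_bullet sq si X y \<in> Forms1 \<otimes>\<^sub>A TV" by (rule in_TV[OF X])
  have db: "ext_deriv (act sq si y a) \<in> forms 1" by (intro ext_deriv_0 act_forms_0 a y)
  show "form_act sq si (form_bullet sq si X y) a = wedge (rev_ev (ext_deriv (act sq si y a)) X)"
  proof (rule tprod_eqI[OF X])
    show "additive_on (Forms1 \<otimes>\<^sub>A Fields) (\<lambda>X. form_act sq si (form_bullet sq si X y) a)"
      by (rule additive_on_compose[OF add form_act_add[OF a] in_TV])
    show "additive_on (Forms1 \<otimes>\<^sub>A Fields) (\<lambda>X. wedge (rev_ev (ext_deriv (act sq si y a)) X))"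
      by (rule additive_on_compose[OF rev_ev_add[OF db] additive_wedge[of UNIV]]) simp
    fix \<omega> w :: "'w tensor" assume \<omega>: "\<omega> \<in> Forms1" and "w \<in> Fields"
    then obtain u where u: "w = vfield u" by auto
    show "form_act sq si (form_bullet sq si (\<omega> * w) y) a = wedge (rev_ev (ext_deriv (act sq si y a)) (\<omega> * w))"
      unfolding u bl[OF \<omega>] form_act_mult[OF a \<omega> lmul_in[OF y]] act_lmul[OF a y] rev_ev_form[OF \<omega> db]
      by (simp add: wedge_mult)
  qed
qed

lemma additive_form_act_sum:
  "a \<in> forms 0 \<Longrightarrow> (\<And>i. i \<in> I \<Longrightarrow> X i \<in> Forms1 \<otimes>\<^sub>A TV) \<Longrightarrow>
    form_act sq si (sum X I) a = (\<Sum>i\<in>I. form_act sq si (X i) a)"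
  by (rule additive_on_sum[OF form_act_add subgrp_tprod])

lemma act_one: "a \<in> forms 0 \<Longrightarrow> act sq si 1 a = a"
  using act_form[OF _ forms_one, of a] by (simp add: form_one)

lemma act_vfield: "a \<in> forms 0 \<Longrightarrow> act sq si (vfield u) a = vec_apply u (ext_deriv a)"
proof -
  assume a: "a \<in> forms 0"
  have "lmul u 1 = vfield u"
    using additive_on_zero[OF contr_add subgrp_tprod] by (simp add: lmul_def sq_all_one)
  then show ?thesis using act_lmul[OF a one_tensor_algebra, of u] by (simp add: act_one a)
qed

lemma tpower_mono: "M \<subseteq> N \<Longrightarrow> tpower M n \<subseteq> tpower N n"
  by (induction n) (simp_all add: tprod_mono)

lemma tensor_algebra_mono: "M \<subseteq> N \<Longrightarrow> tensor_algebra M \<subseteq> tensor_algebra N"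
proof -
  assume MN: "M \<subseteq> N"
  have "tpower M n \<subseteq> tensor_algebra N" for n
    by (rule subset_trans[OF tpower_mono[OF MN] tpower_tensor_algebra])
  then have "(\<Union>n. tpower M n) \<subseteq> tensor_algebra N" by blast
  then show ?thesis
    unfolding tensor_algebra_def[of M] by (rule group_closure_least[OF _ subgrp_tensor_algebra])
qed

lemma TV10_TV: "x \<in> tensor_algebra (Fields10 J) \<Longrightarrow> x \<in> TV"
  using tensor_algebra_mono[of "Fields10 J" Fields] by blast

definition vec_proj10 :: "'w vec \<Rightarrow> 'w vec" where
  "vec_proj10 v = Abs_vec (\<lambda>\<xi>. if \<xi> \<in> forms 1 then vec_apply v (pr (- \<i>) \<xi>) else 0)"

lemma vec_apply_vec_proj10: "\<xi> \<in> forms 1 \<Longrightarrow> vec_apply (vec_proj10 v) \<xi> = vec_apply v (pr (- \<i>) \<xi>)"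
  unfolding vec_proj10_def
  by (subst Abs_vec_inverse) (auto simp: vec_apply_forms pr_forms pr_add vec_apply_add forms_add forms_mult_0 pr_rmult vec_apply_mult)

lemma vec_proj10_in: "vec_proj10 v \<in> vec10 J"
proof -
  have "vec_apply (vec_proj10 v) (J \<xi>) = \<i> *\<^sub>C vec_apply (vec_proj10 v) \<xi>" if \<xi>: "\<xi> \<in> forms 1" for \<xi>
  proof -
    have "pr (- \<i>) (J \<xi>) = J (pr (- \<i>) \<xi>)"
      using \<xi> by (simp add: pr_def J_scaleC forms_add forms_scaleC J_forms J_add)
    also have "\<dots> = \<i> *\<^sub>C pr (- \<i>) \<xi>" using pr_10[OF \<xi>] by (simp add: pq_10)
    finally show ?thesis by (simp add: vec_apply_vec_proj10 \<xi> J_forms vec_apply_scaleC pr_forms)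
  qed
  then show ?thesis by (simp add: vec10_def)
qed

text \<open>Projecting both members of a dual basis of the 1-forms to type (1,0) gives one for the
  (1,0)-forms, since the projection is right linear and fixes these forms.\<close>

lemma basis10: "\<exists>r \<eta> e. dual_basis10 J r \<eta> e"
proof -
  obtain n and \<xi> :: "nat \<Rightarrow> 'w" and u where b: "dual_basis n \<xi> u" using ex_dual_basis[OF fgp] by blast
  have "\<zeta> = (\<Sum>i<n. pr (- \<i>) (\<xi> i) * vec_apply (vec_proj10 (u i)) \<zeta>)" if \<zeta>: "\<zeta> \<in> pq_forms J 1 0" for \<zeta>
  proof -
    have \<zeta>1: "\<zeta> \<in> forms 1" by (rule pq_forms_1(2)[OF \<zeta>])
    have pr0: "pr (- \<i>) 0 = 0" using pr_add[of "- \<i>" 0 0] by simp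
    have "\<zeta> = pr (- \<i>) (\<Sum>i<n. \<xi> i * vec_apply (u i) \<zeta>)"
      by (simp add: dual_basis_eq[OF b \<zeta>1] pr_of_10 \<zeta>)
    also have "\<dots> = (\<Sum>i<n. pr (- \<i>) (\<xi> i * vec_apply (u i) \<zeta>))"
      using pr0 by (induction n) (simp_all add: pr_add)
    also have "\<dots> = (\<Sum>i<n. pr (- \<i>) (\<xi> i) * vec_apply (vec_proj10 (u i)) \<zeta>)"
      by (rule sum.cong) (simp_all add: pr_rmult dual_basis_forms[OF b] vec_apply_forms \<zeta>1 vec_apply_vec_proj10 pr_of_10 \<zeta>)
    finally show ?thesis .
  qed
  then have "dual_basis10 J n (\<lambda>i. pr (- \<i>) (\<xi> i)) (\<lambda>i. vec_proj10 (u i))"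
    by (simp add: dual_basis10_def vec_proj10_in pr_10 dual_basis_forms[OF b])
  then show ?thesis by blast
qed

lemma contr_phi_01:
  assumes "\<omega> \<in> pq_forms J 1 1"
  shows "ev_left Forms1 u (phi J \<omega>) = contr u (phi J \<omega>)" and "contr u (phi J \<omega>) \<in> PQ_Forms J 0 1"
proof -
  show "ev_left Forms1 u (phi J \<omega>) = contr u (phi J \<omega>)"
    by (rule ev_left_eq_contr[OF tmod_lsummand[OF tmod_Forms1] PQ11_FF[OF phi_in[OF assms]]])
  show "contr u (phi J \<omega>) \<in> PQ_Forms J 0 1"
    by (rule contr_in[OF PQ11_FPQ[OF phi_in[OF assms]] bimod_lmod[OF bimod_01]])
qed

lemma PQ01_Forms1: "x \<in> PQ_Forms J 0 1 \<Longrightarrow> x \<in> Forms1"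
  using pq_forms_1 by blast

lemma pi01_sq_vec_in: "pi01_id J (sq_vec sq u) \<in> Forms1 \<otimes>\<^sub>A Fields"
  using pi01_in[OF sq_vec_in[of u] subset_refl] tprod_mono[of "PQ_Forms J 0 1" Forms1 Fields Fields] PQ01_Forms1 by blast

lemma dbar_vec_0:
  assumes u: "u \<in> vec10 J" and a: "a \<in> forms 0" and "dbar J 0 0 a = 0" and "dual_basis10 J r \<eta> e"
  shows "form (dbar J 0 0 (vec_apply u (ext_deriv a))) = rev_ev (ext_deriv a) (pi01_id J (sq_vec sq u))"
  \<comment> \<open>The vanishing \<partial>-bar derivative of a is represented by the empty
    sum.\<close>
  using dbar_vec[OF u a assms(4), where n = 0 and \<xi> = "\<lambda>_. 0" and c = "\<lambda>_. 0"] assms(3) by simp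

text \<open>The claim concerns every pair in the graph, whichever expression of the intermediate
  values was used. The memberships are part of the induction because the additivity of
  \<open>act\<close> and \<open>form_act\<close> is known on these domains.\<close>

lemma dbar_HD_graph_sound:
  assumes "dbar_HD_graph J sq si x X"
  shows "x \<in> TV \<and> X \<in> Forms1 \<otimes>\<^sub>A TV \<and>
    (\<forall>a\<in>forms 0. dbar J 0 0 a = 0 \<longrightarrow> dbar J 0 0 (act sq si x a) = form_act sq si X a)"
  using assms(1)
proof induction
  case (alg b)
  have F: "form (dbar J 0 0 b) \<in> Forms1" using PQ01_Forms1 dbar_in[OF alg] by blast
  then show ?case
    using alg form_act_mult[OF _ F one_tensor_algebra] tprodI[OF F one_tensor_algebra]
    by (auto simp: Alg_tensor_algebra act_form dbar_mult act_one)
next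
  case (vfield u)
  have X: "pi01_id J (sq_vec sq u) \<in> Forms1 \<otimes>\<^sub>A Fields" by (rule pi01_sq_vec_in)
  have "dbar J 0 0 (act sq si (vfield u) a) = form_act sq si (pi01_id J (sq_vec sq u)) a"
    if a: "a \<in> forms 0" "dbar J 0 0 a = 0" for a
  proof -
    have da: "ext_deriv a \<in> forms 1" by (rule ext_deriv_0[OF a(1)])
    have "form_act sq si X a = wedge (rev_ev (ext_deriv a) X)" if "X \<in> Forms1 \<otimes>\<^sub>A Fields" for X
    proof (rule tprod_eqI[OF that additive_on_subset[OF form_act_add[OF a(1)]]])
      show "additive_on (Forms1 \<otimes>\<^sub>A Fields) (\<lambda>X. wedge (rev_ev (ext_deriv a) X))"
        by (rule additive_on_compose[OF rev_ev_add[OF da] additive_wedge[of UNIV]]) simp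
      fix \<omega> w :: "'w tensor" assume \<omega>: "\<omega> \<in> Forms1" and "w \<in> Fields"
      then obtain v where v: "w = vfield v" by auto
      have "vfield v \<in> TV" using Fields_TV by blast
      then show "form_act sq si (\<omega> * w) a = wedge (rev_ev (ext_deriv a) (\<omega> * w))"
        unfolding v by (simp add: form_act_mult[OF a(1) \<omega>] act_vfield[OF a(1)] rev_ev_form[OF \<omega> da] wedge_mult)
    qed (use FV_FTV in blast)
    from this[OF X] dbar_vec_0[OF vfield a] basis10 show ?thesis
      by (metis act_vfield[OF a(1)] wedge_form)
  qed
  then show ?case using FV_FTV[OF X] Fields_TV by blast
next
  case (add x X y Y)
  then show ?case
    by (auto simp: subgrp_add[OF subgrp_tensor_algebra] subgrp_add[OF subgrp_tprod] additive_on_add[OF act_add]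
        additive_on_add[OF form_act_add] dbar_add act_forms_0)
next
  case (Leibniz b x X)
  have x: "x \<in> TV" and X: "X \<in> Forms1 \<otimes>\<^sub>A TV" using Leibniz.IH by auto
  have F: "form (dbar J 0 0 b) \<in> Forms1" using PQ01_Forms1 dbar_in[OF Leibniz.hyps(1)] by blast
  have 1: "form (dbar J 0 0 b) * x \<in> Forms1 \<otimes>\<^sub>A TV" by (rule tprodI[OF F x])
  have lm: "lmod (Forms1 \<otimes>\<^sub>A TV :: 'w tensor set)" by (rule lmod_tprod[OF tmod_lmod[OF tmod_Forms1]])
  have 2: "form b * X \<in> Forms1 \<otimes>\<^sub>A TV" by (rule lmod_mult[OF lm Leibniz.hyps(1) X])
  have fa: "form_act sq si (form b * X) a = b * form_act sq si X a" if a: "a \<in> forms 0" for a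
  proof (rule tprod_eqI[OF X])
    show "additive_on (Forms1 \<otimes>\<^sub>A TV) (\<lambda>X. form_act sq si (form b * X) a)"
      by (rule additive_on_compose[OF additive_on_mult_left form_act_add[OF a]]) (rule lmod_mult[OF lm Leibniz.hyps(1)])
    show "additive_on (Forms1 \<otimes>\<^sub>A TV) (\<lambda>X. b * form_act sq si X a)"
      by (rule additive_on_mult_left_ring(1)[OF form_act_add[OF a]])
    fix \<omega> x :: "'w tensor" assume \<omega>: "\<omega> \<in> Forms1" and x: "x \<in> TV"
    have "form b * \<omega> \<in> Forms1" by (rule lmod_mult[OF tmod_lmod[OF tmod_Forms1] Leibniz.hyps(1) \<omega>])
    from form_act_mult[OF a this x] show "form_act sq si (form b * (\<omega> * x)) a = b * form_act sq si (\<omega> * x) a"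
      by (simp add: form_act_mult[OF a \<omega> x] mult.assoc wedge_mult)
  qed
  show ?case
  proof (intro conjI ballI impI)
    show "form b * x \<in> TV" by (rule lmod_mult[OF lmod_TV Leibniz.hyps(1) x])
    show "form (dbar J 0 0 b) * x + form b * X \<in> Forms1 \<otimes>\<^sub>A TV" by (rule subgrp_add[OF subgrp_tprod 1 2])
    fix a :: 'w assume a: "a \<in> forms 0" "dbar J 0 0 a = 0"
    then have IH: "dbar J 0 0 (act sq si x a) = form_act sq si X a" using Leibniz.IH by blast
    show "dbar J 0 0 (act sq si (form b * x) a) = form_act sq si (form (dbar J 0 0 b) * x + form b * X) a"
      using Leibniz.hyps(1) a x
      by (simp add: act_lmult dbar_mult act_forms_0 additive_on_add[OF form_act_add[OF a(1)] 1 2] fa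
          form_act_mult[OF a(1) F x] IH)
  qed
next
  case (bullet u v m \<xi> w n r \<eta> e)
  have u: "u \<in> vec10 J" and db: "dual_basis10 J r \<eta> e" by fact+
  have v: "v \<in> TV" using bullet.IH by blast
  have \<xi>: "\<xi> k \<in> pq_forms J 0 1" and w: "w k \<in> TV" if "k < n" for k
    using bullet.hyps(4) that TV10_TV by auto
  have \<xi>1: "\<xi> k \<in> forms 1" if "k < n" for k by (rule pq_forms_1(1)[OF \<xi>[OF that]])
  have \<eta>: "\<eta> i \<in> pq_forms J 1 0" if "i < r" for i using db that by (simp add: dual_basis10_def)
  have a11: "proj_wedge_proj J (0, 1) (1, 0) (sq (\<xi> k)) \<in> pq_forms J 1 1" if "k < n" for k
    unfolding proj_wedge_proj_eq by (rule wedge_pr_tensor_in(3)[OF sq_in[OF \<xi>1[OF that]]])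
  have b11: "\<xi> k * \<eta> i \<in> pq_forms J 1 1" if "k < n" "i < r" for k i
    using pq_forms_mult[OF \<xi>[OF that(1)] \<eta>[OF that(2)]] by simp
  let ?X0 = "form_bullet sq si (pi01_id J (sq_vec sq u)) v"
  let ?C = "\<lambda>k. ev_left Forms1 u (phi J (proj_wedge_proj J (0, 1) (1, 0) (sq (\<xi> k))))"
  let ?D = "\<lambda>k i. ev_left Forms1 u (phi J (\<xi> k * \<eta> i))"
  let ?ew = "\<lambda>k i. bullet sq si (vfield (e i)) (w k)"
  have C: "?C k = contr u (phi J (wedge (pr_tensor \<i> (- \<i>) (sq (\<xi> k)))))" "?C k \<in> Forms1" if "k < n" for k
    using contr_phi_01[OF a11[OF that], of u] PQ01_Forms1 by (simp_all add: proj_wedge_proj_eq)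
  have D: "?D k i = contr u (phi J (\<xi> k * \<eta> i))" "?D k i \<in> Forms1" if "k < n" "i < r" for k i
    using contr_phi_01[OF b11[OF that], of u] PQ01_Forms1 by simp_all
  have ew: "?ew k i = lmul (e i) (w k)" "?ew k i \<in> TV" if "k < n" for k i
    using bullet_vfield[OF w[OF that]] lmul_in[OF w[OF that]] by simp_all
  have X0: "?X0 \<in> Forms1 \<otimes>\<^sub>A TV" by (rule form_act_form_bullet(1)[OF forms_one v pi01_sq_vec_in])
  have X1: "(\<Sum>k<n. ?C k * w k) \<in> Forms1 \<otimes>\<^sub>A TV"
    using C(2) w by (intro subgrp_sum[OF subgrp_tprod] tprodI) auto
  have X2: "(\<Sum>k<n. \<Sum>i<r. ?D k i * ?ew k i) \<in> Forms1 \<otimes>\<^sub>A TV"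
    using D(2) ew(2) by (intro subgrp_sum[OF subgrp_tprod] tprodI) auto
  show ?case
  proof (intro conjI ballI impI)
    show "bullet sq si (vfield u) v \<in> TV" by (simp add: bullet_vfield[OF v] lmul_in[OF v])
    show "?X0 - (\<Sum>k<n. ?C k * w k) - (\<Sum>k<n. \<Sum>i<r. ?D k i * ?ew k i) \<in> Forms1 \<otimes>\<^sub>A TV"
      by (intro subgrp_diff[OF subgrp_tprod] X0 X1 X2)
    fix a :: 'w assume a: "a \<in> forms 0" "dbar J 0 0 a = 0"
    let ?b = "act sq si v a" and ?c = "\<lambda>k. act sq si (w k) a"
    have b: "?b \<in> forms 0" by (rule act_forms_0[OF a(1) v])
    have c: "?c k \<in> forms 0" if "k < n" for k by (rule act_forms_0[OF a(1) w[OF that]])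
    \<comment> \<open>The induction hypothesis writes the \<partial>-bar derivative of
      \<open>?b\<close> as a sum of \<xi>_k c_k with c_k the action of w_k on a, the form of input
      that \<open>dbar_vec\<close> asks for.\<close>
    have "dbar J 0 0 ?b = form_act sq si (\<Sum>k<n. form (\<xi> k) * w k) a" using bullet.IH a by blast
    also have "\<dots> = (\<Sum>k<n. form_act sq si (form (\<xi> k) * w k) a)"
      using \<xi>1 w by (intro additive_form_act_sum a tprodI) auto
    also have "\<dots> = (\<Sum>k<n. \<xi> k * ?c k)"
      using \<xi>1 w by (intro sum.cong) (simp_all add: form_act_mult[OF a(1)])
    finally have eq: "dbar J 0 0 ?b = (\<Sum>k<n. \<xi> k * ?c k)" .
    have "form (dbar J 0 0 (act sq si (bullet sq si (vfield u) v) a)) = form (dbar J 0 0 (vec_apply u (ext_deriv ?b)))"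
      by (simp add: bullet_vfield[OF v] act_lmul[OF a(1) v])
    also have "\<dots> = rev_ev (ext_deriv ?b) (pi01_id J (sq_vec sq u))
      - (\<Sum>k<n. ?C k * form (?c k)) - (\<Sum>k<n. \<Sum>i<r. ?D k i * form (vec_apply (e i) (ext_deriv (?c k))))"
      by (subst dbar_vec[OF u b db eq]) (simp_all add: \<xi> c C(1) D(1))
    finally have "dbar J 0 0 (act sq si (bullet sq si (vfield u) v) a) =
      wedge (rev_ev (ext_deriv ?b) (pi01_id J (sq_vec sq u))
      - (\<Sum>k<n. ?C k * form (?c k)) - (\<Sum>k<n. \<Sum>i<r. ?D k i * form (vec_apply (e i) (ext_deriv (?c k)))))"
      by (metis wedge_form)
    also have "\<dots> = form_act sq si ?X0 a - (\<Sum>k<n. wedge (?C k) * ?c k)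
        - (\<Sum>k<n. \<Sum>i<r. wedge (?D k i) * vec_apply (e i) (ext_deriv (?c k)))"
      by (simp add: wedge_diff wedge_sum wedge_mult form_act_form_bullet(2)[OF a(1) v pi01_sq_vec_in])
    also have "(\<Sum>k<n. wedge (?C k) * ?c k) = form_act sq si (\<Sum>k<n. ?C k * w k) a"
      using C(2) w by (subst additive_form_act_sum[OF a(1)]) (auto intro!: sum.cong tprodI simp: form_act_mult[OF a(1)])
    also have "(\<Sum>k<n. \<Sum>i<r. wedge (?D k i) * vec_apply (e i) (ext_deriv (?c k))) =
        form_act sq si (\<Sum>k<n. \<Sum>i<r. ?D k i * ?ew k i) a"
    proof -
      have "form_act sq si (\<Sum>k<n. \<Sum>i<r. ?D k i * ?ew k i) a = (\<Sum>k<n. form_act sq si (\<Sum>i<r. ?D k i * ?ew k i) a)"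
        using D(2) ew(2) by (intro additive_form_act_sum a subgrp_sum[OF subgrp_tprod] tprodI) auto
      also have "\<dots> = (\<Sum>k<n. \<Sum>i<r. form_act sq si (?D k i * ?ew k i) a)"
        using D(2) ew(2) by (intro sum.cong HOL.refl additive_form_act_sum a tprodI) auto
      also have "\<dots> = (\<Sum>k<n. \<Sum>i<r. wedge (?D k i) * vec_apply (e i) (ext_deriv (?c k)))"
      proof (intro sum.cong HOL.refl)
        fix k i assume "k \<in> {..<n}" "i \<in> {..<r}"
        then have k: "k < n" and i: "i < r" by auto
        show "form_act sq si (?D k i * ?ew k i) a = wedge (?D k i) * vec_apply (e i) (ext_deriv (?c k))"
          unfolding form_act_mult[OF a(1) D(2)[OF k i] ew(2)[OF k]]
          unfolding ew(1)[OF k] act_lmul[OF a(1) w[OF k]] ..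
      qed
      finally show ?thesis ..
    qed
    also have "form_act sq si ?X0 a - form_act sq si (\<Sum>k<n. ?C k * w k) a
        - form_act sq si (\<Sum>k<n. \<Sum>i<r. ?D k i * ?ew k i) a =
        form_act sq si (?X0 - (\<Sum>k<n. ?C k * w k) - (\<Sum>k<n. \<Sum>i<r. ?D k i * ?ew k i)) a"
      by (simp only: additive_on_diff[OF form_act_add[OF a(1)] subgrp_tprod] X0 X1 X2 subgrp_diff[OF subgrp_tprod])
    finally show "dbar J 0 0 (act sq si (bullet sq si (vfield u) v) a) =
        form_act sq si (?X0 - (\<Sum>k<n. ?C k * w k) - (\<Sum>k<n. \<Sum>i<r. ?D k i * ?ew k i)) a" .
  qed
qed

subsection \<open>Every holomorphic differential operator has a value\<close>

lemma vec_apply_diff: "vec_apply (u - v) \<xi> = vec_apply u \<xi> - vec_apply v \<xi>"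
  using vec_apply_plus[of "u - v" v \<xi>] by simp

lemma bimod_Fields10: "bimod (Fields10 J)"
proof -
  have "subgrp (vec10 J)"
    unfolding subgrp_def
    by (auto simp: vec10_def vec_apply_zero vec_apply_diff scaleC_zero_right scaleC_diff_right)
  moreover have "vec_lmult a v \<in> vec10 J" if "a \<in> forms 0" "v \<in> vec10 J" for a v
    using that by (auto simp: vec10_def vec_apply_lmult mult_scaleC_right)
  moreover have "vec_rmult v a \<in> vec10 J" if "a \<in> forms 0" "v \<in> vec10 J" for a v
    using that by (auto simp: vec10_def vec_apply_rmult J_forms J_lmult[symmetric] forms_0_mult)
  ultimately show ?thesis
    unfolding bimod_def lmod_def by (auto simp: subgrp_vfield_image vfield_lmult vfield_rmult)
qed

text \<open>Let Q project the field factor to type (1,0). Then Q of the derivative of u satisfies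
  the duality equation that characterises this derivative, so the two coincide.\<close>

lemma sq_vec_10:
  assumes u: "u \<in> vec10 J"
  shows "sq_vec sq u \<in> Forms1 \<otimes>\<^sub>A Fields10 J"
proof -
  let ?q = "\<lambda>x :: 'w tensor. vfield (vec_proj10 (the_field x))"
  have "vec_proj10 (v + w) = vec_proj10 v + vec_proj10 w" for v w
    by (rule vec_eqI) (simp add: vec_apply_vec_proj10 vec_apply_plus)
  moreover have "vec_proj10 (vec_lmult a v) = vec_lmult a (vec_proj10 v)" if "a \<in> forms 0" for a v
    by (rule vec_eqI) (simp add: vec_apply_vec_proj10 vec_apply_lmult that)
  ultimately have ql: "llin Fields ?q"
    unfolding llin_def
    by (auto simp: additive_on_def vfield_add[symmetric] vfield_lmult tmod_lsummand tmod_Fields)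
  let ?Q = "tensor_map Forms1 id Fields ?q"
  have Q_add: "additive_on (Forms1 \<otimes>\<^sub>A Fields) ?Q" by (rule tmap_add[OF rlin_id[OF tmod_Forms1] ql])
  have Q_mult: "?Q (\<omega> * vfield v) = \<omega> * vfield (vec_proj10 v)" if "\<omega> \<in> Forms1" for \<omega> v
    using tmap_mult[OF rlin_id[OF tmod_Forms1] ql that, of "vfield v"] by simp
  have Q_in: "?Q X \<in> Forms1 \<otimes>\<^sub>A Fields10 J" if "X \<in> Forms1 \<otimes>\<^sub>A Fields" for X
  proof (rule additive_image_in[OF that Q_add subgrp_tprod])
    fix x y :: "'w tensor" assume "x \<in> Forms1" "y \<in> Fields"
    then show "?Q (x * y) \<in> Forms1 \<otimes>\<^sub>A Fields10 J" using Q_mult[of x] vec_proj10_in by (auto intro!: tprodI)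
  qed
  have Q_FV: "?Q X \<in> Forms1 \<otimes>\<^sub>A Fields" if "X \<in> Forms1 \<otimes>\<^sub>A Fields" for X
    using Q_in[OF that] tprod_mono[of Forms1 Forms1 "Fields10 J" Fields] by blast
  have Q_rev: "rev_ev \<xi> (?Q X) = rev_ev (pr (- \<i>) \<xi>) X" if \<xi>: "\<xi> \<in> forms 1" and X: "X \<in> Forms1 \<otimes>\<^sub>A Fields" for \<xi> X
  proof (rule tprod_eqI[OF X additive_on_compose[OF Q_add rev_ev_add[OF \<xi>] Q_FV] rev_ev_add[OF pr_forms[OF \<xi>]]])
    fix x y :: "'w tensor" assume x: "x \<in> Forms1" and "y \<in> Fields"
    then obtain v where v: "y = vfield v" by auto
    show "rev_ev \<xi> (?Q (x * y)) = rev_ev (pr (- \<i>) \<xi>) (x * y)"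
      unfolding v Q_mult[OF x] rev_ev_form[OF x \<xi>] rev_ev_form[OF x pr_forms[OF \<xi>]] vec_apply_vec_proj10[OF \<xi>] ..
  qed
  have "sq_vec sq u = ?Q (sq_vec sq u)"
  proof (rule sq_vecI[OF Q_FV[OF sq_vec_in]])
    fix \<xi> :: 'w assume \<xi>: "\<xi> \<in> forms 1"
    note id = llin_id[OF tmod_lsummand[OF tmod_Forms1]]
    \<comment> \<open>The projection passes to the first factor of the connection, where
      \<open>u\<close>, being of type (1,0), does not see it.\<close>
    have "contr u (sq (pr (- \<i>) \<xi>)) = contr u (sq \<xi>)"
      unfolding sq_pr[OF \<xi>]
    proof (rule tprod_eqI[OF sq_in[OF \<xi>]])
      have "tensor_map Forms1 (pr_form (- \<i>)) Forms1 id x \<in> Forms1 \<otimes>\<^sub>A Forms1" if "x \<in> Forms1 \<otimes>\<^sub>A Forms1" for x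
        by (rule additive_image_in[OF that tmap_add[OF pr_form_rlin id] subgrp_tprod])
          (auto simp: tmap_mult[OF pr_form_rlin id] pr_form_form intro!: tprodI pr_forms)
      then show "additive_on (Forms1 \<otimes>\<^sub>A Forms1) (\<lambda>x. contr u (tensor_map Forms1 (pr_form (- \<i>)) Forms1 id x))"
        by (intro additive_on_compose[OF tmap_add[OF pr_form_rlin id] contr_add] Forms1_T[where N = Forms1])
      show "additive_on (Forms1 \<otimes>\<^sub>A Forms1) (contr u)" by (rule additive_on_subset[OF contr_add]) (auto intro: Forms1_T)
      fix x y :: "'w tensor" assume "x \<in> Forms1" "y \<in> Forms1"
      then show "contr u (tensor_map Forms1 (pr_form (- \<i>)) Forms1 id (x * y)) = contr u (x * y)"
        by (auto simp: tmap_mult[OF pr_form_rlin id] pr_form_form contr_mult pr_forms vec10_pr[OF u])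
    qed
    then show "form (ext_deriv (vec_apply u \<xi>)) = rev_ev \<xi> (?Q (sq_vec sq u)) + contr u (sq \<xi>)"
      using sq_vec_eq[OF pr_forms[OF \<xi>], of u "- \<i>"] by (simp add: Q_rev[OF \<xi> sq_vec_in] vec10_pr[OF u \<xi>])
  qed
  then show ?thesis using Q_in[OF sq_vec_in[of u]] by simp
qed

lemma bimod_F10: "bimod (Forms1 \<otimes>\<^sub>A Fields10 J)"
  by (rule bimod_tprod[OF tmod_lmod[OF tmod_Forms1] bimod_Fields10])

text \<open>On an exact form, \<open>sigma si\<close> of v \<otimes> db is the derivative of v.b
  minus the derivative of v times b, and both have their field factor of type (1,0). Every 1-form is
  a combination of terms a db, and a can be absorbed in v.\<close>

lemma sigma_10:
  assumes "v \<in> vec10 J" and \<omega>: "\<omega> \<in> forms 1"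
  shows "sigma si (vfield v * form \<omega>) \<in> Forms1 \<otimes>\<^sub>A Fields10 J"
proof -
  let ?S = "{\<omega> \<in> forms 1. \<forall>v\<in>vec10 J. sigma si (vfield v * form \<omega>) \<in> Forms1 \<otimes>\<^sub>A Fields10 J}"
  have rm: "vec_rmult v a \<in> vec10 J" if "v \<in> vec10 J" "a \<in> forms 0" for v a
    using bimod_rmult[OF bimod_Fields10 that(2), of "vfield v"] that
    by (auto simp: vfield_rmult vfield_inject)
  have VF: "vfield v * form \<omega> \<in> Fields_Forms1" if "\<omega> \<in> forms 1" for v \<omega> using that by (auto intro: tprodI)
  have d: "sigma si (vfield v * form (ext_deriv b)) \<in> Forms1 \<otimes>\<^sub>A Fields10 J" if v: "v \<in> vec10 J" and b: "b \<in> forms 0" for v b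
  proof -
    have "sigma si (vfield v * form (ext_deriv b)) = sq_vec sq (vec_rmult v b) - sq_vec sq v * form b"
      by (simp add: sq_vec_rmult[OF b])
    then show ?thesis
      using subgrp_diff[OF subgrp_tprod sq_vec_10[OF rm[OF v b]] bimod_rmult[OF bimod_F10 b sq_vec_10[OF v]]] by simp
  qed
  have "{a * ext_deriv b | a b. a \<in> forms 0 \<and> b \<in> forms 0} \<subseteq> ?S"
  proof (clarify, intro conjI ballI)
    fix a b :: 'w and v assume a: "a \<in> forms 0" and b: "b \<in> forms 0"
    show "a * ext_deriv b \<in> forms 1" by (intro forms_0_mult ext_deriv_0 a b)
    assume v: "v \<in> vec10 J"
    have "vfield v * form (a * ext_deriv b) = vfield (vec_rmult v a) * form (ext_deriv b)"
      by (simp add: vfield_rmult[OF a, symmetric] form_lmult[OF a, symmetric] mult.assoc)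
    then show "sigma si (vfield v * form (a * ext_deriv b)) \<in> Forms1 \<otimes>\<^sub>A Fields10 J"
      using d[OF rm[OF v a] b] by simp
  qed
  moreover have "subgrp ?S"
    unfolding subgrp_def
    by (auto simp: forms_zero form_zero additive_on_zero[OF sigma_add subgrp_tprod] subgrp_zero[OF subgrp_tprod]
        form_diff right_diff_distrib additive_on_diff[OF sigma_add subgrp_tprod] VF subgrp_diff[OF subgrp_tprod]
        subgrp_diff[OF subgrp_forms])
  ultimately have "forms 1 \<subseteq> ?S" unfolding forms_1_eq by (rule group_closure_least)
  then show ?thesis using assms by blast
qed

abbreviation tpow10 :: "nat \<Rightarrow> 'w tensor set" where
  "tpow10 n \<equiv> tpower (Fields10 J) n"

abbreviation TV10 :: "'w tensor set" where
  "TV10 \<equiv> tensor_algebra (Fields10 J)"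

lemma tpow10_tpow: "x \<in> tpow10 n \<Longrightarrow> x \<in> tpower Fields n"
  using tpower_mono[of "Fields10 J" Fields n] by blast

lemma sigma_id_10:
  assumes v: "v \<in> vec10 J" and z: "z \<in> Forms1 \<otimes>\<^sub>A N"
  shows "sigma_id (vfield v * z) \<in> Forms1 \<otimes>\<^sub>A (Fields10 J \<otimes>\<^sub>A N)"
proof (rule additive_image_in[OF z additive_on_compose[OF additive_on_mult_left sigma_id_add] subgrp_tprod])
  show "vfield v * x \<in> Fields_Forms1 \<otimes>\<^sub>A UNIV" if "x \<in> Forms1 \<otimes>\<^sub>A N" for x
    by (rule vfield_mult_FT[OF Forms1_T[OF that]])
  fix x y :: "'w tensor" assume "x \<in> Forms1" and y: "y \<in> N"
  then obtain \<omega> where \<omega>: "x = form \<omega>" "\<omega> \<in> forms 1" by auto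
  show "sigma_id (vfield v * (x * y)) \<in> Forms1 \<otimes>\<^sub>A (Fields10 J \<otimes>\<^sub>A N)"
    unfolding \<omega>(1) sigma_id_mult[OF \<omega>(2)] tprod_assoc[symmetric] by (rule tprodI[OF sigma_10[OF v \<omega>(2)] y])
qed

lemma sq_all_10: "y \<in> tpow10 n \<Longrightarrow> sq_all y \<in> Forms1 \<otimes>\<^sub>A tpow10 n"
proof (induction n arbitrary: y)
  case 0
  then show ?case by (auto simp: sq_all_form tprod_Alg bimod_forms ext_deriv_0)
next
  case (Suc n)
  have sub: "tpow10 (Suc n) \<subseteq> TV" using tpow10_tpow tpow_TV by blast
  show ?case
  proof (rule additive_image_in[OF Suc.prems[unfolded tpower.simps] additive_on_subset[OF sq_all_add] subgrp_tprod])
    show "Fields10 J \<otimes>\<^sub>A tpow10 n \<subseteq> TV" using sub by simp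
    fix x y :: "'w tensor" assume "x \<in> Fields10 J" and y: "y \<in> tpow10 n"
    then obtain v where v: "x = vfield v" "v \<in> vec10 J" by auto
    have "sq_vec sq v * y \<in> Forms1 \<otimes>\<^sub>A (Fields10 J \<otimes>\<^sub>A tpow10 n)"
      using tprodI[OF sq_vec_10[OF v(2)] y] by (simp only: tprod_assoc)
    then show "sq_all (x * y) \<in> Forms1 \<otimes>\<^sub>A tpow10 (Suc n)"
      unfolding v(1) sq_all_mult[OF tpow10_tpow[OF y]] tpower.simps
      by (rule subgrp_add[OF subgrp_tprod _ sigma_id_10[OF v(2) Suc.IH[OF y]]])
  qed
qed

lemma lmod_tpow10: "lmod (tpow10 n)"
  by (rule lmod_tpower[OF bimod_lmod[OF bimod_Fields10]])

lemma contr_sq_all_10: "y \<in> tpow10 n \<Longrightarrow> contr u (sq_all y) \<in> tpow10 n"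
  by (rule contr_in[OF sq_all_10 lmod_tpow10])

lemma lmul_10:
  assumes u: "u \<in> vec10 J" and y: "y \<in> TV10"
  shows "lmul u y \<in> TV10"
proof (rule tensor_algebra_image_in[OF y additive_on_subset[OF lmul_add] subgrp_tensor_algebra])
  show "TV10 \<subseteq> TV" using TV10_TV by blast
  fix n and y :: "'w tensor" assume y: "y \<in> tpow10 n"
  have "vfield u * y \<in> tpow10 (Suc n)" using u y by (auto intro: tprodI)
  then show "lmul u y \<in> TV10"
    unfolding lmul_def using tpower_tensor_algebra contr_sq_all_10[OF y, of u]
    by (intro subgrp_add[OF subgrp_tensor_algebra]) blast+
qed

text \<open>The value must lie in this module because the recursive clause accepts only sums of
  (0,1)-forms times holomorphic operators.\<close>

abbreviation has_value :: "'w tensor \<Rightarrow> bool" where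
  "has_value x \<equiv> \<exists>X \<in> PQ_Forms J 0 1 \<otimes>\<^sub>A TV10. dbar_HD_graph J sq si x X"

lemma has_value_form: "a \<in> forms 0 \<Longrightarrow> has_value (form a)"
  using dbar_HD_graph.alg[of a J sq si] tprodI[OF imageI[OF dbar_in] one_tensor_algebra, of a form "Fields10 J"] by auto

text \<open>The graph is closed under sums, whereas the tensor products are generated by
  differences. Negation is obtained from the Leibniz clause with the coefficient -1, whose
  \<partial>-bar derivative is 0.\<close>

lemma has_value_diff: "has_value x \<Longrightarrow> has_value y \<Longrightarrow> has_value (x - y)"
proof (elim bexE)
  fix X Y assume X: "X \<in> PQ_Forms J 0 1 \<otimes>\<^sub>A TV10" "dbar_HD_graph J sq si x X"
    and Y: "Y \<in> PQ_Forms J 0 1 \<otimes>\<^sub>A TV10" "dbar_HD_graph J sq si y Y"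
  have m: "- 1 \<in> (forms 0 :: 'w set)" by (rule forms_uminus[OF forms_one])
  have d1: "dbar J 0 0 1 = 0" using dbar_mult[OF forms_one forms_one] by simp
  have "dbar J 0 0 (- 1) + dbar J 0 0 1 = dbar J 0 0 (- 1 + 1)" by (rule dbar_add[OF m forms_one, symmetric])
  moreover have "dbar J 0 0 0 = 0" using dbar_add[OF forms_zero forms_zero] by simp
  ultimately have "dbar J 0 0 (- 1) = 0" using d1 by simp
  then have "dbar_HD_graph J sq si (- y) (- Y)"
    using dbar_HD_graph.Leibniz[OF m Y(2)] by (simp add: form_uminus form_one form_zero)
  from dbar_HD_graph.add[OF X(2) this] show "has_value (x - y)"
    using subgrp_diff[OF subgrp_tprod X(1) Y(1)] by auto
qed

text \<open>Expanding the value of y as a finite sum makes the recursive clause applicable. Each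
  term of the result has the required type again, because contractions of \<open>phi\<close> lie in
  the (0,1)-forms and left multiplication by (1,0)-fields preserves \<open>TV10\<close>.\<close>

lemma has_value_bullet:
  assumes u: "u \<in> vec10 J" and y: "y \<in> tpow10 m" and "has_value y"
  shows "has_value (lmul u y)"
proof -
  obtain X where X: "X \<in> PQ_Forms J 0 1 \<otimes>\<^sub>A TV10" "dbar_HD_graph J sq si y X" using assms(3) by blast
  obtain r \<eta> e where db: "dual_basis10 J r \<eta> e" using basis10 by blast
  have "subgrp (PQ_Forms J 0 1)" by (rule lmod_subgrp[OF bimod_lmod[OF bimod_01]])
  from tprod_sumE[OF X(1) this] obtain n :: nat and x w where
    xw: "\<And>k. k < n \<Longrightarrow> x k \<in> PQ_Forms J 0 1 \<and> w k \<in> TV10" "X = (\<Sum>k<n. x k * w k)" by metis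
  define \<xi> where "\<xi> = (\<lambda>k. wedge (x k))"
  have \<xi>: "x k = form (\<xi> k)" "\<xi> k \<in> pq_forms J 0 1" "w k \<in> TV10" if "k < n" for k
    using xw(1)[OF that] by (auto simp: \<xi>_def)
  have X': "X = (\<Sum>k<n. form (\<xi> k) * w k)" unfolding xw(2) by (rule sum.cong) (simp_all add: \<xi>(1))
  have yTV: "y \<in> TV10" using y tpower_tensor_algebra by blast
  let ?X0 = "form_bullet sq si (pi01_id J (sq_vec sq u)) y"
  have X0: "?X0 \<in> PQ_Forms J 0 1 \<otimes>\<^sub>A TV10"
  proof -
    have "pi01_id J (sq_vec sq u) \<in> PQ_Forms J 0 1 \<otimes>\<^sub>A Fields10 J"
      by (rule pi01_in[OF sq_vec_10[OF u]]) blast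
    then show ?thesis
    proof (rule additive_image_in[OF _ additive_on_subset[OF form_bullet_add[OF TV10_TV[OF yTV]]] subgrp_tprod])
      show "PQ_Forms J 0 1 \<otimes>\<^sub>A Fields10 J \<subseteq> Forms1 \<otimes>\<^sub>A TV"
        by (rule tprod_mono) (use PQ01_Forms1 Fields_TV in blast)+
      fix \<omega> z :: "'w tensor" assume \<omega>: "\<omega> \<in> PQ_Forms J 0 1" and "z \<in> Fields10 J"
      then obtain v where v: "z = vfield v" "v \<in> vec10 J" by auto
      have "z \<in> TV" using v Fields_TV by blast
      then show "form_bullet sq si (\<omega> * z) y \<in> PQ_Forms J 0 1 \<otimes>\<^sub>A TV10"
        using form_bullet_mult[OF TV10_TV[OF yTV] PQ01_Forms1[OF \<omega>]] v
        by (simp add: bullet_vfield[OF TV10_TV[OF yTV]] tprodI[OF \<omega> lmul_10[OF v(2) yTV]])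
    qed
  qed
  have \<eta>: "\<eta> i \<in> pq_forms J 1 0" and e: "e i \<in> vec10 J" if "i < r" for i
    using db that by (auto simp: dual_basis10_def)
  have X1: "(\<Sum>k<n. ev_left Forms1 u (phi J (proj_wedge_proj J (0, 1) (1, 0) (sq (\<xi> k)))) * w k)
      \<in> PQ_Forms J 0 1 \<otimes>\<^sub>A TV10"
  proof (intro subgrp_sum[OF subgrp_tprod] tprodI)
    fix k assume "k \<in> {..<n}"
    then have k: "k < n" by simp
    show "w k \<in> TV10" by (rule \<xi>(3)[OF k])
    have "proj_wedge_proj J (0, 1) (1, 0) (sq (\<xi> k)) \<in> pq_forms J 1 1"
      unfolding proj_wedge_proj_eq by (rule wedge_pr_tensor_in(3)[OF sq_in[OF pq_forms_1(1)[OF \<xi>(2)[OF k]]]])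
    from contr_phi_01[OF this] show "ev_left Forms1 u (phi J (proj_wedge_proj J (0, 1) (1, 0) (sq (\<xi> k)))) \<in> PQ_Forms J 0 1"
      by simp
  qed
  have X2: "(\<Sum>k<n. \<Sum>i<r. ev_left Forms1 u (phi J (\<xi> k * \<eta> i)) * bullet sq si (vfield (e i)) (w k))
      \<in> PQ_Forms J 0 1 \<otimes>\<^sub>A TV10"
  proof (intro subgrp_sum[OF subgrp_tprod] tprodI)
    fix k i assume "k \<in> {..<n}" "i \<in> {..<r}"
    then have k: "k < n" and i: "i < r" by auto
    show "bullet sq si (vfield (e i)) (w k) \<in> TV10"
      unfolding bullet_vfield[OF TV10_TV[OF \<xi>(3)[OF k]]] by (rule lmul_10[OF e[OF i] \<xi>(3)[OF k]])
    have "\<xi> k * \<eta> i \<in> pq_forms J 1 1" using pq_forms_mult[OF \<xi>(2)[OF k] \<eta>[OF i]] by simp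
    from contr_phi_01[OF this] show "ev_left Forms1 u (phi J (\<xi> k * \<eta> i)) \<in> PQ_Forms J 0 1" by simp
  qed
  have "\<forall>k<n. \<xi> k \<in> pq_forms J 0 1 \<and> w k \<in> TV10" using \<xi> by blast
  note dbar_HD_graph.bullet[OF u y X(2)[unfolded X'] this db]
  then show ?thesis
    using subgrp_diff[OF subgrp_tprod subgrp_diff[OF subgrp_tprod X0 X1] X2]
    unfolding bullet_vfield[OF TV10_TV[OF yTV]] by blast
qed

lemma has_value_zero: "has_value 0"
  using has_value_form[OF forms_zero] by (simp add: form_zero)

lemma has_value_tpow10: "x \<in> tpow10 n \<Longrightarrow> has_value x"
proof (induction n arbitrary: x)
  case 0
  then show ?case using has_value_form by auto
next
  case (Suc n)
  show ?case
    using Suc.prems[unfolded tpower.simps]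
  proof (induction rule: tprod_induct)
    case (mult x y)
    then obtain u where u: "x = vfield u" "u \<in> vec10 J" by auto
    \<comment> \<open>The recursion is stated for the product of operators and not for tensors. The
      two differ by a term of the degree of y, which the induction hypothesis covers.\<close>
    have "x * y = lmul u y - contr u (sq_all y)" by (simp add: lmul_def u)
    then show ?case
      using has_value_diff[OF has_value_bullet[OF u(2) mult(2) Suc.IH[OF mult(2)]] Suc.IH[OF contr_sq_all_10[OF mult(2)]], of u]
      by simp
  qed (rule has_value_zero has_value_diff; assumption)+
qed

lemma has_value: "x \<in> TV10 \<Longrightarrow> has_value x"
proof (induction rule: tensor_algebra_induct)
  case (tpower n x)
  then show ?case by (rule has_value_tpow10)
qed (rule has_value_zero has_value_diff; assumption)+

end

theorem proposition14p2:
  fixes J :: "'w::star_dga \<Rightarrow> 'w"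
    and sq :: "'w \<Rightarrow> 'w tensor"
    and si :: "'w tensor \<Rightarrow> 'w tensor"
    and v :: "'w tensor"
    and a :: 'w
  assumes "fg_projective (forms 1 :: 'w set)"
    and "almost_complex J"
    and "right_bimodule_connection sq si"
    and a: "bij_betw wedge (PQ_Forms J 1 0 \<otimes>\<^sub>A PQ_Forms J 0 1) (pq_forms J 1 1)"
    and b: "\<forall>\<xi>\<in>forms 1. tensor_map Forms1 (on_forms J) Forms1 id (sq \<xi>) = sq (J \<xi>)"
    and c: "\<forall>\<xi>\<in>forms 1. proj J 1 1 (torsion sq \<xi>) = 0"
    and d: "\<forall>x\<in>Forms1 \<otimes>\<^sub>A Forms1. proj J 1 1 (wedge (si x)) =
              - proj_wedge_proj J (0, 1) (1, 0) x - proj_wedge_proj J (1, 0) (0, 1) x"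
    and "v \<in> tensor_algebra (Fields10 J)"
    and "a \<in> forms 0"
    and "dbar J 0 0 a = 0"
  shows "dbar J 0 0 (act sq si v a) = form_act sq si (dbar_HD J sq si v) a"
proof -
  interpret acs sq si J
    by unfold_locales (fact assms(1,2,3) a b c)+
  \<comment> \<open>Since a value exists, the one chosen by \<open>dbar_HD\<close> belongs to the
    graph.\<close>
  have "dbar_HD_graph J sq si v (dbar_HD J sq si v)"
    unfolding dbar_HD_def using has_value[OF assms(8)] by (blast intro: someI)
  from dbar_HD_graph_sound[OF this] assms(9,10) show ?thesis by blast
qed

end
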